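(* Let $p,q,r$ be prime numbers such that $q$ divides $p-1$ and $r-1$. Let $G_1=\mathbb Z_p\rtimes\mathbb Z_q$ and $G_2=\mathbb Z_r\rtimes\mathbb Z_q$ be the (unique up to isomorphism) nonabelian groups of orders $pq$ and $rq$, respectively, let $G=G_1\times G_2$, and let $S\subseteq G$ be a subgroup of order $q^2$, $S\simeq\mathbb Z_q\times\mathbb Z_q$. Let $1\neq\alpha\in H^2(S,k^* )$ (such an $\alpha$ is non-degenerate), and let $J$ be the twist associated to $(S,\alpha)$. Then $(kG)^J$ is a simple Hopf algebra.
   Context: $k$ is an algebraically closed field of characteristic zero. For a 2-cocycle $\alpha$ on a finite group $S$ (trivial action on $k^*$), $k_\alpha S$ is the twisted group algebra with basis $(x_s)_{s\in S}$, $x_sx_t=\alpha(s,t)x_{st}$; $\alpha$ is non-degenerate if $1$ is the only $s\in S$ with $\alpha(s,t)=\alpha(t,s)$ for all $t\in C_S(s)$ (this depends only on the cohomology class). For a finite group $G$, a subgroup $S$ and $\alpha$ non-degenerate on $S$, the $k^G$-Galois object associated to $(S,\alpha)$ is $A(G,S,\alpha)=\{f:G\to k_\alpha S : f(sg)=s\rhd f(g)\ \forall s\in S,g\in G\}$ with pointwise product, $s\rhd x_t=x_sx_tx_s^{-1}$, and $G$-action $(g.f)(h)=f(hg)$, equivalently right $k^G$-coaction $\rho(a)=\sum_g g.a\otimes e_g$, $e_g(h)=\delta_{g,h}$. Up to isomorphism it depends only on the cohomology class of $\alpha$. For a Hopf algebra $H$ and a convolution invertible normalized 2-cocycle $\sigma:H\otimes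 H\to k$, $H^{(\sigma)}$ denotes $H$ as a right $H$-comodule with product $h\cdot g=\sigma(h_1,g_1)h_2g_2$, and $H^\sigma$ denotes the Hopf algebra equal to $H$ as a coalgebra with product $\sigma(h_1,g_1)h_2g_2\sigma^{-1}(h_3,g_3)$. There is $\sigma$ on $H=k^G$ with $A(G,S,\alpha)\simeq (k^G)^{(\sigma)}$ as right $k^G$-comodule algebras. The associated twist is the element $J\in kG\otimes kG$ given by $\sigma$ (it may be chosen in $kS\otimes kS$); $(kG)^J$ is the Hopf algebra equal to $kG$ as an algebra, with comultiplication $\Delta_J(x)=J\Delta(x)J^{-1}$; thus $(kG)^J\simeq((k^G)^\sigma)^*$. A Hopf subalgebra is normal if it is stable under the (left or right) adjoint action. A finite-dimensional Hopf algebra is simple if it contains no proper normal Hopf subalgebra, i.e. none other than $k$ and itself. *)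

theory Defs
  imports
    "HOL-Algebra.Elementary_Groups"
    "HOL-Computational_Algebra.Computational_Algebra"
    "HOL-Library.Function_Algebras"
begin

section \<open>Vector spaces of functions and their tensor products\<close>

text \<open>
  All vector spaces are subspaces of spaces \<open>'i \<Rightarrow> 'k\<close>. If \<open>V \<subseteq> ('i \<Rightarrow> 'k)\<close> and
  \<open>W \<subseteq> ('j \<Rightarrow> 'k)\<close>, then \<open>V \<otimes> W\<close> is the span in \<open>'i \<times> 'j \<Rightarrow> 'k\<close> of the products
  \<open>\<lambda>(i, j). x i * y j\<close>; the canonical map from the abstract tensor product is injective.
  The space with basis \<open>I\<close> is the space of functions vanishing off \<open>I\<close> (for finite \<open>I\<close>),
  and then \<open>free_space I \<otimes> free_space J = free_space (I \<times> J)\<close>.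
\<close>

definition fscale :: "'k::field \<Rightarrow> ('i \<Rightarrow> 'k) \<Rightarrow> ('i \<Rightarrow> 'k)" where
  "fscale c x = (\<lambda>i. c * x i)"

interpretation fun_space: vector_space "fscale :: 'k::field \<Rightarrow> ('i \<Rightarrow> 'k) \<Rightarrow> ('i \<Rightarrow> 'k)"
  by unfold_locales (auto simp: fscale_def fun_eq_iff algebra_simps)

definition free_space :: "'i set \<Rightarrow> ('i \<Rightarrow> 'k::field) set" where
  "free_space I = {x. \<forall>i. i \<notin> I \<longrightarrow> x i = 0}"

definition basis_vec :: "'i \<Rightarrow> ('i \<Rightarrow> 'k::field)" where
  "basis_vec i = (\<lambda>j. if j = i then 1 else 0)"

definition linear_form_on :: "('i \<Rightarrow> 'k::field) set \<Rightarrow> (('i \<Rightarrow> 'k) \<Rightarrow> 'k) \<Rightarrow> bool" where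
  "linear_form_on V f \<longleftrightarrow>
     (\<forall>x\<in>V. \<forall>y\<in>V. f (x + y) = f x + f y) \<and> (\<forall>c. \<forall>x\<in>V. f (fscale c x) = c * f x)"

definition linear_map_on :: "('i \<Rightarrow> 'k::field) set \<Rightarrow> (('i \<Rightarrow> 'k) \<Rightarrow> ('j \<Rightarrow> 'k)) \<Rightarrow> bool" where
  "linear_map_on V f \<longleftrightarrow>
     (\<forall>x\<in>V. \<forall>y\<in>V. f (x + y) = f x + f y) \<and> (\<forall>c. \<forall>x\<in>V. f (fscale c x) = fscale c (f x))"

definition tensor :: "('i \<Rightarrow> 'k::field) \<Rightarrow> ('j \<Rightarrow> 'k) \<Rightarrow> ('i \<times> 'j \<Rightarrow> 'k)" where
  "tensor x y = (\<lambda>(i, j). x i * y j)"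

definition tensor_space :: "('i \<Rightarrow> 'k::field) set \<Rightarrow> ('j \<Rightarrow> 'k) set \<Rightarrow> ('i \<times> 'j \<Rightarrow> 'k) set" where
  "tensor_space V W = fun_space.span {tensor x y |x y. x \<in> V \<and> y \<in> W}"

text \<open>
  The map \<open>\<phi> \<otimes> id\<close>: writing \<open>t = \<Sum>\<^sub>n x\<^sub>n \<otimes> y\<^sub>n\<close>, the slice \<open>\<lambda>i. t (i, j)\<close> is
  \<open>\<Sum>\<^sub>n y\<^sub>n j * x\<^sub>n\<close>, which \<open>\<phi>\<close> sends to \<open>\<Sum>\<^sub>n y\<^sub>n j * \<phi> x\<^sub>n\<close>.
\<close>

definition map_tensor_id ::
    "(('i \<Rightarrow> 'k::field) \<Rightarrow> ('l \<Rightarrow> 'k)) \<Rightarrow> ('i \<times> 'j \<Rightarrow> 'k) \<Rightarrow> ('l \<times> 'j \<Rightarrow> 'k)" where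
  "map_tensor_id \<phi> t = (\<lambda>(l, j). \<phi> (\<lambda>i. t (i, j)) l)"


section \<open>Finite-dimensional algebras and Hopf algebras\<close>

record ('i, 'k) based_algebra = "('i \<Rightarrow> 'k) monoid" +
  basis :: "'i set"

locale fd_algebra = monoid A
  for A :: "('i, 'k::field, 'm) based_algebra_scheme" (structure) +
  assumes finite_basis: "finite (basis A)"
    and carrier_eq: "carrier A = free_space (basis A)"
    and linear_mult_left: "y \<in> carrier A \<Longrightarrow> linear_map_on (carrier A) (\<lambda>x. x \<otimes> y)"
    and linear_mult_right: "x \<in> carrier A \<Longrightarrow> linear_map_on (carrier A) (\<lambda>y. x \<otimes> y)"

text \<open>The product is \<open>(a \<otimes> b) (a' \<otimes> b') = a a' \<otimes> b b'\<close>, extended bilinearly.\<close>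

definition tensor_algebra ::
    "('i, 'k::field, 'm) based_algebra_scheme \<Rightarrow> ('j, 'k, 'n) based_algebra_scheme
      \<Rightarrow> ('i \<times> 'j, 'k) based_algebra" where
  "tensor_algebra A B =
     \<lparr>carrier = free_space (basis A \<times> basis B),
      monoid.mult = (\<lambda>t u. \<Sum>(i, j)\<in>basis A \<times> basis B. \<Sum>(i', j')\<in>basis A \<times> basis B.
        fscale (t (i, j) * u (i', j'))
          (tensor (basis_vec i \<otimes>\<^bsub>A\<^esub> basis_vec i') (basis_vec j \<otimes>\<^bsub>B\<^esub> basis_vec j'))),
      one = tensor \<one>\<^bsub>A\<^esub> \<one>\<^bsub>B\<^esub>,
      basis = basis A \<times> basis B\<rparr>"

record ('i, 'k) bialgebra = "('i, 'k) based_algebra" +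
  comult :: "('i \<Rightarrow> 'k) \<Rightarrow> ('i \<times> 'i \<Rightarrow> 'k)"
  counit :: "('i \<Rightarrow> 'k) \<Rightarrow> 'k"

text \<open>
  For \<open>f\<close> bilinear, \<open>sweedler_form H f x\<close> is \<open>f x\<^sub>1 x\<^sub>2\<close> in Sweedler notation for a
  scalar-valued \<open>f\<close>, and \<open>sweedler H f x\<close> the same for an \<open>f\<close> with values in a space of functions.
\<close>

definition sweedler_form ::
    "('i, 'k::field, 'm) bialgebra_scheme \<Rightarrow> (('i \<Rightarrow> 'k) \<Rightarrow> ('i \<Rightarrow> 'k) \<Rightarrow> 'k) \<Rightarrow> ('i \<Rightarrow> 'k) \<Rightarrow> 'k" where
  "sweedler_form H f x =
     (\<Sum>(i, j)\<in>basis H \<times> basis H. comult H x (i, j) * f (basis_vec i) (basis_vec j))"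

definition sweedler ::
    "('i, 'k::field, 'm) bialgebra_scheme \<Rightarrow> (('i \<Rightarrow> 'k) \<Rightarrow> ('i \<Rightarrow> 'k) \<Rightarrow> ('l \<Rightarrow> 'k))
      \<Rightarrow> ('i \<Rightarrow> 'k) \<Rightarrow> ('l \<Rightarrow> 'k)" where
  "sweedler H f x =
     (\<Sum>(i, j)\<in>basis H \<times> basis H. fscale (comult H x (i, j)) (f (basis_vec i) (basis_vec j)))"

locale fd_bialgebra = fd_algebra H
  for H :: "('i, 'k::field, 'm) bialgebra_scheme" (structure) +
  assumes comult_closed: "x \<in> carrier H \<Longrightarrow> comult H x \<in> free_space (basis H \<times> basis H)"
    and linear_comult: "linear_map_on (carrier H) (comult H)"
    and linear_counit: "linear_form_on (carrier H) (counit H)"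
    and coassoc: "x \<in> carrier H \<Longrightarrow>
          sweedler H (\<lambda>a b. tensor a (comult H b)) x =
          sweedler H (\<lambda>a b. \<lambda>(i, j, l). tensor (comult H a) b ((i, j), l)) x"
    and counit_left: "x \<in> carrier H \<Longrightarrow> sweedler H (\<lambda>a b. fscale (counit H a) b) x = x"
    and counit_right: "x \<in> carrier H \<Longrightarrow> sweedler H (\<lambda>a b. fscale (counit H b) a) x = x"
    and comult_mult: "\<lbrakk>x \<in> carrier H; y \<in> carrier H\<rbrakk> \<Longrightarrow>
          comult H (x \<otimes> y) = comult H x \<otimes>\<^bsub>tensor_algebra H H\<^esub> comult H y"
    and comult_one: "comult H \<one> = \<one>\<^bsub>tensor_algebra H H\<^esub>"
    and counit_mult: "\<lbrakk>x \<in> carrier H; y \<in> carrier H\<rbrakk> \<Longrightarrow>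
          counit H (x \<otimes> y) = counit H x * counit H y"
    and counit_one: "counit H \<one> = 1"

definition is_antipode ::
    "('i, 'k::field, 'm) bialgebra_scheme \<Rightarrow> (('i \<Rightarrow> 'k) \<Rightarrow> ('i \<Rightarrow> 'k)) \<Rightarrow> bool" where
  "is_antipode H S \<longleftrightarrow>
     linear_map_on (carrier H) S \<and> S \<in> carrier H \<rightarrow> carrier H \<and>
     (\<forall>x\<in>carrier H.
        sweedler H (\<lambda>a b. S a \<otimes>\<^bsub>H\<^esub> b) x = fscale (counit H x) \<one>\<^bsub>H\<^esub> \<and>
        sweedler H (\<lambda>a b. a \<otimes>\<^bsub>H\<^esub> S b) x = fscale (counit H x) \<one>\<^bsub>H\<^esub>)"

definition hopf_algebra :: "('i, 'k::field, 'm) bialgebra_scheme \<Rightarrow> bool" where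
  "hopf_algebra H \<longleftrightarrow> fd_bialgebra H \<and> (\<exists>S. is_antipode H S)"

text \<open>An antipode is unique on the carrier; its values elsewhere are irrelevant.\<close>

definition antipode :: "('i, 'k::field, 'm) bialgebra_scheme \<Rightarrow> ('i \<Rightarrow> 'k) \<Rightarrow> ('i \<Rightarrow> 'k)" where
  "antipode H = (SOME S. is_antipode H S)"

definition hopf_subalgebra :: "('i \<Rightarrow> 'k::field) set \<Rightarrow> ('i, 'k, 'm) bialgebra_scheme \<Rightarrow> bool" where
  "hopf_subalgebra B H \<longleftrightarrow>
     B \<subseteq> carrier H \<and> fun_space.subspace B \<and>
     \<one>\<^bsub>H\<^esub> \<in> B \<and> (\<forall>x\<in>B. \<forall>y\<in>B. x \<otimes>\<^bsub>H\<^esub> y \<in> B) \<and>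
     (\<forall>x\<in>B. comult H x \<in> tensor_space B B) \<and>
     (\<forall>x\<in>B. antipode H x \<in> B)"

text \<open>\<open>h\<^sub>1 y S(h\<^sub>2)\<close> and \<open>S(h\<^sub>1) y h\<^sub>2\<close>\<close>

definition left_adjoint ::
    "('i, 'k::field, 'm) bialgebra_scheme \<Rightarrow> ('i \<Rightarrow> 'k) \<Rightarrow> ('i \<Rightarrow> 'k) \<Rightarrow> ('i \<Rightarrow> 'k)" where
  "left_adjoint H h y = sweedler H (\<lambda>a b. a \<otimes>\<^bsub>H\<^esub> y \<otimes>\<^bsub>H\<^esub> antipode H b) h"

definition right_adjoint ::
    "('i, 'k::field, 'm) bialgebra_scheme \<Rightarrow> ('i \<Rightarrow> 'k) \<Rightarrow> ('i \<Rightarrow> 'k) \<Rightarrow> ('i \<Rightarrow> 'k)" where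
  "right_adjoint H h y = sweedler H (\<lambda>a b. antipode H a \<otimes>\<^bsub>H\<^esub> y \<otimes>\<^bsub>H\<^esub> b) h"

text \<open>
  In a finite-dimensional Hopf algebra the antipode is bijective and interchanges the two
  stability conditions, so that either one of them expresses normality.
\<close>

definition normal_hopf_subalgebra ::
    "('i \<Rightarrow> 'k::field) set \<Rightarrow> ('i, 'k, 'm) bialgebra_scheme \<Rightarrow> bool" where
  "normal_hopf_subalgebra B H \<longleftrightarrow>
     hopf_subalgebra B H \<and>
     ((\<forall>h\<in>carrier H. \<forall>y\<in>B. left_adjoint H h y \<in> B) \<or>
      (\<forall>h\<in>carrier H. \<forall>y\<in>B. right_adjoint H h y \<in> B))"

definition simple_hopf_algebra :: "('i, 'k::field, 'm) bialgebra_scheme \<Rightarrow> bool" where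
  "simple_hopf_algebra H \<longleftrightarrow>
     hopf_algebra H \<and>
     (\<forall>B. normal_hopf_subalgebra B H \<longrightarrow> B = range (\<lambda>c. fscale c \<one>\<^bsub>H\<^esub>) \<or> B = carrier H)"


section \<open>Hopf 2-cocycles and comodule algebras\<close>

text \<open>
  A linear form on \<open>H \<otimes> H\<close> is given as a bilinear form on \<open>H\<close>. The cocycle identity is
  \<open>\<sigma>(h\<^sub>1, g\<^sub>1) \<sigma>(h\<^sub>2 g\<^sub>2, l) = \<sigma>(g\<^sub>1, l\<^sub>1) \<sigma>(h, g\<^sub>2 l\<^sub>2)\<close>, which is equivalent to
  associativity of the product \<open>\<sigma>(h\<^sub>1, g\<^sub>1) h\<^sub>2 g\<^sub>2\<close>.
\<close>

definition bilinear_form_on ::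
    "('i \<Rightarrow> 'k::field) set \<Rightarrow> (('i \<Rightarrow> 'k) \<Rightarrow> ('i \<Rightarrow> 'k) \<Rightarrow> 'k) \<Rightarrow> bool" where
  "bilinear_form_on V \<sigma> \<longleftrightarrow>
     (\<forall>y\<in>V. linear_form_on V (\<lambda>x. \<sigma> x y)) \<and> (\<forall>x\<in>V. linear_form_on V (\<lambda>y. \<sigma> x y))"

definition convolution ::
    "('i, 'k::field, 'm) bialgebra_scheme \<Rightarrow> (('i \<Rightarrow> 'k) \<Rightarrow> ('i \<Rightarrow> 'k) \<Rightarrow> 'k)
      \<Rightarrow> (('i \<Rightarrow> 'k) \<Rightarrow> ('i \<Rightarrow> 'k) \<Rightarrow> 'k) \<Rightarrow> ('i \<Rightarrow> 'k) \<Rightarrow> ('i \<Rightarrow> 'k) \<Rightarrow> 'k" where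
  "convolution H \<sigma> \<tau> h g =
     sweedler_form H (\<lambda>h1 h2. sweedler_form H (\<lambda>g1 g2. \<sigma> h1 g1 * \<tau> h2 g2) g) h"

definition convolution_invertible ::
    "('i, 'k::field, 'm) bialgebra_scheme \<Rightarrow> (('i \<Rightarrow> 'k) \<Rightarrow> ('i \<Rightarrow> 'k) \<Rightarrow> 'k) \<Rightarrow> bool" where
  "convolution_invertible H \<sigma> \<longleftrightarrow>
     (\<exists>\<tau>. bilinear_form_on (carrier H) \<tau> \<and>
        (\<forall>h\<in>carrier H. \<forall>g\<in>carrier H.
           convolution H \<sigma> \<tau> h g = counit H h * counit H g \<and>
           convolution H \<tau> \<sigma> h g = counit H h * counit H g))"

definition hopf_2cocycle ::
    "('i, 'k::field, 'm) bialgebra_scheme \<Rightarrow> (('i \<Rightarrow> 'k) \<Rightarrow> ('i \<Rightarrow> 'k) \<Rightarrow> 'k) \<Rightarrow> bool" where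
  "hopf_2cocycle H \<sigma> \<longleftrightarrow>
     bilinear_form_on (carrier H) \<sigma> \<and>
     convolution_invertible H \<sigma> \<and>
     (\<forall>h\<in>carrier H. \<sigma> h \<one>\<^bsub>H\<^esub> = counit H h \<and> \<sigma> \<one>\<^bsub>H\<^esub> h = counit H h) \<and>
     (\<forall>h\<in>carrier H. \<forall>g\<in>carrier H. \<forall>l\<in>carrier H.
        sweedler_form H (\<lambda>h1 h2. sweedler_form H (\<lambda>g1 g2. \<sigma> h1 g1 * \<sigma> (h2 \<otimes>\<^bsub>H\<^esub> g2) l) g) h =
        sweedler_form H (\<lambda>g1 g2. sweedler_form H (\<lambda>l1 l2. \<sigma> g1 l1 * \<sigma> h (g2 \<otimes>\<^bsub>H\<^esub> l2)) l) g)"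

record ('x, 'k, 'i) comodule_algebra = "('x \<Rightarrow> 'k) monoid" +
  coaction :: "('x \<Rightarrow> 'k) \<Rightarrow> ('x \<times> 'i \<Rightarrow> 'k)"

definition comodule_algebra_iso ::
    "('x, 'k::field, 'i) comodule_algebra \<Rightarrow> ('y, 'k, 'i) comodule_algebra
      \<Rightarrow> (('x \<Rightarrow> 'k) \<Rightarrow> ('y \<Rightarrow> 'k)) \<Rightarrow> bool" where
  "comodule_algebra_iso A B \<phi> \<longleftrightarrow>
     \<phi> \<in> iso A B \<and> \<phi> \<one>\<^bsub>A\<^esub> = \<one>\<^bsub>B\<^esub> \<and> linear_map_on (carrier A) \<phi> \<and>
     (\<forall>a\<in>carrier A. coaction B (\<phi> a) = map_tensor_id \<phi> (coaction A a))"

text \<open>The comodule algebra \<open>H\<^sup>(\<^sup>\<sigma>\<^sup>)\<close>, with product \<open>\<sigma>(h\<^sub>1, g\<^sub>1) h\<^sub>2 g\<^sub>2\<close>.\<close>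

definition cocycle_comodule_algebra ::
    "('i, 'k::field, 'm) bialgebra_scheme \<Rightarrow> (('i \<Rightarrow> 'k) \<Rightarrow> ('i \<Rightarrow> 'k) \<Rightarrow> 'k)
      \<Rightarrow> ('i, 'k, 'i) comodule_algebra" where
  "cocycle_comodule_algebra H \<sigma> =
     \<lparr>carrier = carrier H,
      monoid.mult = (\<lambda>h g.
        sweedler H (\<lambda>h1 h2. sweedler H (\<lambda>g1 g2. fscale (\<sigma> h1 g1) (h2 \<otimes>\<^bsub>H\<^esub> g2)) g) h),
      one = \<one>\<^bsub>H\<^esub>,
      coaction = comult H\<rparr>"


section \<open>Group algebras, function algebras and twisting\<close>

definition group_algebra :: "('g, 'm) monoid_scheme \<Rightarrow> ('g, 'k::field) bialgebra" where
  "group_algebra G =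
     \<lparr>carrier = free_space (carrier G),
      monoid.mult = (\<lambda>x y. \<Sum>g\<in>carrier G. \<Sum>h\<in>carrier G. fscale (x g * y h) (basis_vec (g \<otimes>\<^bsub>G\<^esub> h))),
      one = basis_vec \<one>\<^bsub>G\<^esub>,
      basis = carrier G,
      comult = (\<lambda>x. \<Sum>g\<in>carrier G. fscale (x g) (tensor (basis_vec g) (basis_vec g))),
      counit = (\<lambda>x. \<Sum>g\<in>carrier G. x g)\<rparr>"

text \<open>
  The dual \<open>k\<^sup>G\<close>, with basis vectors \<open>e\<^sub>g\<close>; \<open>\<Delta>(x) = \<Sum> x(gh) e\<^sub>g \<otimes> e\<^sub>h\<close>.
\<close>

definition function_algebra :: "('g, 'm) monoid_scheme \<Rightarrow> ('g, 'k::field) bialgebra" where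
  "function_algebra G =
     \<lparr>carrier = free_space (carrier G),
      monoid.mult = (\<lambda>x y. \<lambda>g. x g * y g),
      one = (\<lambda>g. if g \<in> carrier G then 1 else 0),
      basis = carrier G,
      comult = (\<lambda>x. \<lambda>(g, h). if g \<in> carrier G \<and> h \<in> carrier G then x (g \<otimes>\<^bsub>G\<^esub> h) else 0),
      counit = (\<lambda>x. x \<one>\<^bsub>G\<^esub>)\<rparr>"

text \<open>The element of \<open>kG \<otimes> kG = (k\<^sup>G \<otimes> k\<^sup>G)\<^sup>*\<close> given by a bilinear form on \<open>k\<^sup>G\<close>.\<close>

definition twist_of_form ::
    "('g, 'm) monoid_scheme \<Rightarrow> (('g \<Rightarrow> 'k::field) \<Rightarrow> ('g \<Rightarrow> 'k) \<Rightarrow> 'k) \<Rightarrow> ('g \<times> 'g \<Rightarrow> 'k)" where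
  "twist_of_form G \<sigma> =
     (\<Sum>(g, h)\<in>carrier G \<times> carrier G.
        fscale (\<sigma> (basis_vec g) (basis_vec h)) (tensor (basis_vec g) (basis_vec h)))"

text \<open>The Hopf algebra \<open>(kG)\<^sup>J\<close>, with comultiplication \<open>x \<mapsto> J \<Delta>(x) J\<^sup>-\<^sup>1\<close>.\<close>

definition twisted_hopf_algebra ::
    "('g, 'm) monoid_scheme \<Rightarrow> ('g \<times> 'g \<Rightarrow> 'k::field) \<Rightarrow> ('g, 'k) bialgebra" where
  "twisted_hopf_algebra G J =
     (let KG = group_algebra G; T = tensor_algebra KG KG
      in KG\<lparr>comult := (\<lambda>x. J \<otimes>\<^bsub>T\<^esub> comult KG x \<otimes>\<^bsub>T\<^esub> inv\<^bsub>T\<^esub> J)\<rparr>)"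


section \<open>Group 2-cocycles and the Galois objects \<open>A(G, S, \<alpha>)\<close>\<close>

definition group_2cocycle :: "('s, 'm) monoid_scheme \<Rightarrow> ('s \<Rightarrow> 's \<Rightarrow> 'k::field) \<Rightarrow> bool" where
  "group_2cocycle S \<alpha> \<longleftrightarrow>
     (\<forall>s\<in>carrier S. \<forall>t\<in>carrier S. \<alpha> s t \<noteq> 0) \<and>
     (\<forall>s\<in>carrier S. \<forall>t\<in>carrier S. \<forall>u\<in>carrier S.
        \<alpha> s t * \<alpha> (s \<otimes>\<^bsub>S\<^esub> t) u = \<alpha> t u * \<alpha> s (t \<otimes>\<^bsub>S\<^esub> u))"

definition group_2coboundary :: "('s, 'm) monoid_scheme \<Rightarrow> ('s \<Rightarrow> 's \<Rightarrow> 'k::field) \<Rightarrow> bool" where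
  "group_2coboundary S \<alpha> \<longleftrightarrow>
     (\<exists>c. (\<forall>s\<in>carrier S. c s \<noteq> 0) \<and>
        (\<forall>s\<in>carrier S. \<forall>t\<in>carrier S. \<alpha> s t = c s * c t / c (s \<otimes>\<^bsub>S\<^esub> t)))"

definition nondegenerate :: "('s, 'm) monoid_scheme \<Rightarrow> ('s \<Rightarrow> 's \<Rightarrow> 'k::field) \<Rightarrow> bool" where
  "nondegenerate S \<alpha> \<longleftrightarrow>
     (\<forall>s\<in>carrier S.
        (\<forall>t\<in>carrier S. s \<otimes>\<^bsub>S\<^esub> t = t \<otimes>\<^bsub>S\<^esub> s \<longrightarrow> \<alpha> s t = \<alpha> t s) \<longrightarrow> s = \<one>\<^bsub>S\<^esub>)"

text \<open>
  The algebra \<open>k\<^sub>\<alpha>S\<close>. The cocycle is not assumed to be normalized, hence the scalar in the unit.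
\<close>

definition twisted_group_algebra ::
    "('s, 'm) monoid_scheme \<Rightarrow> ('s \<Rightarrow> 's \<Rightarrow> 'k::field) \<Rightarrow> ('s, 'k) based_algebra" where
  "twisted_group_algebra S \<alpha> =
     \<lparr>carrier = free_space (carrier S),
      monoid.mult = (\<lambda>x y. \<Sum>s\<in>carrier S. \<Sum>t\<in>carrier S.
        fscale (x s * y t * \<alpha> s t) (basis_vec (s \<otimes>\<^bsub>S\<^esub> t))),
      one = fscale (inverse (\<alpha> \<one>\<^bsub>S\<^esub> \<one>\<^bsub>S\<^esub>)) (basis_vec \<one>\<^bsub>S\<^esub>),
      basis = carrier S\<rparr>"

definition twisted_conj ::
    "('s, 'm) monoid_scheme \<Rightarrow> ('s \<Rightarrow> 's \<Rightarrow> 'k::field) \<Rightarrow> 's \<Rightarrow> ('s \<Rightarrow> 'k) \<Rightarrow> ('s \<Rightarrow> 'k)" where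
  "twisted_conj S \<alpha> s y =
     (let A = twisted_group_algebra S \<alpha> in basis_vec s \<otimes>\<^bsub>A\<^esub> y \<otimes>\<^bsub>A\<^esub> inv\<^bsub>A\<^esub> (basis_vec s))"

text \<open>
  A map \<open>f: G \<rightarrow> k\<^sub>\<alpha>S\<close> is stored uncurried: \<open>f (g, s)\<close> is the coefficient of \<open>x\<^sub>s\<close> in
  \<open>f(g)\<close>, so that \<open>curry f g\<close> is the value \<open>f(g)\<close>. In the coaction
  \<open>\<rho>(f) = \<Sum>\<^sub>g g.f \<otimes> e\<^sub>g\<close> the coefficient at \<open>((h, s), g)\<close> is \<open>(g.f)(h)\<^sub>s = f(h g)\<^sub>s\<close>.
\<close>

definition galois_object ::
    "('g, 'm) monoid_scheme \<Rightarrow> 'g set \<Rightarrow> ('g \<Rightarrow> 'g \<Rightarrow> 'k::field)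
      \<Rightarrow> ('g \<times> 'g, 'k, 'g) comodule_algebra" where
  "galois_object G S \<alpha> =
     (let GS = G\<lparr>carrier := S\<rparr>; A = twisted_group_algebra GS \<alpha>
      in \<lparr>carrier = {f \<in> free_space (carrier G \<times> S).
             \<forall>s\<in>S. \<forall>g\<in>carrier G. curry f (s \<otimes>\<^bsub>G\<^esub> g) = twisted_conj GS \<alpha> s (curry f g)},
          monoid.mult = (\<lambda>f f'. \<lambda>(g, s).
             if g \<in> carrier G then (curry f g \<otimes>\<^bsub>A\<^esub> curry f' g) s else 0),
          one = (\<lambda>(g, s). if g \<in> carrier G then \<one>\<^bsub>A\<^esub> s else 0),
          coaction = (\<lambda>f. \<lambda>((h, s), g).
             if h \<in> carrier G \<and> g \<in> carrier G then f (h \<otimes>\<^bsub>G\<^esub> g, s) else 0)\<rparr>)"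

text \<open>
  The twist associated to \<open>(S, \<alpha>)\<close> is determined only up to gauge equivalence, hence a predicate.
\<close>

definition associated_twist ::
    "('g, 'm) monoid_scheme \<Rightarrow> 'g set \<Rightarrow> ('g \<Rightarrow> 'g \<Rightarrow> 'k::field) \<Rightarrow> ('g \<times> 'g \<Rightarrow> 'k) \<Rightarrow> bool" where
  "associated_twist G S \<alpha> J \<longleftrightarrow>
     (\<exists>\<sigma>. hopf_2cocycle (function_algebra G) \<sigma> \<and>
        (\<exists>\<phi>. comodule_algebra_iso
               (cocycle_comodule_algebra (function_algebra G) \<sigma>) (galois_object G S \<alpha>) \<phi>) \<and>
        J = twist_of_form G \<sigma>)"


section \<open>Semidirect products\<close>

text \<open>
  \<open>G\<close> is an (internal) semidirect product \<open>A \<rtimes> B\<close>, for some action of \<open>B\<close> on \<open>A\<close>.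
\<close>

definition is_semidirect_product ::
    "('g, 'm) monoid_scheme \<Rightarrow> ('a, 'n) monoid_scheme \<Rightarrow> ('b, 'l) monoid_scheme \<Rightarrow> bool" where
  "is_semidirect_product G A B \<longleftrightarrow>
     (\<exists>N Q. N \<lhd> G \<and> subgroup Q G \<and> N \<inter> Q = {\<one>\<^bsub>G\<^esub>} \<and> N <#>\<^bsub>G\<^esub> Q = carrier G \<and>
        G\<lparr>carrier := N\<rparr> \<cong> A \<and> G\<lparr>carrier := Q\<rparr> \<cong> B)"

end

theory Submission
  imports Defs "HOL-Algebra.Multiplicative_Group"
begin

text \<open>
  Let \<open>B\<close> be a normal Hopf subalgebra of \<open>(kG)\<^sup>J\<close>. The ideal of \<open>kG\<close> generated by the augmentation
  ideal of \<open>B\<close> belongs to a normal subgroup \<open>N\<close> of \<open>G\<close>, and comparing it with an integral of \<open>B\<close>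
  shows that the idempotent \<open>avg N\<close>, the average of the elements of \<open>N\<close>, lies in \<open>B\<close> and is an
  integral of \<open>B\<close>. So \<open>B = k\<close> if \<open>N = 1\<close>, and \<open>B = kG\<close> if \<open>N = G\<close>.

  The Galois object gives \<open>J = (v \<otimes> v) J\<^sub>0 \<Delta>(v)\<^sup>-\<^sup>1\<close> with \<open>v \<in> kG\<close> invertible, where
  \<open>J\<^sub>0 = \<Sum> \<alpha>(s, t) E\<^sub>s \<otimes> E\<^sub>t\<close> and the \<open>E\<^sub>s\<close> are the primitive idempotents of \<open>kS\<close>. For \<open>m \<in> S\<close>,
  slices of the coproduct of \<open>avg N\<close> give elements \<open>x \<in> kN\<close> of weight
  \<open>\<alpha>(s, m) / \<alpha>(m, s)\<close> under conjugation by \<open>s \<in> S\<close> that lie in \<open>v\<^sup>-\<^sup>1 B v\<close> up to a unit of \<open>kS\<close>. If such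
  an \<open>x\<close> is nonzero, its own coproduct shows that \<open>m \<in> N\<close>.

  If \<open>N\<close> contains an element of order \<open>p\<close> of \<open>G\<^sub>1\<close>, then such an \<open>x \<noteq> 0\<close> exists for every
  \<open>m \<in> S \<inter> G\<^sub>2\<close>. A nontrivial \<open>N\<close> meets \<open>G\<^sub>1\<close> or \<open>G\<^sub>2\<close>, say \<open>G\<^sub>1\<close>, so it contains the elements of
  order \<open>p\<close> of \<open>G\<^sub>1\<close>, hence \<open>S \<inter> G\<^sub>2\<close>, hence \<open>G\<^sub>2\<close>, and by symmetry also \<open>G\<^sub>1\<close>.
\<close>

section \<open>Linear maps and group algebras\<close>

text \<open>The twisted coproduct need not be cocommutative, so a Hopf subalgebra \<open>B\<close>
  need not be spanned by group elements. Its ideal is easier: twisting only conjugates the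
  coproduct, and a two-sided ideal absorbs J and its inverse, so the ideal is also a coideal for the
  cocommutative coproduct of kG and the quotient is some k[G/N]. So far J puts no restriction on
  \<open>N\<close>; in G the two factors are independent, and \<alpha> must couple them.

  The coupling is the commutator pairing \<open>bichar\<close>. Being nondegenerate, it indexes the
  characters of S by S. This makes \<open>J0\<close> diagonal, and an element of weight m acquires
  the group element m in the second leg of its coproduct, which coinvariance forces to be trivial
  modulo \<open>N\<close>. The danger is that the element of weight m vanishes. If n has a component
  of order p in G1, then y n x = n with x, y in S forces x into S \<inter> G2; that group is cyclic,
  so the alternating pairing is trivial on it. Hence for m in S \<inter> G2 nothing cancels, and
  information passes from G1 to G2 and, symmetrically, back.\<close>

abbreviation lin :: "(('i \<Rightarrow> 'k::field) \<Rightarrow> ('j \<Rightarrow> 'k)) \<Rightarrow> bool" where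
  "lin \<equiv> linear_map_on UNIV"

lemma linI: "(\<And>x y. f (x + y) = f x + f y) \<Longrightarrow> (\<And>c x. f (fscale c x) = fscale c (f x)) \<Longrightarrow> lin f"
  by (auto simp: linear_map_on_def)

lemma lin_add: "lin f \<Longrightarrow> f (x + y) = f x + f y"
  and lin_scale: "lin f \<Longrightarrow> f (fscale c x) = fscale c (f x)"
  by (auto simp: linear_map_on_def)

lemma lin_iff_linear: "lin f \<longleftrightarrow> Vector_Spaces.linear fscale fscale f"
  unfolding linear_map_on_def Vector_Spaces.linear_iff
  by (simp add: fun_space.vector_space_axioms)

lemma lin_zero: "lin f \<Longrightarrow> f 0 = 0"
  using lin_scale[of f 0 0] by (simp add: fscale_def zero_fun_def)

lemma lin_sum: "lin f \<Longrightarrow> f (\<Sum>a\<in>A. g a) = (\<Sum>a\<in>A. f (g a))"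
  by (induction A rule: infinite_finite_induct) (simp_all add: lin_zero[of f] lin_add[of f])

lemma lin_diff: "lin f \<Longrightarrow> f (x - y) = f x - f y"
  using lin_add[of f "x - y" y] by (simp add: algebra_simps)

lemma lin_id: "lin (\<lambda>x. x)"
  by (auto intro: linI)

lemma lin_comp: "lin f \<Longrightarrow> lin g \<Longrightarrow> lin (\<lambda>x. f (g x))"
  by (rule linI) (simp_all add: lin_add[of f] lin_add[of g] lin_scale[of f] lin_scale[of g])

lemma fscale_apply [simp]: "fscale c x i = c * x i"
  by (simp add: fscale_def)

lemma sum_fun_apply: "(\<Sum>a\<in>A. f a) i = (\<Sum>a\<in>A. f a i)"
  by (induction A rule: infinite_finite_induct) auto

lemma basis_vec_apply: "basis_vec i j = (if j = i then 1 else 0)"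
  by (simp add: basis_vec_def)

lemma basis_vec_free_space [simp]: "a \<in> A \<Longrightarrow> basis_vec a \<in> free_space A"
  by (auto simp: basis_vec_def free_space_def)

lemma subspace_free_space: "fun_space.subspace (free_space A)"
  by (auto simp: fun_space.subspace_def free_space_def)

lemma fscale_sum: "fscale c (\<Sum>a\<in>A. f a) = (\<Sum>a\<in>A. fscale c (f a))"
  by (rule fun_space.scale_sum_right)

lemma fscale_zero [simp]: "fscale c 0 = 0" "fscale 0 x = 0"
  and fscale_one [simp]: "fscale 1 x = x"
  and fscale_fscale [simp]: "fscale c (fscale d x) = fscale (c * d) x"
  by (auto simp: fscale_def fun_eq_iff)

text \<open>Coordinates outside \<open>A\<close> are ignored, so \<open>lext A f\<close> is linear
  on the whole function space and its rules carry no membership hypotheses. With \<open>A\<close>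
  the index set of a tensor square and the argument a coproduct, this is Sweedler notation.\<close>

definition lext :: "'i set \<Rightarrow> ('i \<Rightarrow> 'j \<Rightarrow> 'k::field) \<Rightarrow> ('i \<Rightarrow> 'k) \<Rightarrow> ('j \<Rightarrow> 'k)" where
  "lext A f x = (\<Sum>a\<in>A. fscale (x a) (f a))"

lemma lin_lext: "lin (lext A f)"
  by (auto intro!: linI simp: lext_def fun_eq_iff sum_fun_apply sum.distrib distrib_right
      sum_distrib_left mult.assoc)

lemma lext_apply: "lext A f x j = (\<Sum>a\<in>A. x a * f a j)"
  by (simp add: lext_def sum_fun_apply)

lemma lext_cong: "(\<And>a. a \<in> A \<Longrightarrow> f a = g a) \<Longrightarrow> lext A f x = lext A g x"
  by (auto simp: lext_def)

lemma lext_basis [simp]: "finite A \<Longrightarrow> a \<in> A \<Longrightarrow> lext A f (basis_vec a) = f a"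
  by (auto simp: fun_eq_iff lext_apply basis_vec_def if_distrib [of "\<lambda>x. x * _"] cong: if_cong)

lemma lin_lext_comm: "lin F \<Longrightarrow> F (lext A f x) = lext A (\<lambda>a. F (f a)) x"
  by (simp add: lext_def lin_sum[of F] lin_scale[of F])

lemma lext_basis_vec_id:
  assumes "finite A" "x \<in> free_space A"
  shows "lext A basis_vec x = x"
proof
  fix i
  have "lext A basis_vec x i = (\<Sum>a\<in>A. if a = i then x a else 0)"
    unfolding lext_apply by (intro sum.cong) (auto simp: basis_vec_def)
  then show "lext A basis_vec x i = x i" using assms by (auto simp: free_space_def)
qed

lemma lin_expand:
  assumes "lin F" "finite A" "x \<in> free_space A"
  shows "F x = lext A (\<lambda>a. F (basis_vec a)) x"
  using lin_lext_comm[OF assms(1), of A basis_vec x] lext_basis_vec_id[OF assms(2,3)] by simp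

lemma lin_eqI:
  assumes "lin F" "lin F'" "finite A" "x \<in> free_space A"
    and "\<And>a. a \<in> A \<Longrightarrow> F (basis_vec a) = F' (basis_vec a)"
  shows "F x = F' x"
  using assms lin_expand[of F A x] lin_expand[of F' A x] lext_cong[of A "\<lambda>a. F (basis_vec a)"] by metis

lemma lext_closed: "fun_space.subspace V \<Longrightarrow> (\<And>a. a \<in> A \<Longrightarrow> f a \<in> V) \<Longrightarrow> lext A f x \<in> V"
  unfolding lext_def by (intro fun_space.subspace_sum fun_space.subspace_scale)

lemma lext_swap: "lext A (\<lambda>a. lext B (f a) y) x = lext B (\<lambda>b. lext A (\<lambda>a. f a b) x) y"
  by (simp add: fun_eq_iff lext_apply sum_distrib_left sum.swap[of _ A B] mult.left_commute)

lemma lin_lext_arg: "(\<And>a. a \<in> A \<Longrightarrow> lin (f a)) \<Longrightarrow> lin (\<lambda>y. lext A (\<lambda>a. f a y) x)"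
proof (rule linI)
  assume f: "\<And>a. a \<in> A \<Longrightarrow> lin (f a)"
  have "lext A (\<lambda>a. f a (y + z)) x = lext A (\<lambda>a. f a y + f a z) x" for y z
    using f by (intro lext_cong) (auto simp: linear_map_on_def)
  then show "lext A (\<lambda>a. f a (y + z)) x = lext A (\<lambda>a. f a y) x + lext A (\<lambda>a. f a z) x" for y z
    by (simp add: fun_eq_iff lext_apply sum.distrib distrib_left)
  have "lext A (\<lambda>a. f a (fscale c y)) x = lext A (\<lambda>a. fscale c (f a y)) x" for c y
    using f by (intro lext_cong) (auto simp: linear_map_on_def)
  then show "lext A (\<lambda>a. f a (fscale c y)) x = fscale c (lext A (\<lambda>a. f a y) x)" for c y
    by (simp add: fun_eq_iff lext_apply sum_distrib_left mult.left_commute)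
qed

lemma lin_tensor_left: "lin (\<lambda>x. tensor x y)" and lin_tensor_right: "lin (tensor x)"
  by (auto intro!: linI simp: tensor_def fun_eq_iff algebra_simps)

lemma tensor_apply [simp]: "tensor x y (i, j) = x i * y j"
  by (simp add: tensor_def)

lemma tensor_basis [simp]: "tensor (basis_vec a) (basis_vec b) = basis_vec (a, b)"
  by (auto simp: tensor_def basis_vec_def fun_eq_iff)

lemma tensor_free_space: "x \<in> free_space A \<Longrightarrow> y \<in> free_space B \<Longrightarrow> tensor x y \<in> free_space (A \<times> B)"
  by (auto simp: free_space_def)

lemma lext_tensor:
  "lext (A \<times> B) f (tensor x y) = lext A (\<lambda>a. lext B (\<lambda>b. f (a, b)) y) x"
proof
  fix j
  show "lext (A \<times> B) f (tensor x y) j = lext A (\<lambda>a. lext B (\<lambda>b. f (a, b)) y) x j"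
    by (simp add: lext_apply sum_distrib_left sum.cartesian_product mult.assoc)
      (intro sum.cong refl, auto)
qed

text \<open>A bilinear product on the whole function space, for an arbitrary group structure: kG
  \<otimes> kG and its threefold analogue are then simply the group algebras of \<open>G2\<close>
  and \<open>G3\<close>.\<close>

definition gmult :: "('g, 'm) monoid_scheme \<Rightarrow> ('g \<Rightarrow> 'k::field) \<Rightarrow> ('g \<Rightarrow> 'k) \<Rightarrow> ('g \<Rightarrow> 'k)"
    (infixl \<open>\<star>\<index>\<close> 70) where
  "x \<star>\<^bsub>G\<^esub> y = lext (carrier G) (\<lambda>g. lext (carrier G) (\<lambda>h. basis_vec (g \<otimes>\<^bsub>G\<^esub> h)) y) x"

text \<open>Along a group homomorphism this is an algebra map (\<open>push_gmult\<close>). The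
  coproduct, the counit applied to one leg and the embeddings of two legs into three are all of this
  kind; the antipode of kG is a push along inversion.\<close>

definition push :: "'i set \<Rightarrow> ('i \<Rightarrow> 'j) \<Rightarrow> ('i \<Rightarrow> 'k::field) \<Rightarrow> ('j \<Rightarrow> 'k)" where
  "push A f = lext A (\<lambda>a. basis_vec (f a))"

lemma lin_push: "lin (push A f)"
  unfolding push_def by (rule lin_lext)

lemma push_basis [simp]: "finite A \<Longrightarrow> a \<in> A \<Longrightarrow> push A f (basis_vec a) = basis_vec (f a)"
  by (simp add: push_def)

lemma push_closed: "(\<And>a. a \<in> A \<Longrightarrow> f a \<in> B) \<Longrightarrow> push A f x \<in> free_space B"
  unfolding push_def by (intro lext_closed subspace_free_space) auto

lemma lext_push:
  assumes "finite B" "\<And>a. a \<in> A \<Longrightarrow> g a \<in> B"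
  shows "lext B f (push A g x) = lext A (\<lambda>a. f (g a)) x"
  unfolding push_def lin_lext_comm[OF lin_lext] using assms by (intro lext_cong) auto

lemma push_push:
  assumes "finite B" "\<And>a. a \<in> A \<Longrightarrow> g a \<in> B"
  shows "push B f (push A g x) = push A (\<lambda>a. f (g a)) x"
  using lext_push[OF assms] unfolding push_def .

lemma lin_gmult_left: "lin (\<lambda>x. x \<star>\<^bsub>G\<^esub> y)"
  unfolding gmult_def by (rule lin_lext)

lemma lin_gmult_right: "lin (\<lambda>y. x \<star>\<^bsub>G\<^esub> y)"
  unfolding gmult_def by (intro lin_lext_arg lin_lext)

lemma gmult_free_space:
  assumes "monoid G"
  shows "x \<star>\<^bsub>G\<^esub> y \<in> free_space (carrier G)"
  unfolding gmult_def using assms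
  by (intro lext_closed subspace_free_space basis_vec_free_space) (auto intro: monoid.m_closed)

lemma gmult_lext_left: "lext A f x \<star>\<^bsub>G\<^esub> y = lext A (\<lambda>a. f a \<star>\<^bsub>G\<^esub> y) x"
  by (rule lin_lext_comm[OF lin_gmult_left])

lemma gmult_lext_right: "y \<star>\<^bsub>G\<^esub> lext A f x = lext A (\<lambda>a. y \<star>\<^bsub>G\<^esub> f a) x"
  by (rule lin_lext_comm[OF lin_gmult_right])

lemmas lin_intros = lin_id lin_comp[OF lin_gmult_left] lin_comp[OF lin_gmult_right]
  lin_comp[OF lin_push] lin_comp[OF lin_lext] lin_comp[OF lin_tensor_left] lin_comp[OF lin_tensor_right]

locale fin_group = group G for G (structure) +
  assumes fin: "finite (carrier G)"
begin

lemma gmult_basis [simp]: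
  "g \<in> carrier G \<Longrightarrow> h \<in> carrier G \<Longrightarrow> basis_vec g \<star> basis_vec h = basis_vec (g \<otimes> h)"
  by (simp add: gmult_def fin)

lemma gmult_closed [simp]: "x \<star> y \<in> free_space (carrier G)"
  by (rule gmult_free_space) (rule monoid_axioms)

lemma gmult_basis_left: "g \<in> carrier G \<Longrightarrow> basis_vec g \<star> y = lext (carrier G) (\<lambda>h. basis_vec (g \<otimes> h)) y"
  by (simp add: gmult_def fin)

lemma gmult_assoc: "(x \<star> y) \<star> z = x \<star> (y \<star> z)"
proof -
  have "(x \<star> y) \<star> z = lext (carrier G) (\<lambda>g. lext (carrier G) (\<lambda>h. lext (carrier G) (\<lambda>k. basis_vec (g \<otimes> h \<otimes> k)) z) y) x"
    unfolding gmult_def[of G x y] gmult_lext_left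
    by (intro lext_cong) (simp add: gmult_basis_left)
  also have "\<dots> = lext (carrier G) (\<lambda>g. basis_vec g \<star> (y \<star> z)) x"
  proof (intro lext_cong)
    fix g assume g: "g \<in> carrier G"
    have "basis_vec g \<star> (y \<star> z) = lext (carrier G) (\<lambda>h. lext (carrier G) (\<lambda>k. basis_vec g \<star> basis_vec (h \<otimes> k)) z) y"
      unfolding gmult_def[of G y z] gmult_lext_right ..
    also have "\<dots> = lext (carrier G) (\<lambda>h. lext (carrier G) (\<lambda>k. basis_vec (g \<otimes> h \<otimes> k)) z) y"
      using g by (intro lext_cong) (simp add: m_assoc)
    finally show "lext (carrier G) (\<lambda>h. lext (carrier G) (\<lambda>k. basis_vec (g \<otimes> h \<otimes> k)) z) y = basis_vec g \<star> (y \<star> z)" ..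
  qed
  also have "\<dots> = x \<star> (y \<star> z)"
    unfolding gmult_def[of G x "y \<star> z"] by (intro lext_cong) (simp add: gmult_basis_left)
  finally show ?thesis .
qed

lemma gmult_one_left: "x \<in> free_space (carrier G) \<Longrightarrow> basis_vec \<one> \<star> x = x"
  by (rule lin_eqI[OF lin_gmult_right lin_id fin]) auto

lemma gmult_one_right: "x \<in> free_space (carrier G) \<Longrightarrow> x \<star> basis_vec \<one> = x"
  by (rule lin_eqI[OF lin_gmult_left lin_id fin]) auto

lemma gmult_basis_right_apply:
  assumes "h \<in> carrier G" "k \<in> carrier G"
  shows "(x \<star> basis_vec h) k = x (k \<otimes> inv h)"
proof -
  have "(x \<star> basis_vec h) k = (\<Sum>g\<in>carrier G. if g = k \<otimes> inv h then x g else 0)"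
    unfolding gmult_def lext_apply[of _ _ x] using assms
    by (intro sum.cong refl) (auto simp: fin basis_vec_apply inv_solve_right' m_assoc)
  then show ?thesis using assms fin by simp
qed

lemma gmult_apply:
  assumes "k \<in> carrier G"
  shows "(x \<star> y) k = (\<Sum>h\<in>carrier G. x (k \<otimes> inv h) * y h)"
proof -
  have "x \<star> y = lext (carrier G) (\<lambda>h. x \<star> basis_vec h) y"
    unfolding gmult_def by (subst lext_swap) (auto simp: fin intro!: lext_cong)
  then show ?thesis
    by (simp add: lext_apply gmult_basis_right_apply assms mult.commute)
qed

lemma gmult_basis_left_apply:
  assumes "h \<in> carrier G" "k \<in> carrier G"
  shows "(basis_vec h \<star> x) k = x (inv h \<otimes> k)"
proof -
  have *: "k \<otimes> inv a = h \<longleftrightarrow> a = inv h \<otimes> k" if "a \<in> carrier G" for a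
    using that assms by (metis inv_solve_left inv_solve_right')
  show ?thesis
    unfolding gmult_apply[OF assms(2)] basis_vec_apply
    using assms fin by (simp add: * if_distrib [of "\<lambda>x. x * _"] cong: if_cong sum.cong)
qed

lemma group_algebra_mult: "x \<otimes>\<^bsub>group_algebra G\<^esub> y = x \<star> y"
  by (simp add: group_algebra_def gmult_def lext_def fscale_sum)

end

lemma push_gmult:
  assumes "fin_group A" "fin_group B" "f \<in> hom A B"
  shows "push (carrier A) f (x \<star>\<^bsub>A\<^esub> y) = push (carrier A) f x \<star>\<^bsub>B\<^esub> push (carrier A) f y"
proof -
  interpret A: fin_group A by fact
  interpret B: fin_group B by fact
  have f: "f a \<in> carrier B" if "a \<in> carrier A" for a
    using assms(3) that by (auto simp: hom_def)
  have "push (carrier A) f (x \<star>\<^bsub>A\<^esub> y) = lext (carrier A) (\<lambda>g. lext (carrier A) (\<lambda>h. basis_vec (f g \<otimes>\<^bsub>B\<^esub> f h)) y) x"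
    unfolding gmult_def[of A] lin_lext_comm[OF lin_push]
    using assms(3) by (intro lext_cong) (auto simp: A.fin hom_mult)
  also have "\<dots> = push (carrier A) f x \<star>\<^bsub>B\<^esub> push (carrier A) f y"
    unfolding push_def gmult_lext_left gmult_lext_right
    by (subst lext_swap, intro lext_cong) (simp add: f)
  finally show ?thesis .
qed

lemma fin_group_DirProd:
  assumes "fin_group A" "fin_group B"
  shows "fin_group (A \<times>\<times> B)"
  using assms by (auto simp: fin_group_def fin_group_axioms_def DirProd_def intro: DirProd_group[unfolded DirProd_def])

text \<open>The identification of kA \<otimes> kB with k[A x B]. At a point (a, b) the structure
  constants are products of a factor for A and a factor for B, so the fourfold sum splits.\<close>

lemma gmult_tensor:
  fixes x x' :: "'a \<Rightarrow> 'k::field" and y y' :: "'c \<Rightarrow> 'k"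
  assumes "fin_group A" "fin_group B"
  shows "tensor x y \<star>\<^bsub>A \<times>\<times> B\<^esub> tensor x' y' = tensor (x \<star>\<^bsub>A\<^esub> x') (y \<star>\<^bsub>B\<^esub> y')"
proof -
  interpret A: fin_group A by fact
  interpret B: fin_group B by fact
  show ?thesis
  proof
    fix k :: "'a \<times> 'c"
    obtain a b where k: "k = (a, b)" by force
    have bp: "basis_vec (u, v) (a, b) = basis_vec u a * (basis_vec v b :: 'k)" for u v
      by (simp add: basis_vec_apply)
    have "(\<Sum>g\<in>carrier A. x g * (\<Sum>h\<in>carrier B. y h * (\<Sum>g'\<in>carrier A. x' g' * (\<Sum>h'\<in>carrier B. y' h' * basis_vec (g \<otimes>\<^bsub>A\<^esub> g', h \<otimes>\<^bsub>B\<^esub> h') (a, b)))))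
       = (\<Sum>g\<in>carrier A. \<Sum>h\<in>carrier B. x g * y h * (\<Sum>g'\<in>carrier A. \<Sum>h'\<in>carrier B. x' g' * basis_vec (g \<otimes>\<^bsub>A\<^esub> g') a * (y' h' * basis_vec (h \<otimes>\<^bsub>B\<^esub> h') b)))"
      by (simp only: bp sum_distrib_left mult_ac)
    also have "\<dots> = (\<Sum>g\<in>carrier A. x g * (\<Sum>g'\<in>carrier A. x' g' * basis_vec (g \<otimes>\<^bsub>A\<^esub> g') a)) *
        (\<Sum>h\<in>carrier B. y h * (\<Sum>h'\<in>carrier B. y' h' * basis_vec (h \<otimes>\<^bsub>B\<^esub> h') b))"
      unfolding sum_product by (intro sum.cong refl) (simp add: sum_product mult_ac)
    finally show "(tensor x y \<star>\<^bsub>A \<times>\<times> B\<^esub> tensor x' y') k = tensor (x \<star>\<^bsub>A\<^esub> x') (y \<star>\<^bsub>B\<^esub> y') k"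
      by (simp add: gmult_def k DirProd_def lext_tensor lext_apply)
  qed
qed

section \<open>Twisting the Hopf algebra of a finite group\<close>

lemma push_cong: "(\<And>a. a \<in> A \<Longrightarrow> f a = g a) \<Longrightarrow> push A f x = push A g x"
  unfolding push_def by (intro lext_cong) auto

lemma lext_Sigma_cong:
  "(\<And>a b. a \<in> A \<Longrightarrow> b \<in> B \<Longrightarrow> f (a, b) = g (a, b)) \<Longrightarrow> lext (A \<times> B) f x = lext (A \<times> B) g x"
  by (intro lext_cong) auto

lemma push_id: "finite A \<Longrightarrow> x \<in> free_space A \<Longrightarrow> push A (\<lambda>a. a) x = x"
  unfolding push_def by (rule lext_basis_vec_id)

definition aug :: "('g, 'm) monoid_scheme \<Rightarrow> ('g \<Rightarrow> 'k::field) \<Rightarrow> 'k" where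
  "aug G x = (\<Sum>g\<in>carrier G. x g)"

lemma (in group) inv_mult_cancel:
  "x \<in> carrier G \<Longrightarrow> y \<in> carrier G \<Longrightarrow> inv x \<otimes> (x \<otimes> y) = y"
  "x \<in> carrier G \<Longrightarrow> y \<in> carrier G \<Longrightarrow> x \<otimes> (inv x \<otimes> y) = y"
  by (simp_all add: m_assoc[symmetric])

text \<open>Turns a linear map evaluated on a product of pushed elements into a double sum over the
  original index sets. Identities between expressions in J and K are checked by comparing such sums
  term by term.\<close>

lemma (in fin_group) bil_push:
  assumes "\<And>a. a \<in> A \<Longrightarrow> f a \<in> carrier G" "\<And>b. b \<in> B \<Longrightarrow> f' b \<in> carrier G"
  shows "lext (carrier G) w (push A f x \<star> push B f' y) = lext A (\<lambda>p. lext B (\<lambda>q. w (f p \<otimes> f' q)) y) x"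
  unfolding push_def gmult_lext_left gmult_lext_right lin_lext_comm[OF lin_lext]
  using assms by (subst lext_swap, intro lext_cong) (simp add: fin)

context fin_group
begin

lemma lext_gmult:
  "lext (carrier G) w (x \<star> y) = lext (carrier G) (\<lambda>p. lext (carrier G) (\<lambda>q. w (p \<otimes> q)) y) x"
  unfolding gmult_def lin_lext_comm[OF lin_lext] by (intro lext_cong) (simp add: fin)

section \<open>The untwisted Hopf algebra kG and its tensor powers\<close>

abbreviation "G2 \<equiv> G \<times>\<times> G"
abbreviation "G3 \<equiv> G \<times>\<times> G2"
abbreviation "one2 \<equiv> basis_vec (\<one>, \<one>)"
abbreviation "one3 \<equiv> basis_vec (\<one>, \<one>, \<one>)"

lemma carrier_G2: "carrier G2 = carrier G \<times> carrier G" and carrier_G3: "carrier G3 = carrier G \<times> carrier G \<times> carrier G"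
  and one_G2: "\<one>\<^bsub>G2\<^esub> = (\<one>, \<one>)" and one_G3: "\<one>\<^bsub>G3\<^esub> = (\<one>, \<one>, \<one>)"
  by (auto simp: DirProd_def)

lemma G3_mult: "(a, b, c) \<otimes>\<^bsub>G3\<^esub> (a', b', c') = (a \<otimes> a', b \<otimes> b', c \<otimes> c')"
  and G2_mult: "(a, b) \<otimes>\<^bsub>G2\<^esub> (a', b') = (a \<otimes> a', b \<otimes> b')"
  by (simp_all add: DirProd_def)

lemma fin_group_G: "fin_group G" ..

lemma fin_group_G2: "fin_group G2"
  by (rule fin_group_DirProd[OF fin_group_G fin_group_G])

lemma fin_group_G3: "fin_group G3"
  by (rule fin_group_DirProd[OF fin_group_G fin_group_G2])

interpretation G2: fin_group G2
  rewrites "carrier G2 = carrier G \<times> carrier G" and "\<one>\<^bsub>G2\<^esub> = (\<one>, \<one>)"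
  by (rule fin_group_G2) (simp_all add: DirProd_def)

lemma aug_basis [simp]: "g \<in> carrier G \<Longrightarrow> aug G (basis_vec g) = 1"
  using fin by (simp add: aug_def basis_vec_apply)

lemma aug_add: "aug G (x + y) = aug G x + aug G y" and aug_scale: "aug G (fscale c x) = c * aug G x"
  by (auto simp: aug_def sum.distrib sum_distrib_left)

lemma aug_lext: "aug G (lext A f x) = (\<Sum>a\<in>A. x a * aug G (f a))"
  unfolding aug_def lext_apply by (simp add: sum_distrib_left sum.swap[of _ "carrier G" A])

lemma aug_gmult: "aug G (x \<star> y) = aug G x * aug G y"
proof -
  have "aug G (x \<star> y) = (\<Sum>a\<in>carrier G. x a * (\<Sum>b\<in>carrier G. y b))"
    unfolding gmult_def aug_lext by (intro sum.cong refl) (simp add: aug_lext)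
  then show ?thesis by (simp add: aug_def sum_distrib_right)
qed

definition cop :: "('a \<Rightarrow> 'k::field) \<Rightarrow> ('a \<times> 'a \<Rightarrow> 'k)" where
  "cop = push (carrier G) (\<lambda>g. (g, g))"

lemma lin_cop: "lin cop"
  unfolding cop_def by (rule lin_push)

lemma cop_basis [simp]: "g \<in> carrier G \<Longrightarrow> cop (basis_vec g) = basis_vec (g, g)"
  by (simp add: cop_def fin)

lemma cop_gmult: "cop (x \<star> y) = cop x \<star>\<^bsub>G2\<^esub> cop y"
  unfolding cop_def
  by (rule push_gmult[OF fin_group_G G2.fin_group_axioms]) (auto simp: hom_def DirProd_def)

lemma tensor_algebra_mult: "t \<otimes>\<^bsub>tensor_algebra (group_algebra G) (group_algebra G)\<^esub> u = t \<star>\<^bsub>G2\<^esub> u"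
proof -
  have "t \<otimes>\<^bsub>tensor_algebra (group_algebra G) (group_algebra G)\<^esub> u =
    lext (carrier G \<times> carrier G) (\<lambda>p. lext (carrier G \<times> carrier G) (\<lambda>p'.
       tensor (basis_vec (fst p) \<star> basis_vec (fst p')) (basis_vec (snd p) \<star> basis_vec (snd p'))) u) t"
    unfolding tensor_algebra_def by (simp add: group_algebra_mult lext_def fscale_sum split_def)
      (simp add: group_algebra_def)
  also have "\<dots> = t \<star>\<^bsub>G2\<^esub> u"
    unfolding gmult_def[of G2] carrier_G2 by (intro lext_cong) auto
  finally show ?thesis .
qed

lemma monoid_tensor_algebra: "monoid (tensor_algebra (group_algebra G) (group_algebra G) :: ('a \<times> 'a, 'k::field) based_algebra)"
  (is "monoid ?T")
proof -
  have c: "carrier ?T = free_space (carrier G \<times> carrier G)" and o: "\<one>\<^bsub>?T\<^esub> = one2"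
    by (simp_all add: tensor_algebra_def group_algebra_def)
  show ?thesis
    by (rule monoidI)
      (simp_all add: c o tensor_algebra_mult G2.gmult_assoc G2.gmult_one_left G2.gmult_one_right)
qed

definition S0 :: "('a \<Rightarrow> 'k::field) \<Rightarrow> ('a \<Rightarrow> 'k)" where "S0 = push (carrier G) (\<lambda>g. inv g)"

lemma lin_S0: "lin S0"
  unfolding S0_def by (rule lin_push)

lemma S0_closed [simp]: "S0 x \<in> free_space (carrier G)"
  unfolding S0_def by (rule push_closed) auto

lemma S0_basis [simp]: "g \<in> carrier G \<Longrightarrow> S0 (basis_vec g) = basis_vec (inv g)"
  by (simp add: S0_def fin)

lemma S0_S0: "x \<in> free_space (carrier G) \<Longrightarrow> S0 (S0 x) = x"
  by (rule lin_eqI[OF lin_comp[OF lin_S0 lin_S0] lin_id fin]) auto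

lemma S0_gmult: "S0 (x \<star> y) = S0 y \<star> S0 x"
proof -
  have "S0 (x \<star> y) = lext (carrier G) (\<lambda>g. lext (carrier G) (\<lambda>h. S0 (basis_vec (g \<otimes> h))) y) x"
    unfolding gmult_def lin_lext_comm[OF lin_S0] ..
  also have "\<dots> = lext (carrier G) (\<lambda>g. lext (carrier G) (\<lambda>h. basis_vec (inv h) \<star> basis_vec (inv g)) y) x"
    by (intro lext_cong) (simp add: inv_mult_group)
  also have "\<dots> = S0 y \<star> S0 x"
    unfolding S0_def push_def gmult_lext_left gmult_lext_right by (rule refl)
  finally show ?thesis .
qed

lemma aug_S0: "aug G (S0 x) = aug G x"
  unfolding S0_def push_def aug_lext by (simp add: aug_def[of G x])

end

text \<open>
  \<open>J_cocycle\<close> is \<open>(J \<otimes> 1) (\<Delta> \<otimes> id)(J) = (1 \<otimes> J) (id \<otimes> \<Delta>)(J)\<close>, and \<open>K\<close> is \<open>J\<^sup>-\<^sup>1\<close>.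
\<close>

locale group_twist = fin_group G for G (structure) +
  fixes J K :: "'a \<times> 'a \<Rightarrow> 'k::field"
  assumes J_closed: "J \<in> free_space (carrier G \<times> carrier G)"
    and K_closed: "K \<in> free_space (carrier G \<times> carrier G)"
    and JK: "J \<star>\<^bsub>G2\<^esub> K = one2"
    and KJ: "K \<star>\<^bsub>G2\<^esub> J = one2"
    and J_cocycle: "push (carrier G \<times> carrier G) (\<lambda>(a, b). (a, b, \<one>)) J \<star>\<^bsub>G3\<^esub> push (carrier G \<times> carrier G) (\<lambda>(a, b). (a, a, b)) J =
      push (carrier G \<times> carrier G) (Pair \<one>) J \<star>\<^bsub>G3\<^esub> push (carrier G \<times> carrier G) (\<lambda>(a, b). (a, b, b)) J"
    and J_fst: "push (carrier G \<times> carrier G) fst J = basis_vec \<one>"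
    and J_snd: "push (carrier G \<times> carrier G) snd J = basis_vec \<one>"
begin

sublocale G2: fin_group G2
  rewrites "carrier G2 = carrier G \<times> carrier G" and "\<one>\<^bsub>G2\<^esub> = (\<one>, \<one>)"
  by (rule fin_group_G2) (simp_all add: DirProd_def)

sublocale G3: fin_group G3
  rewrites "carrier G3 = carrier G \<times> carrier G \<times> carrier G" and "\<one>\<^bsub>G3\<^esub> = (\<one>, \<one>, \<one>)"
  by (rule fin_group_G3) (simp_all add: DirProd_def)

abbreviation "PP \<equiv> carrier G \<times> carrier G"
definition tw :: "('a \<Rightarrow> 'k) \<Rightarrow> ('a \<times> 'a \<Rightarrow> 'k)" where
  "tw x = J \<star>\<^bsub>G2\<^esub> cop x \<star>\<^bsub>G2\<^esub> K"

text \<open>These are X \<otimes> 1 and 1 \<otimes> X, then \<Delta> \<otimes> id and id \<otimes>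
  \<Delta> for the untwisted coproduct \<Delta>. All four are pushes along homomorphisms from
  \<open>G2\<close> to \<open>G3\<close>.\<close>

abbreviation "leg12 \<equiv> push PP (\<lambda>(a, b). (a, b, \<one>))"
abbreviation "leg23 \<equiv> push PP (Pair \<one>)"
abbreviation "dbl1 \<equiv> push PP (\<lambda>(a, b). (a, a, b))"
abbreviation "dbl2 \<equiv> push PP (\<lambda>(a, b). (a, b, b))"

lemma push3_gmult:
  "leg12 (x \<star>\<^bsub>G2\<^esub> y) = leg12 x \<star>\<^bsub>G3\<^esub> leg12 y" "leg23 (x \<star>\<^bsub>G2\<^esub> y) = leg23 x \<star>\<^bsub>G3\<^esub> leg23 y"
  "dbl1 (x \<star>\<^bsub>G2\<^esub> y) = dbl1 x \<star>\<^bsub>G3\<^esub> dbl1 y" "dbl2 (x \<star>\<^bsub>G2\<^esub> y) = dbl2 x \<star>\<^bsub>G3\<^esub> dbl2 y"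
  by (rule push_gmult[OF G2.fin_group_axioms G3.fin_group_axioms, unfolded carrier_G2],
      force simp: hom_def DirProd_def)+

lemma push2_gmult:
  "push PP fst (x \<star>\<^bsub>G2\<^esub> y) = push PP fst x \<star> push PP fst y"
  "push PP snd (x \<star>\<^bsub>G2\<^esub> y) = push PP snd x \<star> push PP snd y"
  by (rule push_gmult[OF G2.fin_group_axioms fin_group_G, unfolded carrier_G2],
      force simp: hom_def DirProd_def)+

lemma push_one2 [simp]: "leg12 one2 = one3" "leg23 one2 = one3" "dbl1 one2 = one3" "dbl2 one2 = one3"
  "push PP fst one2 = basis_vec \<one>" "push PP snd one2 = basis_vec \<one>"
  by (simp_all add: G2.fin)

lemma push_closed3 [simp]:
  "leg12 x \<in> free_space (carrier G \<times> PP)" "leg23 x \<in> free_space (carrier G \<times> PP)"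
  "dbl1 x \<in> free_space (carrier G \<times> PP)" "dbl2 x \<in> free_space (carrier G \<times> PP)"
  by (auto intro!: push_closed)

lemma push_closed1 [simp]:
  "push PP fst x \<in> free_space (carrier G)" "push PP snd x \<in> free_space (carrier G)"
  by (auto intro!: push_closed)

lemma K_fst: "push PP fst K = basis_vec \<one>" and K_snd: "push PP snd K = basis_vec \<one>"
proof -
  show "push PP fst K = basis_vec \<one>"
    using push2_gmult(1)[of J K] by (simp add: JK J_fst gmult_one_left)
  show "push PP snd K = basis_vec \<one>"
    using push2_gmult(2)[of J K] by (simp add: JK J_snd gmult_one_left)
qed

lemma leg_inv: "leg12 J \<star>\<^bsub>G3\<^esub> leg12 K = one3" "leg12 K \<star>\<^bsub>G3\<^esub> leg12 J = one3"
  "leg23 J \<star>\<^bsub>G3\<^esub> leg23 K = one3" "leg23 K \<star>\<^bsub>G3\<^esub> leg23 J = one3"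
  "dbl1 J \<star>\<^bsub>G3\<^esub> dbl1 K = one3" "dbl1 K \<star>\<^bsub>G3\<^esub> dbl1 J = one3"
  "dbl2 J \<star>\<^bsub>G3\<^esub> dbl2 K = one3" "dbl2 K \<star>\<^bsub>G3\<^esub> dbl2 J = one3"
  by (simp_all add: push3_gmult[symmetric] JK KJ)

lemma leg_cancel:
  "x \<in> free_space (carrier G \<times> PP) \<Longrightarrow> leg12 K \<star>\<^bsub>G3\<^esub> (leg12 J \<star>\<^bsub>G3\<^esub> x) = x"
  "x \<in> free_space (carrier G \<times> PP) \<Longrightarrow> leg23 K \<star>\<^bsub>G3\<^esub> (leg23 J \<star>\<^bsub>G3\<^esub> x) = x"
  "x \<in> free_space (carrier G \<times> PP) \<Longrightarrow> dbl1 J \<star>\<^bsub>G3\<^esub> (dbl1 K \<star>\<^bsub>G3\<^esub> x) = x"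
  "x \<in> free_space (carrier G \<times> PP) \<Longrightarrow> dbl2 J \<star>\<^bsub>G3\<^esub> (dbl2 K \<star>\<^bsub>G3\<^esub> x) = x"
  "x \<in> free_space (carrier G \<times> PP) \<Longrightarrow> dbl1 K \<star>\<^bsub>G3\<^esub> (dbl1 J \<star>\<^bsub>G3\<^esub> x) = x"
  "x \<in> free_space (carrier G \<times> PP) \<Longrightarrow> dbl2 K \<star>\<^bsub>G3\<^esub> (dbl2 J \<star>\<^bsub>G3\<^esub> x) = x"
  by (simp_all add: G3.gmult_assoc[symmetric] leg_inv G3.gmult_one_left)

text \<open>The cocycle identity multiplied by \<open>leg23 K\<close> on the left and
  \<open>dbl1 K\<close> on the right. One side has doubled legs, which cancel when contracted with
  an antipode; the other is the shape in which \<open>Q\<close> and \<open>Q'\<close> meet.\<close>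

lemma mixed1: "dbl2 J \<star>\<^bsub>G3\<^esub> dbl1 K = leg23 K \<star>\<^bsub>G3\<^esub> leg12 J"
proof -
  have "leg23 K \<star>\<^bsub>G3\<^esub> leg12 J = leg23 K \<star>\<^bsub>G3\<^esub> (leg12 J \<star>\<^bsub>G3\<^esub> dbl1 J) \<star>\<^bsub>G3\<^esub> dbl1 K"
    by (simp add: G3.gmult_assoc leg_inv G3.gmult_one_right)
  also have "\<dots> = dbl2 J \<star>\<^bsub>G3\<^esub> dbl1 K"
    unfolding J_cocycle by (simp add: G3.gmult_assoc leg_cancel)
  finally show ?thesis ..
qed

lemma mixed2: "dbl1 J \<star>\<^bsub>G3\<^esub> dbl2 K = leg12 K \<star>\<^bsub>G3\<^esub> leg23 J"
proof -
  have "leg12 K \<star>\<^bsub>G3\<^esub> leg23 J = leg12 K \<star>\<^bsub>G3\<^esub> (leg23 J \<star>\<^bsub>G3\<^esub> dbl2 J) \<star>\<^bsub>G3\<^esub> dbl2 K"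
    by (simp add: G3.gmult_assoc leg_inv G3.gmult_one_right)
  also have "\<dots> = dbl1 J \<star>\<^bsub>G3\<^esub> dbl2 K"
    unfolding J_cocycle[symmetric] by (simp add: G3.gmult_assoc leg_cancel)
  finally show ?thesis ..
qed

text \<open>Needed for the right-hand factors of the conjugation in \<open>tw_coassoc\<close>, where
  \<open>J_cocycle\<close> handles the left-hand ones. Taking inverses reverses the order of the
  factors.\<close>

lemma K_cocycle: "dbl1 K \<star>\<^bsub>G3\<^esub> leg12 K = dbl2 K \<star>\<^bsub>G3\<^esub> leg23 K"
proof -
  have "dbl1 K \<star>\<^bsub>G3\<^esub> leg12 K = dbl1 K \<star>\<^bsub>G3\<^esub> (leg12 K \<star>\<^bsub>G3\<^esub> leg23 J) \<star>\<^bsub>G3\<^esub> leg23 K"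
    by (simp add: G3.gmult_assoc leg_inv G3.gmult_one_right)
  also have "\<dots> = dbl2 K \<star>\<^bsub>G3\<^esub> leg23 K"
    unfolding mixed2[symmetric] by (simp add: G3.gmult_assoc leg_cancel)
  finally show ?thesis .
qed

text \<open>
  If \<open>J = \<Sum> a \<otimes> b\<close>, then \<open>Q = \<Sum> a S(b)\<close> for the antipode \<open>S\<close> of \<open>kG\<close>, and the antipode of
  \<open>(kG)\<^sup>J\<close> is \<open>x \<mapsto> Q S(x) Q\<^sup>-\<^sup>1\<close>.
\<close>

definition Q :: "'a \<Rightarrow> 'k" where "Q = push PP (\<lambda>(a, b). a \<otimes> inv b) J"
definition Q' :: "'a \<Rightarrow> 'k" where "Q' = push PP (\<lambda>(a, b). inv a \<otimes> b) K"

lemma Q_closed [simp]: "Q \<in> free_space (carrier G)" "Q' \<in> free_space (carrier G)"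
  unfolding Q_def Q'_def by (auto intro!: push_closed)

lemma bil_gmult:
  assumes "\<And>a. a \<in> A \<Longrightarrow> f a \<in> carrier G" "\<And>b. b \<in> B \<Longrightarrow> f' b \<in> carrier G"
  shows "push A f x \<star> push B f' y = lext A (\<lambda>p. lext B (\<lambda>q. basis_vec (f p \<otimes> f' q)) y) x"
  using bil_push[of A f B f' basis_vec x y] assms by (simp add: lext_basis_vec_id fin)

text \<open>Contract \<open>mixed1\<close> by sending a \<otimes> b \<otimes> c to a b^-1 c. The
  side without doubled legs gives the product of \<open>Q\<close> and \<open>Q'\<close>; on the
  other side equal legs cancel and leave (id \<otimes> \<epsilon>)(J) times (\<epsilon> \<otimes>
  id)(K), which is 1.\<close>

lemma QQ': "Q \<star> Q' = basis_vec \<one>"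
proof -
  let ?w = "\<lambda>(a, b, c). basis_vec (a \<otimes> inv b \<otimes> c) :: 'a \<Rightarrow> 'k"
  have "Q \<star> Q' = lext (carrier G \<times> PP) ?w (leg23 K \<star>\<^bsub>G3\<^esub> leg12 J)"
    unfolding Q_def Q'_def
    by (subst bil_gmult, force, force, subst G3.bil_push, force, force, subst lext_swap)
      (force simp: G3_mult inv_mult_group m_assoc intro!: lext_cong)
  also have "\<dots> = lext (carrier G \<times> PP) ?w (dbl2 J \<star>\<^bsub>G3\<^esub> dbl1 K)"
    by (simp add: mixed1)
  also have "\<dots> = push PP fst J \<star> push PP snd K"
    by (subst bil_gmult, force, force, subst G3.bil_push, force, force)
      (force simp: G3_mult inv_mult_group m_assoc inv_mult_cancel intro!: lext_cong)
  finally show ?thesis by (simp add: J_fst K_snd)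
qed

text \<open>The companion contraction of \<open>mixed2\<close>, sending a \<otimes> b \<otimes> c to
  a^-1 b c^-1. Here the surviving legs appear inverted, hence the two factors
  \<open>S0\<close>.\<close>

lemma Q'Q: "Q' \<star> Q = basis_vec \<one>"
proof -
  let ?w = "\<lambda>(a, b, c). basis_vec (inv a \<otimes> b \<otimes> inv c) :: 'a \<Rightarrow> 'k"
  have "Q' \<star> Q = lext (carrier G \<times> PP) ?w (leg12 K \<star>\<^bsub>G3\<^esub> leg23 J)"
    unfolding Q_def Q'_def
    by (subst bil_gmult, force, force, subst G3.bil_push, force, force)
      (force simp: G3_mult inv_mult_group m_assoc intro!: lext_cong)
  also have "\<dots> = lext (carrier G \<times> PP) ?w (dbl1 J \<star>\<^bsub>G3\<^esub> dbl2 K)"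
    by (simp add: mixed2)
  also have "\<dots> = S0 (push PP fst K) \<star> S0 (push PP snd J)"
    unfolding S0_def
    by (subst push_push, use fin in force, force, subst push_push, use fin in force, force,
        subst bil_gmult, force, force, subst G3.bil_push, force, force, subst lext_swap)
      (force simp: G3_mult inv_mult_group m_assoc inv_mult_cancel intro!: lext_cong)
  finally show ?thesis by (simp add: J_snd K_fst)
qed

lemma lin_tw: "lin tw"
  unfolding tw_def[abs_def] by (intro lin_intros lin_comp[OF lin_gmult_left] lin_comp[OF lin_gmult_right] lin_cop)

lemma tw_closed [simp]: "tw x \<in> free_space PP"
  unfolding tw_def by simp

lemma tw_gmult: "tw (x \<star> y) = tw x \<star>\<^bsub>G2\<^esub> tw y"
proof -
  have "tw x \<star>\<^bsub>G2\<^esub> tw y = J \<star>\<^bsub>G2\<^esub> cop x \<star>\<^bsub>G2\<^esub> (K \<star>\<^bsub>G2\<^esub> J) \<star>\<^bsub>G2\<^esub> cop y \<star>\<^bsub>G2\<^esub> K"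
    by (simp add: tw_def G2.gmult_assoc)
  then show ?thesis
    unfolding KJ tw_def cop_gmult by (simp add: G2.gmult_assoc G2.gmult_one_right G2.gmult_one_left)
qed

lemma tw_one: "tw (basis_vec \<one>) = one2"
  by (simp add: tw_def G2.gmult_one_right J_closed JK)

text \<open>As g is group-like, its twisted coproduct is the sum of a g c \<otimes> b g d, where J =
  \<Sum> a \<otimes> b and K = \<Sum> c \<otimes> d. The antipode axioms are verified from this
  expansion.\<close>

lemma tw_lext:
  assumes "g \<in> carrier G"
  shows "lext PP w (tw (basis_vec g)) =
    lext PP (\<lambda>(a, b). lext PP (\<lambda>(c, d). w (a \<otimes> g \<otimes> c, b \<otimes> g \<otimes> d)) K) J"
proof -
  have J: "J \<star>\<^bsub>G2\<^esub> basis_vec (g, g) = push PP (\<lambda>(a, b). (a \<otimes> g, b \<otimes> g)) J"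
    using assms by - (rule lin_eqI[OF lin_gmult_left lin_push G2.fin J_closed], auto simp: G2.fin G2_mult)
  have "tw (basis_vec g) = push PP (\<lambda>(a, b). (a \<otimes> g, b \<otimes> g)) J \<star>\<^bsub>G2\<^esub> push PP (\<lambda>p. p) K"
    using assms by (simp add: tw_def J push_id G2.fin K_closed)
  then show ?thesis
    using assms by (simp only:, subst G2.bil_push, force, force)
      (force simp: G2_mult intro!: lext_cong)
qed

section \<open>The bialgebra structure of (kG)^J\<close>

abbreviation "H \<equiv> twisted_hopf_algebra G J"

lemma tensor_algebra_simps:
  "carrier (tensor_algebra (group_algebra G) (group_algebra G)) = free_space PP"
  "\<one>\<^bsub>tensor_algebra (group_algebra G) (group_algebra G)\<^esub> = one2"
  by (simp_all add: tensor_algebra_def group_algebra_def)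

lemma inv_J: "inv\<^bsub>tensor_algebra (group_algebra G) (group_algebra G)\<^esub> J = K"
  by (rule monoid.inv_unique'[OF monoid_tensor_algebra, symmetric])
    (simp_all only: tensor_algebra_mult tensor_algebra_simps J_closed K_closed JK KJ)

lemma H_simps [simp]:
  "carrier H = free_space (carrier G)" "x \<otimes>\<^bsub>H\<^esub> y = x \<star> y" "\<one>\<^bsub>H\<^esub> = basis_vec \<one>"
  "basis H = carrier G" "counit H x = aug G x"
proof -
  show "x \<otimes>\<^bsub>H\<^esub> y = x \<star> y"
    using group_algebra_mult[of x y] by (simp add: twisted_hopf_algebra_def Let_def)
qed (simp_all add: twisted_hopf_algebra_def Let_def group_algebra_def aug_def)

lemma H_comult [simp]: "comult H x = tw x"
proof -
  have "comult (group_algebra G) x = cop x"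
    unfolding cop_def push_def lext_def by (simp add: group_algebra_def)
  then show ?thesis
    by (simp add: twisted_hopf_algebra_def Let_def inv_J tensor_algebra_mult tw_def)
qed

lemma H_sweedler: "sweedler H f x = lext PP (\<lambda>(i, j). f (basis_vec i) (basis_vec j)) (tw x)"
  by (simp add: sweedler_def lext_def split_def)

lemma tensor_one_leg23: "X \<in> free_space PP \<Longrightarrow> tensor (basis_vec \<one>) X = leg23 X"
  by (rule lin_eqI[OF lin_tensor_right lin_push G2.fin]) (auto simp: G2.fin)

text \<open>Twisting only the second leg is conjugation of the doubled leg by 1 \<otimes> J, once
  the untouched leg i is written as 1 i 1.\<close>

lemma id_tw:
  "lext PP (\<lambda>(i, j). tensor (basis_vec i) (tw (basis_vec j))) X = leg23 J \<star>\<^bsub>G3\<^esub> dbl2 X \<star>\<^bsub>G3\<^esub> leg23 K"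
proof -
  have "lext PP (\<lambda>(i, j). tensor (basis_vec i) (tw (basis_vec j))) X =
    lext PP (\<lambda>p. leg23 J \<star>\<^bsub>G3\<^esub> basis_vec (fst p, snd p, snd p) \<star>\<^bsub>G3\<^esub> leg23 K) X"
  proof (rule lext_Sigma_cong)
    fix i j assume ij: "i \<in> carrier G" "j \<in> carrier G"
    have "tensor (basis_vec i) (tw (basis_vec j)) =
      tensor (basis_vec \<one> \<star> basis_vec i \<star> basis_vec \<one>) (J \<star>\<^bsub>G2\<^esub> basis_vec (j, j) \<star>\<^bsub>G2\<^esub> K)"
      using ij by (simp add: tw_def)
    also have "\<dots> = leg23 J \<star>\<^bsub>G3\<^esub> basis_vec (i, j, j) \<star>\<^bsub>G3\<^esub> leg23 K"
      unfolding gmult_tensor[OF fin_group_G G2.fin_group_axioms, symmetric]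
      by (simp add: tensor_one_leg23 J_closed K_closed)
    finally show "(case (i, j) of (i, j) \<Rightarrow> tensor (basis_vec i) (tw (basis_vec j))) =
      leg23 J \<star>\<^bsub>G3\<^esub> basis_vec (fst (i, j), snd (i, j), snd (i, j)) \<star>\<^bsub>G3\<^esub> leg23 K" by simp
  qed
  also have "\<dots> = leg23 J \<star>\<^bsub>G3\<^esub> dbl2 X \<star>\<^bsub>G3\<^esub> leg23 K"
    unfolding push_def[of PP "\<lambda>(a, b). (a, b, b)"] gmult_lext_left gmult_lext_right by (simp add: split_def)
  finally show ?thesis .
qed

lemma tw_id:
  "lext PP (\<lambda>(i, j). \<lambda>(a, b, c). tensor (tw (basis_vec i)) (basis_vec j) ((a, b), c)) X =
    leg12 J \<star>\<^bsub>G3\<^esub> dbl1 X \<star>\<^bsub>G3\<^esub> leg12 K"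
proof -
  \<comment> \<open>The bracketing ((a, b), c) is not the one of \<open>G3\<close>, so reassociation
    is made explicit. It agrees with a push along a group isomorphism and is therefore
    multiplicative.\<close>
  define asc :: "(('a \<times> 'a) \<times> 'a \<Rightarrow> 'k) \<Rightarrow> 'a \<times> 'a \<times> 'a \<Rightarrow> 'k" where
    "asc X = (\<lambda>(a, b, c). X ((a, b), c))" for X
  have lin_asc: "lin asc"
    by (rule linI) (auto simp: asc_def)
  have asc_basis: "asc (basis_vec ((a, b), c)) = basis_vec (a, b, c)" for a b c
    by (auto simp: asc_def basis_vec_def)
  have leg: "asc (tensor X (basis_vec \<one>)) = leg12 X" if "X \<in> free_space PP" for X
    by (rule lin_eqI[OF lin_comp[OF lin_asc lin_tensor_left] lin_push G2.fin that])
      (auto simp: G2.fin asc_basis)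
  have asc_push: "asc X = push (PP \<times> carrier G) (\<lambda>p. (fst (fst p), snd (fst p), snd p)) X" if "X \<in> free_space (PP \<times> carrier G)" for X
  proof (rule lin_eqI[OF lin_asc lin_push _ that])
    show f: "finite (PP \<times> carrier G)" using fin by simp
    fix p assume p: "p \<in> PP \<times> carrier G"
    show "asc (basis_vec p) = push (PP \<times> carrier G) (\<lambda>p. (fst (fst p), snd (fst p), snd p)) (basis_vec p)"
      unfolding push_basis[OF f p] using p by (auto simp: asc_basis)
  qed
  have g: "fin_group (G2 \<times>\<times> G)" by (rule fin_group_DirProd[OF fin_group_G2 fin_group_G])
  have m: "X \<star>\<^bsub>G2 \<times>\<times> G\<^esub> Y \<in> free_space (PP \<times> carrier G)" for X Y :: "('a \<times> 'a) \<times> 'a \<Rightarrow> 'k"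
    using fin_group.gmult_closed[OF g, of X Y] by (simp add: DirProd_def)
  have asc_mult: "asc (X \<star>\<^bsub>G2 \<times>\<times> G\<^esub> Y) = asc X \<star>\<^bsub>G3\<^esub> asc Y"
    if "X \<in> free_space (PP \<times> carrier G)" "Y \<in> free_space (PP \<times> carrier G)" for X Y
  proof -
    have "push (carrier (G2 \<times>\<times> G)) (\<lambda>p. (fst (fst p), snd (fst p), snd p)) (X \<star>\<^bsub>G2 \<times>\<times> G\<^esub> Y) =
      push (carrier (G2 \<times>\<times> G)) (\<lambda>p. (fst (fst p), snd (fst p), snd p)) X \<star>\<^bsub>G3\<^esub>
      push (carrier (G2 \<times>\<times> G)) (\<lambda>p. (fst (fst p), snd (fst p), snd p)) Y"
    proof (rule push_gmult[OF g G3.fin_group_axioms])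
      show "(\<lambda>p. (fst (fst p), snd (fst p), snd p)) \<in> hom (G2 \<times>\<times> G) G3"
        by (rule homI) (simp_all add: DirProd_def split_def mem_Times_iff)
    qed
    then show ?thesis using that asc_push[OF m] by (simp add: asc_push DirProd_def)
  qed
  have "lext PP (\<lambda>(i, j). \<lambda>(a, b, c). tensor (tw (basis_vec i)) (basis_vec j) ((a, b), c)) X =
    lext PP (\<lambda>p. leg12 J \<star>\<^bsub>G3\<^esub> basis_vec (fst p, fst p, snd p) \<star>\<^bsub>G3\<^esub> leg12 K) X"
  proof (rule lext_Sigma_cong)
    fix i j assume ij: "i \<in> carrier G" "j \<in> carrier G"
    have "asc (tensor (tw (basis_vec i)) (basis_vec j)) =
      asc (tensor (J \<star>\<^bsub>G2\<^esub> basis_vec (i, i) \<star>\<^bsub>G2\<^esub> K) (basis_vec \<one> \<star> basis_vec j \<star> basis_vec \<one>))"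
      using ij by (simp add: tw_def)
    also have "\<dots> = asc (tensor J (basis_vec \<one>)) \<star>\<^bsub>G3\<^esub> asc (tensor (basis_vec (i, i)) (basis_vec j)) \<star>\<^bsub>G3\<^esub> asc (tensor K (basis_vec \<one>))"
      unfolding gmult_tensor[OF G2.fin_group_axioms fin_group_G, symmetric]
      using ij by (simp add: asc_mult m tensor_free_space J_closed K_closed del: tensor_basis)
    also have "\<dots> = leg12 J \<star>\<^bsub>G3\<^esub> basis_vec (i, i, j) \<star>\<^bsub>G3\<^esub> leg12 K"
      by (simp add: leg J_closed K_closed asc_basis)
    finally show "(case (i, j) of (i, j) \<Rightarrow> \<lambda>(a, b, c). tensor (tw (basis_vec i)) (basis_vec j) ((a, b), c)) =
      leg12 J \<star>\<^bsub>G3\<^esub> basis_vec (fst (i, j), fst (i, j), snd (i, j)) \<star>\<^bsub>G3\<^esub> leg12 K"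
      unfolding asc_def by simp
  qed
  also have "\<dots> = leg12 J \<star>\<^bsub>G3\<^esub> dbl1 X \<star>\<^bsub>G3\<^esub> leg12 K"
    unfolding push_def[of PP "\<lambda>(a, b). (a, a, b)"] gmult_lext_left gmult_lext_right by (simp add: split_def)
  finally show ?thesis .
qed

lemma dbl_cop: "dbl2 (cop x) = dbl1 (cop x)"
  unfolding cop_def by (subst push_push, use fin in force, force)+ simp

text \<open>Both sides conjugate the untwisted threefold coproduct, one by (1 \<otimes> J) (id
  \<otimes> \<Delta>)(J), the other by (J \<otimes> 1) (\<Delta> \<otimes> id)(J). These agree by
  the cocycle identity, and \<open>dbl_cop\<close> is coassociativity before twisting.\<close>

lemma tw_coassoc:
  "lext PP (\<lambda>(i, j). tensor (basis_vec i) (tw (basis_vec j))) (tw x) =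
   lext PP (\<lambda>(i, j). \<lambda>(a, b, c). tensor (tw (basis_vec i)) (basis_vec j) ((a, b), c)) (tw x)"
proof -
  have "leg23 J \<star>\<^bsub>G3\<^esub> dbl2 (tw x) \<star>\<^bsub>G3\<^esub> leg23 K = (leg23 J \<star>\<^bsub>G3\<^esub> dbl2 J) \<star>\<^bsub>G3\<^esub> dbl2 (cop x) \<star>\<^bsub>G3\<^esub> (dbl2 K \<star>\<^bsub>G3\<^esub> leg23 K)"
    unfolding tw_def push3_gmult by (simp add: G3.gmult_assoc)
  also have "\<dots> = leg12 J \<star>\<^bsub>G3\<^esub> dbl1 (tw x) \<star>\<^bsub>G3\<^esub> leg12 K"
    unfolding J_cocycle[symmetric] K_cocycle[symmetric] dbl_cop tw_def push3_gmult by (simp add: G3.gmult_assoc)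
  finally show ?thesis unfolding id_tw tw_id .
qed

lemma counit_snd: "x \<in> free_space (carrier G) \<Longrightarrow> push PP snd (tw x) = x"
  unfolding tw_def push2_gmult J_snd K_snd cop_def
  by (subst push_push, use fin in force, force) (simp add: push_id fin gmult_one_left gmult_one_right)

lemma counit_fst: "x \<in> free_space (carrier G) \<Longrightarrow> push PP fst (tw x) = x"
  unfolding tw_def push2_gmult J_fst K_fst cop_def
  by (subst push_push, use fin in force, force) (simp add: push_id fin gmult_one_left gmult_one_right)

lemma fd_bialgebra_H: "fd_bialgebra H"
proof (intro_locales)
  show "monoid H"
    by (rule monoidI) (simp_all add: gmult_assoc gmult_one_left gmult_one_right)
  show "fd_algebra_axioms H"
    by unfold_locales (auto simp: fin linear_map_on_def lin_add[OF lin_gmult_left] lin_scale[OF lin_gmult_left]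
        lin_add[OF lin_gmult_right] lin_scale[OF lin_gmult_right])
  have ta: "tensor_algebra H H = tensor_algebra (group_algebra G) (group_algebra G)"
    by (simp add: tensor_algebra_def twisted_hopf_algebra_def Let_def group_algebra_def)
  show "fd_bialgebra_axioms H"
  proof
    fix x assume "x \<in> carrier H"
    then have x: "x \<in> free_space (carrier G)" by simp
    show "comult H x \<in> free_space (basis H \<times> basis H)" by simp
    show "sweedler H (\<lambda>a b. tensor a (comult H b)) x =
          sweedler H (\<lambda>a b. \<lambda>(i, j, l). tensor (comult H a) b ((i, j), l)) x"
      using tw_coassoc[of x] by (simp add: H_sweedler)
    have "sweedler H (\<lambda>a b. fscale (counit H a) b) x = push PP snd (tw x)"
      unfolding H_sweedler push_def by (intro lext_Sigma_cong) simp
    then show "sweedler H (\<lambda>a b. fscale (counit H a) b) x = x"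
      by (simp add: counit_snd x)
    have "sweedler H (\<lambda>a b. fscale (counit H b) a) x = push PP fst (tw x)"
      unfolding H_sweedler push_def by (intro lext_Sigma_cong) simp
    then show "sweedler H (\<lambda>a b. fscale (counit H b) a) x = x"
      by (simp add: counit_fst x)
  next
    show "linear_map_on (carrier H) (comult H)"
      using lin_tw by (simp add: linear_map_on_def)
    show "linear_form_on (carrier H) (counit H)"
      by (simp add: linear_form_on_def aug_add aug_scale)
    show "comult H (x \<otimes>\<^bsub>H\<^esub> y) = comult H x \<otimes>\<^bsub>tensor_algebra H H\<^esub> comult H y" for x y
      by (simp add: ta tensor_algebra_mult tw_gmult)
    show "comult H \<one>\<^bsub>H\<^esub> = \<one>\<^bsub>tensor_algebra H H\<^esub>"
      by (simp add: ta tw_one) (simp add: tensor_algebra_def group_algebra_def)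
    show "counit H (x \<otimes>\<^bsub>H\<^esub> y) = counit H x * counit H y" for x y
      by (simp add: aug_gmult)
    show "counit H \<one>\<^bsub>H\<^esub> = 1" by simp
  qed
qed

section \<open>The antipode of (kG)^J\<close>

definition S :: "('a \<Rightarrow> 'k) \<Rightarrow> ('a \<Rightarrow> 'k)" where "S x = Q \<star> S0 x \<star> Q'"

lemma lin_S: "lin S"
  unfolding S_def[abs_def] by (intro lin_intros lin_comp[OF lin_gmult_left] lin_comp[OF lin_gmult_right] lin_S0)

lemma S_closed [simp]: "S x \<in> free_space (carrier G)"
  by (simp add: S_def)

text \<open>With K = \<Sum> c \<otimes> d inside \<open>Q'\<close>, the sum becomes \<Sum> (c a)^-1
  (d b): the map x \<otimes> y to S(x) y of kG, applied to K J = 1.\<close>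

lemma inner1: "lext PP (\<lambda>(a, b). basis_vec (inv a) \<star> Q' \<star> basis_vec b) J = basis_vec \<one>"
proof -
  have "lext PP (\<lambda>(a, b). basis_vec (inv a) \<star> Q' \<star> basis_vec b) J =
    lext PP (\<lambda>p. lext PP (\<lambda>q. basis_vec (inv (fst q \<otimes> fst p) \<otimes> (snd q \<otimes> snd p))) K) J"
    unfolding Q'_def push_def gmult_lext_left gmult_lext_right
    by (intro lext_cong) (auto simp: gmult_lext_left gmult_lext_right m_assoc inv_mult_group intro!: lext_cong)
  also have "\<dots> = lext PP (\<lambda>(a, b). basis_vec (inv a \<otimes> b)) (K \<star>\<^bsub>G2\<^esub> J)"
    unfolding G2.lext_gmult by (subst lext_swap) (auto simp: G2_mult intro!: lext_cong)
  also have "\<dots> = basis_vec \<one>"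
    by (simp add: KJ G2.fin)
  finally show ?thesis .
qed

text \<open>With J = \<Sum> a \<otimes> b inside \<open>Q\<close>, this is the map x \<otimes> y to
  x S(y) of kG, again applied to K J = 1.\<close>

lemma inner2: "lext PP (\<lambda>(c, d). basis_vec c \<star> Q \<star> basis_vec (inv d)) K = basis_vec \<one>"
proof -
  have "lext PP (\<lambda>(c, d). basis_vec c \<star> Q \<star> basis_vec (inv d)) K =
    lext PP (\<lambda>p. lext PP (\<lambda>q. basis_vec ((fst p \<otimes> fst q) \<otimes> inv (snd p \<otimes> snd q))) J) K"
    unfolding Q_def push_def gmult_lext_left gmult_lext_right
    by (intro lext_cong) (auto simp: gmult_lext_left gmult_lext_right m_assoc inv_mult_group intro!: lext_cong)
  also have "\<dots> = lext PP (\<lambda>(a, b). basis_vec (a \<otimes> inv b)) (K \<star>\<^bsub>G2\<^esub> J)"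
    unfolding G2.lext_gmult by (auto simp: G2_mult intro!: lext_cong)
  also have "\<dots> = basis_vec \<one>"
    by (simp add: KJ G2.fin)
  finally show ?thesis .
qed

text \<open>By \<open>tw_lext\<close> the sum runs over Q c^-1 g^-1 (a^-1 Q' b) g d. The bracket
  sums to 1 by \<open>inner1\<close>, then g cancels, and the products c^-1 d sum to
  \<open>Q'\<close>.\<close>

lemma antipode_left_basis:
  assumes g: "g \<in> carrier G"
  shows "lext PP (\<lambda>(i, j). S (basis_vec i) \<star> basis_vec j) (tw (basis_vec g)) = basis_vec \<one>"
proof -
  have "lext PP (\<lambda>(i, j). S (basis_vec i) \<star> basis_vec j) (tw (basis_vec g)) =
     lext PP (\<lambda>q. lext PP (\<lambda>p. Q \<star> (basis_vec (inv (fst q)) \<star> (basis_vec (inv g) \<star>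
       (basis_vec (inv (fst p)) \<star> Q' \<star> basis_vec (snd p)) \<star> (basis_vec g \<star> basis_vec (snd q))))) J) K"
    unfolding tw_lext[OF g] S_def
    by (subst lext_swap, intro lext_cong)
       (auto simp: g S0_gmult inv_mult_group gmult_assoc m_assoc gmult_basis[symmetric] simp del: gmult_basis intro!: lext_cong)
  also have "\<dots> = Q \<star> lext PP (\<lambda>q. basis_vec (inv (fst q)) \<star> (basis_vec (inv g) \<star>
       lext PP (\<lambda>(a, b). basis_vec (inv a) \<star> Q' \<star> basis_vec b) J \<star> (basis_vec g \<star> basis_vec (snd q)))) K"
    unfolding gmult_lext_left gmult_lext_right by (simp add: split_def)
  also have "\<dots> = Q \<star> Q'"
    unfolding inner1 unfolding Q'_def push_def
    by (intro arg_cong[of _ _ "\<lambda>x. Q \<star> x"] lext_cong) (auto simp: g m_assoc inv_mult_cancel)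
  finally show ?thesis by (simp add: QQ')
qed

text \<open>Here the bracket in a g (c Q d^-1) g^-1 b^-1 Q' sums to 1 by \<open>inner2\<close>, and
  the products a b^-1 sum to \<open>Q\<close>.\<close>

lemma antipode_right_basis:
  assumes g: "g \<in> carrier G"
  shows "lext PP (\<lambda>(i, j). basis_vec i \<star> S (basis_vec j)) (tw (basis_vec g)) = basis_vec \<one>"
proof -
  have "lext PP (\<lambda>(i, j). basis_vec i \<star> S (basis_vec j)) (tw (basis_vec g)) =
     lext PP (\<lambda>p. lext PP (\<lambda>q. basis_vec (fst p) \<star> basis_vec g \<star>
       (basis_vec (fst q) \<star> Q \<star> basis_vec (inv (snd q))) \<star> basis_vec (inv g) \<star> basis_vec (inv (snd p)) \<star> Q') K) J"
    unfolding tw_lext[OF g] S_def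
    by (intro lext_cong)
       (auto simp: g S0_gmult inv_mult_group gmult_assoc m_assoc gmult_basis[symmetric] simp del: gmult_basis intro!: lext_cong)
  also have "\<dots> = lext PP (\<lambda>p. basis_vec (fst p) \<star> basis_vec g \<star>
       lext PP (\<lambda>(c, d). basis_vec c \<star> Q \<star> basis_vec (inv d)) K \<star> basis_vec (inv g) \<star> basis_vec (inv (snd p))) J \<star> Q'"
    unfolding gmult_lext_left gmult_lext_right by (simp add: split_def)
  also have "\<dots> = Q \<star> Q'"
    unfolding inner2 unfolding Q_def push_def
    by (intro arg_cong[of _ _ "\<lambda>x. x \<star> Q'"] lext_cong) (auto simp: g m_assoc inv_mult_cancel)
  finally show ?thesis by (simp add: QQ')
qed

lemma lin_fscale_aug: "lin (\<lambda>x. fscale (aug G x) (y :: 'a \<Rightarrow> 'k))"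
  by (rule linI) (auto simp: aug_add aug_scale fun_eq_iff algebra_simps)

lemma antipode_left:
  "x \<in> free_space (carrier G) \<Longrightarrow>
    lext PP (\<lambda>(i, j). S (basis_vec i) \<star> basis_vec j) (tw x) = fscale (aug G x) (basis_vec \<one>)"
  by (rule lin_eqI[OF lin_comp[OF lin_lext lin_tw] lin_fscale_aug fin]) (auto simp: antipode_left_basis)

lemma antipode_right:
  "x \<in> free_space (carrier G) \<Longrightarrow>
    lext PP (\<lambda>(i, j). basis_vec i \<star> S (basis_vec j)) (tw x) = fscale (aug G x) (basis_vec \<one>)"
  by (rule lin_eqI[OF lin_comp[OF lin_lext lin_tw] lin_fscale_aug fin]) (auto simp: antipode_right_basis)

lemma is_antipode_S: "is_antipode H S"
  unfolding is_antipode_def H_sweedler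
  by (auto simp: antipode_left antipode_right) (use lin_S in \<open>simp add: linear_map_on_def\<close>)

lemma hopf_algebra_H: "hopf_algebra H"
  unfolding hopf_algebra_def using fd_bialgebra_H is_antipode_S by blast

end

section \<open>Normal Hopf subalgebras of a twisted group algebra\<close>

lemma linear_map_on_sum:
  assumes "linear_map_on V f" "fun_space.subspace V" "\<And>a. a \<in> A \<Longrightarrow> g a \<in> V"
  shows "f (\<Sum>a\<in>A. g a) = (\<Sum>a\<in>A. f (g a))"
proof -
  have "f (fscale 0 0) = fscale 0 (f 0)"
    using assms(1) fun_space.subspace_0[OF assms(2)] unfolding linear_map_on_def by blast
  then have f0: "f 0 = 0" by (simp only: fscale_zero)
  show ?thesis
    using assms(3)
  proof (induction A rule: infinite_finite_induct)
    case (insert a A)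
    have "f (g a + sum g A) = f (g a) + f (sum g A)"
      using assms(1) insert.prems fun_space.subspace_sum[OF assms(2), of A g] unfolding linear_map_on_def by blast
    moreover have "f (sum g A) = (\<Sum>a\<in>A. f (g a))"
      using insert by blast
    ultimately show ?case by (simp only: sum.insert[OF insert.hyps])
  next
    case empty
    show ?case by (simp only: sum.empty f0)
  next
    case (infinite A)
    then show ?case by (simp only: sum.infinite[OF infinite.hyps] f0)
  qed
  qed

text \<open>Serves maps known to be linear only on the carrier, such as an arbitrary antipode or the
  comodule isomorphism.\<close>

lemma linear_map_on_expand:
  assumes "linear_map_on (free_space A) f" "finite A" "x \<in> free_space A"
  shows "f x = lext A (\<lambda>a. f (basis_vec a)) x"
proof -
  have "f x = f (\<Sum>a\<in>A. fscale (x a) (basis_vec a))"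
    using lext_basis_vec_id[OF assms(2,3)] by (simp add: lext_def)
  also have "\<dots> = (\<Sum>a\<in>A. f (fscale (x a) (basis_vec a)))"
    by (rule linear_map_on_sum[OF assms(1) subspace_free_space])
      (auto intro: fun_space.subspace_scale[OF subspace_free_space])
  also have "\<dots> = lext A (\<lambda>a. f (basis_vec a)) x"
    unfolding lext_def using assms(1) by (intro sum.cong refl) (simp add: linear_map_on_def)
  finally show ?thesis .
qed

text \<open>Projections take the place of bases of subspaces: a trace or a tensor over a subspace is
  computed in the coordinates of the ambient space after projecting.\<close>

lemma exists_projection:
  fixes V :: "('i \<Rightarrow> 'k::field) set"
  assumes "fun_space.subspace V"
  obtains p where "lin p" "\<And>x. p x \<in> V" "\<And>x. x \<in> V \<Longrightarrow> p x = x"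
proof -
  interpret pair: vector_space_pair "fscale :: 'k \<Rightarrow> ('i \<Rightarrow> 'k) \<Rightarrow> _" "fscale :: 'k \<Rightarrow> ('i \<Rightarrow> 'k) \<Rightarrow> _"
    by unfold_locales
  have "Vector_Spaces.linear fscale fscale (\<lambda>x :: 'i \<Rightarrow> 'k. x)"
    using lin_id lin_iff_linear by blast
  then obtain p where "range p \<subseteq> V" "Vector_Spaces.linear fscale fscale p" "\<forall>v\<in>V. p v = v"
    using pair.linear_exists_left_inverse_on[OF _ assms, of "\<lambda>x. x"] by (auto simp: inj_on_def)
  then show ?thesis using that[of p] by (auto simp: lin_iff_linear)
qed

lemma subspace_separation:
  fixes V :: "('i \<Rightarrow> 'k::field) set"
  assumes "fun_space.subspace V" "finite A" "x \<in> free_space A" "x \<notin> V" "V \<subseteq> free_space A"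
  obtains f where "\<And>y. y \<in> V \<Longrightarrow> (\<Sum>a\<in>A. f a * y a) = 0" "(\<Sum>a\<in>A. f a * x a) \<noteq> 0"
proof -
  obtain p where p: "lin p" "\<And>x. p x \<in> V" "\<And>x. x \<in> V \<Longrightarrow> p x = x"
    using exists_projection[OF assms(1)] by blast
  have "p x \<noteq> x" using p(2)[of x] assms(4) by metis
  then obtain k where k: "x k \<noteq> p x k" by fastforce
  \<comment> \<open>The separating functional is a coordinate of id - p at which \<open>x\<close>
    differs from its projection; id - p vanishes on \<open>V\<close>.\<close>
  define f where "f a = basis_vec a k - p (basis_vec a) k" for a
  have f: "(\<Sum>a\<in>A. f a * y a) = y k - p y k" if "y \<in> free_space A" for y
  proof -
    have "y k - p y k = lext A basis_vec y k - lext A (\<lambda>a. p (basis_vec a)) y k"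
      using lin_expand[OF p(1) assms(2) that] lext_basis_vec_id[OF assms(2) that] by simp
    then show ?thesis by (simp add: lext_apply f_def sum_subtractf[symmetric] algebra_simps)
  qed
  show ?thesis
  proof (rule that[of f])
    show "(\<Sum>a\<in>A. f a * y a) = 0" if "y \<in> V" for y
      using f[of y] that p(3)[OF that] assms(5) by auto
  qed (use f[OF assms(3)] k in auto)
qed

text \<open>The image of a basis of \<open>B\<close> is independent of the same size, so a further
  vector of \<open>B\<close> outside its span would exceed the dimension.\<close>

lemma inj_endo_surj:
  fixes B :: "('i \<Rightarrow> 'k::field) set"
  assumes "finite A" "B \<subseteq> free_space A" "fun_space.subspace B" "lin f" "f ` B \<subseteq> B" "inj_on f B"
  shows "f ` B = B"
proof -
  interpret pair: vector_space_pair "fscale :: 'k \<Rightarrow> ('i \<Rightarrow> 'k) \<Rightarrow> _" "fscale :: 'k \<Rightarrow> ('i \<Rightarrow> 'k) \<Rightarrow> _"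
    by unfold_locales
  obtain b where b: "b \<subseteq> B" "fun_space.independent b" "B \<subseteq> fun_space.span b"
    using fun_space.basis_exists[of B] by metis
  have lf: "Vector_Spaces.linear fscale fscale f" using assms(4) by (simp add: lin_iff_linear)
  have "(free_space A :: ('i \<Rightarrow> 'k) set) \<subseteq> fun_space.span (basis_vec ` A)"
  proof
    fix x :: "'i \<Rightarrow> 'k" assume x: "x \<in> free_space A"
    have "lext A basis_vec x \<in> fun_space.span (basis_vec ` A)"
      by (intro lext_closed fun_space.subspace_span fun_space.span_base) auto
    then show "x \<in> fun_space.span (basis_vec ` A)" by (simp add: lext_basis_vec_id[OF assms(1) x])
  qed
  then have fin_b: "finite b"
    using fun_space.independent_span_bound[of "basis_vec ` A" b] b(1,2) assms(1,2) by blast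
  have sb: "fun_space.span b = B"
    using b(1,3) fun_space.span_minimal[OF b(1) assms(3)] by blast
  have ind: "fun_space.independent (f ` b)"
    using pair.linear_independent_injective_image[OF lf b(2)] assms(6) sb by simp
  have "B \<subseteq> fun_space.span (f ` b)"
  proof (rule ccontr)
    assume "\<not> B \<subseteq> fun_space.span (f ` b)"
    then obtain y where y: "y \<in> B" "y \<notin> fun_space.span (f ` b)" by blast
    then have "fun_space.independent (insert y (f ` b))"
      using ind fun_space.independent_insert[of y "f ` b"] fun_space.span_base[of y "f ` b"] by auto
    moreover have "insert y (f ` b) \<subseteq> fun_space.span b" using y(1) sb b(1) assms(5) by blast
    ultimately have "card (insert y (f ` b)) \<le> card b"
      using fun_space.independent_span_bound[OF fin_b] by blast
    moreover have "card (f ` b) = card b"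
      using card_image inj_on_subset[OF assms(6) b(1)] by blast
    moreover have "y \<notin> f ` b" using y(2) fun_space.span_base by blast
    ultimately show False using fin_b by simp
  qed
  also have "\<dots> = f ` B"
    using pair.linear_span_image[OF lf, of b] sb by simp
  finally show ?thesis using assms(5) by blast
qed

section \<open>Averages over subgroups, and ideals of the group algebra\<close>

context fin_group
begin

abbreviation pair :: "('a \<Rightarrow> 'k::field) \<Rightarrow> ('a \<Rightarrow> 'k) \<Rightarrow> 'k" where
  "pair f x \<equiv> (\<Sum>g\<in>carrier G. f g * x g)"

definition avg :: "'a set \<Rightarrow> ('a \<Rightarrow> 'k::field_char_0)" where
  "avg N = fscale (1 / of_nat (card N)) (\<Sum>n\<in>N. basis_vec n)"

lemma avg_apply: "finite N \<Longrightarrow> avg N k = (if k \<in> N then 1 / of_nat (card N) else 0)"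
  by (simp add: avg_def sum_fun_apply basis_vec_apply)

lemma finite_subgroup: "subgroup N G \<Longrightarrow> finite N"
  using fin finite_subset subgroup.subset by blast

lemma card_subgroup_nz: "subgroup N G \<Longrightarrow> (of_nat (card N) :: 'k::field_char_0) \<noteq> 0"
  using finite_subgroup[of N] subgroup.one_closed[of N G] by auto

lemma avg_closed: "subgroup N G \<Longrightarrow> avg N \<in> free_space (carrier G)"
  using finite_subgroup[of N] subgroup.subset[of N G] by (auto simp: free_space_def avg_apply)

lemma basis_avg:
  assumes "subgroup N G" "n \<in> N"
  shows "basis_vec n \<star> avg N = avg N"
proof
  fix k
  note N = subgroup.subset[OF assms(1)]
  have n: "n \<in> carrier G" using assms N by blast
  show "(basis_vec n \<star> avg N) k = (avg N k :: 'k::field_char_0)"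
  proof (cases "k \<in> carrier G")
    case True
    have "inv n \<otimes> k \<in> N \<longleftrightarrow> k \<in> N"
      using True n assms by (metis inv_solve_left inv_closed m_closed subgroup.m_closed subgroup.m_inv_closed)
    then show ?thesis using True n by (simp add: gmult_basis_left_apply avg_apply finite_subgroup[OF assms(1)])
  next
    case False
    then show ?thesis using gmult_closed[of "basis_vec n" "avg N"] N
      by (auto simp: free_space_def avg_apply finite_subgroup[OF assms(1)])
  qed
qed

lemma avg_central:
  assumes "N \<lhd> G" "x \<in> free_space (carrier G)"
  shows "x \<star> avg N = avg N \<star> (x :: 'a \<Rightarrow> 'k::field_char_0)"
proof (rule lin_eqI[OF lin_gmult_left lin_gmult_right fin assms(2)])
  fix g assume g: "g \<in> carrier G"
  note N = normal_imp_subgroup[OF assms(1)]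
  show "basis_vec g \<star> avg N = avg N \<star> (basis_vec g :: 'a \<Rightarrow> 'k)"
  proof
    fix k
    show "(basis_vec g \<star> avg N) k = (avg N \<star> (basis_vec g :: 'a \<Rightarrow> 'k)) k"
    proof (cases "k \<in> carrier G")
      case True
      have "inv g \<otimes> k \<in> N \<longleftrightarrow> k \<otimes> inv g \<in> N"
      proof
        assume "inv g \<otimes> k \<in> N"
        then have "g \<otimes> (inv g \<otimes> k) \<otimes> inv g \<in> N" using normal.inv_op_closed2[OF assms(1) g] by blast
        then show "k \<otimes> inv g \<in> N" using g True by (simp add: m_assoc[symmetric])
      next
        assume "k \<otimes> inv g \<in> N"
        then have "inv g \<otimes> (k \<otimes> inv g) \<otimes> g \<in> N" using normal.inv_op_closed1[OF assms(1) g] by blast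
        then show "inv g \<otimes> k \<in> N" using g True by (simp add: m_assoc)
      qed
      then show ?thesis using True g
        by (simp add: gmult_basis_left_apply gmult_basis_right_apply avg_apply finite_subgroup[OF N])
    next
      case False
      then show ?thesis using gmult_closed by (metis (mono_tags, lifting) free_space_def mem_Collect_eq)
    qed
  qed
qed

text \<open>
  The functions on \<open>G\<close> orthogonal to \<open>I\<close> form a unital subalgebra of \<open>k\<^sup>G\<close>. A product of such
  functions, each separating one point outside \<open>N\<close> from \<open>1\<close>, is the indicator function of \<open>N\<close>.
\<close>

lemma ideal_subgroup:
  fixes I :: "('a \<Rightarrow> 'k::field_char_0) set"
  defines "N \<equiv> {g \<in> carrier G. basis_vec g - basis_vec \<one> \<in> I}"
  assumes I: "fun_space.subspace I" "I \<subseteq> free_space (carrier G)"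
    and left: "\<And>g x. g \<in> carrier G \<Longrightarrow> x \<in> I \<Longrightarrow> basis_vec g \<star> x \<in> I"
    and right: "\<And>g x. g \<in> carrier G \<Longrightarrow> x \<in> I \<Longrightarrow> x \<star> basis_vec g \<in> I"
    and aug0: "\<And>x. x \<in> I \<Longrightarrow> aug G x = 0"
    and coideal: "\<And>f f' x. (\<And>x. x \<in> I \<Longrightarrow> pair f x = 0) \<Longrightarrow> (\<And>x. x \<in> I \<Longrightarrow> pair f' x = 0) \<Longrightarrow>
      x \<in> I \<Longrightarrow> pair (\<lambda>g. f g * f' g) x = 0"
  shows "N \<lhd> G" "basis_vec \<one> - avg N \<in> I" "\<And>x. x \<in> I \<Longrightarrow> x \<star> avg N = 0"
proof -
  have NG: "N \<subseteq> carrier G" by (auto simp: N_def)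
  have sub: "subgroup N G"
  proof (rule subgroupI)
    show "N \<noteq> {}" using fun_space.subspace_0[OF I(1)] by (auto simp: N_def)
    fix a assume a: "a \<in> N"
    then have aG: "a \<in> carrier G" using NG by blast
    have "(basis_vec a - basis_vec \<one>) \<star> basis_vec (inv a) \<in> I"
      using a right[of "inv a"] by (auto simp: N_def)
    then have "fscale (- 1) (basis_vec \<one> - basis_vec (inv a)) \<in> I"
      using aG by (intro fun_space.subspace_scale[OF I(1)]) (simp add: lin_diff[OF lin_gmult_left])
    also have "fscale (- 1) (basis_vec \<one> - basis_vec (inv a)) = basis_vec (inv a) - (basis_vec \<one> :: 'a \<Rightarrow> 'k)"
      by (auto simp: fun_eq_iff)
    finally show "inv a \<in> N" using aG unfolding N_def by blast
    fix b assume b: "b \<in> N"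
    then have bG: "b \<in> carrier G" using NG by blast
    have "(basis_vec a - basis_vec \<one>) \<star> basis_vec b + (basis_vec b - basis_vec \<one>) \<in> I"
      using a b bG right[of b] fun_space.subspace_add[OF I(1)] by (auto simp: N_def)
    then show "a \<otimes> b \<in> N"
      using aG bG by (simp add: lin_diff[OF lin_gmult_left] N_def)
  qed (rule NG)
  show nor: "N \<lhd> G"
    unfolding normal_inv_iff
  proof (intro conjI sub ballI)
    fix x h assume x: "x \<in> carrier G" and h: "h \<in> N"
    have "basis_vec x \<star> (basis_vec h - basis_vec \<one>) \<star> basis_vec (inv x) \<in> I"
      using x h by (intro left right) (auto simp: N_def)
    then show "x \<otimes> h \<otimes> inv x \<in> N"
      using x h NG by (auto simp: lin_diff[OF lin_gmult_left] lin_diff[OF lin_gmult_right] N_def)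
  qed
  note finN = finite_subgroup[OF sub] and nz = card_subgroup_nz[OF sub, where ?'k = 'k]
  have "(\<Sum>n\<in>N. fscale (1 / of_nat (card N)) (fscale (- 1) (basis_vec n - basis_vec \<one>))) \<in> I"
    by (intro fun_space.subspace_sum[OF I(1)] fun_space.subspace_scale[OF I(1)]) (auto simp: N_def)
  also have "(\<Sum>n\<in>N. fscale (1 / of_nat (card N)) (fscale (- 1) (basis_vec n - basis_vec \<one>))) = basis_vec \<one> - (avg N :: 'a \<Rightarrow> 'k)"
    using nz by (simp add: avg_def fun_eq_iff sum_fun_apply sum_subtractf sum_negf sum_distrib_left right_diff_distrib)
  finally show "basis_vec \<one> - avg N \<in> I" .
  define perp where "perp f \<longleftrightarrow> (\<forall>x\<in>I. pair f x = 0)" for f :: "'a \<Rightarrow> 'k"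
  have pair_basis: "pair f (basis_vec g) = f g" if "g \<in> carrier G" for g and f :: "'a \<Rightarrow> 'k"
    using that fin by (simp add: basis_vec_apply if_distrib cong: if_cong)
  have perp_one: "perp (\<lambda>_. 1)"
    using aug0 by (simp add: perp_def aug_def)
  have perp_mult: "perp (\<lambda>g. f g * f' g)" if "perp f" "perp f'" for f f'
    using coideal[of f f'] that by (auto simp: perp_def)
  have perp_affine: "perp (\<lambda>g. (f g - c) / d)" if "perp f" for f c d
  proof -
    have "pair (\<lambda>g. (f g - c) / d) x = (pair f x - c * pair (\<lambda>_. 1) x) / d" for x
      by (simp add: sum_subtractf sum_distrib_left sum_divide_distrib left_diff_distrib diff_divide_distrib)
    then show ?thesis using that perp_one by (simp add: perp_def)
  qed
  have perp_N: "f n = f \<one>" if "perp f" "n \<in> N" for f n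
  proof -
    have "pair f (basis_vec n - basis_vec \<one>) = 0" using that by (auto simp: perp_def N_def)
    moreover have "pair f (basis_vec n - basis_vec \<one>) = pair f (basis_vec n) - pair f (basis_vec \<one>)"
      by (simp add: right_diff_distrib sum_subtractf)
    ultimately show ?thesis using that NG pair_basis[of n f] pair_basis[of \<one> f] by auto
  qed
  have "\<exists>f. perp f \<and> f \<one> \<noteq> f g" if "g \<in> carrier G - N" for g
  proof -
    have "basis_vec g - basis_vec \<one> \<notin> I" using that by (auto simp: N_def)
    moreover have "basis_vec g - basis_vec \<one> \<in> free_space (carrier G)"
      using that by (intro fun_space.subspace_diff[OF subspace_free_space]) auto
    ultimately obtain f where f: "\<And>y. y \<in> I \<Longrightarrow> pair f y = 0" "pair f (basis_vec g - basis_vec \<one>) \<noteq> 0"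
      using subspace_separation[OF I(1) fin _ _ I(2)] by blast
    have "pair f (basis_vec g - basis_vec \<one>) = pair f (basis_vec g) - pair f (basis_vec \<one>)"
      by (simp add: right_diff_distrib sum_subtractf)
    then have "f g \<noteq> f \<one>" using f(2) that pair_basis[of g f] pair_basis[of \<one> f] by auto
    then show ?thesis using f(1) unfolding perp_def by metis
  qed
  then obtain F where F: "\<And>g. g \<in> carrier G - N \<Longrightarrow> perp (F g) \<and> F g \<one> \<noteq> F g g"
    by metis
  define ind where "ind h = (\<Prod>g\<in>carrier G - N. (F g h - F g g) / (F g \<one> - F g g))" for h
  have "perp (\<lambda>h. \<Prod>g\<in>M. (F g h - F g g) / (F g \<one> - F g g))" if "finite M" "M \<subseteq> carrier G - N" for M
    using that
  proof (induction M)
    case (insert g M)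
    then show ?case using perp_mult[OF perp_affine[of "F g"], of "\<lambda>h. \<Prod>g\<in>M. (F g h - F g g) / (F g \<one> - F g g)"] F[of g]
      by simp
  qed (simp add: perp_one)
  then have perp_ind: "perp ind" unfolding ind_def[abs_def] using fin by auto
  have ind: "ind h = (if h \<in> N then 1 else 0)" if "h \<in> carrier G" for h
  proof (cases "h \<in> N")
    case True
    have "ind \<one> = 1" unfolding ind_def using F by (intro prod.neutral) auto
    then show ?thesis using perp_N[OF perp_ind True] True by simp
  next
    case False
    then show ?thesis using fin that unfolding ind_def by (auto intro!: prod_zero)
  qed
  show "x \<star> avg N = 0" if x: "x \<in> I" for x
  proof
    fix k
    show "(x \<star> avg N) k = 0 k"
    proof (cases "k \<in> carrier G")
      case True
      \<comment> \<open>Orthogonality of \<open>ind\<close> to the translate of \<open>x\<close> by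
        k^-1 says that the coefficients of \<open>x\<close> on the coset kN sum to 0. This sum is
        |N| times the coefficient of \<open>x \<star> avg N\<close> at k.\<close>
      have "pair ind (basis_vec (inv k) \<star> x) = 0"
        using perp_ind left[of "inv k" x] x True by (simp add: perp_def)
      then have "0 = (\<Sum>m\<in>carrier G. (if m \<in> N then 1 else 0) * x (k \<otimes> m))"
        using True by (simp add: ind gmult_basis_left_apply)
      also have "\<dots> = (\<Sum>m\<in>carrier G. (if inv m \<in> N then 1 else 0) * x (k \<otimes> inv m))"
        by (rule sum.reindex_bij_witness[of _ "\<lambda>m. inv m" "\<lambda>m. inv m"]) auto
      also have "\<dots> = of_nat (card N) * (\<Sum>m\<in>carrier G. x (k \<otimes> inv m) * avg N m)"
        unfolding sum_distrib_left
      proof (intro sum.cong refl)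
        fix m assume "m \<in> carrier G"
        then have "inv m \<in> N \<longleftrightarrow> m \<in> N" using subgroup.m_inv_closed[OF sub] by force
        then show "(if inv m \<in> N then 1 else 0) * x (k \<otimes> inv m) = of_nat (card N) * (x (k \<otimes> inv m) * avg N m)"
          using nz by (simp add: avg_apply finN)
      qed
      finally show ?thesis using nz by (simp add: gmult_apply True)
    next
      case False
      then show ?thesis using gmult_closed[of x "avg N"] by (auto simp: free_space_def)
    qed
  qed
qed

text \<open>Cyclicity of the trace, in coefficients. In \<open>integral_left\<close> it moves a left
  multiplication around the trace.\<close>

lemma trace_comm:
  fixes \<Phi> \<Psi> :: "('a \<Rightarrow> 'k::field) \<Rightarrow> 'a \<Rightarrow> 'k"
  assumes "lin \<Phi>" "lin \<Psi>" "\<And>x. \<Phi> x \<in> free_space (carrier G)" "\<And>x. \<Psi> x \<in> free_space (carrier G)"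
  shows "(\<Sum>g\<in>carrier G. \<Phi> (\<Psi> (basis_vec g)) g) = (\<Sum>g\<in>carrier G. \<Psi> (\<Phi> (basis_vec g)) g)"
proof -
  have "(\<Sum>g\<in>carrier G. \<Phi> (\<Psi> (basis_vec g)) g) =
      (\<Sum>g\<in>carrier G. \<Sum>h\<in>carrier G. \<Psi> (basis_vec g) h * \<Phi> (basis_vec h) g)"
    using lin_expand[OF assms(1) fin assms(4)] by (simp add: lext_apply)
  also have "\<dots> = (\<Sum>h\<in>carrier G. \<Sum>g\<in>carrier G. \<Phi> (basis_vec h) g * \<Psi> (basis_vec g) h)"
    by (subst sum.swap) (simp add: mult.commute)
  also have "\<dots> = (\<Sum>g\<in>carrier G. \<Psi> (\<Phi> (basis_vec g)) g)"
    using lin_expand[OF assms(2) fin assms(3)] by (simp add: lext_apply)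
  finally show ?thesis .
qed

end

section \<open>Uniqueness and inverse of the antipode\<close>

context group_twist
begin

text \<open>Coassociativity in the form needed for Sweedler calculations: any expression in three
  legs may be regrouped. It is \<open>tw_coassoc\<close> followed by the linear extension of
  f.\<close>

lemma coassoc_lext:
  "lext PP (\<lambda>(i, j). lext PP (\<lambda>(k, l). f i k l) (tw (basis_vec j))) (tw x) =
   lext PP (\<lambda>(i, j). lext PP (\<lambda>(k, l). f k l j) (tw (basis_vec i))) (tw x)"
proof -
  define L where "L = lext (carrier G \<times> PP) (\<lambda>(a, b, c). f a b c)"
  have lin_L: "lin L" unfolding L_def by (rule lin_lext)
  have 1: "L (tensor (basis_vec i) X) = lext PP (\<lambda>(k, l). f i k l) X" if "i \<in> carrier G" for i X
    using that by (simp add: L_def lext_tensor fin)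
  have 2: "L (\<lambda>(a, b, c). tensor X (basis_vec j) ((a, b), c)) = lext PP (\<lambda>(k, l). f k l j) X"
    if "j \<in> carrier G" for j X
  proof
    fix m
    have "L (\<lambda>(a, b, c). tensor X (basis_vec j) ((a, b), c)) m =
      (\<Sum>a\<in>carrier G. \<Sum>b\<in>carrier G. \<Sum>c\<in>carrier G. X (a, b) * basis_vec j c * f a b c m)"
      unfolding L_def lext_apply sum.cartesian_product by (intro sum.cong refl) auto
    also have "\<dots> = (\<Sum>a\<in>carrier G. \<Sum>b\<in>carrier G. X (a, b) * f a b j m)"
      using that fin by (intro sum.cong refl)
        (simp add: basis_vec_apply if_distrib[of "\<lambda>x. _ * x"] if_distrib[of "\<lambda>x. x * _"] cong: if_cong)
    also have "\<dots> = lext PP (\<lambda>(k, l). f k l j) X m"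
      by (simp add: lext_apply sum.cartesian_product split_def)
    finally show "L (\<lambda>(a, b, c). tensor X (basis_vec j) ((a, b), c)) m = lext PP (\<lambda>(k, l). f k l j) X m" .
  qed
  have "lext PP (\<lambda>(i, j). lext PP (\<lambda>(k, l). f i k l) (tw (basis_vec j))) (tw x) =
     L (lext PP (\<lambda>(i, j). tensor (basis_vec i) (tw (basis_vec j))) (tw x))"
    unfolding lin_lext_comm[OF lin_L] by (intro lext_Sigma_cong) (simp add: 1)
  also have "\<dots> = L (lext PP (\<lambda>(i, j). \<lambda>(a, b, c). tensor (tw (basis_vec i)) (basis_vec j) ((a, b), c)) (tw x))"
    by (simp only: tw_coassoc)
  also have "\<dots> = lext PP (\<lambda>(i, j). lext PP (\<lambda>(k, l). f k l j) (tw (basis_vec i))) (tw x)"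
    unfolding lin_lext_comm[OF lin_L] using 2 by (intro lext_Sigma_cong) simp
  finally show ?thesis .
qed

lemma lext_counit_left:
  assumes "lin F" "x \<in> free_space (carrier G)"
  shows "lext PP (\<lambda>(i, j). F (basis_vec j)) (tw x) = F x"
proof -
  have "F x = F (push PP snd (tw x))" by (simp add: counit_snd assms)
  then show ?thesis unfolding push_def lin_lext_comm[OF assms(1)] by (simp add: split_def)
qed

lemma lext_counit_right:
  assumes "lin F" "x \<in> free_space (carrier G)"
  shows "lext PP (\<lambda>(i, j). F (basis_vec i)) (tw x) = F x"
proof -
  have "F x = F (push PP fst (tw x))" by (simp add: counit_fst assms)
  then show ?thesis unfolding push_def lin_lext_comm[OF assms(1)] by (simp add: split_def)
qed

text \<open>\<open>antipode\<close> is only a choice, so it is identified by uniqueness of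
  convolution inverses: S'(x) = S'(x1) x2 S(x3) = S(x).\<close>

lemma antipode_H:
  assumes "x \<in> free_space (carrier G)"
  shows "antipode H x = S x"
proof -
  define S' where "S' = antipode H"
  have S': "is_antipode H S'"
    unfolding S'_def antipode_def using someI[of "is_antipode H", OF is_antipode_S] .
  \<comment> \<open>\<open>S'\<close> is arbitrary off the carrier; \<open>S''\<close> is the total
    linear map that agrees with it on kG.\<close>
  define S'' where "S'' = lext (carrier G) (\<lambda>a. S' (basis_vec a))"
  have S'': "S' y = S'' y" if "y \<in> free_space (carrier G)" for y
    using linear_map_on_expand[OF _ fin that, of S'] S' by (simp add: is_antipode_def S''_def)
  have lin_S'': "lin S''" unfolding S''_def by (rule lin_lext)
  have cl: "S'' (basis_vec i) \<in> free_space (carrier G)" if "i \<in> carrier G" for i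
  proof -
    have "S' \<in> free_space (carrier G) \<rightarrow> free_space (carrier G)" using S' by (simp add: is_antipode_def)
    from Pi_mem[OF this basis_vec_free_space[OF that]] show ?thesis using S''[of "basis_vec i"] that by simp
  qed
  have left: "lext PP (\<lambda>(k, l). S'' (basis_vec k) \<star> basis_vec l) (tw (basis_vec i)) = basis_vec \<one>"
    if "i \<in> carrier G" for i
  proof -
    have "lext PP (\<lambda>(k, l). S' (basis_vec k) \<star> basis_vec l) (tw (basis_vec i)) = basis_vec \<one>"
      using S' that by (simp add: is_antipode_def H_sweedler)
    moreover have "lext PP (\<lambda>(k, l). S' (basis_vec k) \<star> basis_vec l) (tw (basis_vec i)) =
      lext PP (\<lambda>(k, l). S'' (basis_vec k) \<star> basis_vec l) (tw (basis_vec i))"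
      by (intro lext_Sigma_cong) (simp add: S'')
    ultimately show ?thesis by simp
  qed
  have "S'' x = lext PP (\<lambda>(i, j). S'' (basis_vec i)) (tw x)"
    by (simp add: lext_counit_right[OF lin_S'' assms])
  also have "\<dots> = lext PP (\<lambda>(i, j). S'' (basis_vec i) \<star> lext PP (\<lambda>(k, l). basis_vec k \<star> S (basis_vec l)) (tw (basis_vec j))) (tw x)"
    by (intro lext_Sigma_cong) (simp add: antipode_right gmult_one_right cl)
  also have "\<dots> = lext PP (\<lambda>(i, j). lext PP (\<lambda>(k, l). S'' (basis_vec i) \<star> basis_vec k \<star> S (basis_vec l)) (tw (basis_vec j))) (tw x)"
    by (simp add: gmult_lext_right gmult_assoc split_def)
  also have "\<dots> = lext PP (\<lambda>(i, j). lext PP (\<lambda>(k, l). S'' (basis_vec k) \<star> basis_vec l \<star> S (basis_vec j)) (tw (basis_vec i))) (tw x)"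
    by (rule coassoc_lext)
  also have "\<dots> = lext PP (\<lambda>(i, j). lext PP (\<lambda>(k, l). S'' (basis_vec k) \<star> basis_vec l) (tw (basis_vec i)) \<star> S (basis_vec j)) (tw x)"
    by (simp add: gmult_lext_left split_def)
  also have "\<dots> = lext PP (\<lambda>(i, j). S (basis_vec j)) (tw x)"
    by (intro lext_Sigma_cong) (simp add: left gmult_one_left)
  also have "\<dots> = S x"
    by (rule lext_counit_left[OF lin_S assms])
  finally show ?thesis using S''[OF assms] by (simp add: S'_def)
qed

lemma left_adjoint_H: "left_adjoint H h y = lext PP (\<lambda>(i, j). basis_vec i \<star> y \<star> S (basis_vec j)) (tw h)"
  unfolding left_adjoint_def H_sweedler by (intro lext_Sigma_cong) (simp add: antipode_H)

lemma right_adjoint_H: "right_adjoint H h y = lext PP (\<lambda>(i, j). S (basis_vec i) \<star> y \<star> basis_vec j) (tw h)"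
  unfolding right_adjoint_def H_sweedler by (intro lext_Sigma_cong) (simp add: antipode_H)

lemma S_gmult: "S (x \<star> y) = S y \<star> S x"
proof -
  have "S y \<star> S x = Q \<star> S0 y \<star> (Q' \<star> Q) \<star> S0 x \<star> Q'"
    by (simp add: S_def gmult_assoc)
  then show ?thesis by (simp add: Q'Q gmult_one_right S_def S0_gmult gmult_assoc)
qed

lemma S_one: "S (basis_vec \<one>) = basis_vec \<one>"
  by (simp add: S_def gmult_one_right QQ')

lemma aug_Q: "aug G Q * aug G Q' = 1"
  using aug_gmult[of Q Q'] by (simp add: QQ')

lemma aug_S: "aug G (S x) = aug G x"
  using aug_Q by (simp add: S_def aug_gmult aug_S0 mult_ac)

text \<open>The inverse of \<open>S\<close>. It acts as an antipode for the opposite coproduct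
  (\<open>antipode_R\<close>), and its square S^-2 enters the trace formula for integrals.\<close>

definition R :: "('a \<Rightarrow> 'k) \<Rightarrow> ('a \<Rightarrow> 'k)" where "R x = S0 (Q' \<star> x \<star> Q)"

lemma lin_R: "lin R"
  unfolding R_def[abs_def] by (intro lin_comp[OF lin_S0] lin_comp[OF lin_gmult_left] lin_gmult_right)

lemma R_closed [simp]: "R x \<in> free_space (carrier G)"
  by (simp add: R_def)

lemma R_S: "x \<in> free_space (carrier G) \<Longrightarrow> R (S x) = x"
proof -
  assume x: "x \<in> free_space (carrier G)"
  have "Q' \<star> (Q \<star> S0 x \<star> Q') \<star> Q = (Q' \<star> Q) \<star> S0 x \<star> (Q' \<star> Q)"
    by (simp only: gmult_assoc)
  then show ?thesis using x by (simp add: R_def S_def Q'Q gmult_one_left gmult_one_right S0_S0)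
qed

lemma S_R: "x \<in> free_space (carrier G) \<Longrightarrow> S (R x) = x"
proof -
  assume x: "x \<in> free_space (carrier G)"
  have "Q \<star> (Q' \<star> x \<star> Q) \<star> Q' = (Q \<star> Q') \<star> x \<star> (Q \<star> Q')"
    by (simp only: gmult_assoc)
  then show ?thesis using x by (simp add: R_def S_def QQ' gmult_one_left gmult_one_right S0_S0)
qed

lemma R_gmult: "x \<in> free_space (carrier G) \<Longrightarrow> y \<in> free_space (carrier G) \<Longrightarrow> R (x \<star> y) = R y \<star> R x"
  using R_S[of "R y \<star> R x"] by (simp add: S_gmult S_R)

lemma R_one: "R (basis_vec \<one>) = basis_vec \<one>"
  using R_S[of "basis_vec \<one>"] by (simp add: S_one)

text \<open>Apply the antimultiplicative map \<open>R\<close> to b1 S(b2) = \<epsilon>(b) 1.\<close>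

lemma antipode_R:
  assumes "b \<in> free_space (carrier G)"
  shows "lext PP (\<lambda>(i, j). basis_vec j \<star> R (basis_vec i)) (tw b) = fscale (aug G b) (basis_vec \<one>)"
proof -
  have "lext PP (\<lambda>(i, j). basis_vec j \<star> R (basis_vec i)) (tw b) =
     lext PP (\<lambda>(i, j). R (basis_vec i \<star> S (basis_vec j))) (tw b)"
    by (intro lext_Sigma_cong) (simp add: R_gmult R_S)
  also have "\<dots> = R (lext PP (\<lambda>(i, j). basis_vec i \<star> S (basis_vec j)) (tw b))"
    unfolding lin_lext_comm[OF lin_R] by (simp add: split_def)
  finally show ?thesis by (simp add: antipode_right assms lin_scale[OF lin_R] R_one)
qed

text \<open>In Sweedler notation this reads \<open>y\<^sub>1 \<otimes> b y\<^sub>2 = S(b\<^sub>1) b\<^sub>2 y\<^sub>1 \<otimes> b\<^sub>3 y\<^sub>2\<close>.\<close>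

lemma shift_mult:
  assumes "\<And>y. lin (\<lambda>x. F x y)" "\<And>x. lin (F x)" "b \<in> free_space (carrier G)"
  shows "lext PP (\<lambda>(k, l). F (basis_vec k) (b \<star> basis_vec l)) (tw y) =
    lext PP (\<lambda>(i, j). lext PP (\<lambda>(k, l). F (S (basis_vec i) \<star> basis_vec k) (basis_vec l)) (tw (basis_vec j \<star> y))) (tw b)"
proof -
  have lin1: "lin (\<lambda>z. lext PP (\<lambda>(m, n). F (z \<star> basis_vec m) (basis_vec j \<star> basis_vec n)) (tw y))" for j
    by (rule lin_lext_arg) (auto intro!: lin_comp[OF assms(1) lin_gmult_left])
  have lin2: "lin (\<lambda>z. lext PP (\<lambda>(m, n). F (basis_vec m) (z \<star> basis_vec n)) (tw y))"
    by (rule lin_lext_arg) (auto intro!: lin_comp[OF assms(2) lin_gmult_left])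
  have "lext PP (\<lambda>(i, j). lext PP (\<lambda>(k, l). F (S (basis_vec i) \<star> basis_vec k) (basis_vec l)) (tw (basis_vec j \<star> y))) (tw b) =
    lext PP (\<lambda>(i, j). lext PP (\<lambda>(k, l). lext PP (\<lambda>(m, n).
      F (S (basis_vec i) \<star> basis_vec k \<star> basis_vec m) (basis_vec l \<star> basis_vec n)) (tw y)) (tw (basis_vec j))) (tw b)"
    by (intro lext_Sigma_cong)
      (auto simp: tw_gmult G2.lext_gmult G2_mult gmult_assoc intro!: lext_Sigma_cong)
  also have "\<dots> = lext PP (\<lambda>(i, j). lext PP (\<lambda>(k, l). lext PP (\<lambda>(m, n).
      F (S (basis_vec k) \<star> basis_vec l \<star> basis_vec m) (basis_vec j \<star> basis_vec n)) (tw y)) (tw (basis_vec i))) (tw b)"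
    by (rule coassoc_lext)
  also have "\<dots> = lext PP (\<lambda>(i, j). lext PP (\<lambda>(m, n).
      F (lext PP (\<lambda>(k, l). S (basis_vec k) \<star> basis_vec l) (tw (basis_vec i)) \<star> basis_vec m) (basis_vec j \<star> basis_vec n)) (tw y)) (tw b)"
    unfolding lin_lext_comm[OF lin1] by (simp add: split_def)
  also have "\<dots> = lext PP (\<lambda>(i, j). lext PP (\<lambda>(m, n). F (basis_vec m) (basis_vec j \<star> basis_vec n)) (tw y)) (tw b)"
    by (intro lext_Sigma_cong) (auto simp: antipode_left gmult_one_left intro!: lext_Sigma_cong)
  also have "\<dots> = lext PP (\<lambda>(k, l). F (basis_vec k) (b \<star> basis_vec l)) (tw y)"
    by (rule lext_counit_left[OF lin2 assms(3)])
  finally show ?thesis ..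
qed

end

section \<open>Hopf subalgebras and the projection onto them\<close>

lemma lext_bilinear_tensor:
  assumes "\<And>y. lin (\<lambda>x. F x y)" "\<And>x. lin (F x)" "finite A" "finite C" "x \<in> free_space A" "y \<in> free_space C"
  shows "lext (A \<times> C) (\<lambda>(i, j). F (basis_vec i) (basis_vec j)) (tensor x y) = F x y"
  unfolding lext_tensor using lin_expand[OF assms(2) assms(4,6), symmetric] lin_expand[OF assms(1,3,5), symmetric] by simp

locale twist_subhopf = group_twist G J K
  for G (structure) and J K :: "'a \<times> 'a \<Rightarrow> 'k::field_char_0" +
  fixes B :: "('a \<Rightarrow> 'k) set"
  assumes B_sub: "B \<subseteq> free_space (carrier G)"
    and B_subspace: "fun_space.subspace B"
    and B_one: "basis_vec \<one> \<in> B"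
    and B_mult: "\<And>x y. x \<in> B \<Longrightarrow> y \<in> B \<Longrightarrow> x \<star> y \<in> B"
    and B_tw: "\<And>x. x \<in> B \<Longrightarrow> tw x \<in> tensor_space B B"
    and B_S: "\<And>x. x \<in> B \<Longrightarrow> S x \<in> B"
begin

lemma B_free: "x \<in> B \<Longrightarrow> x \<in> free_space (carrier G)"
  using B_sub by blast

definition prj :: "('a \<Rightarrow> 'k) \<Rightarrow> ('a \<Rightarrow> 'k)" where
  "prj = (SOME p. lin p \<and> (\<forall>x. p x \<in> B) \<and> (\<forall>x\<in>B. p x = x))"

lemma prj: "lin prj" "prj x \<in> B" "x \<in> B \<Longrightarrow> prj x = x"
proof -
  have "\<exists>p. lin p \<and> (\<forall>x. p x \<in> B) \<and> (\<forall>x\<in>B. p x = x)"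
    using exists_projection[OF B_subspace] by metis
  then have "lin prj \<and> (\<forall>x. prj x \<in> B) \<and> (\<forall>x\<in>B. prj x = x)"
    unfolding prj_def by (rule someI_ex)
  then show "lin prj" "prj x \<in> B" "x \<in> B \<Longrightarrow> prj x = x" by blast+
qed

lemma prj_free [simp]: "prj x \<in> free_space (carrier G)"
  using prj(2) B_free by blast

lemma tensor_space_expand:
  assumes "X \<in> tensor_space B B"
  shows "X = lext PP (\<lambda>(i, j). tensor (prj (basis_vec i)) (prj (basis_vec j))) X"
  using assms unfolding tensor_space_def
proof (induction rule: fun_space.span_induct_alt)
  case base
  show ?case using lin_zero[OF lin_lext] by (rule sym)
next
  case (step c x y)
  then obtain u v where uv: "x = tensor u v" "u \<in> B" "v \<in> B" by blast
  have "lext PP (\<lambda>(i, j). tensor (prj (basis_vec i)) (prj (basis_vec j))) x = x"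
    unfolding uv(1)
    by (subst lext_bilinear_tensor[where F = "\<lambda>x y. tensor (prj x) (prj y)"])
      (auto intro: lin_comp[OF lin_tensor_left prj(1)] lin_comp[OF lin_tensor_right prj(1)]
        simp: fin prj(3) uv(2,3) B_free)
  then show ?case using step(2) by (simp only: lin_add[OF lin_lext] lin_scale[OF lin_lext])
qed

text \<open>Elements of B \<otimes> B are fixed by prj \<otimes> prj. So both legs of the coproduct
  of an element of \<open>B\<close> may be assumed to lie in \<open>B\<close>, although they are
  expanded in group elements.\<close>

lemma lext_prj:
  assumes "\<And>y. lin (\<lambda>x. F x y)" "\<And>x. lin (F x)" "X \<in> tensor_space B B"
  shows "lext PP (\<lambda>(i, j). F (basis_vec i) (basis_vec j)) X =
    lext PP (\<lambda>(i, j). F (prj (basis_vec i)) (prj (basis_vec j))) X"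
proof -
  have "lext PP (\<lambda>(i, j). F (basis_vec i) (basis_vec j)) X =
    lext PP (\<lambda>(i, j). F (basis_vec i) (basis_vec j)) (lext PP (\<lambda>(i, j). tensor (prj (basis_vec i)) (prj (basis_vec j))) X)"
    using tensor_space_expand[OF assms(3)] by simp
  also have "\<dots> = lext PP (\<lambda>(i, j). F (prj (basis_vec i)) (prj (basis_vec j))) X"
    unfolding lin_lext_comm[OF lin_lext]
    by (intro lext_Sigma_cong) (simp add: lext_bilinear_tensor[where F = F] assms fin)
  finally show ?thesis .
qed

lemma lext_in_B:
  assumes "\<And>y. lin (\<lambda>x. F x y)" "\<And>x. lin (F x)" "X \<in> tensor_space B B"
    and "\<And>x y. x \<in> B \<Longrightarrow> y \<in> B \<Longrightarrow> F x y \<in> B"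
  shows "lext PP (\<lambda>(i, j). F (basis_vec i) (basis_vec j)) X \<in> B"
  unfolding lext_prj[OF assms(1-3)] by (rule lext_closed[OF B_subspace]) (auto intro: assms(4) prj(2))

text \<open>Injectivity suffices in finite dimension. The point is that \<open>B\<close> is then
  stable under \<open>R\<close> as well.\<close>

lemma S_image_B: "S ` B = B"
proof (rule inj_endo_surj[OF fin B_sub B_subspace lin_S])
  show "inj_on S B" by (rule inj_on_inverseI[of _ R]) (simp add: R_S B_free)
qed (use B_S in blast)

lemma R_B: "x \<in> B \<Longrightarrow> R x \<in> B"
  using S_image_B R_S B_free by (metis (no_types, lifting) image_iff)

section \<open>Integrals of a Hopf subalgebra\<close>

definition trace_form :: "('a \<Rightarrow> 'k) \<Rightarrow> 'a \<Rightarrow> ('a \<Rightarrow> 'k) \<Rightarrow> ('a \<Rightarrow> 'k)" where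
  "trace_form x k y = lext PP (\<lambda>(i, j). fscale (basis_vec j k) (R (R (basis_vec i \<star> x)))) (tw y)"

text \<open>
  The existence proof for integrals of Larson and Sweedler in closed form: with dual bases
  \<open>e\<^sub>i\<close>, \<open>e\<^sup>i\<close> of \<open>B\<close>, this is \<open>\<Sum>\<^sub>i e\<^sup>i(S\<^sup>-\<^sup>2(e\<^sub>i\<^sub>1 x)) e\<^sub>i\<^sub>2\<close>.
  The trace over \<open>B\<close> is taken over all of \<open>kG\<close> after composing with a projection onto \<open>B\<close>.
\<close>

definition integral :: "('a \<Rightarrow> 'k) \<Rightarrow> ('a \<Rightarrow> 'k)" where
  "integral x k = (\<Sum>g\<in>carrier G. trace_form x k (prj (basis_vec g)) g)"

lemma lin_fscale_coord: "lin (\<lambda>y. fscale (y k) z)"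
  by (rule linI) (auto simp: fun_eq_iff algebra_simps)

lemma lin_fscale_right: "lin (fscale c)"
  by (rule linI) (auto simp: fun_eq_iff algebra_simps)

lemma lin_trace_form: "lin (trace_form x k)"
  unfolding trace_form_def[abs_def] by (intro lin_comp[OF lin_lext lin_tw])

lemma trace_form_closed [simp]: "trace_form x k y \<in> free_space (carrier G)"
  unfolding trace_form_def
  by (rule lext_closed[OF subspace_free_space]) (auto intro: fun_space.subspace_scale[OF subspace_free_space])

lemma trace_form_B:
  assumes "x \<in> B" "y \<in> B"
  shows "trace_form x k y \<in> B"
  unfolding trace_form_def
  by (rule lext_in_B[where F = "\<lambda>a b. fscale (b k) (R (R (a \<star> x)))"])
    (auto intro!: lin_fscale_coord lin_comp[OF lin_fscale_right] lin_comp[OF lin_R] lin_gmult_left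
      fun_space.subspace_scale[OF B_subspace] R_B B_mult assms B_tw)

lemma integral_B:
  assumes "x \<in> B"
  shows "integral x \<in> B"
proof -
  have "integral x = (\<Sum>g\<in>carrier G. lext PP (\<lambda>(i, j). fscale (R (R (basis_vec i \<star> x)) g) (basis_vec j)) (tw (prj (basis_vec g))))"
    by (rule ext) (simp add: integral_def trace_form_def sum_fun_apply lext_apply split_def mult_ac)
  also have "\<dots> \<in> B"
  proof (intro fun_space.subspace_sum[OF B_subspace])
    fix g
    show "lext PP (\<lambda>(i, j). fscale (R (R (basis_vec i \<star> x)) g) (basis_vec j)) (tw (prj (basis_vec g))) \<in> B"
      by (rule lext_in_B[where F = "\<lambda>a b. fscale (R (R (a \<star> x)) g) b"])
        (auto intro!: lin_fscale_right lin_comp[OF lin_fscale_coord] lin_comp[OF lin_R] lin_gmult_left B_tw prj(2)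
          fun_space.subspace_scale[OF B_subspace])
  qed
  finally show ?thesis .
qed

text \<open>Let T be \<open>trace_form x k\<close>. By \<open>shift_mult\<close>, multiplying the
  second leg by b inserts S(b1) into the argument of S^-2, and S^-2(S(b1) z) = S^-1(b1) S^-2(z). So
  the coefficient at k of b times the integral is the trace of y mapped to S^-1(b1) T(b2 y). By
  cyclicity b2 S^-1(b1) comes together, and it equals \<epsilon>(b).\<close>

lemma integral_left:
  assumes "x \<in> B" "b \<in> B"
  shows "b \<star> integral x = fscale (aug G b) (integral x)"
proof
  fix k
  show "(b \<star> integral x) k = fscale (aug G b) (integral x) k"
  proof (cases "k \<in> carrier G")
    case False
    have "(b \<star> integral x) k = 0" "integral x k = 0"
      using False gmult_closed[of b "integral x"] B_free[OF integral_B[OF assms(1)]] by (auto simp: free_space_def)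
    then show ?thesis by simp
  next
    case k: True
    note b = B_free[OF assms(2)] and x = B_free[OF assms(1)]
    have step: "(\<Sum>h\<in>carrier G. b (k \<otimes> inv h) * trace_form x h y g) =
        (\<Sum>(i, j)\<in>PP. tw b (i, j) * (R (prj (basis_vec i)) \<star> trace_form x k (prj (basis_vec j) \<star> y)) g)" for y g
    proof -
      have "(\<Sum>h\<in>carrier G. b (k \<otimes> inv h) * trace_form x h y g) =
        (\<Sum>p\<in>PP. tw y p * (\<Sum>h\<in>carrier G. b (k \<otimes> inv h) * basis_vec (snd p) h) * R (R (basis_vec (fst p) \<star> x)) g)"
        unfolding trace_form_def lext_apply
        by (simp add: sum_distrib_left sum_distrib_right split_def sum.swap[of _ "carrier G" PP] mult_ac)
      also have "\<dots> = lext PP (\<lambda>(i, j). fscale ((b \<star> basis_vec j) k) (R (R (basis_vec i \<star> x)))) (tw y) g"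
        unfolding lext_apply by (intro sum.cong refl) (auto simp: gmult_apply[OF k] mult_ac)
      also have "lext PP (\<lambda>(i, j). fscale ((b \<star> basis_vec j) k) (R (R (basis_vec i \<star> x)))) (tw y) =
        lext PP (\<lambda>(i, j). lext PP (\<lambda>(m, l). fscale (basis_vec l k) (R (R (S (basis_vec i) \<star> basis_vec m \<star> x)))) (tw (basis_vec j \<star> y))) (tw b)"
        by (rule shift_mult[where F = "\<lambda>z w. fscale (w k) (R (R (z \<star> x)))"])
          (intro lin_fscale_coord lin_comp[OF lin_fscale_right] lin_comp[OF lin_R] lin_gmult_left b)+
      also have "\<dots> = lext PP (\<lambda>(i, j). R (basis_vec i) \<star> trace_form x k (basis_vec j \<star> y)) (tw b)"
        unfolding trace_form_def gmult_lext_right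
        by (intro lext_Sigma_cong) (simp add: gmult_assoc R_gmult R_S split_def lin_scale[OF lin_gmult_right])
      also have "\<dots> = lext PP (\<lambda>(i, j). R (prj (basis_vec i)) \<star> trace_form x k (prj (basis_vec j) \<star> y)) (tw b)"
        by (rule lext_prj[where F = "\<lambda>c d. R c \<star> trace_form x k (d \<star> y)"])
          (auto intro!: lin_comp[OF lin_gmult_left lin_R] lin_comp[OF lin_gmult_right] lin_comp[OF lin_trace_form] lin_gmult_left B_tw assms)
      finally show ?thesis by (simp add: lext_apply split_def)
    qed
    \<comment> \<open>Both operators are cut down to \<open>B\<close> by \<open>prj\<close>. As they
      preserve \<open>B\<close>, the inner projections disappear from the composites and
      \<open>trace_comm\<close> applies.\<close>
    have cyc: "(\<Sum>g\<in>carrier G. (R c \<star> trace_form x k (d \<star> prj (basis_vec g))) g) =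
      (\<Sum>g\<in>carrier G. (d \<star> R c \<star> trace_form x k (prj (basis_vec g))) g)" if "c \<in> B" "d \<in> B" for c d
    proof -
      define \<Phi> where "\<Phi> z = R c \<star> trace_form x k (prj z)" for z
      define \<Psi> where "\<Psi> z = d \<star> prj z" for z
      have lins: "lin \<Phi>" "lin \<Psi>"
        unfolding \<Phi>_def[abs_def] \<Psi>_def[abs_def]
        by (intro lin_comp[OF lin_gmult_right] lin_comp[OF lin_trace_form] prj(1))+
      have "\<Phi> (\<Psi> z) = R c \<star> trace_form x k (d \<star> prj z)" for z
        unfolding \<Phi>_def \<Psi>_def using that by (simp add: prj(3) B_mult prj(2))
      moreover have "\<Psi> (\<Phi> z) = d \<star> R c \<star> trace_form x k (prj z)" for z
        unfolding \<Phi>_def \<Psi>_def using that assms by (simp add: prj(3) B_mult prj(2) R_B trace_form_B gmult_assoc)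
      ultimately show ?thesis
        using trace_comm[OF lins] by (simp add: \<Phi>_def[of "\<Psi> _"] \<Psi>_def[of "\<Phi> _"]) (simp add: \<Phi>_def \<Psi>_def)
    qed
    have "(b \<star> integral x) k = (\<Sum>h\<in>carrier G. \<Sum>g\<in>carrier G. b (k \<otimes> inv h) * trace_form x h (prj (basis_vec g)) g)"
      by (simp add: gmult_apply[OF k] integral_def sum_distrib_left)
    also have "\<dots> = (\<Sum>g\<in>carrier G. \<Sum>(i, j)\<in>PP. tw b (i, j) * (R (prj (basis_vec i)) \<star> trace_form x k (prj (basis_vec j) \<star> prj (basis_vec g))) g)"
      by (subst sum.swap) (simp only: step)
    also have "\<dots> = (\<Sum>(i, j)\<in>PP. tw b (i, j) * (\<Sum>g\<in>carrier G. (R (prj (basis_vec i)) \<star> trace_form x k (prj (basis_vec j) \<star> prj (basis_vec g))) g))"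
      by (subst sum.swap) (simp add: sum_distrib_left split_def)
    also have "\<dots> = (\<Sum>(i, j)\<in>PP. tw b (i, j) * (\<Sum>g\<in>carrier G. (prj (basis_vec j) \<star> R (prj (basis_vec i)) \<star> trace_form x k (prj (basis_vec g))) g))"
      by (simp only: cyc prj(2))
    also have "\<dots> = (\<Sum>g\<in>carrier G. (lext PP (\<lambda>(i, j). prj (basis_vec j) \<star> R (prj (basis_vec i))) (tw b) \<star> trace_form x k (prj (basis_vec g))) g)"
      by (simp add: gmult_lext_left lext_apply sum_distrib_left split_def sum.swap[of _ "carrier G" PP])
    also have "lext PP (\<lambda>(i, j). prj (basis_vec j) \<star> R (prj (basis_vec i))) (tw b) = fscale (aug G b) (basis_vec \<one>)"
      unfolding antipode_R[OF b, symmetric]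
      by (rule lext_prj[symmetric, where F = "\<lambda>c d. d \<star> R c"])
        (auto intro!: lin_comp[OF lin_gmult_right lin_R] lin_gmult_left B_tw assms)
    also have "(\<Sum>g\<in>carrier G. (fscale (aug G b) (basis_vec \<one>) \<star> trace_form x k (prj (basis_vec g))) g) = fscale (aug G b) (integral x) k"
      by (simp add: lin_scale[OF lin_gmult_left] gmult_one_left integral_def sum_distrib_left)
    finally show ?thesis .
  qed
qed

text \<open>Guarantees that some integral is nonzero. The sum is the trace over \<open>B\<close> of
  y mapped to S^-2(y1 S(y2)) = \<epsilon>(y) 1, an operator of rank one with trace \<epsilon>(1) =
  1.\<close>

lemma sum_integral: "(\<Sum>k\<in>carrier G. integral (S (prj (basis_vec k))) k) = 1"
proof -
  have inner: "(\<Sum>k\<in>carrier G. trace_form (S (prj (basis_vec k))) k y g) = aug G y * basis_vec \<one> g" if y: "y \<in> B" for y g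
  proof -
    have "(\<Sum>k\<in>carrier G. trace_form (S (prj (basis_vec k))) k y g) =
      (\<Sum>p\<in>PP. tw y p * (\<Sum>k\<in>carrier G. basis_vec (snd p) k * R (R (basis_vec (fst p) \<star> S (prj (basis_vec k)))) g))"
      unfolding trace_form_def lext_apply
      by (simp add: sum_distrib_left split_def sum.swap[of _ "carrier G" PP] mult_ac)
    also have "\<dots> = lext PP (\<lambda>(i, j). R (R (basis_vec i \<star> S (prj (basis_vec j))))) (tw y) g"
      unfolding lext_apply by (intro sum.cong refl)
        (auto simp: basis_vec_apply fin if_distrib[of "\<lambda>x. x * _"] cong: if_cong)
    \<comment> \<open>Passing to projected legs and back again removes the inner
      \<open>prj\<close>.\<close>
    also have "lext PP (\<lambda>(i, j). R (R (basis_vec i \<star> S (prj (basis_vec j))))) (tw y) =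
      lext PP (\<lambda>(i, j). R (R (prj (basis_vec i) \<star> S (prj (prj (basis_vec j)))))) (tw y)"
      by (rule lext_prj[where F = "\<lambda>c d. R (R (c \<star> S (prj d)))"])
        (auto intro!: lin_comp[OF lin_R] lin_gmult_left lin_comp[OF lin_gmult_right] lin_comp[OF lin_S] prj(1) B_tw y)
    also have "\<dots> = lext PP (\<lambda>(i, j). R (R (prj (basis_vec i) \<star> S (prj (basis_vec j))))) (tw y)"
      by (simp only: prj(3)[OF prj(2)])
    also have "\<dots> = lext PP (\<lambda>(i, j). R (R (basis_vec i \<star> S (basis_vec j)))) (tw y)"
      by (rule lext_prj[symmetric, where F = "\<lambda>c d. R (R (c \<star> S d))"])
        (auto intro!: lin_comp[OF lin_R] lin_gmult_left lin_comp[OF lin_gmult_right lin_S] B_tw y)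
    also have "\<dots> = R (R (lext PP (\<lambda>(i, j). basis_vec i \<star> S (basis_vec j)) (tw y)))"
      unfolding lin_lext_comm[OF lin_R] by (simp add: split_def)
    also have "\<dots> = fscale (aug G y) (basis_vec \<one>)"
      by (simp add: antipode_right B_free[OF y] lin_scale[OF lin_R] R_one)
    finally show ?thesis by simp
  qed
  have "(\<Sum>k\<in>carrier G. integral (S (prj (basis_vec k))) k) =
    (\<Sum>g\<in>carrier G. \<Sum>k\<in>carrier G. trace_form (S (prj (basis_vec k))) k (prj (basis_vec g)) g)"
    unfolding integral_def by (rule sum.swap)
  also have "\<dots> = (\<Sum>g\<in>carrier G. aug G (prj (basis_vec g)) * basis_vec \<one> g)"
    by (simp only: inner prj(2))
  also have "\<dots> = aug G (prj (basis_vec \<one>))"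
    using fin by (simp add: basis_vec_apply if_distrib[of "\<lambda>x. _ * x"] cong: if_cong)
  finally show ?thesis by (simp add: prj(3) B_one)
qed

lemma exists_left_integral:
  obtains \<Lambda> where "\<Lambda> \<in> B" "\<Lambda> \<noteq> 0" "\<And>b. b \<in> B \<Longrightarrow> b \<star> \<Lambda> = fscale (aug G b) \<Lambda>"
proof -
  have "\<exists>k\<in>carrier G. integral (S (prj (basis_vec k))) k \<noteq> 0"
    using sum_integral by (metis (no_types, lifting) sum.neutral zero_neq_one)
  then obtain k where "integral (S (prj (basis_vec k))) k \<noteq> 0" by blast
  then have "integral (S (prj (basis_vec k))) \<noteq> 0" by (metis zero_fun_apply)
  moreover have "S (prj (basis_vec k)) \<in> B" by (intro B_S prj(2))
  ultimately show ?thesis using integral_left integral_B that by blast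
qed

text \<open>The antipode is antimultiplicative, preserves the augmentation and maps \<open>B\<close>
  onto itself, so it turns left integrals into right ones.\<close>

lemma exists_right_integral:
  obtains \<Lambda> where "\<Lambda> \<in> B" "\<Lambda> \<noteq> 0" "\<And>b. b \<in> B \<Longrightarrow> \<Lambda> \<star> b = fscale (aug G b) \<Lambda>"
proof -
  obtain \<Lambda> where L: "\<Lambda> \<in> B" "\<Lambda> \<noteq> 0" "\<And>b. b \<in> B \<Longrightarrow> b \<star> \<Lambda> = fscale (aug G b) \<Lambda>"
    using exists_left_integral by blast
  show ?thesis
  proof (rule that[of "S \<Lambda>"])
    show "S \<Lambda> \<in> B" by (rule B_S[OF L(1)])
    show "S \<Lambda> \<noteq> 0" using R_S[OF B_free[OF L(1)]] L(2) lin_zero[OF lin_R] by metis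
    fix b assume "b \<in> B"
    then obtain b' where b': "b' \<in> B" "b = S b'" using S_image_B by blast
    have "S \<Lambda> \<star> b = S (b' \<star> \<Lambda>)" by (simp add: S_gmult b')
    then show "S \<Lambda> \<star> b = fscale (aug G b) (S \<Lambda>)"
      by (simp add: L(3) b' lin_scale[OF lin_S] aug_S)
  qed
qed

section \<open>The ideal generated by the augmentation ideal of B\<close>

definition ideal :: "('a \<Rightarrow> 'k) set" where
  "ideal = fun_space.span {u \<star> b \<star> v | u b v. u \<in> free_space (carrier G) \<and> b \<in> B \<and> aug G b = 0 \<and> v \<in> free_space (carrier G)}"

lemma ideal_induct [consumes 1, case_names zero add scale gen]:
  assumes "x \<in> ideal" "P 0" "\<And>x y. P x \<Longrightarrow> P y \<Longrightarrow> P (x + y)" "\<And>c x. P x \<Longrightarrow> P (fscale c x)"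
    and "\<And>u b v. u \<in> free_space (carrier G) \<Longrightarrow> b \<in> B \<Longrightarrow> aug G b = 0 \<Longrightarrow> v \<in> free_space (carrier G) \<Longrightarrow> P (u \<star> b \<star> v)"
  shows "P x"
  using assms(1) unfolding ideal_def
proof (induction rule: fun_space.span_induct_alt)
  case base
  show ?case by (rule assms(2))
next
  case (step c x y)
  then have "P x" using assms(5) by blast
  from assms(3)[OF assms(4)[OF this] step(2)] show ?case .
qed

lemma ideal_gen:
  "u \<in> free_space (carrier G) \<Longrightarrow> b \<in> B \<Longrightarrow> aug G b = 0 \<Longrightarrow> v \<in> free_space (carrier G) \<Longrightarrow> u \<star> b \<star> v \<in> ideal"
  unfolding ideal_def by (rule fun_space.span_base) blast

lemma ideal_subspace: "fun_space.subspace ideal"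
  unfolding ideal_def by (rule fun_space.subspace_span)

lemma ideal_closed: "ideal \<subseteq> free_space (carrier G)"
  unfolding ideal_def by (rule fun_space.span_minimal) (auto simp: subspace_free_space)

lemma ideal_left: "x \<in> ideal \<Longrightarrow> y \<star> x \<in> ideal"
proof (induction rule: ideal_induct)
  case (gen u b v)
  then show ?case using ideal_gen[of "y \<star> u" b v] by (simp add: gmult_assoc)
qed (use ideal_subspace in \<open>simp_all only: lin_zero[OF lin_gmult_right] lin_add[OF lin_gmult_right]
    lin_scale[OF lin_gmult_right] fun_space.subspace_0 fun_space.subspace_add fun_space.subspace_scale\<close>)

lemma ideal_right: "x \<in> ideal \<Longrightarrow> x \<star> y \<in> ideal"
proof (induction rule: ideal_induct)
  case (gen u b v)
  then show ?case using ideal_gen[of u b "v \<star> y"] by (simp add: gmult_assoc)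
qed (use ideal_subspace in \<open>simp_all only: lin_zero[OF lin_gmult_left] lin_add[OF lin_gmult_left]
    lin_scale[OF lin_gmult_left] fun_space.subspace_0 fun_space.subspace_add fun_space.subspace_scale\<close>)

lemma ideal_aug: "x \<in> ideal \<Longrightarrow> aug G x = 0"
proof (induction rule: ideal_induct)
  case zero
  then show ?case by (simp add: aug_def)
next
  case (add x y)
  then show ?case unfolding aug_add by simp
next
  case (scale c x)
  then show ?case unfolding aug_scale by simp
qed (simp add: aug_gmult)

lemma B_ideal: "b \<in> B \<Longrightarrow> aug G b = 0 \<Longrightarrow> b \<in> ideal"
  using ideal_gen[of "basis_vec \<one>" b "basis_vec \<one>"] by (simp add: gmult_one_left gmult_one_right B_free)

definition pair2 :: "('a \<Rightarrow> 'k) \<Rightarrow> ('a \<Rightarrow> 'k) \<Rightarrow> ('a \<times> 'a \<Rightarrow> 'k) \<Rightarrow> 'k" where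
  "pair2 f f' X = (\<Sum>(i, j)\<in>PP. f i * f' j * X (i, j))"

lemma pair2_lext: "pair2 f f' (lext A h x) = (\<Sum>a\<in>A. x a * pair2 f f' (h a))"
  unfolding pair2_def lext_apply split_def by (simp add: sum_distrib_left sum.swap[of _ PP A] mult_ac)

lemma pair2_tensor: "pair2 f f' (tensor x y) = pair f x * pair f' y"
  unfolding pair2_def by (simp add: sum_product sum.cartesian_product mult_ac)

lemma pair2_add: "pair2 f f' (X + Y) = pair2 f f' X + pair2 f f' Y"
  unfolding pair2_def by (simp add: split_def sum.distrib distrib_left)

lemma pair2_cop:
  assumes "x \<in> free_space (carrier G)"
  shows "pair2 f f' (cop x) = pair (\<lambda>g. f g * f' g) x"
proof -
  have b: "pair2 f f' (basis_vec (g, g)) = f g * f' g" if "g \<in> carrier G" for g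
  proof -
    have "pair2 f f' (tensor (basis_vec g) (basis_vec g)) = f g * f' g"
      unfolding pair2_tensor using that fin
      by (simp add: basis_vec_apply if_distrib[of "\<lambda>x. _ * x"] cong: if_cong)
    then show ?thesis by simp
  qed
  show ?thesis unfolding cop_def push_def pair2_lext
    by (intro sum.cong refl) (simp add: b)
qed

text \<open>Let B^+ be the kernel of \<epsilon> on \<open>B\<close>. For b in B^+ the twisted
  coproduct lies in B^+ \<otimes> B + 1 \<otimes> B^+. The untwisted coproduct of u b v arises from
  it by multiplying with K, J and the coproducts of u and v, and a two-sided ideal absorbs
  these.\<close>

lemma ideal_coideal:
  assumes f: "\<And>x. x \<in> ideal \<Longrightarrow> pair f x = 0" and f': "\<And>x. x \<in> ideal \<Longrightarrow> pair f' x = 0" and x: "x \<in> ideal"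
  shows "pair (\<lambda>g. f g * f' g) x = 0"
  using x
proof (induction rule: ideal_induct)
  case (gen u b v)
  have b: "b \<in> free_space (carrier G)" using gen(2) by (rule B_free)
  have vanish: "pair2 f f' (U \<star>\<^bsub>G2\<^esub> tensor c d \<star>\<^bsub>G2\<^esub> V) = 0" if "c \<in> ideal \<or> d \<in> ideal" for U V c d
  proof -
    have "U \<star>\<^bsub>G2\<^esub> tensor c d \<star>\<^bsub>G2\<^esub> V = (lext PP basis_vec U \<star>\<^bsub>G2\<^esub> tensor c d) \<star>\<^bsub>G2\<^esub> lext PP basis_vec V"
      unfolding gmult_def[of G2] carrier_G2 lin_lext_comm[OF lin_lext]
      by (simp add: G2.fin cong: lext_cong)
    also have "\<dots> = lext PP (\<lambda>q. lext PP (\<lambda>p. basis_vec p \<star>\<^bsub>G2\<^esub> tensor c d \<star>\<^bsub>G2\<^esub> basis_vec q) U) V"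
      unfolding gmult_lext_left gmult_lext_right by (rule refl)
    finally have e: "pair2 f f' (U \<star>\<^bsub>G2\<^esub> tensor c d \<star>\<^bsub>G2\<^esub> V) =
       (\<Sum>q\<in>PP. V q * (\<Sum>p\<in>PP. U p * pair2 f f' (basis_vec p \<star>\<^bsub>G2\<^esub> tensor c d \<star>\<^bsub>G2\<^esub> basis_vec q)))"
      by (simp only: pair2_lext)
    have "pair2 f f' (basis_vec p \<star>\<^bsub>G2\<^esub> tensor c d \<star>\<^bsub>G2\<^esub> basis_vec q) = 0" for p q
    proof -
      obtain p1 p2 q1 q2 where pq: "p = (p1, p2)" "q = (q1, q2)" by (metis surj_pair)
      have "basis_vec p \<star>\<^bsub>G2\<^esub> tensor c d \<star>\<^bsub>G2\<^esub> basis_vec q =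
        tensor (basis_vec p1 \<star> c \<star> basis_vec q1) (basis_vec p2 \<star> d \<star> basis_vec q2)"
        unfolding pq tensor_basis[symmetric] gmult_tensor[OF fin_group_G fin_group_G] ..
      then show ?thesis
        using that f[OF ideal_right[OF ideal_left]] f'[OF ideal_right[OF ideal_left]] by (auto simp only: pair2_tensor mult_zero_left mult_zero_right)
    qed
    then show ?thesis unfolding e by simp
  qed
  \<comment> \<open>Split x \<otimes> y as (x - \<epsilon>(x) 1) \<otimes> y + \<epsilon>(x) 1
    \<otimes> y; by the counit law the second terms add up to 1 \<otimes> b.\<close>
  define e where "e i = aug G (prj (basis_vec i))" for i
  have "tw b = lext PP (\<lambda>(i, j). tensor (prj (basis_vec i) - fscale (e i) (basis_vec \<one>)) (prj (basis_vec j))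
      + fscale (e i) (tensor (basis_vec \<one>) (prj (basis_vec j)))) (tw b)"
    by (subst tensor_space_expand[OF B_tw[OF gen(2)]], intro lext_Sigma_cong)
      (auto simp: fun_eq_iff algebra_simps)
  also have "\<dots> = lext PP (\<lambda>(i, j). tensor (prj (basis_vec i) - fscale (e i) (basis_vec \<one>)) (prj (basis_vec j))) (tw b)
     + lext PP (\<lambda>(i, j). fscale (e i) (tensor (basis_vec \<one>) (prj (basis_vec j)))) (tw b)"
    by (auto simp: fun_eq_iff lext_apply split_def distrib_left sum.distrib)
  also have "lext PP (\<lambda>(i, j). fscale (e i) (tensor (basis_vec \<one>) (prj (basis_vec j)))) (tw b) =
     tensor (basis_vec \<one>) (lext PP (\<lambda>(i, j). fscale (aug G (basis_vec i)) (basis_vec j)) (tw b))"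
  proof -
    have "lext PP (\<lambda>(i, j). fscale (aug G (basis_vec i)) (basis_vec j)) (tw b) =
      lext PP (\<lambda>(i, j). fscale (aug G (prj (basis_vec i))) (prj (basis_vec j))) (tw b)"
      by (rule lext_prj[where F = "\<lambda>x y. fscale (aug G x) y"])
        (auto intro: lin_fscale_aug lin_fscale_right B_tw gen(2))
    then show ?thesis
      by (simp only: lin_lext_comm[OF lin_tensor_right])
        (intro lext_Sigma_cong, simp add: e_def lin_scale[OF lin_tensor_right])
  qed
  also have "lext PP (\<lambda>(i, j). fscale (aug G (basis_vec i)) (basis_vec j)) (tw b) = b"
  proof -
    have "lext PP (\<lambda>(i, j). fscale (aug G (basis_vec i)) (basis_vec j)) (tw b) = lext PP (\<lambda>(i, j). basis_vec j) (tw b)"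
      by (intro lext_Sigma_cong) simp
    then show ?thesis using lext_counit_left[OF lin_id b] by simp
  qed
  finally have twb: "tw b = lext PP (\<lambda>(i, j). tensor (prj (basis_vec i) - fscale (e i) (basis_vec \<one>)) (prj (basis_vec j))) (tw b)
     + tensor (basis_vec \<one>) b" .
  have van2: "pair2 f f' (U \<star>\<^bsub>G2\<^esub> tw b \<star>\<^bsub>G2\<^esub> V) = 0" for U V
  proof -
    have "pair2 f f' (U \<star>\<^bsub>G2\<^esub> tw b \<star>\<^bsub>G2\<^esub> V) =
      (\<Sum>p\<in>PP. tw b p * pair2 f f' (U \<star>\<^bsub>G2\<^esub> tensor (prj (basis_vec (fst p)) - fscale (e (fst p)) (basis_vec \<one>)) (prj (basis_vec (snd p))) \<star>\<^bsub>G2\<^esub> V))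
      + pair2 f f' (U \<star>\<^bsub>G2\<^esub> tensor (basis_vec \<one>) b \<star>\<^bsub>G2\<^esub> V)"
      by (subst twb, unfold lin_add[OF lin_gmult_right] lin_add[OF lin_gmult_left] gmult_lext_right gmult_lext_left pair2_add pair2_lext)
        (simp add: split_def)
    moreover have "prj (basis_vec i) - fscale (e i) (basis_vec \<one>) \<in> ideal" for i
    proof (rule B_ideal)
      show "prj (basis_vec i) - fscale (e i) (basis_vec \<one>) \<in> B"
        by (intro fun_space.subspace_diff[OF B_subspace] fun_space.subspace_scale[OF B_subspace] prj(2) B_one)
      show "aug G (prj (basis_vec i) - fscale (e i) (basis_vec \<one>)) = 0"
        using aug_add[of "prj (basis_vec i) - fscale (e i) (basis_vec \<one>)" "fscale (e i) (basis_vec \<one>)"]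
        by (simp add: e_def aug_scale)
    qed
    moreover have "b \<in> ideal" by (rule B_ideal[OF gen(2,3)])
    ultimately show ?thesis by (simp add: vanish)
  qed
  have "cop b = K \<star>\<^bsub>G2\<^esub> tw b \<star>\<^bsub>G2\<^esub> J"
  proof -
    have "K \<star>\<^bsub>G2\<^esub> tw b \<star>\<^bsub>G2\<^esub> J = (K \<star>\<^bsub>G2\<^esub> J) \<star>\<^bsub>G2\<^esub> cop b \<star>\<^bsub>G2\<^esub> (K \<star>\<^bsub>G2\<^esub> J)"
      by (simp only: tw_def G2.gmult_assoc)
    moreover have "cop b \<in> free_space PP" unfolding cop_def by (rule push_closed) auto
    ultimately show ?thesis by (simp add: KJ G2.gmult_one_left G2.gmult_one_right)
  qed
  then have "cop (u \<star> b \<star> v) = (cop u \<star>\<^bsub>G2\<^esub> K) \<star>\<^bsub>G2\<^esub> tw b \<star>\<^bsub>G2\<^esub> (J \<star>\<^bsub>G2\<^esub> cop v)"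
    by (simp only: cop_gmult G2.gmult_assoc)
  then show ?case using van2 pair2_cop[of "u \<star> b \<star> v" f f'] by simp
next
  case (add x y)
  then show ?case by (simp add: distrib_left sum.distrib)
next
  case (scale c x)
  have "pair (\<lambda>g. f g * f' g) (fscale c x) = c * pair (\<lambda>g. f g * f' g) x"
    by (simp add: sum_distrib_left mult_ac)
  then show ?case using scale by simp
qed simp

end

section \<open>Normality and the subgroup N\<close>

context twist_subhopf
begin

text \<open>From u b = (u1 b S(u2)) u3 and normality, kG B^+ lies in B^+ kG, where B^+ is the kernel
  of \<epsilon> on \<open>B\<close>. A right integral satisfies \<Lambda> B^+ = 0, so it annihilates
  the whole ideal.\<close>

lemma left_normal_ideal:
  assumes ad: "\<And>h y. h \<in> free_space (carrier G) \<Longrightarrow> y \<in> B \<Longrightarrow> left_adjoint H h y \<in> B"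
    and L: "\<And>b. b \<in> B \<Longrightarrow> \<Lambda> \<star> b = fscale (aug G b) \<Lambda>"
    and x: "x \<in> ideal"
  shows "\<Lambda> \<star> x = 0"
  using x
proof (induction rule: ideal_induct)
  case (gen u b v)
  note b = B_free[OF gen(2)]
  have "u \<star> b = lext PP (\<lambda>(i, j). basis_vec i \<star> b) (tw u)"
    by (rule lext_counit_right[OF lin_gmult_left gen(1), symmetric])
  also have "\<dots> = lext PP (\<lambda>(i, j). lext PP (\<lambda>(k, l). basis_vec i \<star> b \<star> (S (basis_vec k) \<star> basis_vec l)) (tw (basis_vec j))) (tw u)"
  proof (rule lext_Sigma_cong)
    fix i j assume j: "j \<in> carrier G"
    have "lext PP (\<lambda>(k, l). basis_vec i \<star> b \<star> (S (basis_vec k) \<star> basis_vec l)) (tw (basis_vec j)) =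
      basis_vec i \<star> b \<star> lext PP (\<lambda>(k, l). S (basis_vec k) \<star> basis_vec l) (tw (basis_vec j))"
      unfolding gmult_lext_right by (simp add: split_def)
    then show "(case (i, j) of (i, j) \<Rightarrow> basis_vec i \<star> b) =
      (case (i, j) of (i, j) \<Rightarrow> lext PP (\<lambda>(k, l). basis_vec i \<star> b \<star> (S (basis_vec k) \<star> basis_vec l)) (tw (basis_vec j)))"
      using j by (simp add: antipode_left gmult_one_right)
  qed
  also have "\<dots> = lext PP (\<lambda>(i, j). lext PP (\<lambda>(k, l). basis_vec k \<star> b \<star> (S (basis_vec l) \<star> basis_vec j)) (tw (basis_vec i))) (tw u)"
    by (rule coassoc_lext)
  also have "\<dots> = lext PP (\<lambda>(i, j). left_adjoint H (basis_vec i) b \<star> basis_vec j) (tw u)"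
    unfolding left_adjoint_H gmult_lext_left by (simp add: split_def gmult_assoc)
  finally have ub: "u \<star> b = lext PP (\<lambda>(i, j). left_adjoint H (basis_vec i) b \<star> basis_vec j) (tw u)" .
  have "aug G (left_adjoint H h b) = 0" for h
    unfolding left_adjoint_H aug_lext by (intro sum.neutral) (auto simp: aug_gmult gen(3))
  then have "\<Lambda> \<star> left_adjoint H (basis_vec i) b = 0" if "i \<in> carrier G" for i
    using L[OF ad[of "basis_vec i" b]] that gen(2) by simp
  then have "\<Lambda> \<star> (u \<star> b) = lext PP (\<lambda>(i, j). 0) (tw u)"
    unfolding ub gmult_lext_right
    by (intro lext_Sigma_cong) (simp add: gmult_assoc[symmetric] lin_zero[OF lin_gmult_left])
  then have "\<Lambda> \<star> (u \<star> b) = 0" by (simp add: lext_def)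
  then show ?case by (simp add: gmult_assoc[symmetric] lin_zero[OF lin_gmult_left])
qed (simp_all only: lin_zero[OF lin_gmult_right] lin_add[OF lin_gmult_right] lin_scale[OF lin_gmult_right] add_0 fscale_zero)

text \<open>Mirror image: b v = v1 (S(v2) b v3) puts B^+ kG into kG B^+, which a left integral
  annihilates from the right.\<close>

lemma right_normal_ideal:
  assumes ad: "\<And>h y. h \<in> free_space (carrier G) \<Longrightarrow> y \<in> B \<Longrightarrow> right_adjoint H h y \<in> B"
    and L: "\<And>b. b \<in> B \<Longrightarrow> b \<star> \<Lambda> = fscale (aug G b) \<Lambda>"
    and x: "x \<in> ideal"
  shows "x \<star> \<Lambda> = 0"
  using x
proof (induction rule: ideal_induct)
  case (gen u b v)
  note b = B_free[OF gen(2)]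
  have "b \<star> v = lext PP (\<lambda>(i, j). b \<star> basis_vec j) (tw v)"
    by (rule lext_counit_left[OF lin_gmult_right gen(4), symmetric])
  also have "\<dots> = lext PP (\<lambda>(i, j). lext PP (\<lambda>(k, l). basis_vec k \<star> S (basis_vec l) \<star> (b \<star> basis_vec j)) (tw (basis_vec i))) (tw v)"
  proof (rule lext_Sigma_cong)
    fix i j assume i: "i \<in> carrier G"
    have "lext PP (\<lambda>(k, l). basis_vec k \<star> S (basis_vec l) \<star> (b \<star> basis_vec j)) (tw (basis_vec i)) =
      lext PP (\<lambda>(k, l). basis_vec k \<star> S (basis_vec l)) (tw (basis_vec i)) \<star> (b \<star> basis_vec j)"
      unfolding gmult_lext_left by (simp add: split_def)
    then show "(case (i, j) of (i, j) \<Rightarrow> b \<star> basis_vec j) =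
      (case (i, j) of (i, j) \<Rightarrow> lext PP (\<lambda>(k, l). basis_vec k \<star> S (basis_vec l) \<star> (b \<star> basis_vec j)) (tw (basis_vec i)))"
      using i by (simp add: antipode_right gmult_one_left)
  qed
  also have "\<dots> = lext PP (\<lambda>(i, j). lext PP (\<lambda>(k, l). basis_vec i \<star> S (basis_vec k) \<star> (b \<star> basis_vec l)) (tw (basis_vec j))) (tw v)"
    by (rule coassoc_lext[symmetric])
  also have "\<dots> = lext PP (\<lambda>(i, j). basis_vec i \<star> right_adjoint H (basis_vec j) b) (tw v)"
    unfolding right_adjoint_H gmult_lext_right by (simp add: split_def gmult_assoc)
  finally have bv: "b \<star> v = lext PP (\<lambda>(i, j). basis_vec i \<star> right_adjoint H (basis_vec j) b) (tw v)" .
  have "aug G (right_adjoint H h b) = 0" for h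
    unfolding right_adjoint_H aug_lext by (intro sum.neutral) (auto simp: aug_gmult gen(3))
  then have "right_adjoint H (basis_vec i) b \<star> \<Lambda> = 0" if "i \<in> carrier G" for i
    using L[OF ad[of "basis_vec i" b]] that gen(2) by simp
  then have "b \<star> v \<star> \<Lambda> = lext PP (\<lambda>(i, j). 0) (tw v)"
    unfolding bv gmult_lext_left
    by (intro lext_Sigma_cong) (simp add: gmult_assoc lin_zero[OF lin_gmult_right])
  then have "b \<star> v \<star> \<Lambda> = 0" by (simp add: lext_def)
  then show ?case by (simp add: gmult_assoc lin_zero[OF lin_gmult_right])
qed (simp_all only: lin_zero[OF lin_gmult_left] lin_add[OF lin_gmult_left] lin_scale[OF lin_gmult_left] add_0 fscale_zero)

text \<open>The ideal contains 1 - avg N and is annihilated by \<open>avg N\<close>, so each b in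
  \<open>B\<close> acts on \<open>avg N\<close> by \<epsilon>(b). An integral \<Lambda> of
  \<open>B\<close> annihilates the ideal, whence \<Lambda> = \<Lambda> avg N = \<epsilon>(\<Lambda>)
  avg N. As \<Lambda> is not 0, this puts \<open>avg N\<close> into \<open>B\<close>.\<close>

theorem normal_subgroup_of_normal_hopf_subalgebra:
  assumes "(\<forall>h\<in>free_space (carrier G). \<forall>y\<in>B. left_adjoint H h y \<in> B) \<or>
      (\<forall>h\<in>free_space (carrier G). \<forall>y\<in>B. right_adjoint H h y \<in> B)"
  obtains N where "N \<lhd> G" "avg N \<in> B" "\<And>b. b \<in> B \<Longrightarrow> b \<star> avg N = fscale (aug G b) (avg N)"
proof -
  define N where "N = {g \<in> carrier G. basis_vec g - basis_vec \<one> \<in> ideal}"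
  have N: "N \<lhd> G" "basis_vec \<one> - avg N \<in> ideal" "\<And>x. x \<in> ideal \<Longrightarrow> x \<star> avg N = 0"
    unfolding N_def
    by (rule ideal_subgroup[OF ideal_subspace ideal_closed ideal_left ideal_right ideal_aug ideal_coideal]; assumption)+
  have av: "avg N \<in> free_space (carrier G)" by (rule avg_closed[OF normal_imp_subgroup[OF N(1)]])
  have triv: "b \<star> avg N = fscale (aug G b) (avg N)" if b: "b \<in> B" for b
  proof -
    have "aug G (b - fscale (aug G b) (basis_vec \<one>)) = 0"
      using aug_add[of "b - fscale (aug G b) (basis_vec \<one>)" "fscale (aug G b) (basis_vec \<one>)"] by (simp add: aug_scale)
    moreover have "b - fscale (aug G b) (basis_vec \<one>) \<in> B"
      by (intro fun_space.subspace_diff[OF B_subspace] fun_space.subspace_scale[OF B_subspace] b B_one)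
    ultimately have "(b - fscale (aug G b) (basis_vec \<one>)) \<star> avg N = 0"
      using N(3)[OF B_ideal] by blast
    then show ?thesis
      by (simp add: lin_diff[OF lin_gmult_left] lin_scale[OF lin_gmult_left] gmult_one_left[OF av])
  qed
  have "\<exists>\<Lambda>\<in>B. \<Lambda> \<noteq> 0 \<and> \<Lambda> \<star> avg N = \<Lambda>"
    using assms
  proof
    assume "\<forall>h\<in>free_space (carrier G). \<forall>y\<in>B. left_adjoint H h y \<in> B"
    obtain \<Lambda> where L: "\<Lambda> \<in> B" "\<Lambda> \<noteq> 0" "\<And>b. b \<in> B \<Longrightarrow> \<Lambda> \<star> b = fscale (aug G b) \<Lambda>"
      using exists_right_integral by blast
    have "\<Lambda> \<star> (basis_vec \<one> - avg N) = 0"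
      by (rule left_normal_ideal[OF _ L(3) N(2)]) (use \<open>\<forall>h\<in>_. \<forall>y\<in>B. left_adjoint H h y \<in> B\<close> in blast)+
    then show ?thesis using L by (auto simp: lin_diff[OF lin_gmult_right] gmult_one_right B_free)
  next
    assume "\<forall>h\<in>free_space (carrier G). \<forall>y\<in>B. right_adjoint H h y \<in> B"
    obtain \<Lambda> where L: "\<Lambda> \<in> B" "\<Lambda> \<noteq> 0" "\<And>b. b \<in> B \<Longrightarrow> b \<star> \<Lambda> = fscale (aug G b) \<Lambda>"
      using exists_left_integral by blast
    have "(basis_vec \<one> - avg N) \<star> \<Lambda> = 0"
      by (rule right_normal_ideal[OF _ L(3) N(2)]) (use \<open>\<forall>h\<in>_. \<forall>y\<in>B. right_adjoint H h y \<in> B\<close> in blast)+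
    then have "avg N \<star> \<Lambda> = \<Lambda>"
      using L by (simp add: lin_diff[OF lin_gmult_left] gmult_one_left B_free)
    then show ?thesis using L avg_central[OF N(1) B_free[OF L(1)]] by auto
  qed
  then obtain \<Lambda> where L: "\<Lambda> \<in> B" "\<Lambda> \<noteq> 0" "fscale (aug G \<Lambda>) (avg N) = \<Lambda>"
    using triv by metis
  then have "aug G \<Lambda> \<noteq> 0" by auto
  moreover have "fscale (1 / aug G \<Lambda>) (fscale (aug G \<Lambda>) (avg N)) \<in> B"
    unfolding L(3) by (rule fun_space.subspace_scale[OF B_subspace L(1)])
  ultimately have "avg N \<in> B" by simp
  then show ?thesis using that N(1) triv by blast
qed

lemma trivial_if_avg_one:
  assumes "\<And>b. b \<in> B \<Longrightarrow> b \<star> avg {\<one>} = fscale (aug G b) (avg {\<one>})"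
  shows "B = range (\<lambda>c. fscale c (basis_vec \<one>))"
proof -
  have a: "avg {\<one>} = (basis_vec \<one> :: 'a \<Rightarrow> 'k)" by (simp add: avg_def)
  have "b = fscale (aug G b) (basis_vec \<one>)" if "b \<in> B" for b
    using assms[OF that] unfolding a by (simp add: gmult_one_right B_free that)
  then show ?thesis
    using fun_space.subspace_scale[OF B_subspace B_one] by blast
qed

lemma S0_inverse: "S0 Q' \<star> S0 Q = basis_vec \<one>" "S0 Q \<star> S0 Q' = basis_vec \<one>"
  by (simp_all add: S0_gmult[symmetric] QQ' Q'Q)

text \<open>
  Every \<open>y\<close> is of the form \<open>(id \<otimes> f) \<Delta>\<^sub>J(u)\<close> for \<open>u = \<Sum> g\<close>; the functional \<open>f(g) = c(g\<^sup>-\<^sup>1)\<close> below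
  solves this equation.
\<close>

lemma total_if_avg_carrier:
  assumes "avg (carrier G) \<in> B"
  shows "B = free_space (carrier G)"
proof (intro equalityI B_sub subsetI)
  fix y :: "'a \<Rightarrow> 'k" assume y: "y \<in> free_space (carrier G)"
  \<comment> \<open>Chosen so that \<open>Q \<star> S0 c \<star> S0 Q'\<close>, the value of the
    slice computed below, equals \<open>y\<close>.\<close>
  define c where "c = S0 (Q' \<star> y \<star> S0 Q)"
  define u :: "'a \<Rightarrow> 'k" where "u = (\<Sum>g\<in>carrier G. basis_vec g)"
  define F where "F x z = fscale (\<Sum>k\<in>carrier G. z k * c (inv k)) x" for x z :: "'a \<Rightarrow> 'k"
  have "fscale (of_nat (card (carrier G))) (avg (carrier G)) = u"
    using card_subgroup_nz[OF subgroup_self, where ?'k = 'k] by (simp add: avg_def u_def)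
  then have u: "u \<in> B" using fun_space.subspace_scale[OF B_subspace assms] by metis
  have "lext PP (\<lambda>(i, j). F (basis_vec i) (basis_vec j)) (tw u) \<in> B"
  proof (rule lext_in_B[OF _ _ B_tw[OF u]])
    show "lin (\<lambda>x. F x z)" for z unfolding F_def by (rule lin_fscale_right)
    show "lin (F x)" for x
      unfolding F_def[abs_def] by (rule linI) (auto simp: fun_eq_iff algebra_simps sum.distrib sum_distrib_left)
    show "F x z \<in> B" if "x \<in> B" for x z
      unfolding F_def by (rule fun_space.subspace_scale[OF B_subspace that])
  qed
  also have "lext PP (\<lambda>(i, j). F (basis_vec i) (basis_vec j)) (tw u) = Q \<star> S0 c \<star> S0 Q'"
  proof -
    have F: "F (basis_vec i) (basis_vec j) = fscale (c (inv j)) (basis_vec i)" if "j \<in> carrier G" for i j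
      using that fin by (simp add: F_def basis_vec_apply if_distrib[of "\<lambda>x. x * _"] cong: if_cong)
    have S0Q': "S0 Q' = push PP (\<lambda>p. inv (snd p) \<otimes> fst p) K"
      unfolding S0_def Q'_def by (subst push_push) (auto simp: fin inv_mult_group intro!: push_cong)
    have S0c: "S0 c = (\<Sum>k\<in>carrier G. fscale (c k) (basis_vec (inv k)))"
      by (simp add: S0_def push_def lext_def)
    \<comment> \<open>Summing over k = (b g e)^-1 instead of g separates the legs of J from those of
      K.\<close>
    have inner: "(\<Sum>g\<in>carrier G. fscale (c (inv (b \<otimes> g \<otimes> e))) (basis_vec (a \<otimes> g \<otimes> d))) =
        basis_vec (a \<otimes> inv b) \<star> S0 c \<star> (basis_vec (inv e \<otimes> d) :: 'a \<Rightarrow> 'k)"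
      if "a \<in> carrier G" "b \<in> carrier G" "d \<in> carrier G" "e \<in> carrier G" for a b d e
    proof -
      have "(\<Sum>g\<in>carrier G. fscale (c (inv (b \<otimes> g \<otimes> e))) (basis_vec (a \<otimes> g \<otimes> d))) =
        (\<Sum>k\<in>carrier G. fscale (c k) (basis_vec (a \<otimes> (inv b \<otimes> inv k \<otimes> inv e) \<otimes> d) :: 'a \<Rightarrow> 'k))"
        by (rule sum.reindex_bij_witness[of _ "\<lambda>k. inv b \<otimes> inv k \<otimes> inv e" "\<lambda>g. inv (b \<otimes> g \<otimes> e)"])
          (use that in \<open>simp_all add: inv_mult_group m_assoc inv_mult_cancel\<close>)
      also have "\<dots> = basis_vec (a \<otimes> inv b) \<star> S0 c \<star> basis_vec (inv e \<otimes> d)"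
        unfolding S0c lin_sum[OF lin_gmult_right] lin_sum[OF lin_gmult_left] lin_scale[OF lin_gmult_right] lin_scale[OF lin_gmult_left]
        using that by (intro sum.cong refl) (simp add: m_assoc)
      finally show ?thesis .
    qed
    have "lext PP (\<lambda>(i, j). F (basis_vec i) (basis_vec j)) (tw u) =
      (\<Sum>g\<in>carrier G. lext PP (\<lambda>(i, j). fscale (c (inv j)) (basis_vec i)) (tw (basis_vec g)))"
      unfolding u_def lin_sum[OF lin_tw] lin_sum[OF lin_lext]
      by (intro sum.cong refl lext_Sigma_cong) (simp add: F)
    also have "\<dots> = (\<Sum>g\<in>carrier G. lext PP (\<lambda>(a, b). lext PP (\<lambda>(d, e). fscale (c (inv (b \<otimes> g \<otimes> e))) (basis_vec (a \<otimes> g \<otimes> d))) K) J)"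
      by (intro sum.cong refl) (simp add: tw_lext)
    also have "\<dots> = lext PP (\<lambda>(a, b). lext PP (\<lambda>(d, e). \<Sum>g\<in>carrier G. fscale (c (inv (b \<otimes> g \<otimes> e))) (basis_vec (a \<otimes> g \<otimes> d))) K) J"
      unfolding lext_def by (simp add: split_def fscale_sum sum.swap[of _ "carrier G" PP])
    also have "\<dots> = lext PP (\<lambda>(a, b). lext PP (\<lambda>(d, e). basis_vec (a \<otimes> inv b) \<star> S0 c \<star> basis_vec (inv e \<otimes> d)) K) J"
      by (intro lext_Sigma_cong) (auto simp: inner intro!: lext_Sigma_cong)
    also have "\<dots> = Q \<star> S0 c \<star> S0 Q'"
      unfolding S0Q' Q_def push_def gmult_lext_left gmult_lext_right
      by (subst lext_swap) (simp add: split_def)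
    finally show ?thesis .
  qed
  also have "\<dots> = y"
  proof -
    have "Q \<star> S0 c \<star> S0 Q' = (Q \<star> Q') \<star> y \<star> (S0 Q \<star> S0 Q')"
      unfolding c_def by (simp add: S0_S0 gmult_assoc)
    then show ?thesis by (simp add: QQ' S0_inverse gmult_one_left gmult_one_right y)
  qed
  finally show "y \<in> B" .
qed

text \<open>With k[G/N] realized as kG avg N, this is (id \<otimes> \<pi>)(tw b) = b \<otimes> 1 for
  the projection \<pi>. The second leg may be taken in \<open>B\<close>, where multiplication by
  \<open>avg N\<close> is \<epsilon>.\<close>

lemma tw_coinvariant:
  assumes N: "N \<lhd> G" "\<And>b. b \<in> B \<Longrightarrow> b \<star> avg N = fscale (aug G b) (avg N)" and b: "b \<in> B"
  shows "tw b \<star>\<^bsub>G2\<^esub> tensor (basis_vec \<one>) (avg N) = tensor b (avg N)"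
proof -
  have "tw b \<star>\<^bsub>G2\<^esub> tensor (basis_vec \<one>) (avg N) = lext PP basis_vec (tw b) \<star>\<^bsub>G2\<^esub> tensor (basis_vec \<one>) (avg N)"
    by (simp add: lext_basis_vec_id G2.fin)
  also have "\<dots> = lext PP (\<lambda>(i, j). tensor (basis_vec i) (basis_vec j \<star> avg N)) (tw b)"
    unfolding gmult_lext_left
  proof (rule lext_Sigma_cong)
    fix i j assume "i \<in> carrier G" "j \<in> carrier G"
    then show "basis_vec (i, j) \<star>\<^bsub>G2\<^esub> tensor (basis_vec \<one>) (avg N) =
      (case (i, j) of (i, j) \<Rightarrow> tensor (basis_vec i) (basis_vec j \<star> avg N))"
      unfolding tensor_basis[symmetric] gmult_tensor[OF fin_group_G fin_group_G] by simp
  qed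
  also have "\<dots> = lext PP (\<lambda>(i, j). tensor (prj (basis_vec i)) (prj (basis_vec j) \<star> avg N)) (tw b)"
    by (rule lext_prj[where F = "\<lambda>x y. tensor x (y \<star> avg N)"])
      (auto intro!: lin_tensor_left lin_comp[OF lin_tensor_right] lin_gmult_left B_tw b)
  also have "\<dots> = lext PP (\<lambda>(i, j). tensor (prj (basis_vec i)) (fscale (aug G (prj (basis_vec j))) (avg N))) (tw b)"
    by (simp only: N(2)[OF prj(2)])
  also have "\<dots> = lext PP (\<lambda>(i, j). tensor (basis_vec i) (fscale (aug G (basis_vec j)) (avg N))) (tw b)"
    by (rule lext_prj[symmetric, where F = "\<lambda>x y. tensor x (fscale (aug G y) (avg N))"])
      (auto intro!: lin_tensor_left lin_comp[OF lin_tensor_right] lin_fscale_aug B_tw b)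
  also have "\<dots> = lext PP (\<lambda>(i, j). tensor (basis_vec i) (avg N)) (tw b)"
    by (intro lext_Sigma_cong) simp
  also have "\<dots> = tensor b (avg N)"
    by (rule lext_counit_right[OF lin_tensor_left B_free[OF b]])
  finally show ?thesis .
qed

end

lemma fscale_sum_left: "fscale (\<Sum>a\<in>A. c a) x = (\<Sum>a\<in>A. fscale (c a) x)"
  by (simp add: fun_eq_iff sum_fun_apply sum_distrib_right)

section \<open>Cocycles on abelian subgroups\<close>

locale abelian_cocycle = fin_group G for G (structure) +
  fixes A :: "'a set" and \<alpha> :: "'a \<Rightarrow> 'a \<Rightarrow> 'k::field_char_0"
  assumes A: "subgroup A G"
    and comm: "s \<in> A \<Longrightarrow> t \<in> A \<Longrightarrow> s \<otimes> t = t \<otimes> s"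
    and cocycle_nz: "s \<in> A \<Longrightarrow> t \<in> A \<Longrightarrow> \<alpha> s t \<noteq> 0"
    and cocycle: "s \<in> A \<Longrightarrow> t \<in> A \<Longrightarrow> u \<in> A \<Longrightarrow> \<alpha> s t * \<alpha> (s \<otimes> t) u = \<alpha> t u * \<alpha> s (t \<otimes> u)"
begin

lemma A_carrier: "s \<in> A \<Longrightarrow> s \<in> carrier G"
  using subgroup.subset[OF A] by blast

lemma A_closed [simp]: "s \<in> A \<Longrightarrow> t \<in> A \<Longrightarrow> s \<otimes> t \<in> A" "s \<in> A \<Longrightarrow> inv s \<in> A" "\<one> \<in> A"
  using A by (auto simp: subgroup.m_closed subgroup.m_inv_closed subgroup.one_closed)

lemma finA: "finite A" by (rule finite_subgroup[OF A])

text \<open>The commutator pairing of the twisted group algebra: x_s x_t is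
  \<open>bichar s t\<close> times x_t x_s. It is an alternating bicharacter because \<open>A\<close>
  is abelian.\<close>

definition bichar :: "'a \<Rightarrow> 'a \<Rightarrow> 'k" where "bichar s t = \<alpha> s t / \<alpha> t s"

lemma bichar_nz: "s \<in> A \<Longrightarrow> t \<in> A \<Longrightarrow> bichar s t \<noteq> 0"
  by (simp add: bichar_def cocycle_nz)

lemma bichar_swap: "bichar t s = inverse (bichar s t)"
  by (simp add: bichar_def)

lemma bichar_self: "s \<in> A \<Longrightarrow> bichar s s = 1"
  by (simp add: bichar_def cocycle_nz)

text \<open>Combines the cocycle identity at (s, t, u), (u, s, t) and (s, u, t), with arguments
  reordered by commutativity.\<close>

lemma bichar_mult_left:
  assumes "s \<in> A" "t \<in> A" "u \<in> A"
  shows "bichar (s \<otimes> t) u = bichar s u * bichar t u"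
proof -
  note nz = cocycle_nz[OF assms(1,2)] cocycle_nz[OF assms(1,3)] cocycle_nz[OF assms(2,3)]
    cocycle_nz[OF assms(3,1)] cocycle_nz[OF assms(3,2)] cocycle_nz[of u "s \<otimes> t"] cocycle_nz[of "s \<otimes> t" u]
  have c1: "\<alpha> s t * \<alpha> (s \<otimes> t) u = \<alpha> t u * \<alpha> s (t \<otimes> u)" by (rule cocycle) (use assms in auto)
  have c2: "\<alpha> u s * \<alpha> (s \<otimes> u) t = \<alpha> s t * \<alpha> u (s \<otimes> t)"
    using cocycle[of u s t] comm[of u s] assms by simp
  have c3: "\<alpha> s u * \<alpha> (s \<otimes> u) t = \<alpha> u t * \<alpha> s (t \<otimes> u)"
    using cocycle[of s u t] comm[of u t] assms by simp
  have "\<alpha> s t * (\<alpha> (s \<otimes> t) u * \<alpha> u s * \<alpha> u t) = (\<alpha> s t * \<alpha> (s \<otimes> t) u) * \<alpha> u s * \<alpha> u t" by simp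
  also have "\<dots> = \<alpha> t u * \<alpha> u s * (\<alpha> u t * \<alpha> s (t \<otimes> u))" unfolding c1 by simp
  also have "\<dots> = \<alpha> s u * \<alpha> t u * (\<alpha> u s * \<alpha> (s \<otimes> u) t)" unfolding c3[symmetric] by simp
  also have "\<dots> = \<alpha> s t * (\<alpha> s u * \<alpha> t u * \<alpha> u (s \<otimes> t))" unfolding c2 by simp
  finally have "\<alpha> (s \<otimes> t) u * \<alpha> u s * \<alpha> u t = \<alpha> s u * \<alpha> t u * \<alpha> u (s \<otimes> t)" using nz by simp
  then show ?thesis using nz assms by (simp add: bichar_def frac_eq_eq mult_ac)
qed

lemma bichar_mult_right:
  assumes "s \<in> A" "t \<in> A" "u \<in> A"
  shows "bichar u (s \<otimes> t) = bichar u s * bichar u t"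
  using bichar_mult_left[OF assms] bichar_swap[of u "s \<otimes> t"] bichar_swap[of u s] bichar_swap[of u t] by simp

lemma bichar_one: "s \<in> A \<Longrightarrow> bichar \<one> s = 1" "s \<in> A \<Longrightarrow> bichar s \<one> = 1"
proof -
  show *: "bichar \<one> s = 1" if s: "s \<in> A" for s
    using bichar_mult_left[of \<one> \<one> s] bichar_nz[of \<one> s] s by simp
  show "s \<in> A \<Longrightarrow> bichar s \<one> = 1" using *[of s] bichar_swap[of s \<one>] by simp
qed

lemma bichar_inv: "s \<in> A \<Longrightarrow> t \<in> A \<Longrightarrow> bichar (inv s) t = inverse (bichar s t)"
  "s \<in> A \<Longrightarrow> t \<in> A \<Longrightarrow> bichar t (inv s) = inverse (bichar t s)"
proof -
  show *: "bichar (inv s) t = inverse (bichar s t)" if "s \<in> A" "t \<in> A" for s t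
    using bichar_mult_left[of s "inv s" t] that A_carrier inverse_unique[of "bichar s t" "bichar (inv s) t"]
    by (simp add: bichar_one)
  show "s \<in> A \<Longrightarrow> t \<in> A \<Longrightarrow> bichar t (inv s) = inverse (bichar t s)"
    using *[of s t] bichar_swap[of t "inv s"] bichar_swap[of t s] by simp
qed

lemma bij_A: "s \<in> A \<Longrightarrow> bij_betw (\<lambda>y. s \<otimes> y) A A"
  by (rule bij_betw_byWitness[where f' = "\<lambda>y. inv s \<otimes> y"]) (auto simp: A_carrier m_assoc[symmetric])

text \<open>The cocycle need not be normalized. This constancy takes the place of normalization and
  is the source of the scalars \<open>\<alpha> \<one> \<one>\<close>.\<close>

lemma cocycle_one: "s \<in> A \<Longrightarrow> \<alpha> s \<one> = \<alpha> \<one> \<one>"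
  using cocycle[of s \<one> \<one>] cocycle_nz[of s \<one>] by (simp add: A_carrier)

end

section \<open>Idempotents of kA and the diagonal twist\<close>

locale nondeg_cocycle = abelian_cocycle G A \<alpha> for G (structure) and A and \<alpha> :: "'a \<Rightarrow> 'a \<Rightarrow> 'k::field_char_0" +
  assumes nondeg: "s \<in> A \<Longrightarrow> (\<And>t. t \<in> A \<Longrightarrow> \<alpha> s t = \<alpha> t s) \<Longrightarrow> s = \<one>"
begin

text \<open>Orthogonality of characters; nondegeneracy provides an s at which the character of t is
  not 1.\<close>

lemma sum_bichar:
  assumes "t \<in> A" "t \<noteq> \<one>"
  shows "(\<Sum>s\<in>A. bichar s t) = 0"
proof -
  obtain s where s: "s \<in> A" "bichar s t \<noteq> 1"
    using nondeg[OF assms(1)] assms by (auto simp: bichar_def cocycle_nz) metis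
  have "(\<Sum>y\<in>A. bichar y t) = (\<Sum>y\<in>A. bichar (s \<otimes> y) t)"
    using sum.reindex_bij_betw[OF bij_A[OF s(1)], of "\<lambda>y. bichar y t"] by simp
  also have "\<dots> = bichar s t * (\<Sum>y\<in>A. bichar y t)"
    using s assms by (simp add: bichar_mult_left sum_distrib_left)
  finally show ?thesis using s(2) by simp
qed

lemma sum_bichar_delta:
  assumes "u \<in> A" "v \<in> A"
  shows "(\<Sum>y\<in>A. inverse (bichar y u) * bichar y v) = (if u = v then of_nat (card A) else 0)"
proof -
  have "(\<Sum>y\<in>A. inverse (bichar y u) * bichar y v) = (\<Sum>y\<in>A. bichar y (inv u \<otimes> v))"
    using assms by (intro sum.cong refl) (simp add: bichar_mult_right bichar_inv)
  also have "\<dots> = (if u = v then of_nat (card A) else 0)"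
  proof (cases "u = v")
    case True
    then show ?thesis using assms by (simp add: A_carrier bichar_one)
  next
    case False
    then have "inv u \<otimes> v \<noteq> \<one>" using assms by (metis A_carrier inv_closed inv_equality inv_inv)
    then show ?thesis using False assms by (simp add: sum_bichar)
  qed
  finally show ?thesis .
qed

text \<open>
  Nondegeneracy identifies \<open>A\<close> with its group of characters, \<open>t\<close> corresponding to \<open>bichar _ t\<close>;
  \<open>E t\<close> is the idempotent of that character, and \<open>dg c\<close> the element of \<open>kA\<close> whose value at it is \<open>c t\<close>.
\<close>

definition E :: "'a \<Rightarrow> ('a \<Rightarrow> 'k)" where
  "E t = fscale (1 / of_nat (card A)) (\<Sum>s\<in>A. fscale (inverse (bichar s t)) (basis_vec s))"

lemma card_A_nz: "(of_nat (card A) :: 'k) \<noteq> 0"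
  by (rule card_subgroup_nz[OF A])

lemma E_closed [simp]: "E t \<in> free_space (carrier G)"
  unfolding E_def
  by (intro fun_space.subspace_scale[OF subspace_free_space] fun_space.subspace_sum[OF subspace_free_space])
    (auto intro: A_carrier basis_vec_free_space)

lemma basis_E:
  assumes "s \<in> A" "t \<in> A"
  shows "basis_vec s \<star> E t = fscale (bichar s t) (E t)"
proof -
  have "(\<Sum>y\<in>A. fscale (inverse (bichar y t)) (basis_vec (s \<otimes> y))) =
     (\<Sum>y\<in>A. fscale (bichar s t) (fscale (inverse (bichar (s \<otimes> y) t)) (basis_vec (s \<otimes> y) :: 'a \<Rightarrow> 'k)))"
    using assms by (intro sum.cong refl) (simp add: bichar_mult_left bichar_nz)
  also have "\<dots> = fscale (bichar s t) (\<Sum>y\<in>A. fscale (inverse (bichar y t)) (basis_vec y))"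
    unfolding fscale_sum[symmetric]
    using sum.reindex_bij_betw[OF bij_A[OF assms(1)], of "\<lambda>y. fscale (inverse (bichar y t)) (basis_vec y :: 'a \<Rightarrow> 'k)"] by simp
  finally show ?thesis
    unfolding E_def lin_scale[OF lin_gmult_right] lin_sum[OF lin_gmult_right]
    using assms by (simp add: A_carrier mult.commute)
qed

lemma E_basis:
  assumes "s \<in> A" "t \<in> A"
  shows "E t \<star> basis_vec s = fscale (bichar s t) (E t)"
proof -
  have "E t \<star> basis_vec s = basis_vec s \<star> E t"
    unfolding E_def lin_scale[OF lin_gmult_right] lin_sum[OF lin_gmult_right] lin_scale[OF lin_gmult_left] lin_sum[OF lin_gmult_left]
    using assms by (intro arg_cong[of _ _ "fscale _"] sum.cong refl) (simp add: A_carrier comm)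
  then show ?thesis by (simp add: basis_E assms)
qed

lemma E_E:
  assumes "u \<in> A" "t \<in> A"
  shows "E u \<star> E t = (if u = t then E u else 0)"
proof -
  have "E u \<star> E t = fscale (1 / of_nat (card A)) (\<Sum>s\<in>A. fscale (inverse (bichar s u) * bichar s t) (E t))"
    unfolding E_def[of u] lin_scale[OF lin_gmult_left] lin_sum[OF lin_gmult_left]
    using assms by (simp add: basis_E)
  also have "\<dots> = fscale (1 / of_nat (card A) * (\<Sum>s\<in>A. inverse (bichar s u) * bichar s t)) (E t)"
    by (simp add: fscale_sum_left[symmetric])
  also have "\<dots> = (if u = t then E u else 0)"
    using card_A_nz by (simp add: sum_bichar_delta assms)
  finally show ?thesis .
qed

lemma sum_E: "(\<Sum>t\<in>A. E t) = basis_vec \<one>"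
proof -
  have *: "(\<Sum>t\<in>A. inverse (bichar s t)) = (if s = \<one> then of_nat (card A) else 0)" if "s \<in> A" for s
    using sum_bichar_delta[of \<one> s] that by (simp add: bichar_one bichar_swap[symmetric])
  have "(\<Sum>t\<in>A. E t) = fscale (1 / of_nat (card A)) (\<Sum>s\<in>A. fscale (\<Sum>t\<in>A. inverse (bichar s t)) (basis_vec s))"
    unfolding E_def fscale_sum[symmetric] by (subst sum.swap) (simp add: fscale_sum_left)
  also have "(\<Sum>s\<in>A. fscale (\<Sum>t\<in>A. inverse (bichar s t)) (basis_vec s)) = (\<Sum>s\<in>A. if s = \<one> then fscale (of_nat (card A)) (basis_vec \<one>) else 0 :: 'a \<Rightarrow> 'k)"
    by (intro sum.cong refl) (simp add: *)
  finally show ?thesis using finA card_A_nz by simp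
qed

definition dg :: "('a \<Rightarrow> 'k) \<Rightarrow> ('a \<Rightarrow> 'k)" where "dg = lext A E"
definition dg2 :: "('a \<times> 'a \<Rightarrow> 'k) \<Rightarrow> ('a \<times> 'a \<Rightarrow> 'k)" where
  "dg2 = lext (A \<times> A) (\<lambda>p. tensor (E (fst p)) (E (snd p)))"

lemma lext_orth:
  assumes "finite I" "\<And>p q. p \<in> I \<Longrightarrow> q \<in> I \<Longrightarrow> e p \<star>\<^bsub>M\<^esub> e q = (if p = q then e p else 0)"
  shows "lext I e c \<star>\<^bsub>M\<^esub> lext I e d = lext I e (\<lambda>p. c p * (d p :: 'k))"
proof -
  have "lext I e c \<star>\<^bsub>M\<^esub> lext I e d = (\<Sum>p\<in>I. fscale (c p) (e p \<star>\<^bsub>M\<^esub> lext I e d))"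
    unfolding lext_def[of I e c] lin_sum[OF lin_gmult_left] lin_scale[OF lin_gmult_left] ..
  also have "\<dots> = (\<Sum>p\<in>I. fscale (c p) (fscale (d p) (e p)))"
  proof (intro sum.cong refl arg_cong[of _ _ "fscale _"])
    fix p assume p: "p \<in> I"
    have "e p \<star>\<^bsub>M\<^esub> lext I e d = (\<Sum>q\<in>I. if q = p then fscale (d p) (e p) else 0)"
      unfolding lext_def lin_sum[OF lin_gmult_right] lin_scale[OF lin_gmult_right]
      by (intro sum.cong refl) (simp add: assms(2) p)
    then show "e p \<star>\<^bsub>M\<^esub> lext I e d = fscale (d p) (e p)" using p assms(1) by simp
  qed
  finally show ?thesis by (simp add: lext_def)
qed

lemma dg_mult: "dg c \<star> dg d = dg (\<lambda>s. c s * d s)"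
  unfolding dg_def by (rule lext_orth[OF finA]) (simp add: E_E)

lemma dg2_mult: "dg2 c \<star>\<^bsub>G2\<^esub> dg2 d = dg2 (\<lambda>p. c p * d p)"
  unfolding dg2_def
proof (rule lext_orth)
  fix p q assume "p \<in> A \<times> A" "q \<in> A \<times> A"
  then show "tensor (E (fst p)) (E (snd p)) \<star>\<^bsub>G2\<^esub> tensor (E (fst q)) (E (snd q)) =
    (if p = q then tensor (E (fst p)) (E (snd p)) else 0)"
    unfolding gmult_tensor[OF fin_group_G fin_group_G]
    by (auto simp: E_E prod_eq_iff lin_zero[OF lin_tensor_left] lin_zero[OF lin_tensor_right])
qed (use finA in simp)

lemma dg_cong: "(\<And>s. s \<in> A \<Longrightarrow> c s = d s) \<Longrightarrow> dg c = dg d"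
  unfolding dg_def lext_def by (intro sum.cong refl) simp

lemma dg2_cong: "(\<And>s t. s \<in> A \<Longrightarrow> t \<in> A \<Longrightarrow> c (s, t) = d (s, t)) \<Longrightarrow> dg2 c = dg2 d"
  unfolding dg2_def lext_def by (intro sum.cong refl) auto

lemma dg_one: "dg (\<lambda>_. 1) = basis_vec \<one>"
  by (simp add: dg_def lext_def sum_E)

lemma dg_closed [simp]: "dg c \<in> free_space (carrier G)"
  unfolding dg_def by (rule lext_closed[OF subspace_free_space]) simp

lemma tensor_dg: "tensor (dg c) (dg d) = dg2 (\<lambda>(s, t). c s * d t)"
  unfolding dg_def dg2_def lin_lext_comm[OF lin_tensor_left] lin_lext_comm[OF lin_tensor_right]
  by (subst lext_swap) (simp add: lext_def fscale_sum sum.cartesian_product split_def)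

lemma dg2_one: "dg2 (\<lambda>_. 1) = basis_vec (\<one>, \<one>)"
  using tensor_dg[of "\<lambda>_. 1" "\<lambda>_. 1"] by (simp add: dg_one split_def)

lemma basis_dg: "m \<in> A \<Longrightarrow> dg (bichar m) = basis_vec m"
proof -
  assume m: "m \<in> A"
  have "basis_vec m = basis_vec m \<star> (\<Sum>t\<in>A. E t)"
    unfolding sum_E using m by (simp add: A_carrier)
  also have "\<dots> = dg (bichar m)"
    unfolding lin_sum[OF lin_gmult_right] dg_def lext_def using m by (intro sum.cong refl) (simp add: basis_E)
  finally show ?thesis ..
qed

lemma E_dg: "t \<in> A \<Longrightarrow> E t = dg (basis_vec t)"
  using finA by (simp add: dg_def)

text \<open>The characters of s and t multiply to that of their product, so the coproduct of the
  idempotent of u acts on E s \<otimes> E t as 1 or 0 by orthogonality.\<close>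

lemma cop_E_tensor:
  assumes "u \<in> A" "s \<in> A" "t \<in> A"
  shows "cop (E u) \<star>\<^bsub>G2\<^esub> tensor (E s) (E t) = (if u = s \<otimes> t then tensor (E s) (E t) else 0)"
proof -
  have 1: "basis_vec (y, y) \<star>\<^bsub>G2\<^esub> tensor (E s) (E t) = fscale (bichar y (s \<otimes> t)) (tensor (E s) (E t))" if "y \<in> A" for y
    unfolding tensor_basis[symmetric] gmult_tensor[OF fin_group_G fin_group_G] using that assms
    by (simp add: basis_E bichar_mult_right lin_scale[OF lin_tensor_left] lin_scale[OF lin_tensor_right])
  have "cop (E u) \<star>\<^bsub>G2\<^esub> tensor (E s) (E t) =
      fscale (1 / of_nat (card A)) (\<Sum>y\<in>A. fscale (inverse (bichar y u) * bichar y (s \<otimes> t)) (tensor (E s) (E t)))"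
    unfolding E_def[of u] lin_scale[OF lin_cop] lin_sum[OF lin_cop] lin_scale[OF lin_gmult_left] lin_sum[OF lin_gmult_left]
    by (simp add: A_carrier 1)
  also have "\<dots> = fscale (1 / of_nat (card A) * (\<Sum>y\<in>A. inverse (bichar y u) * bichar y (s \<otimes> t))) (tensor (E s) (E t))"
    by (simp add: fscale_sum_left[symmetric])
  also have "\<dots> = (if u = s \<otimes> t then tensor (E s) (E t) else 0)"
    using card_A_nz assms by (simp add: sum_bichar_delta)
  finally show ?thesis .
qed

text \<open>In the idempotent basis kA is the algebra of functions on \<open>A\<close>, with
  coproduct dual to the product of \<open>A\<close>. Identities for \<open>J0\<close> thus become
  identities between values of \<alpha>.\<close>

lemma cop_dg: "cop (dg c) = dg2 (\<lambda>(s, t). c (s \<otimes> t))"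
proof -
  have cl: "cop x \<in> free_space (carrier G \<times> carrier G)" for x :: "'a \<Rightarrow> 'k"
    unfolding cop_def by (rule push_closed) auto
  have 1: "cop (dg c) \<star>\<^bsub>G2\<^esub> tensor (E s) (E t) = fscale (c (s \<otimes> t)) (tensor (E s) (E t))" if "s \<in> A" "t \<in> A" for s t
  proof -
    have "cop (dg c) \<star>\<^bsub>G2\<^esub> tensor (E s) (E t) =
        (\<Sum>u\<in>A. fscale (c u) (cop (E u) \<star>\<^bsub>G2\<^esub> tensor (E s) (E t)))"
      unfolding dg_def lext_def lin_sum[OF lin_cop] lin_scale[OF lin_cop] lin_sum[OF lin_gmult_left] lin_scale[OF lin_gmult_left] ..
    also have "\<dots> = (\<Sum>u\<in>A. if u = s \<otimes> t then fscale (c (s \<otimes> t)) (tensor (E s) (E t)) else 0)"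
      by (intro sum.cong refl) (simp add: cop_E_tensor that)
    finally show ?thesis using that finA by simp
  qed
  have "cop (dg c) = cop (dg c) \<star>\<^bsub>G2\<^esub> dg2 (\<lambda>_. 1)"
    using fin_group.gmult_one_right[OF fin_group_G2, of "cop (dg c)"] cl by (simp add: dg2_one DirProd_def)
  also have "\<dots> = dg2 (\<lambda>(s, t). c (s \<otimes> t))"
    unfolding dg2_def gmult_lext_right unfolding lext_def by (intro sum.cong refl) (auto simp: 1)
  finally show ?thesis .
qed

definition J0 :: "'a \<times> 'a \<Rightarrow> 'k" where "J0 = dg2 (\<lambda>(s, t). \<alpha> s t)"
definition J0' :: "'a \<times> 'a \<Rightarrow> 'k" where "J0' = dg2 (\<lambda>(s, t). inverse (\<alpha> s t))"

lemma J0_inverse: "J0 \<star>\<^bsub>G2\<^esub> J0' = basis_vec (\<one>, \<one>)"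
  unfolding J0_def J0'_def dg2_mult dg2_one[symmetric] by (rule dg2_cong) (simp add: cocycle_nz)

end

section \<open>Normal Hopf subalgebras and the cocycle\<close>

text \<open>The data coming from a Galois object: J is gauge equivalent, through \<open>v\<close>,
  to the diagonal twist \<open>J0\<close>. Conjugation by \<open>v\<close> carries
  \<open>tw0\<close> to \<open>tw\<close> (\<open>tw_tw0\<close>), so that calculations can be made
  with \<open>J0\<close>.\<close>

locale gauged_twist = twist_subhopf G J K B + nondeg_cocycle G A \<alpha>
  for G (structure) and J K :: "'a \<times> 'a \<Rightarrow> 'k::field_char_0" and B A and \<alpha> :: "'a \<Rightarrow> 'a \<Rightarrow> 'k" +
  fixes v w :: "'a \<Rightarrow> 'k"
  assumes v_closed: "v \<in> free_space (carrier G)" and w_closed: "w \<in> free_space (carrier G)"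
    and vw: "v \<star> w = basis_vec \<one>" and wv: "w \<star> v = basis_vec \<one>"
    and gauge: "J \<star>\<^bsub>G2\<^esub> cop v = tensor v v \<star>\<^bsub>G2\<^esub> J0"
begin

lemma tensor_mult: "tensor a b \<star>\<^bsub>G2\<^esub> tensor c d = tensor (a \<star> c) (b \<star> (d :: 'a \<Rightarrow> 'k))"
  by (rule gmult_tensor[OF fin_group_G fin_group_G])

lemma cop_closed [simp]: "cop (x :: 'a \<Rightarrow> 'k) \<in> free_space PP"
  unfolding cop_def by (rule push_closed) auto

lemma tensor_vw: "tensor v v \<star>\<^bsub>G2\<^esub> tensor w w = one2" "tensor w w \<star>\<^bsub>G2\<^esub> tensor v v = one2"
  by (simp_all add: tensor_mult vw wv)

lemma cop_vw: "cop v \<star>\<^bsub>G2\<^esub> cop w = one2"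
  by (simp add: cop_gmult[symmetric] vw)

lemma J_eq: "J = tensor v v \<star>\<^bsub>G2\<^esub> J0 \<star>\<^bsub>G2\<^esub> cop w"
proof -
  have "J = J \<star>\<^bsub>G2\<^esub> (cop v \<star>\<^bsub>G2\<^esub> cop w)"
    by (simp add: cop_vw G2.gmult_one_right J_closed)
  then show ?thesis by (simp add: gauge G2.gmult_assoc[symmetric])
qed

lemma K_eq: "K = cop v \<star>\<^bsub>G2\<^esub> J0' \<star>\<^bsub>G2\<^esub> tensor w w"
proof -
  have "J \<star>\<^bsub>G2\<^esub> (cop v \<star>\<^bsub>G2\<^esub> J0' \<star>\<^bsub>G2\<^esub> tensor w w) = tensor v v \<star>\<^bsub>G2\<^esub> (J0 \<star>\<^bsub>G2\<^esub> J0') \<star>\<^bsub>G2\<^esub> tensor w w"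
    by (simp add: G2.gmult_assoc[symmetric] gauge)
  also have "\<dots> = one2"
    by (simp add: J0_inverse G2.gmult_one_right tensor_free_space v_closed tensor_vw)
  finally have "K \<star>\<^bsub>G2\<^esub> (J \<star>\<^bsub>G2\<^esub> (cop v \<star>\<^bsub>G2\<^esub> J0' \<star>\<^bsub>G2\<^esub> tensor w w)) = K"
    by (simp add: G2.gmult_one_right K_closed)
  then show ?thesis
    by (simp add: G2.gmult_assoc[symmetric, of K J] KJ G2.gmult_one_left)
qed

definition tw0 :: "('a \<Rightarrow> 'k) \<Rightarrow> ('a \<times> 'a \<Rightarrow> 'k)" where
  "tw0 x = J0 \<star>\<^bsub>G2\<^esub> cop x \<star>\<^bsub>G2\<^esub> J0'"

lemma tw_tw0: "tw x = tensor v v \<star>\<^bsub>G2\<^esub> tw0 (w \<star> x \<star> v) \<star>\<^bsub>G2\<^esub> tensor w w"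
  unfolding tw_def tw0_def cop_gmult by (subst J_eq, subst K_eq) (simp add: G2.gmult_assoc)

text \<open>Moves a conjugation by tensors from the element into the functional that slices
  it.\<close>

lemma lext_conj:
  fixes X :: "'a \<times> 'a \<Rightarrow> 'k"
  assumes "\<And>y. lin (\<lambda>x. F x y)" "\<And>x. lin (F x)" "X \<in> free_space PP"
  shows "lext PP (\<lambda>(i, j). F (basis_vec i) (basis_vec j)) (tensor a b \<star>\<^bsub>G2\<^esub> X \<star>\<^bsub>G2\<^esub> tensor c d) =
    lext PP (\<lambda>(i, j). F (a \<star> basis_vec i \<star> c) (b \<star> basis_vec j \<star> d)) X"
proof -
  have "tensor a b \<star>\<^bsub>G2\<^esub> X \<star>\<^bsub>G2\<^esub> tensor c d = tensor a b \<star>\<^bsub>G2\<^esub> lext PP basis_vec X \<star>\<^bsub>G2\<^esub> tensor c d"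
    by (simp add: lext_basis_vec_id G2.fin assms(3))
  also have "\<dots> = lext PP (\<lambda>(i, j). tensor (a \<star> basis_vec i \<star> c) (b \<star> basis_vec j \<star> d)) X"
    unfolding gmult_lext_right gmult_lext_left
    by (intro lext_Sigma_cong) (auto simp: tensor_mult tensor_basis[symmetric] simp del: tensor_basis)
  finally have e: "tensor a b \<star>\<^bsub>G2\<^esub> X \<star>\<^bsub>G2\<^esub> tensor c d = lext PP (\<lambda>(i, j). tensor (a \<star> basis_vec i \<star> c) (b \<star> basis_vec j \<star> d)) X" .
  show ?thesis
    unfolding e lin_lext_comm[OF lin_lext]
    by (intro lext_Sigma_cong) (simp add: lext_bilinear_tensor[where F = F] assms fin)
qed

lemma one_avg_central:
  fixes X :: "'a \<times> 'a \<Rightarrow> 'k"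
  assumes "N \<lhd> G" "X \<in> free_space PP"
  shows "X \<star>\<^bsub>G2\<^esub> tensor (basis_vec \<one>) (avg N) = tensor (basis_vec \<one>) (avg N) \<star>\<^bsub>G2\<^esub> X"
proof (rule lin_eqI[OF lin_gmult_left lin_gmult_right G2.fin assms(2)])
  fix p assume "p \<in> PP"
  then obtain i j where p: "p = (i, j)" "i \<in> carrier G" "j \<in> carrier G" by blast
  show "(basis_vec p :: 'a \<times> 'a \<Rightarrow> 'k) \<star>\<^bsub>G2\<^esub> tensor (basis_vec \<one>) (avg N) = tensor (basis_vec \<one>) (avg N) \<star>\<^bsub>G2\<^esub> basis_vec p"
    unfolding p(1) tensor_basis[symmetric] tensor_mult using p(2,3) avg_central[OF assms(1), of "basis_vec j :: 'a \<Rightarrow> 'k"]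
    by (simp del: tensor_basis)
qed

text \<open>
  The element \<open>h\<close> below satisfies \<open>(id \<otimes> \<pi>) \<Delta>(h) = h \<otimes> \<pi>(m)\<close> for the projection
  \<open>\<pi>\<close> of \<open>kG\<close> onto \<open>k[G/N]\<close>, but it also lies in \<open>B\<close> (up to conjugation by \<open>v\<close>), where
  \<open>(id \<otimes> \<pi>) \<Delta>(h) = h \<otimes> 1\<close>. It is the slice of the coproduct of \<open>avg N\<close> by the functional sending
  \<open>b\<close> to the coefficient of \<open>n0\<close> in \<open>E \<one> \<star> b \<star> E m\<close>. The algebra \<open>k[G/N]\<close> is realized as \<open>kG\<close> times the central idempotent \<open>avg N\<close>.
\<close>

theorem weight_in_normal_subgroup:
  assumes N: "N \<lhd> G" "avg N \<in> B" "\<And>b. b \<in> B \<Longrightarrow> b \<star> avg N = fscale (aug G b) (avg N)"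
    and n0: "n0 \<in> N" and m: "m \<in> A"
    and fixing: "\<And>y z. y \<in> A \<Longrightarrow> z \<in> A \<Longrightarrow> y \<otimes> n0 \<otimes> z = n0 \<Longrightarrow> bichar z m = 1"
  shows "m \<in> N"
proof -
  note subN = normal_imp_subgroup[OF N(1)]
  note NG = subgroup.mem_carrier[OF subN]
  note finN = finite_subgroup[OF subN]
  have av: "(avg N :: 'a \<Rightarrow> 'k) \<in> free_space (carrier G)" by (rule avg_closed[OF subN])
  define c where "c n = (E \<one> \<star> basis_vec n \<star> E m) n0" for n
  define x where "x = (\<Sum>n\<in>N. fscale (c n) (basis_vec n))"
  define Am where "Am = dg (\<lambda>s. \<alpha> s m)"
  define Am' where "Am' = dg (\<lambda>s. inverse (\<alpha> s m))"
  define h where "h = x \<star> Am'"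
  have x_closed: "x \<in> free_space (carrier G)"
    unfolding x_def by (intro fun_space.subspace_sum[OF subspace_free_space] fun_space.subspace_scale[OF subspace_free_space])
      (auto intro: NG basis_vec_free_space)
  have Am: "Am' \<star> Am = basis_vec \<one>"
    unfolding Am_def Am'_def dg_mult dg_one[symmetric] by (rule dg_cong) (simp add: cocycle_nz m)

  \<comment> \<open>This coefficient is |A|^-2 times a sum of inverses of \<open>bichar z m\<close>
    over the pairs y, z with y n0 z = n0. Each summand is 1 by \<open>fixing\<close> and the pair
    (1, 1) occurs, so in characteristic 0 the sum is nonzero.\<close>
  have "c n0 \<noteq> 0"
  proof -
    have n0G: "n0 \<in> carrier G" by (rule NG[OF n0])
    have "c n0 = (1 / of_nat (card A)) * (1 / of_nat (card A)) *
        (\<Sum>z\<in>A. \<Sum>y\<in>A. inverse (bichar z m) * basis_vec (y \<otimes> n0 \<otimes> z) n0)"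
      unfolding c_def E_def lin_scale[OF lin_gmult_left] lin_scale[OF lin_gmult_right]
        lin_sum[OF lin_gmult_left] lin_sum[OF lin_gmult_right]
      using n0G by (simp add: A_carrier bichar_one sum_fun_apply sum_distrib_left mult_ac)
    also have "(\<Sum>z\<in>A. \<Sum>y\<in>A. inverse (bichar z m) * basis_vec (y \<otimes> n0 \<otimes> z) n0) =
        (\<Sum>z\<in>A. \<Sum>y\<in>A. if y \<otimes> n0 \<otimes> z = n0 then 1 else 0 :: 'k)"
      using fixing by (intro sum.cong refl) (auto simp: basis_vec_apply)
    also have "\<dots> = of_nat (card {p \<in> A \<times> A. snd p \<otimes> n0 \<otimes> fst p = n0})"
    proof -
      have "(\<Sum>z\<in>A. \<Sum>y\<in>A. if y \<otimes> n0 \<otimes> z = n0 then 1 else 0 :: 'k) = (\<Sum>p\<in>A \<times> A. if snd p \<otimes> n0 \<otimes> fst p = n0 then 1 else 0)"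
        by (simp add: sum.cartesian_product split_def)
      also have "\<dots> = of_nat (card ({p \<in> A \<times> A. snd p \<otimes> n0 \<otimes> fst p = n0}))"
        using finA by (subst sum.inter_filter[symmetric]) auto
      finally show ?thesis .
    qed
    finally have "c n0 = (1 / of_nat (card A)) * (1 / of_nat (card A)) * of_nat (card {p \<in> A \<times> A. snd p \<otimes> n0 \<otimes> fst p = n0})" .
    moreover have "card {p \<in> A \<times> A. snd p \<otimes> n0 \<otimes> fst p = n0} \<noteq> 0"
    proof -
      have "finite {p \<in> A \<times> A. snd p \<otimes> n0 \<otimes> fst p = n0}"
        by (rule finite_subset[of _ "A \<times> A"]) (use finA in auto)
      moreover have "(\<one>, \<one>) \<in> {p \<in> A \<times> A. snd p \<otimes> n0 \<otimes> fst p = n0}" using n0G by simp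
      ultimately show ?thesis by (metis (no_types, lifting) card_0_eq emptyE)
    qed
    ultimately show ?thesis using card_A_nz by simp
  qed
  moreover have "x n0 = c n0"
    using n0 finN by (simp add: x_def sum_fun_apply basis_vec_apply if_distrib[of "\<lambda>x. _ * x"] cong: if_cong)
  ultimately have "x \<noteq> 0" by auto
  moreover have "h \<star> Am = x" unfolding h_def by (simp add: gmult_assoc Am gmult_one_right x_closed)
  ultimately have h_nz: "h \<noteq> 0" using lin_zero[OF lin_gmult_left[of G Am]] by metis

  \<comment> \<open>\<open>E \<one>\<close> absorbs s without a factor and \<open>E m\<close>
    absorbs s^-1 with a factor, so conjugating its argument by s rescales \<open>c\<close>.
    Reindexing the sum over \<open>N\<close> turns this into a weight of \<open>x\<close>.\<close>
  have weight: "basis_vec s \<star> x = fscale (bichar s m) (x \<star> basis_vec s)" if s: "s \<in> A" for s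
  proof -
    have sG: "s \<in> carrier G" by (rule A_carrier[OF s])
    have c_conj: "c (s \<otimes> n \<otimes> inv s) = inverse (bichar s m) * c n" if n: "n \<in> N" for n
    proof -
      have "E \<one> \<star> basis_vec (s \<otimes> n \<otimes> inv s) \<star> E m = (E \<one> \<star> basis_vec s) \<star> basis_vec n \<star> (basis_vec (inv s) \<star> E m)"
        using sG NG[OF n] by (simp add: gmult_assoc[symmetric]) (simp add: gmult_assoc)
      also have "\<dots> = fscale (inverse (bichar s m)) (E \<one> \<star> basis_vec n \<star> E m)"
        using s m by (simp add: E_basis basis_E bichar_one bichar_inv lin_scale[OF lin_gmult_right])
      finally show ?thesis by (simp add: c_def)
    qed
    have bij: "bij_betw (\<lambda>n. s \<otimes> n \<otimes> inv s) N N"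
    proof (rule bij_betw_byWitness[where f' = "\<lambda>n. inv s \<otimes> n \<otimes> s"])
      show "\<forall>n\<in>N. inv s \<otimes> (s \<otimes> n \<otimes> inv s) \<otimes> s = n" "\<forall>n\<in>N. s \<otimes> (inv s \<otimes> n \<otimes> s) \<otimes> inv s = n"
        using sG NG by (auto simp: m_assoc inv_mult_cancel)
    qed (use sG normal.inv_op_closed1[OF N(1)] normal.inv_op_closed2[OF N(1)] in auto)
    have "x = (\<Sum>n\<in>N. fscale (c (s \<otimes> n \<otimes> inv s)) (basis_vec (s \<otimes> n \<otimes> inv s)))"
      unfolding x_def using sum.reindex_bij_betw[OF bij, of "\<lambda>n. fscale (c n) (basis_vec n :: 'a \<Rightarrow> 'k)"] by simp
    then have "x \<star> basis_vec s = (\<Sum>n\<in>N. fscale (c (s \<otimes> n \<otimes> inv s)) (basis_vec (s \<otimes> n \<otimes> inv s) \<star> basis_vec s))"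
      by (simp only: lin_sum[OF lin_gmult_left] lin_scale[OF lin_gmult_left])
    also have "\<dots> = (\<Sum>n\<in>N. fscale (inverse (bichar s m)) (fscale (c n) (basis_vec s \<star> basis_vec n)))"
    proof (intro sum.cong refl)
      fix n assume n: "n \<in> N"
      have "basis_vec (s \<otimes> n \<otimes> inv s) \<star> basis_vec s = (basis_vec s \<star> basis_vec n :: 'a \<Rightarrow> 'k)"
        using sG NG[OF n] by (simp add: m_assoc)
      then show "fscale (c (s \<otimes> n \<otimes> inv s)) (basis_vec (s \<otimes> n \<otimes> inv s) \<star> basis_vec s) =
          fscale (inverse (bichar s m)) (fscale (c n) (basis_vec s \<star> basis_vec n))"
        by (simp only: c_conj[OF n] fscale_fscale)
    qed
    also have "\<dots> = fscale (inverse (bichar s m)) (basis_vec s \<star> x)"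
      unfolding x_def by (simp only: lin_sum[OF lin_gmult_right] lin_scale[OF lin_gmult_right] fscale_sum)
    finally show ?thesis using bichar_nz[OF s m] by simp
  qed
  \<comment> \<open>An element of weight m shifts the idempotents of kA by m.\<close>
  have E_x: "E (m \<otimes> s) \<star> x = x \<star> E s" if s: "s \<in> A" for s
    unfolding E_def lin_scale[OF lin_gmult_left] lin_scale[OF lin_gmult_right] lin_sum[OF lin_gmult_left] lin_sum[OF lin_gmult_right]
    using s m by (intro arg_cong[of _ _ "fscale _"] sum.cong refl) (simp add: weight bichar_mult_right bichar_nz)

  \<comment> \<open>Slices of the coproduct of \<open>avg N\<close> stay in \<open>B\<close>. The
    functional undoes the conjugation by \<open>v\<close>; then \<open>E \<one>\<close> reduces
    \<open>J0\<close> to the scalar \<open>\<alpha> \<one> \<one>\<close>, and \<open>E m\<close>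
    reduces its inverse to \<open>Am'\<close> in the first leg.\<close>
  have B1: "v \<star> h \<star> w \<in> B"
  proof -
    define F where "F a b = fscale ((E \<one> \<star> w \<star> b \<star> v \<star> E m) n0) a" for a b :: "'a \<Rightarrow> 'k"
    have linF: "lin (\<lambda>a. F a b)" "lin (F a)" for a b
      unfolding F_def[abs_def]
      by (intro lin_fscale_right lin_comp[OF lin_fscale_coord] lin_comp[OF lin_gmult_left] lin_gmult_right)+
    define F0 where "F0 a b = fscale (b n0) a" for a b :: "'a \<Rightarrow> 'k"
    have linF0: "lin (\<lambda>a. F0 a b)" "lin (F0 a)" for a b
      unfolding F0_def[abs_def] by (intro lin_fscale_right lin_fscale_coord)+
    have "lext PP (\<lambda>(i, j). F (basis_vec i) (basis_vec j)) (tw (avg N)) \<in> B"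
      by (rule lext_in_B[OF linF B_tw[OF N(2)]]) (auto simp: F_def intro: fun_space.subspace_scale[OF B_subspace])
    also have "tw (avg N) = tensor v v \<star>\<^bsub>G2\<^esub> tw0 (avg N) \<star>\<^bsub>G2\<^esub> tensor w w"
    proof -
      have "w \<star> avg N \<star> v = avg N"
        using avg_central[OF N(1) w_closed] by (simp add: gmult_assoc wv gmult_one_right av)
      then show ?thesis by (simp add: tw_tw0)
    qed
    also have "lext PP (\<lambda>(i, j). F (basis_vec i) (basis_vec j)) (tensor v v \<star>\<^bsub>G2\<^esub> tw0 (avg N) \<star>\<^bsub>G2\<^esub> tensor w w) =
      lext PP (\<lambda>(i, j). v \<star> fscale ((E \<one> \<star> basis_vec j \<star> E m) n0) (basis_vec i) \<star> w) (tw0 (avg N))"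
    proof (subst lext_conj[OF linF], simp add: tw0_def, rule lext_Sigma_cong)
      fix i j assume "i \<in> carrier G" "j \<in> carrier G"
      have "E \<one> \<star> w \<star> (v \<star> basis_vec j \<star> w) \<star> v \<star> E m = E \<one> \<star> (w \<star> v) \<star> basis_vec j \<star> (w \<star> v) \<star> E m"
        by (simp only: gmult_assoc)
      then have "E \<one> \<star> w \<star> (v \<star> basis_vec j \<star> w) \<star> v \<star> E m = E \<one> \<star> basis_vec j \<star> E m"
        by (simp add: wv gmult_one_right)
      then show "(case (i, j) of (i, j) \<Rightarrow> F (v \<star> basis_vec i \<star> w) (v \<star> basis_vec j \<star> w)) =
        (case (i, j) of (i, j) \<Rightarrow> v \<star> fscale ((E \<one> \<star> basis_vec j \<star> E m) n0) (basis_vec i) \<star> w)"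
        by (simp add: F_def lin_scale[OF lin_gmult_right] lin_scale[OF lin_gmult_left])
    qed
    also have "\<dots> = v \<star> lext PP (\<lambda>(i, j). fscale ((E \<one> \<star> basis_vec j \<star> E m) n0) (basis_vec i)) (tw0 (avg N)) \<star> w"
      unfolding gmult_lext_left gmult_lext_right by (simp add: split_def)
    also have "lext PP (\<lambda>(i, j). fscale ((E \<one> \<star> basis_vec j \<star> E m) n0) (basis_vec i)) (tw0 (avg N)) =
      lext PP (\<lambda>(i, j). F0 (basis_vec i) (basis_vec j)) (tensor (basis_vec \<one>) (E \<one>) \<star>\<^bsub>G2\<^esub> tw0 (avg N) \<star>\<^bsub>G2\<^esub> tensor (basis_vec \<one>) (E m))"
      by (subst lext_conj[OF linF0], simp add: tw0_def, intro lext_Sigma_cong) (simp add: F0_def)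
    also have "tensor (basis_vec \<one>) (E \<one>) \<star>\<^bsub>G2\<^esub> tw0 (avg N) \<star>\<^bsub>G2\<^esub> tensor (basis_vec \<one>) (E m) =
      fscale (\<alpha> \<one> \<one>) (tensor (basis_vec \<one>) (E \<one>) \<star>\<^bsub>G2\<^esub> cop (avg N) \<star>\<^bsub>G2\<^esub> tensor Am' (E m))"
    proof -
      have "tensor (basis_vec \<one>) (E \<one>) \<star>\<^bsub>G2\<^esub> J0 = fscale (\<alpha> \<one> \<one>) (tensor (basis_vec \<one>) (E \<one>))"
      proof -
        have "tensor (basis_vec \<one>) (E \<one>) = dg2 (\<lambda>(s, t). basis_vec \<one> t)"
          using tensor_dg[of "\<lambda>_. 1" "basis_vec \<one>"] by (simp add: E_dg dg_one)
        moreover have "dg2 (\<lambda>p. (case p of (s, t) \<Rightarrow> basis_vec \<one> t) * (case p of (s, t) \<Rightarrow> \<alpha> s t)) =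
            dg2 (fscale (\<alpha> \<one> \<one>) (\<lambda>(s, t). basis_vec \<one> t))"
        proof (rule dg2_cong)
          fix s t assume "s \<in> A" "t \<in> A"
          then show "(case (s, t) of (s, t) \<Rightarrow> basis_vec \<one> t) * (case (s, t) of (s, t) \<Rightarrow> \<alpha> s t) =
            fscale (\<alpha> \<one> \<one>) (\<lambda>(s, t). basis_vec \<one> t) (s, t)"
            using cocycle_one[of s] by (simp add: basis_vec_apply)
        qed
        ultimately show ?thesis unfolding J0_def by (simp add: dg2_mult) (simp add: dg2_def lin_scale[OF lin_lext])
      qed
      moreover have "J0' \<star>\<^bsub>G2\<^esub> tensor (basis_vec \<one>) (E m) = tensor Am' (E m)"
      proof -
        have "tensor (basis_vec \<one>) (E m) = dg2 (\<lambda>(s, t). basis_vec m t)"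
          using tensor_dg[of "\<lambda>_. 1" "basis_vec m"] m by (simp add: E_dg dg_one)
        moreover have "tensor Am' (E m) = dg2 (\<lambda>(s, t). inverse (\<alpha> s m) * basis_vec m t)"
          using tensor_dg[of "\<lambda>s. inverse (\<alpha> s m)" "basis_vec m"] m by (simp add: E_dg Am'_def)
        moreover have "dg2 (\<lambda>p. (case p of (s, t) \<Rightarrow> inverse (\<alpha> s t)) * (case p of (s, t) \<Rightarrow> basis_vec m t)) =
            dg2 (\<lambda>(s, t). inverse (\<alpha> s m) * basis_vec m t)"
          by (rule dg2_cong) (auto simp: basis_vec_apply)
        ultimately show ?thesis unfolding J0'_def by (simp add: dg2_mult)
      qed
      ultimately show ?thesis
        unfolding tw0_def
        by (simp add: G2.gmult_assoc) (simp add: G2.gmult_assoc[symmetric] lin_scale[OF lin_gmult_left])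
    qed
    also have "lext PP (\<lambda>(i, j). F0 (basis_vec i) (basis_vec j)) (fscale (\<alpha> \<one> \<one>) (tensor (basis_vec \<one>) (E \<one>) \<star>\<^bsub>G2\<^esub> cop (avg N) \<star>\<^bsub>G2\<^esub> tensor Am' (E m)))
      = fscale (\<alpha> \<one> \<one>) (lext PP (\<lambda>(i, j). F0 (basis_vec \<one> \<star> basis_vec i \<star> Am') (E \<one> \<star> basis_vec j \<star> E m)) (cop (avg N)))"
      unfolding lin_scale[OF lin_lext] by (subst lext_conj[OF linF0]) simp_all
    also have "lext PP (\<lambda>(i, j). F0 (basis_vec \<one> \<star> basis_vec i \<star> Am') (E \<one> \<star> basis_vec j \<star> E m)) (cop (avg N)) =
      fscale (1 / of_nat (card N)) h"
    proof -
      have "cop (avg N) = fscale (1 / of_nat (card N)) (\<Sum>n\<in>N. basis_vec (n, n) :: 'a \<times> 'a \<Rightarrow> 'k)"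
        unfolding avg_def lin_scale[OF lin_cop] lin_sum[OF lin_cop] by (simp add: NG)
      then have "lext PP (\<lambda>(i, j). F0 (basis_vec \<one> \<star> basis_vec i \<star> Am') (E \<one> \<star> basis_vec j \<star> E m)) (cop (avg N)) =
        fscale (1 / of_nat (card N)) (\<Sum>n\<in>N. F0 (basis_vec \<one> \<star> basis_vec n \<star> Am') (E \<one> \<star> basis_vec n \<star> E m))"
        by (simp only: lin_scale[OF lin_lext] lin_sum[OF lin_lext]) (simp add: G2.fin NG)
      also have "(\<Sum>n\<in>N. F0 (basis_vec \<one> \<star> basis_vec n \<star> Am') (E \<one> \<star> basis_vec n \<star> E m)) = h"
        unfolding h_def x_def lin_sum[OF lin_gmult_left] lin_scale[OF lin_gmult_left]
        by (intro sum.cong refl) (simp add: F0_def c_def NG)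
      finally show ?thesis .
    qed
    also have "v \<star> fscale (\<alpha> \<one> \<one>) (fscale (1 / of_nat (card N)) h) \<star> w = fscale (\<alpha> \<one> \<one> / of_nat (card N)) (v \<star> h \<star> w)"
      by (simp add: lin_scale[OF lin_gmult_right] lin_scale[OF lin_gmult_left])
    finally have "fscale (of_nat (card N) / \<alpha> \<one> \<one>) (fscale (\<alpha> \<one> \<one> / of_nat (card N)) (v \<star> h \<star> w)) \<in> B"
      by (rule fun_space.subspace_scale[OF B_subspace])
    then show ?thesis using card_subgroup_nz[OF subN, where ?'k = 'k] cocycle_nz[of \<one> \<one>] by simp
  qed

  let ?P = "tensor (basis_vec \<one>) (avg N) :: 'a \<times> 'a \<Rightarrow> 'k"
  \<comment> \<open>Coinvariance of an element of \<open>B\<close>, transported back along the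
    conjugation by \<open>v\<close>; the central element \<open>avg N\<close> is not
    affected.\<close>
  have coinv: "tw0 h \<star>\<^bsub>G2\<^esub> ?P = tensor h (avg N)"
  proof -
    have h_closed: "h \<in> free_space (carrier G)" by (simp add: h_def)
    have conj: "w \<star> (v \<star> h \<star> w) \<star> v = h"
    proof -
      have "w \<star> (v \<star> h \<star> w) \<star> v = (w \<star> v) \<star> h \<star> (w \<star> v)" by (simp only: gmult_assoc)
      then show ?thesis by (simp add: wv gmult_one_left gmult_one_right h_closed)
    qed
    have "tensor w w \<star>\<^bsub>G2\<^esub> (tw (v \<star> h \<star> w) \<star>\<^bsub>G2\<^esub> ?P) \<star>\<^bsub>G2\<^esub> tensor v v =
      tensor w w \<star>\<^bsub>G2\<^esub> (tensor v v \<star>\<^bsub>G2\<^esub> tw0 h \<star>\<^bsub>G2\<^esub> tensor w w \<star>\<^bsub>G2\<^esub> ?P) \<star>\<^bsub>G2\<^esub> tensor v v"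
      by (simp add: tw_tw0 conj)
    also have "\<dots> = (tensor w w \<star>\<^bsub>G2\<^esub> tensor v v) \<star>\<^bsub>G2\<^esub> tw0 h \<star>\<^bsub>G2\<^esub> (tensor w w \<star>\<^bsub>G2\<^esub> ?P) \<star>\<^bsub>G2\<^esub> tensor v v"
      by (simp only: G2.gmult_assoc)
    also have "\<dots> = (tensor w w \<star>\<^bsub>G2\<^esub> tensor v v) \<star>\<^bsub>G2\<^esub> tw0 h \<star>\<^bsub>G2\<^esub> ?P \<star>\<^bsub>G2\<^esub> (tensor w w \<star>\<^bsub>G2\<^esub> tensor v v)"
      using one_avg_central[OF N(1), of "tensor w w"] by (simp only: G2.gmult_assoc tensor_free_space w_closed)
    also have "\<dots> = tw0 h \<star>\<^bsub>G2\<^esub> ?P"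
      by (simp add: tensor_vw G2.gmult_one_left G2.gmult_one_right tw0_def)
    finally have "tw0 h \<star>\<^bsub>G2\<^esub> ?P = tensor w w \<star>\<^bsub>G2\<^esub> tensor (v \<star> h \<star> w) (avg N) \<star>\<^bsub>G2\<^esub> tensor v v"
      by (simp add: tw_coinvariant[OF N(1,3) B1])
    also have "\<dots> = tensor h (w \<star> avg N \<star> v)"
      by (simp add: tensor_mult conj)
    also have "w \<star> avg N \<star> v = avg N"
      using avg_central[OF N(1) w_closed] by (simp add: gmult_assoc wv gmult_one_right av)
    finally show ?thesis .
  qed
  have "tw0 h \<star>\<^bsub>G2\<^esub> ?P = tensor h (basis_vec m \<star> avg N)"
  proof -
    \<comment> \<open>As \<open>x\<close> is supported on \<open>N\<close>, the second leg of its
      coproduct is absorbed by \<open>avg N\<close>.\<close>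
    have cop_x: "cop x \<star>\<^bsub>G2\<^esub> ?P = tensor x (basis_vec \<one>) \<star>\<^bsub>G2\<^esub> ?P"
    proof -
      have "cop x \<star>\<^bsub>G2\<^esub> ?P = (\<Sum>n\<in>N. fscale (c n) (tensor (basis_vec n) (basis_vec n) \<star>\<^bsub>G2\<^esub> ?P))"
        unfolding x_def lin_sum[OF lin_cop] lin_scale[OF lin_cop] lin_sum[OF lin_gmult_left] lin_scale[OF lin_gmult_left]
        by (simp add: NG)
      also have "\<dots> = (\<Sum>n\<in>N. fscale (c n) (tensor (basis_vec n) (avg N)))"
        by (intro sum.cong refl) (simp add: tensor_mult NG basis_avg[OF subN] del: tensor_basis)
      also have "\<dots> = tensor x (avg N)"
        unfolding x_def lin_sum[OF lin_tensor_left] lin_scale[OF lin_tensor_left] ..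
      finally show ?thesis by (simp add: tensor_mult gmult_one_left gmult_one_right av x_closed)
    qed
    \<comment> \<open>Moving \<open>J0\<close> past \<open>x\<close> shifts its first argument by m,
      by \<open>E_x\<close>.\<close>
    have J0_x: "J0 \<star>\<^bsub>G2\<^esub> tensor x (basis_vec \<one>) = tensor x (basis_vec \<one>) \<star>\<^bsub>G2\<^esub> dg2 (\<lambda>(s, t). \<alpha> (m \<otimes> s) t)"
    proof -
      have "bij_betw (\<lambda>p. (m \<otimes> fst p, snd p)) (A \<times> A) (A \<times> A)"
        by (rule bij_betw_byWitness[where f' = "\<lambda>p. (inv m \<otimes> fst p, snd p)"]) (use m in \<open>auto simp: A_carrier inv_mult_cancel\<close>)
      then have "(\<Sum>p\<in>A \<times> A. fscale (\<alpha> (fst p) (snd p)) (tensor (E (fst p)) (E (snd p)) \<star>\<^bsub>G2\<^esub> tensor x (basis_vec \<one>))) =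
        (\<Sum>p\<in>A \<times> A. fscale (\<alpha> (m \<otimes> fst p) (snd p)) (tensor (E (m \<otimes> fst p)) (E (snd p)) \<star>\<^bsub>G2\<^esub> tensor x (basis_vec \<one>)))"
        using sum.reindex_bij_betw[of "\<lambda>p. (m \<otimes> fst p, snd p)" "A \<times> A" "A \<times> A"
          "\<lambda>p. fscale (\<alpha> (fst p) (snd p)) (tensor (E (fst p)) (E (snd p)) \<star>\<^bsub>G2\<^esub> tensor x (basis_vec \<one>))"] by simp
      also have "\<dots> = (\<Sum>p\<in>A \<times> A. fscale (\<alpha> (m \<otimes> fst p) (snd p)) (tensor x (basis_vec \<one>) \<star>\<^bsub>G2\<^esub> tensor (E (fst p)) (E (snd p))))"
        by (intro sum.cong refl) (auto simp: tensor_mult E_x gmult_one_left gmult_one_right)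
      finally show ?thesis
        unfolding J0_def dg2_def gmult_lext_left gmult_lext_right by (simp add: lext_def split_def)
    qed
    \<comment> \<open>The cocycle identities at (s, m, t) and (s, t, m) share the factor
      \<open>\<alpha> s (m \<otimes> t)\<close>; eliminating it leaves the ratio of
      \<open>\<alpha> m t\<close> and \<open>\<alpha> t m\<close>.\<close>
    have coefficient: "\<alpha> (m \<otimes> s) t * (inverse (\<alpha> (s \<otimes> t) m) * inverse (\<alpha> s t)) = inverse (\<alpha> s m) * bichar m t"
      if "s \<in> A" "t \<in> A" for s t
    proof -
      have c1: "\<alpha> s m * \<alpha> (m \<otimes> s) t = \<alpha> m t * \<alpha> s (m \<otimes> t)"
        using cocycle[of s m t] comm[of s m] that m by simp
      have c2: "\<alpha> s t * \<alpha> (s \<otimes> t) m = \<alpha> t m * \<alpha> s (m \<otimes> t)"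
        using cocycle[of s t m] comm[of t m] that m by simp
      note nz = cocycle_nz[OF that] cocycle_nz[OF that(1) m] cocycle_nz[OF that(2) m] cocycle_nz[of s "m \<otimes> t"] cocycle_nz[of "s \<otimes> t" m]
      have "\<alpha> (m \<otimes> s) t = \<alpha> m t * \<alpha> s (m \<otimes> t) / \<alpha> s m"
        using c1 nz by (simp add: eq_divide_eq mult.commute)
      moreover have "inverse (\<alpha> (s \<otimes> t) m) * inverse (\<alpha> s t) = inverse (\<alpha> s t * \<alpha> (s \<otimes> t) m)"
        by simp
      ultimately show ?thesis using nz cocycle_nz[of m t] cocycle_nz[of s "m \<otimes> t"] that m
        unfolding c2 bichar_def by (simp add: field_simps)
    qed
    have "tw0 h \<star>\<^bsub>G2\<^esub> ?P = J0 \<star>\<^bsub>G2\<^esub> (cop x \<star>\<^bsub>G2\<^esub> (cop Am' \<star>\<^bsub>G2\<^esub> J0' \<star>\<^bsub>G2\<^esub> ?P))"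
      unfolding tw0_def h_def cop_gmult by (simp only: G2.gmult_assoc)
    also have "cop Am' \<star>\<^bsub>G2\<^esub> J0' \<star>\<^bsub>G2\<^esub> ?P = ?P \<star>\<^bsub>G2\<^esub> (cop Am' \<star>\<^bsub>G2\<^esub> J0')"
      by (rule one_avg_central[OF N(1)]) simp
    also have "J0 \<star>\<^bsub>G2\<^esub> (cop x \<star>\<^bsub>G2\<^esub> (?P \<star>\<^bsub>G2\<^esub> (cop Am' \<star>\<^bsub>G2\<^esub> J0'))) =
      J0 \<star>\<^bsub>G2\<^esub> (cop x \<star>\<^bsub>G2\<^esub> ?P) \<star>\<^bsub>G2\<^esub> (cop Am' \<star>\<^bsub>G2\<^esub> J0')"
      by (simp only: G2.gmult_assoc)
    also have "\<dots> = (J0 \<star>\<^bsub>G2\<^esub> tensor x (basis_vec \<one>)) \<star>\<^bsub>G2\<^esub> (?P \<star>\<^bsub>G2\<^esub> (cop Am' \<star>\<^bsub>G2\<^esub> J0'))"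
      unfolding cop_x by (simp only: G2.gmult_assoc)
    also have "?P \<star>\<^bsub>G2\<^esub> (cop Am' \<star>\<^bsub>G2\<^esub> J0') = (cop Am' \<star>\<^bsub>G2\<^esub> J0') \<star>\<^bsub>G2\<^esub> ?P"
      by (rule one_avg_central[OF N(1), symmetric]) simp
    also have "(J0 \<star>\<^bsub>G2\<^esub> tensor x (basis_vec \<one>)) \<star>\<^bsub>G2\<^esub> ((cop Am' \<star>\<^bsub>G2\<^esub> J0') \<star>\<^bsub>G2\<^esub> ?P) =
       tensor x (basis_vec \<one>) \<star>\<^bsub>G2\<^esub> (dg2 (\<lambda>(s, t). \<alpha> (m \<otimes> s) t) \<star>\<^bsub>G2\<^esub> (cop Am' \<star>\<^bsub>G2\<^esub> J0')) \<star>\<^bsub>G2\<^esub> ?P"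
      unfolding J0_x by (simp only: G2.gmult_assoc)
    also have "dg2 (\<lambda>(s, t). \<alpha> (m \<otimes> s) t) \<star>\<^bsub>G2\<^esub> (cop Am' \<star>\<^bsub>G2\<^esub> J0') = tensor Am' (basis_vec m)"
      unfolding Am'_def cop_dg J0'_def dg2_mult basis_dg[OF m, symmetric] tensor_dg
      by (rule dg2_cong) (simp add: coefficient)
    also have "tensor x (basis_vec \<one>) \<star>\<^bsub>G2\<^esub> tensor Am' (basis_vec m) \<star>\<^bsub>G2\<^esub> ?P = tensor h (basis_vec m \<star> avg N)"
      by (simp add: tensor_mult h_def gmult_assoc gmult_one_left gmult_one_right A_carrier m Am'_def)
    finally show ?thesis .
  qed
  then have eq: "tensor h (basis_vec m \<star> avg N) = tensor h (avg N)" using coinv by simp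
  \<comment> \<open>Comparing coefficients at (i, m) shows that \<open>avg N\<close> has the same
    value at m as at 1, which is nonzero.\<close>
  obtain i where i: "h i \<noteq> 0" using h_nz by fastforce
  have "h i * (basis_vec m \<star> avg N) m = h i * avg N m"
    using fun_cong[OF eq, of "(i, m)"] by simp
  then have "(basis_vec m \<star> avg N) m = (avg N m :: 'k)" using i by simp
  then have "avg N \<one> = (avg N m :: 'k)" using m by (simp add: gmult_basis_left_apply A_carrier)
  then show ?thesis
    using card_subgroup_nz[OF subN, where ?'k = 'k] subgroup.one_closed[OF subN] by (auto simp: avg_apply finN split: if_splits)
qed

end

section \<open>The twist of a Galois object\<close>

lemma linear_form_on_zero:
  assumes "linear_form_on V f" "fun_space.subspace V"
  shows "f 0 = 0"
proof -
  have "f (fscale 0 0) = 0 * f 0"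
    using assms(1) fun_space.subspace_0[OF assms(2)] unfolding linear_form_on_def by blast
  then show ?thesis by (simp only: fscale_zero mult_zero_left)
qed

lemma linear_form_on_sum:
  assumes "linear_form_on V f" "fun_space.subspace V" "finite A" "\<And>a. a \<in> A \<Longrightarrow> g a \<in> V"
  shows "f (\<Sum>a\<in>A. g a) = (\<Sum>a\<in>A. f (g a))"
  using assms(3,4)
proof (induction A rule: finite_induct)
  case (insert a A)
  have "f (g a + sum g A) = f (g a) + f (sum g A)"
    using assms(1) insert.prems fun_space.subspace_sum[OF assms(2), of A g] unfolding linear_form_on_def by blast
  moreover have "f (sum g A) = (\<Sum>a\<in>A. f (g a))" using insert by blast
  ultimately show ?case by (simp only: sum.insert[OF insert.hyps])
next
  case empty
  show ?case by (simp only: sum.empty linear_form_on_zero[OF assms(1,2)])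
qed

section \<open>Twists from Hopf 2-cocycles on the function algebra\<close>

context fin_group
begin

interpretation G2: fin_group G2
  rewrites "carrier G2 = carrier G \<times> carrier G" and "\<one>\<^bsub>G2\<^esub> = (\<one>, \<one>)"
  by (rule fin_group_G2) (simp_all add: DirProd_def)

interpretation G3: fin_group G3
  rewrites "carrier G3 = carrier G \<times> carrier G \<times> carrier G" and "\<one>\<^bsub>G3\<^esub> = (\<one>, \<one>, \<one>)"
  by (rule fin_group_G3) (simp_all add: DirProd_def)

abbreviation FA :: "('a, 'k::field) bialgebra" where "FA \<equiv> function_algebra G"

lemma mult_eq_iff: "i \<in> carrier G \<Longrightarrow> j \<in> carrier G \<Longrightarrow> a \<in> carrier G \<Longrightarrow> i \<otimes> j = a \<longleftrightarrow> i = a \<otimes> inv j"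
  by (auto simp: m_assoc)

lemma mult_inv_eq_one: "i \<in> carrier G \<Longrightarrow> j \<in> carrier G \<Longrightarrow> i \<otimes> inv j = \<one> \<longleftrightarrow> i = j"
  using mult_eq_iff[of \<one> j i] by auto

text \<open>The coproduct of e_a is the sum of e_i \<otimes> e_j over i j = a; here it is
  parametrized by j.\<close>

lemma sum_solve_right:
  assumes "a \<in> carrier G"
  shows "(\<Sum>i\<in>carrier G. \<Sum>j\<in>carrier G. if i \<otimes> j = a then F i j else 0) = (\<Sum>j\<in>carrier G. F (a \<otimes> inv j) j)"
proof -
  have "(\<Sum>i\<in>carrier G. \<Sum>j\<in>carrier G. if i \<otimes> j = a then F i j else 0) =
    (\<Sum>j\<in>carrier G. \<Sum>i\<in>carrier G. if i = a \<otimes> inv j then F i j else 0)"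
    by (subst sum.swap, intro sum.cong refl) (use assms in \<open>simp add: mult_eq_iff\<close>)
  then show ?thesis using assms fin by simp
qed

lemma FA_simps: "carrier FA = free_space (carrier G)" "basis FA = carrier G"
  "\<one>\<^bsub>FA\<^esub> = (\<Sum>g\<in>carrier G. basis_vec g)" "counit FA x = x \<one>"
  "comult FA x (i, j) = (if i \<in> carrier G \<and> j \<in> carrier G then x (i \<otimes> j) else 0)"
  "x \<otimes>\<^bsub>FA\<^esub> y = (\<lambda>g. x g * y g)"
  using fin by (simp_all add: function_algebra_def fun_eq_iff sum_fun_apply basis_vec_apply)

lemma FA_mult_basis: "basis_vec i \<otimes>\<^bsub>FA\<^esub> basis_vec j = (if i = j then basis_vec i else 0)"
  by (auto simp: FA_simps basis_vec_apply fun_eq_iff)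

lemma sweedler_form_basis:
  "a \<in> carrier G \<Longrightarrow> sweedler_form FA f (basis_vec a) = (\<Sum>j\<in>carrier G. f (basis_vec (a \<otimes> inv j)) (basis_vec j))"
  unfolding sweedler_form_def sum_solve_right[symmetric, where F = "\<lambda>i j. f (basis_vec i) (basis_vec j)"]
    sum.cartesian_product FA_simps(2)
  by (intro sum.cong refl) (auto simp: FA_simps(5) basis_vec_apply)

lemma sweedler_basis:
  "a \<in> carrier G \<Longrightarrow> sweedler FA f (basis_vec a) = (\<Sum>j\<in>carrier G. f (basis_vec (a \<otimes> inv j)) (basis_vec j))"
  unfolding sweedler_def sum_solve_right[symmetric, where F = "\<lambda>i j. f (basis_vec i) (basis_vec j)"]
    sum.cartesian_product FA_simps(2)
  by (intro sum.cong refl) (auto simp: FA_simps(5) basis_vec_apply)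

lemma twist_of_form_closed: "twist_of_form G \<sigma> \<in> free_space (carrier G \<times> carrier G)"
  unfolding twist_of_form_def
  by (intro fun_space.subspace_sum[OF subspace_free_space]) (auto intro!: fun_space.subspace_scale[OF subspace_free_space])

lemma twist_of_form_apply:
  assumes "a \<in> carrier G" "b \<in> carrier G"
  shows "twist_of_form G \<sigma> (a, b) = \<sigma> (basis_vec a) (basis_vec b)"
proof -
  have "twist_of_form G \<sigma> (a, b) = (\<Sum>p\<in>carrier G \<times> carrier G. if p = (a, b) then \<sigma> (basis_vec a) (basis_vec b) else 0)"
    unfolding twist_of_form_def sum_fun_apply
    by (intro sum.cong refl) (auto simp: basis_vec_apply split: if_splits)
  then show ?thesis using assms fin by simp
qed

lemma G2_gmult_apply:
  assumes "a \<in> carrier G" "b \<in> carrier G"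
  shows "(x \<star>\<^bsub>G2\<^esub> y) (a, b) = (\<Sum>i\<in>carrier G. \<Sum>j\<in>carrier G. x (a \<otimes> inv i, b \<otimes> inv j) * y (i, j))"
  using assms unfolding sum.cartesian_product
  by (subst G2.gmult_apply) (auto simp: G2_mult intro!: sum.cong)

text \<open>By duality, convolution invertibility of \<sigma> becomes invertibility of J in kG
  \<otimes> kG.\<close>

lemma convolution_basis:
  assumes "a \<in> carrier G" "b \<in> carrier G"
  shows "convolution FA \<sigma> \<tau> (basis_vec a) (basis_vec b) = (twist_of_form G \<sigma> \<star>\<^bsub>G2\<^esub> twist_of_form G \<tau>) (a, b)"
  using assms unfolding convolution_def by (simp add: sweedler_form_basis G2_gmult_apply twist_of_form_apply)

lemma push_embed_apply:
  fixes X :: "'p \<Rightarrow> 'k::field"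
  assumes "inj f" "finite P" "X \<in> free_space P"
  shows "push P f X (f p) = X p"
proof -
  have "push P f X (f p) = (\<Sum>q\<in>P. if q = p then X q else 0)"
    unfolding push_def lext_apply using assms(1) by (intro sum.cong refl) (auto simp: basis_vec_apply inj_eq)
  then show ?thesis using assms(2,3) by (auto simp: free_space_def)
qed

lemma push_outside: "y \<notin> range f \<Longrightarrow> push P f X y = 0"
  unfolding push_def lext_apply by (intro sum.neutral) (auto simp: basis_vec_apply)

text \<open>Evaluated on basis vectors e_a, e_b, e_c, the axioms of a Hopf 2-cocycle are the
  coefficients of the axioms of \<open>group_twist\<close>. Normalization of \<sigma> becomes the
  two counit conditions on J.\<close>

lemma group_twist_of_cocycle:
  fixes \<sigma> :: "('a \<Rightarrow> 'k::field) \<Rightarrow> ('a \<Rightarrow> 'k) \<Rightarrow> 'k"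
  assumes \<sigma>: "hopf_2cocycle FA \<sigma>"
  obtains K where "group_twist G (twist_of_form G \<sigma>) K"
proof -
  let ?J = "twist_of_form G \<sigma>"
  have bil: "bilinear_form_on (free_space (carrier G)) \<sigma>"
    using \<sigma> by (simp add: hopf_2cocycle_def FA_simps)
  have "convolution_invertible FA \<sigma>" using \<sigma> unfolding hopf_2cocycle_def by blast
  then obtain \<tau> where "\<forall>h\<in>carrier FA. \<forall>g\<in>carrier FA.
      convolution FA \<sigma> \<tau> h g = counit FA h * counit FA g \<and> convolution FA \<tau> \<sigma> h g = counit FA h * counit FA g"
    unfolding convolution_invertible_def by blast
  then have \<tau>: "\<And>h g. h \<in> free_space (carrier G) \<Longrightarrow> g \<in> free_space (carrier G) \<Longrightarrow> convolution FA \<sigma> \<tau> h g = h \<one> * g \<one>"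
    "\<And>h g. h \<in> free_space (carrier G) \<Longrightarrow> g \<in> free_space (carrier G) \<Longrightarrow> convolution FA \<tau> \<sigma> h g = h \<one> * g \<one>"
    unfolding FA_simps(1,4) by blast+
  let ?K = "twist_of_form G \<tau>"
  have eqI: "X = Y" if "X \<in> free_space (carrier G \<times> carrier G)" "Y \<in> free_space (carrier G \<times> carrier G)"
    "\<And>a b. a \<in> carrier G \<Longrightarrow> b \<in> carrier G \<Longrightarrow> X (a, b) = Y (a, b)" for X Y :: "'a \<times> 'a \<Rightarrow> 'k"
    using that by (auto simp: free_space_def fun_eq_iff) metis
  have JK: "?J \<star>\<^bsub>G2\<^esub> ?K = one2"
    by (rule eqI) (simp_all add: convolution_basis[symmetric] \<tau>, auto simp: basis_vec_apply)
  have KJ: "?K \<star>\<^bsub>G2\<^esub> ?J = one2"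
    by (rule eqI) (simp_all add: convolution_basis[symmetric] \<tau>, auto simp: basis_vec_apply)
  have lin_form: "linear_form_on (free_space (carrier G)) (\<lambda>x. \<sigma> x y)" "linear_form_on (free_space (carrier G)) (\<sigma> y)"
    if "y \<in> free_space (carrier G)" for y
    using bil that by (auto simp: bilinear_form_on_def)
  have zero: "\<sigma> 0 y = 0" "\<sigma> y 0 = 0" if "y \<in> free_space (carrier G)" for y
    using linear_form_on_zero[OF lin_form(1)[OF that] subspace_free_space]
      linear_form_on_zero[OF lin_form(2)[OF that] subspace_free_space] by simp_all
  have normal: "\<sigma> (basis_vec a) (\<Sum>g\<in>carrier G. basis_vec g) = basis_vec a \<one>"
    "\<sigma> (\<Sum>g\<in>carrier G. basis_vec g) (basis_vec a) = basis_vec a \<one>" if "a \<in> carrier G" for a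
  proof -
    have "\<forall>h\<in>carrier FA. \<sigma> h \<one>\<^bsub>FA\<^esub> = counit FA h \<and> \<sigma> \<one>\<^bsub>FA\<^esub> h = counit FA h"
      using \<sigma> unfolding hopf_2cocycle_def by blast
    then show "\<sigma> (basis_vec a) (\<Sum>g\<in>carrier G. basis_vec g) = basis_vec a \<one>"
      "\<sigma> (\<Sum>g\<in>carrier G. basis_vec g) (basis_vec a) = basis_vec a \<one>"
      using that unfolding FA_simps by auto
  qed
  \<comment> \<open>Since e_j e_l = 0 for distinct j and l, each double Sweedler sum collapses to a
    single one.\<close>
  have coc: "(\<Sum>j\<in>carrier G. ?J (a \<otimes> inv j, b \<otimes> inv j) * ?J (j, c)) = (\<Sum>k\<in>carrier G. ?J (b \<otimes> inv k, c \<otimes> inv k) * ?J (a, k))"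
    if abc: "a \<in> carrier G" "b \<in> carrier G" "c \<in> carrier G" for a b c
  proof -
    have "\<forall>h\<in>carrier FA. \<forall>g\<in>carrier FA. \<forall>l\<in>carrier FA.
        sweedler_form FA (\<lambda>h1 h2. sweedler_form FA (\<lambda>g1 g2. \<sigma> h1 g1 * \<sigma> (h2 \<otimes>\<^bsub>FA\<^esub> g2) l) g) h =
        sweedler_form FA (\<lambda>g1 g2. sweedler_form FA (\<lambda>l1 l2. \<sigma> g1 l1 * \<sigma> h (g2 \<otimes>\<^bsub>FA\<^esub> l2)) l) g"
      using \<sigma> unfolding hopf_2cocycle_def by blast
    then have "sweedler_form FA (\<lambda>h1 h2. sweedler_form FA (\<lambda>g1 g2. \<sigma> h1 g1 * \<sigma> (h2 \<otimes>\<^bsub>FA\<^esub> g2) (basis_vec c)) (basis_vec b)) (basis_vec a) =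
        sweedler_form FA (\<lambda>g1 g2. sweedler_form FA (\<lambda>l1 l2. \<sigma> g1 l1 * \<sigma> (basis_vec a) (g2 \<otimes>\<^bsub>FA\<^esub> l2)) (basis_vec c)) (basis_vec b)"
      using abc by (simp only: FA_simps(1) basis_vec_free_space)
    then have e: "(\<Sum>j\<in>carrier G. \<Sum>l\<in>carrier G. \<sigma> (basis_vec (a \<otimes> inv j)) (basis_vec (b \<otimes> inv l)) * \<sigma> (basis_vec j \<otimes>\<^bsub>FA\<^esub> basis_vec l) (basis_vec c)) =
      (\<Sum>k\<in>carrier G. \<Sum>l\<in>carrier G. \<sigma> (basis_vec (b \<otimes> inv k)) (basis_vec (c \<otimes> inv l)) * \<sigma> (basis_vec a) (basis_vec k \<otimes>\<^bsub>FA\<^esub> basis_vec l))"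
      using abc by (simp only: sweedler_form_basis)
    have "(\<Sum>l\<in>carrier G. \<sigma> (basis_vec (a \<otimes> inv j)) (basis_vec (b \<otimes> inv l)) * \<sigma> (basis_vec j \<otimes>\<^bsub>FA\<^esub> basis_vec l) (basis_vec c)) =
        ?J (a \<otimes> inv j, b \<otimes> inv j) * ?J (j, c)" if j: "j \<in> carrier G" for j
    proof -
      have "(\<Sum>l\<in>carrier G. \<sigma> (basis_vec (a \<otimes> inv j)) (basis_vec (b \<otimes> inv l)) * \<sigma> (basis_vec j \<otimes>\<^bsub>FA\<^esub> basis_vec l) (basis_vec c)) =
        (\<Sum>l\<in>carrier G. if l = j then \<sigma> (basis_vec (a \<otimes> inv j)) (basis_vec (b \<otimes> inv j)) * \<sigma> (basis_vec j) (basis_vec c) else 0)"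
        by (intro sum.cong refl) (simp add: FA_mult_basis zero abc)
      then show ?thesis using fin j abc by (simp add: twist_of_form_apply)
    qed
    moreover have "(\<Sum>l\<in>carrier G. \<sigma> (basis_vec (b \<otimes> inv k)) (basis_vec (c \<otimes> inv l)) * \<sigma> (basis_vec a) (basis_vec k \<otimes>\<^bsub>FA\<^esub> basis_vec l)) =
        ?J (b \<otimes> inv k, c \<otimes> inv k) * ?J (a, k)" if k: "k \<in> carrier G" for k
    proof -
      have "(\<Sum>l\<in>carrier G. \<sigma> (basis_vec (b \<otimes> inv k)) (basis_vec (c \<otimes> inv l)) * \<sigma> (basis_vec a) (basis_vec k \<otimes>\<^bsub>FA\<^esub> basis_vec l)) =
        (\<Sum>l\<in>carrier G. if l = k then \<sigma> (basis_vec (b \<otimes> inv k)) (basis_vec (c \<otimes> inv k)) * \<sigma> (basis_vec a) (basis_vec k) else 0)"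
        by (intro sum.cong refl) (simp add: FA_mult_basis zero abc)
      then show ?thesis using fin k abc by (simp add: twist_of_form_apply)
    qed
    ultimately show ?thesis using e by simp
  qed
  let ?PP = "carrier G \<times> carrier G"
  let ?l12 = "push ?PP (\<lambda>(a, b). (a, b, \<one>)) ?J" and ?l23 = "push ?PP (Pair \<one>) ?J"
  have l12: "?l12 (x, y, z) = (if z = \<one> then ?J (x, y) else 0)" for x y z
  proof (cases "z = \<one>")
    case True
    have "inj (\<lambda>(a :: 'a, b :: 'a). (a, b, \<one>))" by (auto simp: inj_def)
    then show ?thesis
      using push_embed_apply[of "\<lambda>(a, b). (a, b, \<one>)" ?PP ?J "(x, y)"] True fin twist_of_form_closed[of \<sigma>] by simp
  next
    case False
    then show ?thesis by (subst push_outside) auto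
  qed
  have l23: "?l23 (x, y, z) = (if x = \<one> then ?J (y, z) else 0)" for x y z
  proof (cases "x = \<one>")
    case True
    have "inj (Pair \<one> :: 'a \<times> 'a \<Rightarrow> _)" by (auto simp: inj_def)
    then show ?thesis
      using push_embed_apply[of "Pair \<one>" ?PP ?J "(y, z)"] True fin twist_of_form_closed[of \<sigma>] by simp
  next
    case False
    then show ?thesis by (subst push_outside) auto
  qed
  have "?l12 \<star>\<^bsub>G3\<^esub> push ?PP (\<lambda>(a, b). (a, a, b)) ?J = ?l23 \<star>\<^bsub>G3\<^esub> push ?PP (\<lambda>(a, b). (a, b, b)) ?J" (is "?L = ?R")
  proof
    fix k :: "'a \<times> 'a \<times> 'a"
    obtain a b c where k: "k = (a, b, c)" by (metis surj_pair)
    show "?L k = ?R k"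
    proof (cases "k \<in> carrier G \<times> ?PP")
      case True
      then have abc: "a \<in> carrier G" "b \<in> carrier G" "c \<in> carrier G" by (auto simp: k)
      have "?L k = (\<Sum>j\<in>carrier G. \<Sum>d\<in>carrier G. ?J (j, d) * ?l12 (a \<otimes> inv j, b \<otimes> inv j, c \<otimes> inv d))"
        unfolding push_def[of ?PP "\<lambda>(a, b). (a, a, b)"] gmult_lext_right lext_apply sum.cartesian_product
        using True by (intro sum.cong refl) (auto simp: G3.gmult_basis_right_apply G3_mult k)
      also have "\<dots> = (\<Sum>j\<in>carrier G. \<Sum>d\<in>carrier G. if d = c then ?J (a \<otimes> inv j, b \<otimes> inv j) * ?J (j, c) else 0)"
        by (intro sum.cong refl) (use abc in \<open>auto simp: l12 mult_inv_eq_one\<close>)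
      also have "\<dots> = (\<Sum>j\<in>carrier G. ?J (a \<otimes> inv j, b \<otimes> inv j) * ?J (j, c))"
        using fin abc by simp
      also have "\<dots> = (\<Sum>k\<in>carrier G. ?J (b \<otimes> inv k, c \<otimes> inv k) * ?J (a, k))"
        by (rule coc[OF abc])
      also have "\<dots> = (\<Sum>k\<in>carrier G. \<Sum>d\<in>carrier G. if d = a then ?J (b \<otimes> inv k, c \<otimes> inv k) * ?J (a, k) else 0)"
        using fin abc by simp
      also have "\<dots> = (\<Sum>d\<in>carrier G. \<Sum>k\<in>carrier G. ?J (d, k) * ?l23 (a \<otimes> inv d, b \<otimes> inv k, c \<otimes> inv k))"
        by (subst sum.swap, intro sum.cong refl) (use abc in \<open>auto simp: l23 mult_inv_eq_one\<close>)
      also have "\<dots> = ?R k"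
        unfolding push_def[of ?PP "\<lambda>(a, b). (a, b, b)"] gmult_lext_right lext_apply sum.cartesian_product
        using True by (intro sum.cong refl) (auto simp: G3.gmult_basis_right_apply G3_mult k)
      finally show ?thesis .
    next
      case False
      then show ?thesis using G3.gmult_closed[of ?l12 "push ?PP (\<lambda>(a, b). (a, a, b)) ?J"]
        G3.gmult_closed[of ?l23 "push ?PP (\<lambda>(a, b). (a, b, b)) ?J"] by (auto simp: free_space_def k)
    qed
  qed
  moreover have "push ?PP fst ?J = basis_vec \<one>"
  proof
    fix a
    show "push ?PP fst ?J a = basis_vec \<one> a"
    proof (cases "a \<in> carrier G")
      case True
      have "push ?PP fst ?J a = (\<Sum>i\<in>carrier G. \<Sum>b\<in>carrier G. if i = a then ?J (a, b) else 0)"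
        unfolding push_def lext_apply sum.cartesian_product by (intro sum.cong refl) (auto simp: basis_vec_apply)
      also have "\<dots> = (\<Sum>b\<in>carrier G. \<Sum>i\<in>carrier G. if i = a then ?J (a, b) else 0)" by (rule sum.swap)
      also have "\<dots> = (\<Sum>b\<in>carrier G. \<sigma> (basis_vec a) (basis_vec b))"
        using True fin by (simp add: twist_of_form_apply)
      also have "\<dots> = basis_vec a \<one>"
        using linear_form_on_sum[OF lin_form(2) subspace_free_space fin, of "basis_vec a" basis_vec] True normal(1)[OF True] by simp
      finally show ?thesis by (auto simp: basis_vec_apply)
    qed (use push_closed[of ?PP fst "carrier G" ?J] in \<open>auto simp: free_space_def basis_vec_apply\<close>)
  qed
  moreover have "push ?PP snd ?J = basis_vec \<one>"
  proof
    fix a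
    show "push ?PP snd ?J a = basis_vec \<one> a"
    proof (cases "a \<in> carrier G")
      case True
      have "push ?PP snd ?J a = (\<Sum>b\<in>carrier G. \<Sum>i\<in>carrier G. if i = a then ?J (b, a) else 0)"
        unfolding push_def lext_apply sum.cartesian_product by (intro sum.cong refl) (auto simp: basis_vec_apply)
      also have "\<dots> = (\<Sum>b\<in>carrier G. \<sigma> (basis_vec b) (basis_vec a))"
        using True fin by (simp add: twist_of_form_apply)
      also have "\<dots> = basis_vec a \<one>"
        using linear_form_on_sum[OF lin_form(1) subspace_free_space fin, of "basis_vec a" basis_vec] True normal(2)[OF True] by simp
      finally show ?thesis by (auto simp: basis_vec_apply)
    qed (use push_closed[of ?PP snd "carrier G" ?J] in \<open>auto simp: free_space_def basis_vec_apply\<close>)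
  qed
  ultimately have "group_twist G ?J ?K"
    using JK KJ twist_of_form_closed[of \<sigma>] twist_of_form_closed[of \<tau>]
    by unfold_locales
  then show ?thesis by (rule that)
qed

lemma S0_apply: "k \<in> carrier G \<Longrightarrow> S0 x k = x (inv k)"
proof -
  assume k: "k \<in> carrier G"
  have "S0 x k = (\<Sum>g\<in>carrier G. if g = inv k then x g else 0)"
    unfolding S0_def push_def lext_apply using k
    by (intro sum.cong refl) (auto simp: basis_vec_apply)
  then show ?thesis using k fin by simp
qed

text \<open>Left multiplication by \<open>v\<close> is injective, hence surjective in finite
  dimension. This supplies a right inverse, which must be \<open>w\<close>.\<close>

lemma left_inverse_imp_right_inverse:
  assumes "v \<in> free_space (carrier G)" "w \<in> free_space (carrier G)" "w \<star> v = basis_vec \<one>"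
  shows "v \<star> w = (basis_vec \<one> :: 'a \<Rightarrow> 'k::field)"
proof -
  have cancel: "w \<star> (v \<star> x) = x" if "x \<in> free_space (carrier G)" for x
    using that assms(3) by (simp add: gmult_assoc[symmetric] gmult_one_left)
  have "(\<lambda>x. v \<star> x) ` free_space (carrier G) = free_space (carrier G)"
    by (rule inj_endo_surj[OF fin order_refl subspace_free_space lin_gmult_right])
      (auto intro!: inj_on_inverseI[of _ "\<lambda>x. w \<star> x"] cancel)
  then obtain x where x: "x \<in> free_space (carrier G)" "v \<star> x = basis_vec \<one>"
    by (metis (no_types, lifting) basis_vec_free_space image_iff one_closed)
  have "x = w" using cancel[OF x(1)] assms(2) unfolding x(2) by (simp add: gmult_one_right)
  then show ?thesis using x(2) by simp
qed

end

section \<open>Twisted group algebras of abelian groups\<close>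

context abelian_cocycle
begin

abbreviation "TA \<equiv> twisted_group_algebra (G\<lparr>carrier := A\<rparr>) \<alpha>"

lemma cocycle_one_left: "s \<in> A \<Longrightarrow> \<alpha> \<one> s = \<alpha> \<one> \<one>"
  using cocycle[of \<one> \<one> s] cocycle_nz[of \<one> s] by (simp add: A_carrier)

lemma TA_mult: "x \<otimes>\<^bsub>TA\<^esub> y = lext A (\<lambda>s. lext A (\<lambda>t. fscale (\<alpha> s t) (basis_vec (s \<otimes> t))) y) x"
  by (simp add: twisted_group_algebra_def lext_def fscale_sum mult.assoc)

lemma TA_simps: "carrier TA = free_space A" "\<one>\<^bsub>TA\<^esub> = fscale (inverse (\<alpha> \<one> \<one>)) (basis_vec \<one>)"
  by (simp_all add: twisted_group_algebra_def)

lemma lin_TA: "lin (\<lambda>x. x \<otimes>\<^bsub>TA\<^esub> y)" "lin (\<lambda>y. x \<otimes>\<^bsub>TA\<^esub> y)"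
  unfolding TA_mult by (intro lin_lext lin_lext_arg)+

lemma TA_basis: "s \<in> A \<Longrightarrow> t \<in> A \<Longrightarrow> basis_vec s \<otimes>\<^bsub>TA\<^esub> basis_vec t = fscale (\<alpha> s t) (basis_vec (s \<otimes> t))"
  by (simp add: TA_mult finA del: fscale_apply)

lemma TA_closed: "x \<otimes>\<^bsub>TA\<^esub> y \<in> free_space A"
  unfolding TA_mult
  by (intro lext_closed[OF subspace_free_space] fun_space.subspace_scale[OF subspace_free_space] basis_vec_free_space) simp_all

lemma monoid_TA: "monoid TA"
proof (rule monoidI)
  show "x \<otimes>\<^bsub>TA\<^esub> y \<in> carrier TA" for x y using TA_closed by (simp add: TA_simps)
  show "\<one>\<^bsub>TA\<^esub> \<in> carrier TA"
    unfolding TA_simps by (intro fun_space.subspace_scale[OF subspace_free_space]) simp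
  fix x assume "x \<in> carrier TA"
  then have x: "x \<in> free_space A" by (simp add: TA_simps)
  show "\<one>\<^bsub>TA\<^esub> \<otimes>\<^bsub>TA\<^esub> x = x"
  proof (rule lin_eqI[OF lin_TA(2) lin_id finA x])
    fix t assume t: "t \<in> A"
    show "\<one>\<^bsub>TA\<^esub> \<otimes>\<^bsub>TA\<^esub> basis_vec t = basis_vec t"
      using t cocycle_one_left[OF t] cocycle_nz[of \<one> \<one>] by (simp add: TA_simps lin_scale[OF lin_TA(1)] TA_basis A_carrier)
  qed
  show "x \<otimes>\<^bsub>TA\<^esub> \<one>\<^bsub>TA\<^esub> = x"
  proof (rule lin_eqI[OF lin_TA(1) lin_id finA x])
    fix t assume t: "t \<in> A"
    show "basis_vec t \<otimes>\<^bsub>TA\<^esub> \<one>\<^bsub>TA\<^esub> = basis_vec t"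
      using t cocycle_one[OF t] cocycle_nz[of \<one> \<one>] by (simp add: TA_simps lin_scale[OF lin_TA(2)] TA_basis A_carrier)
  qed
  fix y z assume "y \<in> carrier TA" "z \<in> carrier TA"
  then have y: "y \<in> free_space A" and z: "z \<in> free_space A" by (simp_all add: TA_simps)
  show "x \<otimes>\<^bsub>TA\<^esub> y \<otimes>\<^bsub>TA\<^esub> z = x \<otimes>\<^bsub>TA\<^esub> (y \<otimes>\<^bsub>TA\<^esub> z)"
  proof (rule lin_eqI[OF lin_comp[OF lin_TA(1) lin_TA(1)] lin_TA(1) finA x])
    fix s assume s: "s \<in> A"
    show "basis_vec s \<otimes>\<^bsub>TA\<^esub> y \<otimes>\<^bsub>TA\<^esub> z = basis_vec s \<otimes>\<^bsub>TA\<^esub> (y \<otimes>\<^bsub>TA\<^esub> z)"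
    proof (rule lin_eqI[OF lin_comp[OF lin_TA(1) lin_TA(2)] lin_comp[OF lin_TA(2) lin_TA(1)] finA y])
      fix t assume t: "t \<in> A"
      show "basis_vec s \<otimes>\<^bsub>TA\<^esub> basis_vec t \<otimes>\<^bsub>TA\<^esub> z = basis_vec s \<otimes>\<^bsub>TA\<^esub> (basis_vec t \<otimes>\<^bsub>TA\<^esub> z)"
      proof (rule lin_eqI[OF lin_TA(2) lin_comp[OF lin_TA(2) lin_TA(2)] finA z])
        fix u assume u: "u \<in> A"
        show "basis_vec s \<otimes>\<^bsub>TA\<^esub> basis_vec t \<otimes>\<^bsub>TA\<^esub> basis_vec u = basis_vec s \<otimes>\<^bsub>TA\<^esub> (basis_vec t \<otimes>\<^bsub>TA\<^esub> basis_vec u)"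
          using s t u cocycle[OF s t u]
          by (simp add: TA_basis lin_scale[OF lin_TA(1)] lin_scale[OF lin_TA(2)] m_assoc A_carrier)
      qed
    qed
  qed
qed

text \<open>For abelian \<open>A\<close>, conjugation by x_s is diagonal in the basis x_t.
  Equivariance in the Galois object is thus a condition on each coefficient separately.\<close>

lemma twisted_conj_eq:
  assumes s: "s \<in> A" and y: "y \<in> free_space A"
  shows "twisted_conj (G\<lparr>carrier := A\<rparr>) \<alpha> s y = (\<lambda>t. bichar s t * y t)"
proof -
  interpret T: monoid TA by (rule monoid_TA)
  define Z where "Z y = lext A (\<lambda>t. fscale (bichar s t) (basis_vec t)) y" for y :: "'a \<Rightarrow> 'k"
  have lin_Z: "lin Z" unfolding Z_def[abs_def] by (rule lin_lext)
  have Z_closed: "Z y \<in> free_space A"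
    unfolding Z_def by (intro lext_closed[OF subspace_free_space] fun_space.subspace_scale[OF subspace_free_space]) simp
  have Z_apply: "Z y = (\<lambda>t. bichar s t * y t)"
  proof
    fix t
    have "Z y t = (\<Sum>a\<in>A. if a = t then bichar s t * y t else 0)"
      unfolding Z_def lext_apply by (intro sum.cong refl) (auto simp: basis_vec_apply)
    then show "Z y t = bichar s t * y t" using finA y by (auto simp: free_space_def)
  qed
  have comm: "basis_vec s \<otimes>\<^bsub>TA\<^esub> y = Z y \<otimes>\<^bsub>TA\<^esub> basis_vec s"
  proof (rule lin_eqI[OF lin_TA(2) lin_comp[OF lin_TA(1) lin_Z] finA y])
    fix t assume t: "t \<in> A"
    then show "basis_vec s \<otimes>\<^bsub>TA\<^esub> basis_vec t = Z (basis_vec t) \<otimes>\<^bsub>TA\<^esub> basis_vec s"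
      using s cocycle_nz[OF t s] comm[OF s t] by (simp add: Z_def finA lin_scale[OF lin_TA(1)] TA_basis bichar_def del: fscale_apply)
  qed
  \<comment> \<open>The inverse of x_s. The factor \<open>\<alpha> \<one> \<one>\<close> is there
    because the unit of \<open>TA\<close> is its inverse times x_1.\<close>
  define s' where "s' = fscale (inverse (\<alpha> (inv s) s * \<alpha> \<one> \<one>)) (basis_vec (inv s) :: 'a \<Rightarrow> 'k)"
  have "\<alpha> s (inv s) = \<alpha> (inv s) s"
    using bichar_inv(2)[OF s s] bichar_self[OF s] cocycle_nz[of "inv s" s] s by (simp add: bichar_def)
  then have "s' \<otimes>\<^bsub>TA\<^esub> basis_vec s = \<one>\<^bsub>TA\<^esub>" "basis_vec s \<otimes>\<^bsub>TA\<^esub> s' = \<one>\<^bsub>TA\<^esub>"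
    using s cocycle_nz[of "inv s" s] cocycle_nz[of \<one> \<one>]
    by (simp_all add: s'_def lin_scale[OF lin_TA(1)] lin_scale[OF lin_TA(2)] TA_basis TA_simps A_carrier)
  moreover have "s' \<in> carrier TA" "basis_vec s \<in> carrier TA"
    using s by (auto simp: TA_simps s'_def intro!: fun_space.subspace_scale[OF subspace_free_space])
  ultimately have unit: "basis_vec s \<in> Units TA" by (auto simp: Units_def)
  have "twisted_conj (G\<lparr>carrier := A\<rparr>) \<alpha> s y = Z y \<otimes>\<^bsub>TA\<^esub> basis_vec s \<otimes>\<^bsub>TA\<^esub> inv\<^bsub>TA\<^esub> (basis_vec s)"
    by (simp add: twisted_conj_def Let_def comm)
  also have "\<dots> = Z y \<otimes>\<^bsub>TA\<^esub> (basis_vec s \<otimes>\<^bsub>TA\<^esub> inv\<^bsub>TA\<^esub> (basis_vec s))"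
    by (rule T.m_assoc[OF _ T.Units_closed[OF unit] T.Units_inv_closed[OF unit]]) (simp add: TA_simps(1) Z_closed)
  also have "\<dots> = Z y"
    unfolding T.Units_r_inv[OF unit] by (rule T.r_one) (simp add: TA_simps(1) Z_closed)
  finally show ?thesis by (simp add: Z_apply)
qed

end

text \<open>
  By equivariance \<open>\<phi>(e\<^sub>c)(g) = \<Sum>\<^sub>t F\<^sub>t(c g\<^sup>-\<^sup>1) x\<^sub>t\<close> for suitable functions \<open>F\<^sub>t\<close>, and \<open>\<phi>\<close> being
  multiplicative says that \<open>v = \<Sum>\<^sub>t F\<^sub>t\<close> satisfies the gauge equation.
\<close>

lemma (in nondeg_cocycle) galois_gauge:
  assumes \<sigma>: "hopf_2cocycle FA \<sigma>"
    and \<phi>: "comodule_algebra_iso (cocycle_comodule_algebra FA \<sigma>) (galois_object G A \<alpha>) \<phi>"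
  obtains v w where "v \<in> free_space (carrier G)" "w \<in> free_space (carrier G)"
    "v \<star> w = basis_vec \<one>" "w \<star> v = basis_vec \<one>"
    "twist_of_form G \<sigma> \<star>\<^bsub>G2\<^esub> cop v = tensor v v \<star>\<^bsub>G2\<^esub> J0"
proof -
  let ?J = "twist_of_form G \<sigma>"
  define CA where "CA = cocycle_comodule_algebra FA \<sigma>"
  define GO where "GO = galois_object G A \<alpha>"
  have CA: "carrier CA = free_space (carrier G)" "coaction CA = comult FA"
    "x \<otimes>\<^bsub>CA\<^esub> y = sweedler FA (\<lambda>h1 h2. sweedler FA (\<lambda>g1 g2. fscale (\<sigma> h1 g1) (h2 \<otimes>\<^bsub>FA\<^esub> g2)) y) x" for x y
    by (simp_all add: CA_def cocycle_comodule_algebra_def FA_simps)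
  have GO_carrier: "carrier GO = {f \<in> free_space (carrier G \<times> A).
             \<forall>s\<in>A. \<forall>g\<in>carrier G. curry f (s \<otimes> g) = twisted_conj (G\<lparr>carrier := A\<rparr>) \<alpha> s (curry f g)}"
    and GO_mult: "f \<otimes>\<^bsub>GO\<^esub> f' = (\<lambda>(g, s). if g \<in> carrier G then (curry f g \<otimes>\<^bsub>TA\<^esub> curry f' g) s else 0)"
    and GO_coaction: "coaction GO f = (\<lambda>((h, s), g). if h \<in> carrier G \<and> g \<in> carrier G then f (h \<otimes> g, s) else 0)" for f f'
    by (simp_all add: GO_def galois_object_def Let_def)
  have iso: "\<phi> \<in> iso CA GO" and lin: "linear_map_on (free_space (carrier G)) \<phi>"
    and colin: "\<And>a. a \<in> free_space (carrier G) \<Longrightarrow> coaction GO (\<phi> a) = map_tensor_id \<phi> (comult FA a)"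
    using \<phi> by (auto simp: comodule_algebra_iso_def CA_def[symmetric] GO_def[symmetric] CA)
  have \<phi>_GO: "\<phi> a \<in> carrier GO" if "a \<in> free_space (carrier G)" for a
    using iso that by (auto simp: iso_def hom_def CA)
  have \<phi>_mult: "\<phi> (a \<otimes>\<^bsub>CA\<^esub> b) = \<phi> a \<otimes>\<^bsub>GO\<^esub> \<phi> b" if "a \<in> free_space (carrier G)" "b \<in> free_space (carrier G)" for a b
    using iso that by (auto simp: iso_def hom_def CA)
  have \<phi>_inj: "inj_on \<phi> (free_space (carrier G))"
    using iso by (auto simp: iso_def bij_betw_def CA)
  \<comment> \<open>Colinearity of \<phi>: the slice of the coproduct of e_c with second leg at g is
    the basis vector at c g^-1.\<close>
  have shift: "\<phi> (basis_vec c) (h \<otimes> g, s) = \<phi> (basis_vec (c \<otimes> inv g)) (h, s)"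
    if "c \<in> carrier G" "h \<in> carrier G" "g \<in> carrier G" for c h g s
  proof -
    have e: "(\<lambda>i. comult FA (basis_vec c) (i, g)) = basis_vec (c \<otimes> inv g)"
      using that by (auto simp: FA_simps basis_vec_apply fun_eq_iff mult_eq_iff m_assoc)
    have "\<phi> (basis_vec c) (h \<otimes> g, s) = \<phi> (\<lambda>i. comult FA (basis_vec c) (i, g)) (h, s)"
      using fun_cong[OF colin[of "basis_vec c"], of "((h, s), g)"] that by (simp add: GO_coaction map_tensor_id_def)
    also have "\<dots> = \<phi> (basis_vec (c \<otimes> inv g)) (h, s)"
      by (rule arg_cong[OF e, of "\<lambda>x. \<phi> x (h, s)"])
    finally show ?thesis .
  qed
  define F where "F t c = (if c \<in> carrier G then \<phi> (basis_vec c) (\<one>, t) else 0)" for t c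
  have F_closed: "F t \<in> free_space (carrier G)" for t by (simp add: F_def free_space_def)
  have \<phi>_F: "\<phi> (basis_vec c) (g, t) = F t (c \<otimes> inv g)" if "c \<in> carrier G" "g \<in> carrier G" for c g t
    using shift[of c \<one> g t] that by (simp add: F_def)
  have curry_free: "curry (\<phi> (basis_vec c)) g \<in> free_space A" if "c \<in> carrier G" for c g
  proof -
    have "\<phi> (basis_vec c) \<in> free_space (carrier G \<times> A)"
      using \<phi>_GO[OF basis_vec_free_space[OF that]] unfolding GO_carrier by blast
    then show ?thesis by (auto simp: free_space_def)
  qed
  \<comment> \<open>The value of \<open>\<phi> (basis_vec c)\<close> at s is computed twice, by
    \<open>\<phi>_F\<close> and by equivariance.\<close>
  have F_equiv: "F t (c \<otimes> inv s) = bichar s t * F t c" if "c \<in> carrier G" "s \<in> A" for s t c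
  proof -
    have "curry (\<phi> (basis_vec c)) (s \<otimes> \<one>) = twisted_conj (G\<lparr>carrier := A\<rparr>) \<alpha> s (curry (\<phi> (basis_vec c)) \<one>)"
      using \<phi>_GO[OF basis_vec_free_space[OF that(1)]] that(2) unfolding GO_carrier by blast
    also have "\<dots> = (\<lambda>t. bichar s t * curry (\<phi> (basis_vec c)) \<one> t)"
      by (rule twisted_conj_eq[OF that(2) curry_free[OF that(1)]])
    finally have "\<phi> (basis_vec c) (s \<otimes> \<one>, t) = bichar s t * \<phi> (basis_vec c) (\<one>, t)"
      by (auto simp: fun_eq_iff)
    then show ?thesis using that \<phi>_F[of c s t] by (simp add: A_carrier F_def)
  qed
  have F_basis: "F t \<star> basis_vec s = fscale (bichar s t) (F t)" if s: "s \<in> A" for s t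
  proof
    fix c
    show "(F t \<star> basis_vec s) c = fscale (bichar s t) (F t) c"
    proof (cases "c \<in> carrier G")
      case True
      then show ?thesis by (simp add: gmult_basis_right_apply A_carrier s F_equiv)
    next
      case False
      then show ?thesis using gmult_closed[of "F t" "basis_vec s"] F_closed[of t] by (simp add: free_space_def)
    qed
  qed
  define v where "v = (\<Sum>t\<in>A. F t)"
  have v_closed: "v \<in> free_space (carrier G)"
    unfolding v_def by (intro fun_space.subspace_sum[OF subspace_free_space] F_closed)
  \<comment> \<open>By \<open>F_basis\<close>, right multiplication by \<open>A\<close> acts on
    \<open>F t\<close> through the character of t, so \<open>E u\<close> extracts the summand
    \<open>F u\<close>.\<close>
  have v_E: "v \<star> E u = F u" if u: "u \<in> A" for u
  proof -
    have "F t \<star> E u = (if t = u then F u else 0)" if t: "t \<in> A" for t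
    proof -
      have "F t \<star> E u = fscale (1 / of_nat (card A)) (\<Sum>s\<in>A. fscale (inverse (bichar s u) * bichar s t) (F t))"
        unfolding E_def lin_scale[OF lin_gmult_right] lin_sum[OF lin_gmult_right] by (simp add: F_basis)
      also have "\<dots> = fscale (1 / of_nat (card A) * (\<Sum>s\<in>A. inverse (bichar s u) * bichar s t)) (F t)"
        by (simp add: fscale_sum_left[symmetric])
      also have "\<dots> = (if t = u then F u else 0)"
        using card_A_nz t u by (auto simp: sum_bichar_delta)
      finally show ?thesis .
    qed
    then have "v \<star> E u = (\<Sum>t\<in>A. if t = u then F u else 0)"
      unfolding v_def lin_sum[OF lin_gmult_left] by (intro sum.cong refl) simp
    then show ?thesis using finA u by simp
  qed

  \<comment> \<open>Multiplicativity of \<phi> on e_c and e_d, read off at the point (1, u): on the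
    left the product deformed by \<sigma>, on the right the product of \<open>TA\<close>.\<close>
  have mult_eq: "(\<Sum>j\<in>carrier G. ?J (c \<otimes> inv j, d \<otimes> inv j) * F u j) =
      (\<Sum>s\<in>A. \<Sum>t\<in>A. if s \<otimes> t = u then \<alpha> s t * F s c * F t d else 0)"
    if c: "c \<in> carrier G" and d: "d \<in> carrier G" for c d u
  proof -
    have "basis_vec c \<otimes>\<^bsub>CA\<^esub> basis_vec d = (\<Sum>j\<in>carrier G. \<Sum>l\<in>carrier G.
        fscale (\<sigma> (basis_vec (c \<otimes> inv j)) (basis_vec (d \<otimes> inv l))) (basis_vec j \<otimes>\<^bsub>FA\<^esub> basis_vec l))"
      using c d unfolding CA by (simp only: sweedler_basis)
    also have "\<dots> = (\<Sum>j\<in>carrier G. \<Sum>l\<in>carrier G. if l = j then fscale (?J (c \<otimes> inv j, d \<otimes> inv j)) (basis_vec j) else 0)"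
      using c d by (intro sum.cong refl) (simp add: FA_mult_basis twist_of_form_apply)
    also have "\<dots> = (\<Sum>j\<in>carrier G. fscale (?J (c \<otimes> inv j, d \<otimes> inv j)) (basis_vec j))"
      using fin by simp
    finally have prod: "basis_vec c \<otimes>\<^bsub>CA\<^esub> basis_vec d = (\<Sum>j\<in>carrier G. fscale (?J (c \<otimes> inv j, d \<otimes> inv j)) (basis_vec j))" .
    have "\<phi> (basis_vec c \<otimes>\<^bsub>CA\<^esub> basis_vec d) = (\<Sum>j\<in>carrier G. \<phi> (fscale (?J (c \<otimes> inv j, d \<otimes> inv j)) (basis_vec j)))"
      unfolding prod
      by (rule linear_map_on_sum[OF lin subspace_free_space]) (auto intro: fun_space.subspace_scale[OF subspace_free_space])
    also have "\<dots> = (\<Sum>j\<in>carrier G. fscale (?J (c \<otimes> inv j, d \<otimes> inv j)) (\<phi> (basis_vec j)))"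
      using lin by (intro sum.cong refl) (simp add: linear_map_on_def)
    finally have "(\<Sum>j\<in>carrier G. fscale (?J (c \<otimes> inv j, d \<otimes> inv j)) (\<phi> (basis_vec j))) = \<phi> (basis_vec c) \<otimes>\<^bsub>GO\<^esub> \<phi> (basis_vec d)"
      using \<phi>_mult[of "basis_vec c" "basis_vec d"] c d by simp
    from fun_cong[OF this, of "(\<one>, u)"]
    have "(\<Sum>j\<in>carrier G. ?J (c \<otimes> inv j, d \<otimes> inv j) * F u j) = (curry (\<phi> (basis_vec c)) \<one> \<otimes>\<^bsub>TA\<^esub> curry (\<phi> (basis_vec d)) \<one>) u"
      by (simp add: sum_fun_apply GO_mult F_def)
    also have "\<dots> = (\<Sum>s\<in>A. \<Sum>t\<in>A. if s \<otimes> t = u then \<alpha> s t * F s c * F t d else 0)"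
      unfolding TA_mult lext_apply sum_distrib_left using c d
      by (intro sum.cong refl) (auto simp: basis_vec_apply F_def mult_ac)
    finally show ?thesis .
  qed
  have cop_apply: "(?J \<star>\<^bsub>G2\<^esub> cop x) (c, d) = (\<Sum>j\<in>carrier G. ?J (c \<otimes> inv j, d \<otimes> inv j) * x j)"
    if "c \<in> carrier G" "d \<in> carrier G" for c d and x :: "'a \<Rightarrow> 'k"
  proof -
    interpret G2: fin_group G2
      rewrites "carrier G2 = carrier G \<times> carrier G" and "\<one>\<^bsub>G2\<^esub> = (\<one>, \<one>)"
      by (rule fin_group_G2) (simp_all add: DirProd_def)
    show ?thesis
      unfolding cop_def push_def gmult_lext_right lext_apply using that
      by (intro sum.cong refl) (simp add: G2.gmult_basis_right_apply G2_mult)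
  qed
  have gauge: "?J \<star>\<^bsub>G2\<^esub> cop v = tensor v v \<star>\<^bsub>G2\<^esub> J0"
  proof -
    have R: "tensor v v \<star>\<^bsub>G2\<^esub> J0 = (\<Sum>s\<in>A. \<Sum>t\<in>A. fscale (\<alpha> s t) (tensor (F s) (F t)))"
      unfolding J0_def dg2_def gmult_lext_right unfolding lext_def sum.cartesian_product
      by (intro sum.cong refl) (auto simp: gmult_tensor[OF fin_group_G fin_group_G] v_E)
    show ?thesis
    proof
      fix k :: "'a \<times> 'a"
      obtain c d where k: "k = (c, d)" by force
      show "(?J \<star>\<^bsub>G2\<^esub> cop v) k = (tensor v v \<star>\<^bsub>G2\<^esub> J0) k"
      proof (cases "c \<in> carrier G \<and> d \<in> carrier G")
        case True
        have "(?J \<star>\<^bsub>G2\<^esub> cop v) k = (\<Sum>u\<in>A. \<Sum>j\<in>carrier G. ?J (c \<otimes> inv j, d \<otimes> inv j) * F u j)"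
          using True unfolding k by (simp add: cop_apply v_def sum_fun_apply sum_distrib_left sum.swap[of _ A])
        also have "\<dots> = (\<Sum>u\<in>A. \<Sum>s\<in>A. \<Sum>t\<in>A. if s \<otimes> t = u then \<alpha> s t * F s c * F t d else 0)"
          using True by (simp add: mult_eq)
        also have "\<dots> = (\<Sum>s\<in>A. \<Sum>u\<in>A. \<Sum>t\<in>A. if s \<otimes> t = u then \<alpha> s t * F s c * F t d else 0)"
          by (rule sum.swap)
        also have "\<dots> = (\<Sum>s\<in>A. \<Sum>t\<in>A. \<Sum>u\<in>A. if s \<otimes> t = u then \<alpha> s t * F s c * F t d else 0)"
          by (intro sum.cong refl sum.swap)
        also have "\<dots> = (\<Sum>s\<in>A. \<Sum>t\<in>A. \<alpha> s t * F s c * F t d)"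
          using finA by (intro sum.cong refl) simp
        finally show ?thesis unfolding R k by (simp add: sum_fun_apply mult.assoc)
      next
        case False
        then show ?thesis
          using fin_group.gmult_closed[OF fin_group_G2, of ?J "cop v"] fin_group.gmult_closed[OF fin_group_G2, of "tensor v v" J0]
          by (auto simp: free_space_def k DirProd_def)
      qed
    qed
  qed

  \<comment> \<open>Invertibility of v comes from injectivity of \<phi>. \<open>L\<close> pairs the
    right translates of f with v; it will be injective, hence surjective, and if \<open>L f\<close>
    is the basis vector at 1, then \<open>S0 f\<close> is a left inverse of v.\<close>
  define L where "L f = (\<lambda>g. if g \<in> carrier G then \<Sum>c\<in>carrier G. f (c \<otimes> g) * v c else 0)" for f :: "'a \<Rightarrow> 'k"
  have lin_L: "Defs.linear_map_on UNIV L"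
    by (rule linI) (auto simp: L_def fun_eq_iff distrib_right sum.distrib sum_distrib_left mult.assoc)
  have L_zero: "f = 0" if f: "f \<in> free_space (carrier G)" "L f = 0" for f
  proof -
    have Lf: "(\<Sum>c\<in>carrier G. f (c \<otimes> g) * v c) = 0" if "g \<in> carrier G" for g
      using fun_cong[OF f(2), of g] that by (simp add: L_def)
    \<comment> \<open>Replacing g by s g amounts to replacing v by v s. Each \<open>F u\<close> is a
      combination of such elements, so all translates of f pair to 0 with every \<open>F u\<close>,
      which means \<phi> f = 0.\<close>
    have vs: "(\<Sum>c\<in>carrier G. f (c \<otimes> g) * (v \<star> basis_vec s) c) = 0" if "g \<in> carrier G" "s \<in> A" for g s
    proof -
      have "(\<Sum>c\<in>carrier G. f (c \<otimes> g) * (v \<star> basis_vec s) c) = (\<Sum>c\<in>carrier G. f (c \<otimes> g) * v (c \<otimes> inv s))"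
        using that by (intro sum.cong refl) (simp add: gmult_basis_right_apply A_carrier)
      also have "\<dots> = (\<Sum>c\<in>carrier G. f (c \<otimes> (s \<otimes> g)) * v c)"
        by (rule sum.reindex_bij_witness[of _ "\<lambda>c. c \<otimes> s" "\<lambda>c. c \<otimes> inv s"])
          (use that A_carrier[OF that(2)] in \<open>simp_all add: m_assoc, simp_all add: m_assoc[symmetric]\<close>)
      finally show ?thesis using Lf[of "s \<otimes> g"] that A_carrier by simp
    qed
    have FS: "(\<Sum>c\<in>carrier G. f (c \<otimes> g) * F u c) = 0" if "g \<in> carrier G" "u \<in> A" for g u
    proof -
      have "F u = fscale (1 / of_nat (card A)) (\<Sum>s\<in>A. fscale (inverse (bichar s u)) (v \<star> basis_vec s))"
        unfolding v_E[OF that(2), symmetric] E_def lin_scale[OF lin_gmult_right] lin_sum[OF lin_gmult_right] ..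
      then have "(\<Sum>c\<in>carrier G. f (c \<otimes> g) * F u c) =
          (\<Sum>s\<in>A. \<Sum>c\<in>carrier G. 1 / of_nat (card A) * inverse (bichar s u) * (f (c \<otimes> g) * (v \<star> basis_vec s) c))"
        by (subst sum.swap) (simp add: sum_fun_apply sum_distrib_left mult_ac)
      also have "\<dots> = 0"
        unfolding sum_distrib_left[symmetric] using vs that by simp
      finally show ?thesis .
    qed
    have "\<phi> f = 0"
    proof
      fix k :: "'a \<times> 'a"
      obtain g u where k: "k = (g, u)" by force
      show "\<phi> f k = 0 k"
      proof (cases "g \<in> carrier G \<and> u \<in> A")
        case True
        have "\<phi> f k = (\<Sum>c\<in>carrier G. f c * F u (c \<otimes> inv g))"
          using linear_map_on_expand[OF lin fin f(1)] True by (simp add: lext_apply k \<phi>_F)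
        also have "\<dots> = (\<Sum>c\<in>carrier G. f (c \<otimes> g) * F u c)"
          by (rule sum.reindex_bij_witness[of _ "\<lambda>c. c \<otimes> g" "\<lambda>c. c \<otimes> inv g"]) (use True in \<open>simp_all add: m_assoc\<close>)
        finally show ?thesis using FS[of g u] True by simp
      next
        case False
        then show ?thesis using \<phi>_GO[OF f(1)] by (auto simp: GO_carrier free_space_def k)
      qed
    qed
    moreover have "\<phi> 0 = 0"
    proof -
      have "\<phi> (fscale 0 0) = fscale 0 (\<phi> 0)"
        using lin fun_space.subspace_0[OF subspace_free_space] unfolding linear_map_on_def by blast
      then show ?thesis by (simp only: fscale_zero)
    qed
    ultimately show "f = 0"
      using inj_onD[OF \<phi>_inj _ f(1) fun_space.subspace_0[OF subspace_free_space]] by simp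
  qed
  have "L ` free_space (carrier G) = free_space (carrier G)"
  proof (rule inj_endo_surj[OF fin order_refl subspace_free_space lin_L])
    show "L ` free_space (carrier G) \<subseteq> free_space (carrier G)" by (auto simp: L_def free_space_def)
    show "inj_on L (free_space (carrier G))"
    proof (rule inj_onI)
      fix x y :: "'a \<Rightarrow> 'k" assume xy: "x \<in> free_space (carrier G)" "y \<in> free_space (carrier G)" "L x = L y"
      have "L (x - y) = 0" using lin_diff[OF lin_L, of x y] xy(3) by simp
      from L_zero[OF fun_space.subspace_diff[OF subspace_free_space xy(1,2)] this] show "x = y" by simp
    qed
  qed
  then obtain f where f: "f \<in> free_space (carrier G)" "L f = basis_vec \<one>"
    by (metis (no_types, lifting) basis_vec_free_space image_iff one_closed)
  have wv: "S0 f \<star> v = basis_vec \<one>"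
  proof
    fix k
    show "(S0 f \<star> v) k = basis_vec \<one> k"
    proof (cases "k \<in> carrier G")
      case True
      have "(S0 f \<star> v) k = L f (inv k)"
        using True by (simp add: gmult_apply S0_apply inv_mult_group L_def)
      then show ?thesis using True by (auto simp: f(2) basis_vec_apply)
    next
      case False
      then show ?thesis using gmult_closed[of "S0 f" v] by (auto simp: free_space_def basis_vec_apply)
    qed
  qed
  show ?thesis
    by (rule that[OF v_closed S0_closed left_inverse_imp_right_inverse[OF v_closed S0_closed wv] wv gauge])
qed

section \<open>Nonabelian groups of order \<open>pq\<close>\<close>

context group
begin

lemma mult_inv_cancel_right:
  assumes "x \<in> carrier G" "y \<in> carrier G" "u \<in> carrier G"
  shows "(x \<otimes> u) \<otimes> inv (y \<otimes> u) = x \<otimes> inv y"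
proof -
  have "(x \<otimes> u) \<otimes> inv (y \<otimes> u) = x \<otimes> (u \<otimes> inv u) \<otimes> inv y"
    using assms by (simp only: inv_mult_group m_assoc m_closed inv_closed)
  then show ?thesis using assms by simp
qed

text \<open>By Lagrange, the order of X \<inter> D is 1 or that of X, and the nontrivial element x
  excludes 1.\<close>

lemma prime_subgroup_subset:
  assumes "subgroup X G" "prime (card X)" "x \<in> X" "x \<noteq> \<one>" "subgroup D G" "x \<in> D"
  shows "X \<subseteq> D"
proof -
  have "finite X" using assms(2) by (metis card.infinite not_prime_0)
  have sub: "subgroup (X \<inter> D) (G\<lparr>carrier := X\<rparr>)"
    using subgroup_incl[OF subgroups_Inter_pair[OF assms(1,5)] assms(1)] by simp
  from group.lagrange[OF subgroup.subgroup_is_group[OF assms(1) group_axioms] sub]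
  have "card X = card (rcosets\<^bsub>G\<lparr>carrier := X\<rparr>\<^esub> (X \<inter> D)) * card (X \<inter> D)"
    by (simp add: Coset.order_def)
  then have "card (X \<inter> D) dvd card X" by (metis dvd_triv_right)
  moreover have "card (X \<inter> D) \<noteq> 1"
  proof
    assume "card (X \<inter> D) = 1"
    then obtain y where "X \<inter> D = {y}" by (auto simp: card_1_singleton_iff)
    moreover have "x \<in> X \<inter> D" "\<one> \<in> X \<inter> D"
      using assms(3,6) subgroup.one_closed[OF assms(1)] subgroup.one_closed[OF assms(5)] by blast+
    ultimately show False using assms(4) by auto
  qed
  ultimately have "card (X \<inter> D) = card X" using assms(2) by (auto simp: prime_nat_iff)
  then have "X \<inter> D = X" using \<open>finite X\<close> by (intro card_subset_eq) auto
  then show ?thesis by blast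
qed

definition centralizer :: "'a set \<Rightarrow> 'a set" where
  "centralizer X = {g \<in> carrier G. \<forall>x\<in>X. g \<otimes> x = x \<otimes> g}"

lemma subgroup_centralizer:
  assumes "X \<subseteq> carrier G"
  shows "subgroup (centralizer X) G"
proof (rule subgroupI)
  show "centralizer X \<subseteq> carrier G" by (auto simp: centralizer_def)
  show "centralizer X \<noteq> {}" using assms by (auto simp: centralizer_def intro!: exI[of _ \<one>])
  fix a assume a: "a \<in> centralizer X"
  then have aG: "a \<in> carrier G" by (auto simp: centralizer_def)
  have "inv a \<otimes> x = x \<otimes> inv a" if x: "x \<in> X" for x
  proof -
    have xG: "x \<in> carrier G" using x assms by blast
    have "inv a \<otimes> x = inv a \<otimes> (x \<otimes> a) \<otimes> inv a" using xG aG by (simp add: m_assoc)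
    also have "x \<otimes> a = a \<otimes> x" using a x by (auto simp: centralizer_def)
    also have "inv a \<otimes> (a \<otimes> x) \<otimes> inv a = x \<otimes> inv a" using xG aG by (simp add: m_assoc[symmetric])
    finally show ?thesis .
  qed
  then show "inv a \<in> centralizer X" using aG by (auto simp: centralizer_def)
  fix b assume b: "b \<in> centralizer X"
  then have bG: "b \<in> carrier G" by (auto simp: centralizer_def)
  have "a \<otimes> b \<otimes> x = x \<otimes> (a \<otimes> b)" if x: "x \<in> X" for x
  proof -
    have xG: "x \<in> carrier G" using x assms by blast
    have "a \<otimes> b \<otimes> x = a \<otimes> (b \<otimes> x)" using xG aG bG by (simp add: m_assoc)
    also have "b \<otimes> x = x \<otimes> b" using b x by (auto simp: centralizer_def)
    also have "a \<otimes> (x \<otimes> b) = (a \<otimes> x) \<otimes> b" using xG aG bG by (simp add: m_assoc)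
    also have "a \<otimes> x = x \<otimes> a" using a x by (auto simp: centralizer_def)
    finally show ?thesis using xG aG bG by (simp add: m_assoc)
  qed
  then show "a \<otimes> b \<in> centralizer X" using aG bG by (auto simp: centralizer_def)
qed

lemma prime_subgroup_commutative:
  assumes X: "subgroup X G" "prime (card X)" and xy: "x \<in> X" "y \<in> X"
  shows "x \<otimes> y = y \<otimes> x"
proof (cases "x = \<one>")
  case True
  then show ?thesis using subgroup.mem_carrier[OF X(1) xy(2)] by simp
next
  case False
  have x: "x \<in> carrier G" by (rule subgroup.mem_carrier[OF X(1) xy(1)])
  have "X \<subseteq> centralizer {x}"
    by (rule prime_subgroup_subset[OF X xy(1) False subgroup_centralizer]) (use x in \<open>auto simp: centralizer_def\<close>)
  then show ?thesis using xy(2) by (auto simp: centralizer_def)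
qed

end

locale nonabelian_pq = group K for K (structure) +
  fixes P Q :: "'a set" and p q :: nat
  assumes P: "P \<lhd> K" and Q: "subgroup Q K" and PQ: "P <#> Q = carrier K"
    and prime_p: "prime p" and prime_q: "prime q" and pq: "p \<noteq> q"
    and card_P: "card P = p" and card_Q: "card Q = q"
    and nonabelian: "\<not> comm_group K"
begin

lemmas subP = normal_imp_subgroup[OF P]

lemma P_carrier: "a \<in> P \<Longrightarrow> a \<in> carrier K" and Q_carrier: "b \<in> Q \<Longrightarrow> b \<in> carrier K"
  using subgroup.mem_carrier[OF subP] subgroup.mem_carrier[OF Q] by blast+

lemma P_closed: "a \<in> P \<Longrightarrow> b \<in> P \<Longrightarrow> a \<otimes> b \<in> P" "a \<in> P \<Longrightarrow> inv a \<in> P" "\<one> \<in> P"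
  using subP by (auto intro: subgroup.m_closed subgroup.m_inv_closed subgroup.one_closed)

lemma P_conj: "g \<in> carrier K \<Longrightarrow> a \<in> P \<Longrightarrow> g \<otimes> a \<otimes> inv g \<in> P"
  by (rule normal.inv_op_closed2[OF P])

lemma decompose:
  assumes "g \<in> carrier K"
  obtains a b where "a \<in> P" "b \<in> Q" "g = a \<otimes> b"
proof -
  have "g \<in> P <#> Q" using assms PQ by simp
  then show ?thesis using that by (auto simp: set_mult_def)
qed

lemma carrier_subset:
  assumes "subgroup D K" "P \<subseteq> D" "Q \<subseteq> D"
  shows "carrier K \<subseteq> D"
proof
  fix g assume "g \<in> carrier K"
  then obtain a b where "a \<in> P" "b \<in> Q" "g = a \<otimes> b" by (rule decompose)
  then show "g \<in> D" using assms subgroup.m_closed by fastforce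
qed

lemma finite_carrier: "finite (carrier K)"
proof -
  have "finite P" "finite Q" using card_P card_Q prime_p prime_q card.infinite not_prime_0 by metis+
  moreover have "carrier K = (\<lambda>(a, b). a \<otimes> b) ` (P \<times> Q)" unfolding PQ[symmetric] by (auto simp: set_mult_def)
  ultimately show ?thesis by simp
qed

lemma P_subset: "subgroup D K \<Longrightarrow> a \<in> P \<Longrightarrow> a \<noteq> \<one> \<Longrightarrow> a \<in> D \<Longrightarrow> P \<subseteq> D"
  using prime_subgroup_subset[OF subP] card_P prime_p by blast

lemma Q_subset: "subgroup D K \<Longrightarrow> b \<in> Q \<Longrightarrow> b \<noteq> \<one> \<Longrightarrow> b \<in> D \<Longrightarrow> Q \<subseteq> D"
  using prime_subgroup_subset[OF Q] card_Q prime_q by blast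

lemma P_comm: "a \<in> P \<Longrightarrow> b \<in> P \<Longrightarrow> a \<otimes> b = b \<otimes> a"
  using prime_subgroup_commutative[OF subP] card_P prime_p by blast

lemma Q_comm: "a \<in> Q \<Longrightarrow> b \<in> Q \<Longrightarrow> a \<otimes> b = b \<otimes> a"
  using prime_subgroup_commutative[OF Q] card_Q prime_q by blast

text \<open>If one nontrivial a commuted with one nontrivial b, primality would make all of P
  commute with all of Q. Both are commutative and together they generate K, which would be
  abelian.\<close>

lemma PQ_not_commute:
  assumes a: "a \<in> P" "a \<noteq> \<one>" and b: "b \<in> Q" "b \<noteq> \<one>"
  shows "a \<otimes> b \<noteq> b \<otimes> a"
proof
  assume ab: "a \<otimes> b = b \<otimes> a"
  note aK = P_carrier[OF a(1)] and bK = Q_carrier[OF b(1)]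
  have PK: "P \<subseteq> carrier K" and QK: "Q \<subseteq> carrier K" using P_carrier Q_carrier by blast+
  have "P \<subseteq> centralizer {b}"
    by (rule P_subset[OF subgroup_centralizer a]) (use aK bK ab in \<open>auto simp: centralizer_def\<close>)
  then have "b \<in> centralizer P" using bK by (auto simp: centralizer_def)
  then have QP: "Q \<subseteq> centralizer P" by (rule Q_subset[OF subgroup_centralizer[OF PK] b])
  have "P \<subseteq> centralizer P" using PK P_comm by (auto simp: centralizer_def)
  from carrier_subset[OF subgroup_centralizer[OF PK] this QP] have "P \<subseteq> centralizer (carrier K)"
    using PK by (fastforce simp: centralizer_def)
  moreover have "P \<subseteq> centralizer Q" using QP PK QK by (fastforce simp: centralizer_def)
  moreover have "Q \<subseteq> centralizer Q" using QK Q_comm by (auto simp: centralizer_def)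
  ultimately have "P \<subseteq> centralizer (carrier K)" "Q \<subseteq> centralizer (carrier K)"
    using carrier_subset[OF subgroup_centralizer[OF QK]] QK by (fastforce simp: centralizer_def)+
  from carrier_subset[OF subgroup_centralizer[OF order_refl] this]
  have "comm_group K" by (intro group_comm_groupI) (auto simp: centralizer_def)
  then show False using nonabelian by contradiction
qed

lemma torsion_P:
  assumes "a \<in> P" "a [^] q = \<one>"
  shows "a = \<one>"
proof -
  have "a [^] p = \<one>"
    using group.pow_order_eq_1[OF subgroup.subgroup_is_group[OF subP group_axioms], of a] assms(1) card_P
    by (simp add: Coset.order_def nat_pow_consistent[symmetric])
  then have "ord a dvd p" "ord a dvd q" using assms P_carrier by (auto simp: pow_eq_id)
  then have "ord a = 1" using prime_p prime_q pq by (metis prime_nat_iff not_prime_1)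
  then show ?thesis using ord_eq_1[OF P_carrier[OF assms(1)]] by blast
qed

lemma centralizes_P:
  assumes a: "a \<in> P" "a \<noteq> \<one>" and y: "y \<in> carrier K" "y \<otimes> a = a \<otimes> y"
  shows "y \<in> P"
proof -
  obtain c d where cd: "c \<in> P" "d \<in> Q" "y = c \<otimes> d" using y(1) by (rule decompose)
  note K = P_carrier[OF a(1)] P_carrier[OF cd(1)] Q_carrier[OF cd(2)]
  have "c \<otimes> (d \<otimes> a) = a \<otimes> c \<otimes> d" using y(2) cd(3) K by (simp add: m_assoc)
  also have "\<dots> = c \<otimes> (a \<otimes> d)" using P_comm[OF a(1) cd(1)] K by (simp add: m_assoc)
  finally have "d \<otimes> a = a \<otimes> d" using K by simp
  then have "d = \<one>" using PQ_not_commute[OF a cd(2)] by metis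
  then show ?thesis using cd K by simp
qed

lemma exists_P: obtains a where "a \<in> P" "a \<noteq> \<one>"
proof -
  have "P \<noteq> {\<one>}" using card_P prime_p not_prime_1 by force
  then show ?thesis using that P_closed(3) by blast
qed

lemma exists_Q: obtains b where "b \<in> Q" "b \<noteq> \<one>"
proof -
  have "Q \<noteq> {\<one>}" using card_Q prime_q not_prime_1 by force
  then show ?thesis using that subgroup.one_closed[OF Q] by blast
qed

lemma center_trivial:
  assumes z: "z \<in> carrier K" "\<And>g. g \<in> carrier K \<Longrightarrow> z \<otimes> g = g \<otimes> z"
  shows "z = \<one>"
proof (rule ccontr)
  assume "z \<noteq> \<one>"
  obtain a where a: "a \<in> P" "a \<noteq> \<one>" by (rule exists_P)
  obtain b where b: "b \<in> Q" "b \<noteq> \<one>" by (rule exists_Q)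
  have "z \<in> P" by (rule centralizes_P[OF a z(1) z(2)[OF P_carrier[OF a(1)]]])
  then show False using PQ_not_commute[OF _ \<open>z \<noteq> \<one>\<close> b] z(2)[OF Q_carrier[OF b(1)]] by blast
qed

text \<open>The quotient K/P is an image of the commutative group Q. In coordinates, g h and h g
  have the same Q-part b d.\<close>

lemma commutator_in_P:
  assumes "g \<in> carrier K" "h \<in> carrier K"
  shows "g \<otimes> h \<otimes> inv g \<otimes> inv h \<in> P"
proof -
  obtain a b where ab: "a \<in> P" "b \<in> Q" "g = a \<otimes> b" using assms(1) by (rule decompose)
  obtain c d where cd: "c \<in> P" "d \<in> Q" "h = c \<otimes> d" using assms(2) by (rule decompose)
  note K = P_carrier[OF ab(1)] P_carrier[OF cd(1)] Q_carrier[OF ab(2)] Q_carrier[OF cd(2)]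
  let ?x = "a \<otimes> (b \<otimes> c \<otimes> inv b)" and ?y = "c \<otimes> (d \<otimes> a \<otimes> inv d)"
  have x: "?x \<in> P" and y: "?y \<in> P" using ab cd K by (auto intro!: P_closed P_conj)
  have "g \<otimes> h = ?x \<otimes> (b \<otimes> d)" using ab cd K by (simp add: m_assoc inv_mult_cancel)
  moreover have "h \<otimes> g = ?y \<otimes> (b \<otimes> d)"
    using ab cd K by (simp add: Q_comm[OF ab(2) cd(2)] m_assoc inv_mult_cancel)
  moreover have "g \<otimes> h \<otimes> inv g \<otimes> inv h = (g \<otimes> h) \<otimes> inv (h \<otimes> g)"
    using assms by (simp add: inv_mult_group m_assoc)
  ultimately have "g \<otimes> h \<otimes> inv g \<otimes> inv h = (?x \<otimes> (b \<otimes> d)) \<otimes> inv (?y \<otimes> (b \<otimes> d))" by simp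
  also have "\<dots> = ?x \<otimes> inv ?y"
    by (rule mult_inv_cancel_right) (use P_carrier[OF x] P_carrier[OF y] K in simp_all)
  finally show ?thesis using x y P_closed by simp
qed

text \<open>If M meets P trivially, every commutator of m lies in both and is 1, so m is central,
  while the centre of K is trivial.\<close>

lemma normal_contains_P:
  assumes M: "M \<lhd> K" "m \<in> M" "m \<noteq> \<one>"
  shows "P \<subseteq> M"
proof (cases "\<exists>x\<in>M \<inter> P. x \<noteq> \<one>")
  case True
  then show ?thesis using P_subset[OF normal_imp_subgroup[OF M(1)]] by blast
next
  case False
  note subM = normal_imp_subgroup[OF M(1)]
  note mK = subgroup.mem_carrier[OF subM M(2)]
  have "m \<otimes> g = g \<otimes> m" if g: "g \<in> carrier K" for g
  proof -
    have "g \<otimes> inv m \<otimes> inv g \<in> M"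
      by (rule normal.inv_op_closed2[OF M(1) g subgroup.m_inv_closed[OF subM M(2)]])
    then have "m \<otimes> (g \<otimes> inv m \<otimes> inv g) \<in> M" by (rule subgroup.m_closed[OF subM M(2)])
    then have "m \<otimes> g \<otimes> inv m \<otimes> inv g \<in> M" using g mK by (simp add: m_assoc)
    then have "m \<otimes> g \<otimes> inv m \<otimes> inv g = \<one>" using commutator_in_P[OF mK g] False by blast
    then have "m \<otimes> g \<otimes> inv (g \<otimes> m) = \<one>" using g mK by (simp add: inv_mult_group m_assoc)
    then show ?thesis using g mK by (metis inv_closed inv_equality inv_inv m_closed)
  qed
  then show ?thesis using center_trivial[OF mK] M(3) by blast
qed

text \<open>The Q-part of z is nontrivial, as P has no q-torsion, and it lies in M because P does;
  so M contains Q.\<close>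

lemma subgroup_all:
  assumes M: "subgroup M K" "P \<subseteq> M" "z \<in> M" "z \<noteq> \<one>" "z [^] q = \<one>"
  shows "M = carrier K"
proof -
  note zK = subgroup.mem_carrier[OF M(1,3)]
  obtain a b where ab: "a \<in> P" "b \<in> Q" "z = a \<otimes> b" using zK by (rule decompose)
  note K = P_carrier[OF ab(1)] Q_carrier[OF ab(2)]
  have "b \<noteq> \<one>" using torsion_P[of z] ab K M(4,5) by auto
  moreover have "inv a \<otimes> z \<in> M" using ab(1) M(1,2,3) by (auto intro!: subgroup.m_closed subgroup.m_inv_closed)
  then have "b \<in> M" using ab K by (simp add: m_assoc[symmetric])
  ultimately have "Q \<subseteq> M" using Q_subset[OF M(1) ab(2)] by blast
  then show ?thesis using carrier_subset[OF M(1,2)] subgroup.subset[OF M(1)] by blast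
qed

text \<open>Subgroups of exponent q meet P trivially and embed into K/P, whose order is the prime q.
  The subgroup \<open>X\<close> below is P D; it contains Q because it contains the nontrivial
  Q-part of z.\<close>

lemma torsion_subgroup:
  assumes T: "subgroup T K" "\<And>t. t \<in> T \<Longrightarrow> t [^] q = \<one>"
    and D: "subgroup D K" "D \<subseteq> T" "z \<in> D" "z \<noteq> \<one>"
  shows "T \<subseteq> D"
proof
  fix t assume t: "t \<in> T"
  define X where "X = {g \<in> carrier K. \<exists>e\<in>D. g \<otimes> inv e \<in> P}"
  note DK = subgroup.mem_carrier[OF D(1)] and TK = subgroup.mem_carrier[OF T(1)]
  have X: "subgroup X K"
  proof (rule subgroupI)
    show "X \<subseteq> carrier K" by (auto simp: X_def)
    have "\<one> \<in> X" unfolding X_def using subgroup.one_closed[OF D(1)] P_closed(3)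
      by (intro CollectI conjI bexI[of _ \<one>]) simp_all
    then show "X \<noteq> {}" by blast
    fix g assume "g \<in> X"
    then obtain e where g: "g \<in> carrier K" "e \<in> D" "g \<otimes> inv e \<in> P" by (auto simp: X_def)
    have "inv e \<otimes> (inv (g \<otimes> inv e)) \<otimes> inv (inv e) \<in> P"
      using g DK by (intro P_conj P_closed(2)) auto
    then have "inv g \<otimes> inv (inv e) \<in> P" using g DK by (simp add: inv_mult_group m_assoc inv_mult_cancel)
    then show "inv g \<in> X" using g subgroup.m_inv_closed[OF D(1)] by (auto simp: X_def)
    fix h assume "h \<in> X"
    then obtain f where h: "h \<in> carrier K" "f \<in> D" "h \<otimes> inv f \<in> P" by (auto simp: X_def)
    have "(g \<otimes> inv e) \<otimes> (e \<otimes> (h \<otimes> inv f) \<otimes> inv e) \<in> P"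
      by (rule P_closed(1)[OF g(3) P_conj[OF DK[OF g(2)] h(3)]])
    then have "g \<otimes> h \<otimes> inv (e \<otimes> f) \<in> P"
      using g h DK by (simp add: inv_mult_group m_assoc inv_mult_cancel)
    then show "g \<otimes> h \<in> X" using g h subgroup.m_closed[OF D(1)] by (auto simp: X_def)
  qed
  have zT: "z \<in> T" using D by blast
  obtain a b where ab: "a \<in> P" "b \<in> Q" "z = a \<otimes> b" using TK[OF zT] by (rule decompose)
  note K = P_carrier[OF ab(1)] Q_carrier[OF ab(2)]
  have "b \<noteq> \<one>" using torsion_P[of z] ab K D(4) T(2)[OF zT] by auto
  moreover have "b \<otimes> inv z = inv a \<otimes> \<one>"
  proof -
    have "b = inv a \<otimes> z" using ab K by (simp add: m_assoc[symmetric])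
    then show ?thesis using K TK[OF zT] by (simp add: m_assoc)
  qed
  then have "b \<in> X" unfolding X_def using D(3) ab(1) K
    by (intro CollectI conjI bexI[of _ z]) (simp_all add: P_closed)
  ultimately have QX: "Q \<subseteq> X" using Q_subset[OF X ab(2)] by blast
  obtain c d where cd: "c \<in> P" "d \<in> Q" "t = c \<otimes> d" using TK[OF t] by (rule decompose)
  obtain e where e: "e \<in> D" "d \<otimes> inv e \<in> P" using QX cd(2) by (auto simp: X_def)
  have "c \<otimes> (d \<otimes> inv e) \<in> P" by (rule P_closed(1)[OF cd(1) e(2)])
  then have "t \<otimes> inv e \<in> P" using cd e DK P_carrier Q_carrier by (simp add: m_assoc)
  moreover have "t \<otimes> inv e \<in> T"
    using t e(1) D(2) T(1) by (auto intro!: subgroup.m_closed subgroup.m_inv_closed)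
  ultimately have "t \<otimes> inv e = \<one>" using torsion_P T(2) by blast
  then have "t = e" using TK[OF t] DK[OF e(1)] by (metis inv_closed inv_equality inv_inv)
  then show "t \<in> D" using e(1) by simp
qed

text \<open>Choosing Q-parts embeds T into Q: elements with equal Q-parts differ by an element of T
  \<inter> P, which is 1 by \<open>torsion_P\<close>.\<close>

lemma card_torsion_subgroup:
  assumes T: "subgroup T K" "\<And>t. t \<in> T \<Longrightarrow> t [^] q = \<one>"
  shows "card T \<le> q"
proof -
  define f where "f t = (SOME b. b \<in> Q \<and> t \<otimes> inv b \<in> P)" for t
  have f: "f t \<in> Q" "t \<otimes> inv (f t) \<in> P" if t: "t \<in> T" for t
  proof -
    obtain a b where ab: "a \<in> P" "b \<in> Q" "t = a \<otimes> b" using subgroup.mem_carrier[OF T(1) t] by (rule decompose)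
    then have "t \<otimes> inv b = a" using P_carrier Q_carrier by (simp add: m_assoc)
    then have "\<exists>b. b \<in> Q \<and> t \<otimes> inv b \<in> P" using ab by auto
    from someI_ex[OF this] show "f t \<in> Q" "t \<otimes> inv (f t) \<in> P" unfolding f_def by auto
  qed
  have "inj_on f T"
  proof (rule inj_onI)
    fix s t assume st: "s \<in> T" "t \<in> T" "f s = f t"
    note K = subgroup.mem_carrier[OF T(1) st(1)] subgroup.mem_carrier[OF T(1) st(2)] Q_carrier[OF f(1)[OF st(2)]]
    have "(s \<otimes> inv (f t)) \<otimes> inv (t \<otimes> inv (f t)) \<in> P"
      using f(2)[OF st(1)] f(2)[OF st(2)] st(3) P_closed by simp
    then have "s \<otimes> inv t \<in> P" using K by (simp add: inv_mult_group m_assoc inv_mult_cancel)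
    moreover have "s \<otimes> inv t \<in> T" using st T(1) by (auto intro!: subgroup.m_closed subgroup.m_inv_closed)
    ultimately have "s \<otimes> inv t = \<one>" using torsion_P T(2) by blast
    then show "s = t" using K by (metis inv_closed inv_equality inv_inv)
  qed
  moreover have "finite Q" using card_Q prime_q card.infinite not_prime_0 by metis
  ultimately have "card T \<le> card Q" using f(1) by (intro card_inj_on_le[of f]) auto
  then show ?thesis by (simp add: card_Q)
qed

end

lemma nonabelian_pq_of_semidirect_product:
  assumes "group K" "prime p" "prime q" "p \<noteq> q" "\<not> comm_group K"
    and "is_semidirect_product K (integer_mod_group p) (integer_mod_group q)"
  obtains P Q where "nonabelian_pq K P Q p q"
proof -
  have c: "card (carrier (integer_mod_group n)) = n" if "prime n" for n
    using that by (auto simp: carrier_integer_mod_group)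
  obtain P Q where PQ: "P \<lhd> K" "subgroup Q K" "P <#>\<^bsub>K\<^esub> Q = carrier K"
    "K\<lparr>carrier := P\<rparr> \<cong> integer_mod_group p" "K\<lparr>carrier := Q\<rparr> \<cong> integer_mod_group q"
    using assms(6) unfolding is_semidirect_product_def by blast
  have "card P = p" "card Q = q"
    using iso_same_card[OF PQ(4)] iso_same_card[OF PQ(5)] c[OF assms(2)] c[OF assms(3)] by simp_all
  then have "nonabelian_pq K P Q p q"
    using assms PQ by (simp add: nonabelian_pq_def nonabelian_pq_axioms_def)
  then show ?thesis by (rule that)
qed

section \<open>Products of two such groups\<close>

text \<open>The product is described by its two projections rather than as a product type. This form
  is symmetric, so each lemma yields its mirror image through \<open>swap\<close>.\<close>

locale pq_pair = fin_group G for G (structure) +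
  fixes K1 :: "'x monoid" and P1 Q1 and K2 :: "'y monoid" and P2 Q2 and p q r :: nat
    and \<pi>1 :: "'a \<Rightarrow> 'x" and \<pi>2 :: "'a \<Rightarrow> 'y" and A :: "'a set"
  assumes K1: "nonabelian_pq K1 P1 Q1 p q" and K2: "nonabelian_pq K2 P2 Q2 r q"
    and \<pi>1: "\<pi>1 \<in> hom G K1" and \<pi>2: "\<pi>2 \<in> hom G K2"
    and inj: "g \<in> carrier G \<Longrightarrow> \<pi>1 g = \<one>\<^bsub>K1\<^esub> \<Longrightarrow> \<pi>2 g = \<one>\<^bsub>K2\<^esub> \<Longrightarrow> g = \<one>"
    and surj: "a \<in> carrier K1 \<Longrightarrow> b \<in> carrier K2 \<Longrightarrow> \<exists>g\<in>carrier G. \<pi>1 g = a \<and> \<pi>2 g = b"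
    and subA: "subgroup A G" and card_A: "card A = q\<^sup>2" and torsion_A: "s \<in> A \<Longrightarrow> s [^] q = \<one>"
begin

sublocale K1: nonabelian_pq K1 P1 Q1 p q by (rule K1)
sublocale K2: nonabelian_pq K2 P2 Q2 r q by (rule K2)
sublocale h1: group_hom G K1 \<pi>1
  by (intro group_hom.intro group_hom_axioms.intro group_axioms K1.group_axioms \<pi>1)

sublocale h2: group_hom G K2 \<pi>2
  by (intro group_hom.intro group_hom_axioms.intro group_axioms K2.group_axioms \<pi>2)

lemma swap: "pq_pair G K2 P2 Q2 K1 P1 Q1 r q p \<pi>2 \<pi>1 A"
proof (intro pq_pair.intro pq_pair_axioms.intro fin_group_axioms K1 K2 \<pi>1 \<pi>2 subA card_A)
  show "s [^] q = \<one>" if "s \<in> A" for s using that by (rule torsion_A)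
  show "g = \<one>" if "g \<in> carrier G" "\<pi>2 g = \<one>\<^bsub>K2\<^esub>" "\<pi>1 g = \<one>\<^bsub>K1\<^esub>" for g
    using that by (intro inj)
  show "\<exists>g\<in>carrier G. \<pi>2 g = a \<and> \<pi>1 g = b" if "a \<in> carrier K2" "b \<in> carrier K1" for a b
    using surj[OF that(2,1)] by blast
qed

lemma eqI:
  assumes "x \<in> carrier G" "y \<in> carrier G" "\<pi>1 x = \<pi>1 y" "\<pi>2 x = \<pi>2 y"
  shows "x = y"
proof -
  have "x \<otimes> inv y = \<one>" using assms by (intro inj) auto
  then show ?thesis using assms by (metis inv_closed inv_equality inv_inv)
qed

lemma A_mem: "s \<in> A \<Longrightarrow> s \<in> carrier G"
  using subgroup.mem_carrier[OF subA] .

text \<open>The image of \<open>A\<close> in K1 has exponent q and so at most q elements, fewer than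
  q^2. A quotient of two distinct elements with the same image is the required m.\<close>

lemma exists_second:
  obtains m where "m \<in> A" "\<pi>1 m = \<one>\<^bsub>K1\<^esub>" "\<pi>2 m \<noteq> \<one>\<^bsub>K2\<^esub>"
proof -
  have sub: "subgroup (\<pi>1 ` A) K1" by (rule h1.subgroup_img_is_subgroup[OF subA])
  have "card (\<pi>1 ` A) \<le> q"
  proof (rule K1.card_torsion_subgroup[OF sub])
    fix t assume "t \<in> \<pi>1 ` A"
    then obtain s where s: "s \<in> A" "t = \<pi>1 s" by blast
    have "t [^]\<^bsub>K1\<^esub> q = \<pi>1 (s [^] q)" using A_mem[OF s(1)] s(2) by (simp add: h1.hom_nat_pow)
    then show "t [^]\<^bsub>K1\<^esub> q = \<one>\<^bsub>K1\<^esub>" by (simp add: torsion_A[OF s(1)])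
  qed
  moreover have "q < q\<^sup>2" using K1.prime_q prime_gt_1_nat[of q] by (simp add: power2_eq_square)
  ultimately have "\<not> inj_on \<pi>1 A" using card_A card_image[of \<pi>1 A] by auto
  then obtain x y where xy: "x \<in> A" "y \<in> A" "\<pi>1 x = \<pi>1 y" "x \<noteq> y" by (auto simp: inj_on_def)
  show ?thesis
  proof (rule that[of "x \<otimes> inv y"])
    show m: "x \<otimes> inv y \<in> A" using xy subA by (auto intro: subgroup.m_closed subgroup.m_inv_closed)
    show 1: "\<pi>1 (x \<otimes> inv y) = \<one>\<^bsub>K1\<^esub>" using xy A_mem by simp
    show "\<pi>2 (x \<otimes> inv y) \<noteq> \<one>\<^bsub>K2\<^esub>"
    proof
      assume "\<pi>2 (x \<otimes> inv y) = \<one>\<^bsub>K2\<^esub>"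
      then have "\<pi>2 x = \<pi>2 y" using xy A_mem by (metis h2.hom_closed h2.hom_inv h2.hom_mult inv_closed K2.inv_equality K2.inv_inv K2.inv_closed)
      then show False using eqI xy A_mem by blast
    qed
  qed
qed

text \<open>The slice is N \<inter> G1 seen in K1; each x in K1 lifts to G, and conjugation by the
  lift preserves the slice.\<close>

lemma normal_slice:
  assumes N: "N \<lhd> G"
  shows "\<pi>1 ` {n \<in> N. \<pi>2 n = \<one>\<^bsub>K2\<^esub>} \<lhd> K1" (is "?M \<lhd> K1")
proof -
  note subN = normal_imp_subgroup[OF N]
  note NG = subgroup.mem_carrier[OF subN]
  have "subgroup {n \<in> N. \<pi>2 n = \<one>\<^bsub>K2\<^esub>} G"
    by (rule subgroupI)
      (use NG subgroup.one_closed[OF subN] subgroup.m_closed[OF subN] subgroup.m_inv_closed[OF subN] in auto)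
  then have sub: "subgroup ?M K1" by (rule h1.subgroup_img_is_subgroup)
  show ?thesis unfolding K1.normal_inv_iff
  proof (intro conjI sub ballI)
    fix x h assume x: "x \<in> carrier K1" and "h \<in> ?M"
    then obtain n where n: "n \<in> N" "\<pi>2 n = \<one>\<^bsub>K2\<^esub>" "h = \<pi>1 n" by blast
    obtain g where g: "g \<in> carrier G" "\<pi>1 g = x" using surj[OF x K2.one_closed] by blast
    have "g \<otimes> n \<otimes> inv g \<in> N" by (rule normal.inv_op_closed2[OF N g(1) n(1)])
    moreover have "\<pi>2 (g \<otimes> n \<otimes> inv g) = \<one>\<^bsub>K2\<^esub>" using g n NG by simp
    moreover have "\<pi>1 (g \<otimes> n \<otimes> inv g) = x \<otimes>\<^bsub>K1\<^esub> h \<otimes>\<^bsub>K1\<^esub> inv\<^bsub>K1\<^esub> x" using g n NG by simp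
    ultimately show "x \<otimes>\<^bsub>K1\<^esub> h \<otimes>\<^bsub>K1\<^esub> inv\<^bsub>K1\<^esub> x \<in> ?M" by force
  qed
qed

lemma slice_P:
  assumes N: "N \<lhd> G" "n \<in> N" "\<pi>1 n \<noteq> \<one>\<^bsub>K1\<^esub>" "\<pi>2 n = \<one>\<^bsub>K2\<^esub>" and a: "a \<in> P1"
  shows "\<exists>n\<in>N. \<pi>1 n = a \<and> \<pi>2 n = \<one>\<^bsub>K2\<^esub>"
proof -
  have "P1 \<subseteq> \<pi>1 ` {n \<in> N. \<pi>2 n = \<one>\<^bsub>K2\<^esub>}"
    by (rule K1.normal_contains_P[OF normal_slice[OF N(1)] _ N(3)]) (use N in blast)
  then show ?thesis using a by blast
qed

lemma slice_all:
  assumes N: "N \<lhd> G" "n \<in> N" "\<pi>1 n \<noteq> \<one>\<^bsub>K1\<^esub>" "\<pi>2 n = \<one>\<^bsub>K2\<^esub>" "n [^] q = \<one>" and a: "a \<in> carrier K1"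
  shows "\<exists>n\<in>N. \<pi>1 n = a \<and> \<pi>2 n = \<one>\<^bsub>K2\<^esub>"
proof -
  note nG = subgroup.mem_carrier[OF normal_imp_subgroup[OF N(1)] N(2)]
  have "P1 \<subseteq> \<pi>1 ` {n \<in> N. \<pi>2 n = \<one>\<^bsub>K2\<^esub>}"
    by (rule K1.normal_contains_P[OF normal_slice[OF N(1)] _ N(3)]) (use N in blast)
  moreover have "\<pi>1 n [^]\<^bsub>K1\<^esub> q = \<one>\<^bsub>K1\<^esub>" using h1.hom_nat_pow[OF nG, of q] N(5) by simp
  ultimately have "\<pi>1 ` {n \<in> N. \<pi>2 n = \<one>\<^bsub>K2\<^esub>} = carrier K1"
    using K1.subgroup_all[OF normal_imp_subgroup[OF normal_slice[OF N(1)]], of "\<pi>1 n"] N by blast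
  from equalityD2[OF this] show ?thesis using a by blast
qed

text \<open>The commutator of n with a lift of x that is trivial in K2 lies in N and in the first
  factor. It is nontrivial for a suitable x because K1 has trivial centre.\<close>

lemma nontrivial_slice:
  assumes N: "N \<lhd> G" "n \<in> N" "\<pi>1 n \<noteq> \<one>\<^bsub>K1\<^esub>"
  shows "\<exists>n\<in>N. \<pi>1 n \<noteq> \<one>\<^bsub>K1\<^esub> \<and> \<pi>2 n = \<one>\<^bsub>K2\<^esub>"
proof -
  note subN = normal_imp_subgroup[OF N(1)]
  note nG = subgroup.mem_carrier[OF subN N(2)]
  obtain x where x: "x \<in> carrier K1" "\<pi>1 n \<otimes>\<^bsub>K1\<^esub> x \<noteq> x \<otimes>\<^bsub>K1\<^esub> \<pi>1 n"
    using K1.center_trivial[of "\<pi>1 n"] N(3) nG by auto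
  obtain g where g: "g \<in> carrier G" "\<pi>1 g = x" "\<pi>2 g = \<one>\<^bsub>K2\<^esub>" using surj[OF x(1) K2.one_closed] by blast
  have "g \<otimes> inv n \<otimes> inv g \<in> N"
    by (rule normal.inv_op_closed2[OF N(1) g(1) subgroup.m_inv_closed[OF subN N(2)]])
  then have "n \<otimes> (g \<otimes> inv n \<otimes> inv g) \<in> N" by (rule subgroup.m_closed[OF subN N(2)])
  moreover have "\<pi>2 (n \<otimes> (g \<otimes> inv n \<otimes> inv g)) = \<one>\<^bsub>K2\<^esub>" using nG g by simp
  moreover have "\<pi>1 (n \<otimes> (g \<otimes> inv n \<otimes> inv g)) \<noteq> \<one>\<^bsub>K1\<^esub>"
  proof
    assume "\<pi>1 (n \<otimes> (g \<otimes> inv n \<otimes> inv g)) = \<one>\<^bsub>K1\<^esub>"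
    then have "(\<pi>1 n \<otimes>\<^bsub>K1\<^esub> x) \<otimes>\<^bsub>K1\<^esub> inv\<^bsub>K1\<^esub> (x \<otimes>\<^bsub>K1\<^esub> \<pi>1 n) = \<one>\<^bsub>K1\<^esub>"
      using nG g x(1) by (simp add: K1.inv_mult_group K1.m_assoc)
    then show False using x nG by (metis K1.inv_closed K1.inv_equality K1.inv_inv K1.m_closed h1.hom_closed)
  qed
  ultimately show ?thesis by blast
qed

lemma torsion_image:
  assumes "s \<in> A"
  shows "\<pi>1 s [^]\<^bsub>K1\<^esub> q = \<one>\<^bsub>K1\<^esub>" "\<pi>2 s [^]\<^bsub>K2\<^esub> q = \<one>\<^bsub>K2\<^esub>"
  using h1.hom_nat_pow[OF A_mem[OF assms], of q] h2.hom_nat_pow[OF A_mem[OF assms], of q] torsion_A[OF assms]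
  by simp_all

text \<open>In K1 the equation gives b = a c^-1 a^-1, so b c is a commutator and lies in P1. As the
  image of y x it is q-torsion, hence 1. Then c commutes with a, so it lies in P1, and being
  q-torsion it is 1 as well.\<close>

lemma fixing_first:
  assumes n: "n \<in> carrier G" "\<pi>1 n \<in> P1" "\<pi>1 n \<noteq> \<one>\<^bsub>K1\<^esub>"
    and xy: "x \<in> A" "y \<in> A" "y \<otimes> n \<otimes> x = n"
  shows "\<pi>1 x = \<one>\<^bsub>K1\<^esub>"
proof -
  define a b c where "a = \<pi>1 n" and "b = \<pi>1 y" and "c = \<pi>1 x"
  have K: "a \<in> carrier K1" "b \<in> carrier K1" "c \<in> carrier K1"
    using n(1) xy A_mem by (simp_all add: a_def b_def c_def)
  have "\<pi>1 (y \<otimes> n \<otimes> x) = b \<otimes>\<^bsub>K1\<^esub> a \<otimes>\<^bsub>K1\<^esub> c"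
    using n(1) xy(1,2) A_mem by (simp add: a_def b_def c_def)
  then have bac: "b \<otimes>\<^bsub>K1\<^esub> a \<otimes>\<^bsub>K1\<^esub> c = a" by (simp add: xy(3) a_def)
  have "b = (b \<otimes>\<^bsub>K1\<^esub> a \<otimes>\<^bsub>K1\<^esub> c) \<otimes>\<^bsub>K1\<^esub> inv\<^bsub>K1\<^esub> c \<otimes>\<^bsub>K1\<^esub> inv\<^bsub>K1\<^esub> a"
    using K by (simp add: K1.m_assoc)
  then have b: "b = a \<otimes>\<^bsub>K1\<^esub> inv\<^bsub>K1\<^esub> c \<otimes>\<^bsub>K1\<^esub> inv\<^bsub>K1\<^esub> a" unfolding bac .
  have "b \<otimes>\<^bsub>K1\<^esub> c \<in> P1"
    using K1.commutator_in_P[OF K(1) K1.inv_closed[OF K(3)]] unfolding b by (simp add: K)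
  moreover have "b \<otimes>\<^bsub>K1\<^esub> c = \<pi>1 (y \<otimes> x)" using xy A_mem by (simp add: b_def c_def)
  then have "(b \<otimes>\<^bsub>K1\<^esub> c) [^]\<^bsub>K1\<^esub> q = \<one>\<^bsub>K1\<^esub>"
    using torsion_image(1)[OF subgroup.m_closed[OF subA xy(2,1)]] by simp
  ultimately have "b \<otimes>\<^bsub>K1\<^esub> c = \<one>\<^bsub>K1\<^esub>" by (rule K1.torsion_P)
  then have "b = inv\<^bsub>K1\<^esub> c" using K by (simp add: K1.inv_equality)
  have "c \<otimes>\<^bsub>K1\<^esub> a = c \<otimes>\<^bsub>K1\<^esub> (b \<otimes>\<^bsub>K1\<^esub> a \<otimes>\<^bsub>K1\<^esub> c)" unfolding bac ..
  also have "\<dots> = a \<otimes>\<^bsub>K1\<^esub> c" unfolding \<open>b = inv\<^bsub>K1\<^esub> c\<close> using K by (simp add: K1.m_assoc K1.inv_mult_cancel)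
  finally have "c \<in> P1" using n K by (intro K1.centralizes_P[of a c]) (simp_all add: a_def)
  then show ?thesis using K1.torsion_P[of c] torsion_image(1)[OF xy(1)] by (simp add: c_def)
qed

end

section \<open>Passing between the two factors through the cocycle\<close>

locale twisted_pq_pair =
  gauged_twist G J K B A \<alpha> v w + pq_pair G K1 P1 Q1 K2 P2 Q2 p q r \<pi>1 \<pi>2 A
  for G (structure) and J K :: "'a \<times> 'a \<Rightarrow> 'k::field_char_0" and B A and \<alpha> :: "'a \<Rightarrow> 'a \<Rightarrow> 'k" and v w
    and K1 :: "'x monoid" and P1 Q1 and K2 :: "'y monoid" and P2 Q2 and p q r :: nat
    and \<pi>1 :: "'a \<Rightarrow> 'x" and \<pi>2 :: "'a \<Rightarrow> 'y"
begin

lemma twisted_swap: "twisted_pq_pair G J K B A \<alpha> v w K2 P2 Q2 K1 P1 Q1 r q p \<pi>2 \<pi>1"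
  by (intro twisted_pq_pair.intro swap gauged_twist_axioms)

text \<open>The fibre of \<open>A\<close> over \<open>1 \<in> K1\<close> is cyclic of order \<open>q\<close>, and \<open>bichar\<close> is alternating.\<close>

lemma bichar_slice:
  assumes m: "m \<in> A" "\<pi>1 m = \<one>\<^bsub>K1\<^esub>" "\<pi>2 m \<noteq> \<one>\<^bsub>K2\<^esub>" and x: "x \<in> A" "\<pi>1 x = \<one>\<^bsub>K1\<^esub>"
  shows "bichar x m = 1"
proof -
  define T where "T = {x \<in> A. \<pi>1 x = \<one>\<^bsub>K1\<^esub>}"
  define D where "D = {x \<in> A. \<pi>1 x = \<one>\<^bsub>K1\<^esub> \<and> bichar x m = 1}"
  have T: "subgroup T G" and D: "subgroup D G"
    unfolding T_def D_def
    by (rule subgroup.intro;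
        use A_mem m(1) subgroup.one_closed[OF subA] subgroup.m_closed[OF subA] subgroup.m_inv_closed[OF subA]
        in \<open>force simp: bichar_mult_left bichar_inv bichar_one\<close>)+
  have "\<pi>2 ` T \<subseteq> \<pi>2 ` D"
  proof (rule K2.torsion_subgroup)
    show "subgroup (\<pi>2 ` T) K2" "subgroup (\<pi>2 ` D) K2"
      by (intro h2.subgroup_img_is_subgroup T D)+
    show "t [^]\<^bsub>K2\<^esub> q = \<one>\<^bsub>K2\<^esub>" if "t \<in> \<pi>2 ` T" for t
      using that torsion_image(2) by (auto simp: T_def)
    show "\<pi>2 ` D \<subseteq> \<pi>2 ` T" by (auto simp: D_def T_def)
    show "\<pi>2 m \<in> \<pi>2 ` D" using m by (auto simp: D_def bichar_self)
    show "\<pi>2 m \<noteq> \<one>\<^bsub>K2\<^esub>" by (rule m(3))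
  qed
  then obtain d where d: "d \<in> D" "\<pi>2 x = \<pi>2 d" using x by (auto simp: T_def)
  have "x = d" using d x A_mem by (intro eqI) (auto simp: D_def)
  then show ?thesis using d(1) by (simp add: D_def)
qed

text \<open>The cocycle couples the factors here: \<open>fixing_first\<close> forces x into the
  fibre over 1, where \<open>bichar x m\<close> is 1, so the coefficient at n survives in
  \<open>weight_in_normal_subgroup\<close>.\<close>

lemma transfer:
  assumes N: "N \<lhd> G" "avg N \<in> B" "\<And>b. b \<in> B \<Longrightarrow> b \<star> avg N = fscale (aug G b) (avg N)"
    and n: "n \<in> N" "\<pi>1 n \<in> P1" "\<pi>1 n \<noteq> \<one>\<^bsub>K1\<^esub>"
    and m: "m \<in> A" "\<pi>1 m = \<one>\<^bsub>K1\<^esub>" "\<pi>2 m \<noteq> \<one>\<^bsub>K2\<^esub>"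
  shows "m \<in> N"
proof (rule weight_in_normal_subgroup[OF N n(1) m(1)])
  fix y x assume xy: "y \<in> A" "x \<in> A" "y \<otimes> n \<otimes> x = n"
  have "n \<in> carrier G" using subgroup.mem_carrier[OF normal_imp_subgroup[OF N(1)] n(1)] .
  from fixing_first[OF this n(2,3) xy(2,1,3)] show "bichar x m = 1"
    by (rule bichar_slice[OF m xy(2)])
qed

text \<open>N contains P1 by normality, hence some nontrivial q-torsion m of the second factor by
  \<open>transfer\<close>; a normal subgroup containing such an m contains the whole second
  factor.\<close>

lemma second_slice:
  assumes N: "N \<lhd> G" "avg N \<in> B" "\<And>b. b \<in> B \<Longrightarrow> b \<star> avg N = fscale (aug G b) (avg N)"
    and n: "n \<in> N" "\<pi>1 n \<noteq> \<one>\<^bsub>K1\<^esub>" "\<pi>2 n = \<one>\<^bsub>K2\<^esub>" and b: "b \<in> carrier K2"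
  shows "\<exists>n\<in>N. \<pi>1 n = \<one>\<^bsub>K1\<^esub> \<and> \<pi>2 n = b"
proof -
  obtain a where a: "a \<in> P1" "a \<noteq> \<one>\<^bsub>K1\<^esub>" by (rule K1.exists_P)
  obtain n0 where n0: "n0 \<in> N" "\<pi>1 n0 = a" using slice_P[OF N(1) n a(1)] by blast
  obtain m where m: "m \<in> A" "\<pi>1 m = \<one>\<^bsub>K1\<^esub>" "\<pi>2 m \<noteq> \<one>\<^bsub>K2\<^esub>" by (rule exists_second)
  have "m \<in> N" using a n0 by (intro transfer[OF N n0(1) _ _ m]) simp_all
  from pq_pair.slice_all[OF swap N(1) this m(3,2) torsion_A[OF m(1)] b]
  show ?thesis by blast
qed

text \<open>Once N contains the second factor, an element of order r there plays the part of n with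
  the factors exchanged, and the first factor follows.\<close>

lemma normal_subgroup_total:
  assumes N: "N \<lhd> G" "avg N \<in> B" "\<And>b. b \<in> B \<Longrightarrow> b \<star> avg N = fscale (aug G b) (avg N)"
    and n: "n \<in> N" "\<pi>1 n \<noteq> \<one>\<^bsub>K1\<^esub>" "\<pi>2 n = \<one>\<^bsub>K2\<^esub>"
  shows "N = carrier G"
proof (intro equalityI subsetI)
  note subN = normal_imp_subgroup[OF N(1)]
  note NG = subgroup.mem_carrier[OF subN]
  show "g \<in> carrier G" if "g \<in> N" for g using that by (rule NG)
  fix g assume g: "g \<in> carrier G"
  obtain b where b: "b \<in> P2" "b \<noteq> \<one>\<^bsub>K2\<^esub>" by (rule K2.exists_P)
  obtain n' where n': "n' \<in> N" "\<pi>1 n' = \<one>\<^bsub>K1\<^esub>" "\<pi>2 n' = b"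
    using second_slice[OF N n K2.P_carrier[OF b(1)]] by blast
  obtain g2 where g2: "g2 \<in> N" "\<pi>1 g2 = \<one>\<^bsub>K1\<^esub>" "\<pi>2 g2 = \<pi>2 g"
    using second_slice[OF N n h2.hom_closed[OF g]] by blast
  obtain g1 where g1: "g1 \<in> N" "\<pi>2 g1 = \<one>\<^bsub>K2\<^esub>" "\<pi>1 g1 = \<pi>1 g"
    using twisted_pq_pair.second_slice[OF twisted_swap N n'(1) _ n'(2) h1.hom_closed[OF g]] n'(3) b(2) by blast
  have "g = g1 \<otimes> g2" using g g1 g2 NG by (intro eqI) simp_all
  then show "g \<in> N" using g1 g2 subgroup.m_closed[OF subN] by blast
qed

theorem normal_hopf_subalgebra_trivial:
  assumes "(\<forall>h\<in>free_space (carrier G). \<forall>y\<in>B. left_adjoint H h y \<in> B) \<or>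
      (\<forall>h\<in>free_space (carrier G). \<forall>y\<in>B. right_adjoint H h y \<in> B)"
  shows "B = range (\<lambda>c. fscale c (basis_vec \<one>)) \<or> B = free_space (carrier G)"
proof -
  obtain N where N: "N \<lhd> G" "avg N \<in> B" "\<And>b. b \<in> B \<Longrightarrow> b \<star> avg N = fscale (aug G b) (avg N)"
    by (rule normal_subgroup_of_normal_hopf_subalgebra[OF assms]) blast
  note subN = normal_imp_subgroup[OF N(1)]
  show ?thesis
  proof (cases "N = {\<one>}")
    case True
    then show ?thesis using trivial_if_avg_one N(3) by blast
  next
    case False
    then obtain n where n: "n \<in> N" "n \<noteq> \<one>" using subgroup.one_closed[OF subN] by blast
    then have "\<pi>1 n \<noteq> \<one>\<^bsub>K1\<^esub> \<or> \<pi>2 n \<noteq> \<one>\<^bsub>K2\<^esub>" using inj subgroup.mem_carrier[OF subN] by blast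
    then have "N = carrier G"
    proof
      assume "\<pi>1 n \<noteq> \<one>\<^bsub>K1\<^esub>"
      then show ?thesis using nontrivial_slice[OF N(1) n(1)] normal_subgroup_total[OF N] by blast
    next
      assume "\<pi>2 n \<noteq> \<one>\<^bsub>K2\<^esub>"
      then show ?thesis
        using pq_pair.nontrivial_slice[OF swap N(1) n(1)] twisted_pq_pair.normal_subgroup_total[OF twisted_swap N] by blast
    qed
    then show ?thesis using total_if_avg_carrier N(2) by simp
  qed
qed

end

section \<open>Nondegenerate cocycles\<close>

lemma (in group) pow_cong:
  assumes "x \<in> carrier G" "x [^] (n::nat) = \<one>" "a mod n = b mod n"
  shows "x [^] a = x [^] b"
proof -
  have "x [^] c = x [^] (c mod n)" for c
  proof -
    have "x [^] c = x [^] (n * (c div n) + c mod n)" by simp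
    also have "\<dots> = (x [^] n) [^] (c div n) \<otimes> x [^] (c mod n)"
      using assms(1) by (simp only: nat_pow_mult[symmetric] nat_pow_pow)
    finally show ?thesis using assms by simp
  qed
  then show ?thesis using assms(3) by metis
qed

context abelian_cocycle
begin

text \<open>
  For symmetric \<open>\<alpha>\<close> this extension of \<open>A\<close> by \<open>k\<^sup>*\<close> is abelian. As \<open>k\<^sup>*\<close> is divisible, it splits, so
  that \<open>\<alpha>\<close> is a coboundary.
\<close>

definition extension :: "('k \<times> 'a) monoid" where
  "extension = \<lparr>carrier = {(a, s). a \<noteq> 0 \<and> s \<in> A},
    monoid.mult = (\<lambda>(a, s) (b, t). (a * b * \<alpha> s t, s \<otimes> t)), one = (inverse (\<alpha> \<one> \<one>), \<one>)\<rparr>"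

lemma extension_simps:
  "(a, s) \<in> carrier extension \<longleftrightarrow> a \<noteq> 0 \<and> s \<in> A"
  "(a, s) \<otimes>\<^bsub>extension\<^esub> (b, t) = (a * b * \<alpha> s t, s \<otimes> t)"
  "\<one>\<^bsub>extension\<^esub> = (inverse (\<alpha> \<one> \<one>), \<one>)"
  by (simp_all add: extension_def)

lemma comm_group_extension:
  assumes sym: "\<And>s t. s \<in> A \<Longrightarrow> t \<in> A \<Longrightarrow> \<alpha> s t = \<alpha> t s"
  shows "comm_group extension"
proof (rule comm_groupI)
  note cl = subgroup.one_closed[OF A] subgroup.m_closed[OF A] subgroup.m_inv_closed[OF A]
  show "\<one>\<^bsub>extension\<^esub> \<in> carrier extension" by (simp add: extension_simps cl cocycle_nz)
  fix X assume "X \<in> carrier extension"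
  then obtain a s where X: "X = (a, s)" "a \<noteq> 0" "s \<in> A" by (cases X) (auto simp: extension_simps)
  have "\<alpha> \<one> \<one> * \<alpha> \<one> s = \<alpha> \<one> s * \<alpha> \<one> s"
    using cocycle[of \<one> \<one> s] X(3) A_carrier by (simp add: cl)
  then have one: "\<alpha> \<one> s = \<alpha> \<one> \<one>" using cocycle_nz[of \<one> s] X(3) by (simp add: cl)
  show "\<one>\<^bsub>extension\<^esub> \<otimes>\<^bsub>extension\<^esub> X = X"
    using X A_carrier cocycle_nz[of \<one> \<one>] by (simp add: extension_simps one cl)
  show "\<exists>Y\<in>carrier extension. Y \<otimes>\<^bsub>extension\<^esub> X = \<one>\<^bsub>extension\<^esub>"
    using X A_carrier cocycle_nz[of \<one> \<one>] cocycle_nz[of "inv s" s]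
    by (intro bexI[of _ "(inverse (\<alpha> \<one> \<one> * a * \<alpha> (inv s) s), inv s)"]) (auto simp: extension_simps cl field_simps)
  fix Y assume "Y \<in> carrier extension"
  then obtain b t where Y: "Y = (b, t)" "b \<noteq> 0" "t \<in> A" by (cases Y) (auto simp: extension_simps)
  show "X \<otimes>\<^bsub>extension\<^esub> Y \<in> carrier extension" using X Y by (simp add: extension_simps cl cocycle_nz)
  show "X \<otimes>\<^bsub>extension\<^esub> Y = Y \<otimes>\<^bsub>extension\<^esub> X"
    using X Y by (simp add: extension_simps sym[OF X(3) Y(3)] comm[OF X(3) Y(3)])
  fix Z assume "Z \<in> carrier extension"
  then obtain c u where Z: "Z = (c, u)" "c \<noteq> 0" "u \<in> A" by (cases Z) (auto simp: extension_simps)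
  have "a * b * \<alpha> s t * c * \<alpha> (s \<otimes> t) u = a * b * c * (\<alpha> s t * \<alpha> (s \<otimes> t) u)" by (simp add: mult_ac)
  also have "\<dots> = a * (b * c * \<alpha> t u) * \<alpha> s (t \<otimes> u)"
    unfolding cocycle[OF X(3) Y(3) Z(3)] by (simp add: mult_ac)
  finally show "X \<otimes>\<^bsub>extension\<^esub> Y \<otimes>\<^bsub>extension\<^esub> Z = X \<otimes>\<^bsub>extension\<^esub> (Y \<otimes>\<^bsub>extension\<^esub> Z)"
    using X Y Z A_carrier by (simp add: extension_simps m_assoc)
qed

lemma pow_closed: "s \<in> A \<Longrightarrow> s [^] (n::nat) \<in> A"
  by (induction n) (use subgroup.one_closed[OF A] subgroup.m_closed[OF A] in simp_all)

lemma bichar_pow: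
  assumes "s \<in> A" "t \<in> A"
  shows "bichar (s [^] (n::nat)) t = bichar s t ^ n" "bichar t (s [^] n) = bichar t s ^ n"
  by (induction n) (simp_all add: pow_closed assms bichar_one bichar_mult_left bichar_mult_right)

text \<open>The factor b does not depend on a, so prescribing the n-th power of a lift of s is a
  root extraction in k.\<close>

lemma extension_pow:
  "\<exists>b. b \<noteq> 0 \<and> (\<forall>a. (a, s) [^]\<^bsub>extension\<^esub> n = (a ^ n * b, s [^] n))" if s: "s \<in> A" for n :: nat
proof (induction n)
  case 0
  show ?case using cocycle_nz[of \<one> \<one>] subgroup.one_closed[OF A]
    by (intro exI[of _ "inverse (\<alpha> \<one> \<one>)"]) (simp add: extension_simps)
next
  case (Suc n)
  then obtain b where b: "b \<noteq> 0" "\<And>a. (a, s) [^]\<^bsub>extension\<^esub> n = (a ^ n * b, s [^] n)" by blast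
  show ?case using b s pow_closed[OF s] cocycle_nz
    by (intro exI[of _ "b * \<alpha> (s [^] n) s"]) (simp add: extension_simps)
qed

end

locale rank_two_cocycle = abelian_cocycle G A \<alpha>
  for G (structure) and A and \<alpha> :: "'a \<Rightarrow> 'a \<Rightarrow> 'k::{alg_closed_field, field_char_0}" +
  fixes q :: nat and e f :: 'a and i j :: "'a \<Rightarrow> nat"
  assumes prime_q: "prime q"
    and ef: "e \<in> A" "f \<in> A" "e [^] q = \<one>" "f [^] q = \<one>"
    and ij_less: "u \<in> A \<Longrightarrow> i u < q" "u \<in> A \<Longrightarrow> j u < q"
    and generate: "u \<in> A \<Longrightarrow> u = e [^] i u \<otimes> f [^] j u"
    and ij_mult: "u \<in> A \<Longrightarrow> v \<in> A \<Longrightarrow> i (u \<otimes> v) = (i u + i v) mod q"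
      "u \<in> A \<Longrightarrow> v \<in> A \<Longrightarrow> j (u \<otimes> v) = (j u + j v) mod q"
begin

text \<open>Roots in k give lifts of e and f to the extension with q-th power 1. Products of their
  powers form a homomorphic section, whose scalar component provides the cochain.\<close>

lemma coboundary_if_symmetric:
  assumes sym: "\<And>s t. s \<in> A \<Longrightarrow> t \<in> A \<Longrightarrow> \<alpha> s t = \<alpha> t s"
  shows "\<exists>c. (\<forall>u\<in>A. c u \<noteq> 0) \<and> (\<forall>u\<in>A. \<forall>v\<in>A. \<alpha> u v = c u * c v / c (u \<otimes> v))"
proof -
  interpret E: comm_group extension by (rule comm_group_extension[OF sym])
  have root: "\<exists>a. (a, s) \<in> carrier extension \<and> (a, s) [^]\<^bsub>extension\<^esub> q = \<one>\<^bsub>extension\<^esub>"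
    if s: "s \<in> A" "s [^] q = \<one>" for s
  proof -
    have nz: "\<alpha> \<one> \<one> \<noteq> 0" using cocycle_nz subgroup.one_closed[OF A] by blast
    obtain b where b: "b \<noteq> 0" "\<And>a. (a, s) [^]\<^bsub>extension\<^esub> q = (a ^ q * b, s [^] q)"
      using extension_pow[OF s(1)] by blast
    \<comment> \<open>The unit of the extension has scalar component
      \<open>inverse (\<alpha> \<one> \<one>)\<close>, which \<open>a ^ q * b\<close> must
      equal.\<close>
    obtain a where a: "a ^ q = inverse (\<alpha> \<one> \<one> * b)"
      using nth_root_exists[of q] prime_gt_0_nat[OF prime_q] by blast
    have "a \<noteq> 0" using a b(1) nz prime_gt_0_nat[OF prime_q] by (auto simp: zero_power)
    then show ?thesis using a b s by (intro exI[of _ a]) (simp add: extension_simps)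
  qed
  obtain a b where ab: "(a, e) \<in> carrier extension" "(a, e) [^]\<^bsub>extension\<^esub> q = \<one>\<^bsub>extension\<^esub>"
    "(b, f) \<in> carrier extension" "(b, f) [^]\<^bsub>extension\<^esub> q = \<one>\<^bsub>extension\<^esub>"
    using root ef by metis
  define \<sigma> where "\<sigma> u = (a, e) [^]\<^bsub>extension\<^esub> i u \<otimes>\<^bsub>extension\<^esub> (b, f) [^]\<^bsub>extension\<^esub> j u" for u
  define c where "c u = fst (\<sigma> u)" for u
  have snd: "snd (X \<otimes>\<^bsub>extension\<^esub> Y) = snd X \<otimes> snd Y" for X Y
    by (cases X; cases Y) (simp add: extension_simps)
  have snd_pow: "snd (X [^]\<^bsub>extension\<^esub> (n::nat)) = snd X [^] n" for X n
    by (induction n) (simp_all add: snd extension_simps)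
  have \<sigma>: "\<sigma> u = (c u, u)" if u: "u \<in> A" for u
    using generate[OF u] by (simp add: prod_eq_iff c_def) (simp add: \<sigma>_def snd snd_pow)
  have nz: "c u \<noteq> 0" if u: "u \<in> A" for u
  proof -
    have "\<sigma> u \<in> carrier extension" using ab by (simp add: \<sigma>_def)
    then show ?thesis using u by (simp add: \<sigma> extension_simps)
  qed
  have mult: "c (u \<otimes> v) = c u * c v * \<alpha> u v" if u: "u \<in> A" and v: "v \<in> A" for u v
  proof -
    have "\<sigma> (u \<otimes> v) = (a, e) [^]\<^bsub>extension\<^esub> (i u + i v) \<otimes>\<^bsub>extension\<^esub> (b, f) [^]\<^bsub>extension\<^esub> (j u + j v)"
      unfolding \<sigma>_def using ab u v
      by (intro arg_cong2[of _ _ _ _ "monoid.mult extension"] E.pow_cong[of _ q]) (simp_all add: ij_mult)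
    also have "\<dots> = \<sigma> u \<otimes>\<^bsub>extension\<^esub> \<sigma> v"
      unfolding \<sigma>_def using ab by (simp add: E.nat_pow_mult[symmetric] E.m_ac)
    finally show ?thesis using u v subgroup.m_closed[OF A] by (simp add: \<sigma> extension_simps)
  qed
  \<comment> \<open>By \<open>mult\<close> the factor \<alpha> stands on the side of c(u) c(v), so
    the cochain is the inverse of \<open>c\<close>.\<close>
  show ?thesis
    by (rule exI[of _ "\<lambda>u. inverse (c u)"]) (auto simp: nz mult field_simps)
qed

text \<open>The pairing is determined by its value \<omega> at (e, f), and \<omega>^q = 1. If s is
  in the radical, \<omega> raised to either exponent of s is 1; for s \<noteq> 1 one exponent lies
  strictly between 0 and q, so \<omega> = 1. Then \<alpha> is symmetric and a coboundary.\<close>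

lemma nondegenerate_if_not_coboundary:
  assumes not_coboundary: "\<nexists>c. (\<forall>u\<in>A. c u \<noteq> 0) \<and> (\<forall>u\<in>A. \<forall>v\<in>A. \<alpha> u v = c u * c v / c (u \<otimes> v))"
    and s: "s \<in> A" "\<And>t. t \<in> A \<Longrightarrow> \<alpha> s t = \<alpha> t s"
  shows "s = \<one>"
proof (rule ccontr)
  assume "s \<noteq> \<one>"
  define \<omega> where "\<omega> = bichar e f"
  have fe: "bichar f e = inverse \<omega>" unfolding \<omega>_def by (rule bichar_swap)
  have gen_bichar: "bichar u e = inverse \<omega> ^ j u" "bichar u f = \<omega> ^ i u" if u: "u \<in> A" for u
  proof -
    show "bichar u e = inverse \<omega> ^ j u"
      by (subst generate[OF u]) (simp add: ef pow_closed bichar_pow bichar_mult_left bichar_self fe)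
    show "bichar u f = \<omega> ^ i u"
      by (subst generate[OF u]) (simp add: ef pow_closed bichar_pow bichar_mult_left bichar_self \<omega>_def)
  qed
  have triv: "bichar s t = 1" if "t \<in> A" for t
    using s(2)[OF that] cocycle_nz[OF that s(1)] by (simp add: bichar_def)
  have w: "\<omega> ^ i s = 1" "\<omega> ^ j s = 1" "\<omega> ^ q = 1"
    using gen_bichar[OF s(1)] triv ef bichar_pow(1)[OF ef(1,2), of q]
    by (simp_all add: power_inverse bichar_one \<omega>_def)
  have "s = \<one>" if "i s = 0" "j s = 0" by (subst generate[OF s(1)]) (simp add: that)
  then have "i s \<noteq> 0 \<or> j s \<noteq> 0" using \<open>s \<noteq> \<one>\<close> by blast
  moreover have "\<omega> = 1" if k: "\<omega> ^ k = 1" "0 < k" "k < q" for k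
  proof -
    have "coprime k q" using prime_q k by (metis coprime_commute nat_dvd_not_less prime_imp_coprime)
    then obtain x y where xy: "k * x = q * y + 1"
      using bezout_nat[of k q] k by auto
    have "\<omega> ^ (k * x) = \<omega>" unfolding xy by (simp add: power_add power_mult w(3))
    then show ?thesis by (simp add: power_mult k(1))
  qed
  ultimately have "\<omega> = 1" using w ij_less[OF s(1)] by blast
  then have "bichar u v = 1" if "u \<in> A" "v \<in> A" for u v
    using gen_bichar[OF that(1)] ef
    by (subst generate[OF that(2)]) (simp add: that ef pow_closed bichar_pow bichar_mult_right)
  then have "\<alpha> u v = \<alpha> v u" if "u \<in> A" "v \<in> A" for u v
    using that cocycle_nz by (simp add: bichar_def divide_simps split: if_splits)
  from coboundary_if_symmetric[OF this] not_coboundary show False by blast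
qed

end

lemma (in group) coordinates_of_iso:
  assumes S: "subgroup S G" and q: "prime q"
    and iso: "G\<lparr>carrier := S\<rparr> \<cong> integer_mod_group q \<times>\<times> integer_mod_group q"
  obtains e f and i j :: "'a \<Rightarrow> nat" where
    "\<And>s t. s \<in> S \<Longrightarrow> t \<in> S \<Longrightarrow> s \<otimes> t = t \<otimes> s" "\<And>s. s \<in> S \<Longrightarrow> s [^] q = \<one>"
    "e \<in> S" "f \<in> S" "\<And>u. u \<in> S \<Longrightarrow> i u < q" "\<And>u. u \<in> S \<Longrightarrow> j u < q"
    "\<And>u. u \<in> S \<Longrightarrow> u = e [^] i u \<otimes> f [^] j u"
    "\<And>u v. u \<in> S \<Longrightarrow> v \<in> S \<Longrightarrow> i (u \<otimes> v) = (i u + i v) mod q"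
    "\<And>u v. u \<in> S \<Longrightarrow> v \<in> S \<Longrightarrow> j (u \<otimes> v) = (j u + j v) mod q"
proof -
  let ?Z = "{0..<int q} \<times> {0..<int q}"
  note q2 = prime_ge_2_nat[OF q]
  obtain \<theta> where \<theta>: "\<theta> \<in> iso (G\<lparr>carrier := S\<rparr>) (integer_mod_group q \<times>\<times> integer_mod_group q)"
    using iso unfolding is_iso_def by blast
  note cl = subgroup.one_closed[OF S] subgroup.m_closed[OF S]
  have bij: "bij_betw \<theta> S ?Z"
    using \<theta> q2 by (simp add: iso_def carrier_integer_mod_group)
  have mult: "\<theta> (s \<otimes> t) = ((fst (\<theta> s) + fst (\<theta> t)) mod int q, (snd (\<theta> s) + snd (\<theta> t)) mod int q)"
    if "s \<in> S" "t \<in> S" for s t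
  proof -
    have "\<theta> (s \<otimes> t) = \<theta> s \<otimes>\<^bsub>integer_mod_group q \<times>\<times> integer_mod_group q\<^esub> \<theta> t"
      using \<theta> that by (simp add: iso_def hom_def)
    then show ?thesis by (cases "\<theta> s"; cases "\<theta> t") simp
  qed
  have range: "0 \<le> fst (\<theta> s)" "fst (\<theta> s) < int q" "0 \<le> snd (\<theta> s)" "snd (\<theta> s) < int q" if "s \<in> S" for s
    using bij_betwE[OF bij] that by (auto simp: mem_Times_iff)
  have eqI: "s = t" if "s \<in> S" "t \<in> S" "fst (\<theta> s) = fst (\<theta> t)" "snd (\<theta> s) = snd (\<theta> t)" for s t
    using bij_betw_imp_inj_on[OF bij] that by (simp add: inj_on_def prod_eq_iff)
  have one: "fst (\<theta> \<one>) = 0" "snd (\<theta> \<one>) = 0"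
  proof -
    have "\<theta> \<one> = ((2 * fst (\<theta> \<one>)) mod int q, (2 * snd (\<theta> \<one>)) mod int q)"
      using mult[OF cl(1) cl(1)] by simp
    then have "fst (\<theta> \<one>) = (2 * fst (\<theta> \<one>)) mod int q" "snd (\<theta> \<one>) = (2 * snd (\<theta> \<one>)) mod int q"
      by (metis fst_conv, metis snd_conv)
    moreover have "x = 0" if "x = (2 * x) mod m" "0 \<le> x" "x < m" for x m :: int
    proof -
      have "(x + x) mod m = (0 + x) mod m" using that by simp
      then have "m dvd x" by (metis add_diff_cancel_right' diff_0_right mod_eq_dvd_iff add_0 add_diff_cancel)
      then show ?thesis using that zdvd_imp_le by force
    qed
    ultimately show "fst (\<theta> \<one>) = 0" "snd (\<theta> \<one>) = 0" using range[OF cl(1)] by blast+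
  qed
  have pow: "s [^] n \<in> S \<and> fst (\<theta> (s [^] n)) = (int n * fst (\<theta> s)) mod int q
      \<and> snd (\<theta> (s [^] n)) = (int n * snd (\<theta> s)) mod int q" if s: "s \<in> S" for s and n :: nat
    by (induction n) (use s in \<open>simp_all add: cl one mult mod_simps algebra_simps\<close>)
  define i j where "i u = nat (fst (\<theta> u))" and "j u = nat (snd (\<theta> u))" for u
  have "(1, 0) \<in> \<theta> ` S" "(0, 1) \<in> \<theta> ` S" using bij_betw_imp_surj_on[OF bij] q2 by simp_all
  then obtain e f where ef: "e \<in> S" "\<theta> e = (1, 0)" "f \<in> S" "\<theta> f = (0, 1)" by (metis imageE)
  show ?thesis
  proof (rule that[of e f i j])
    show "s \<otimes> t = t \<otimes> s" if "s \<in> S" "t \<in> S" for s t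
      using that by (intro eqI) (simp_all add: cl mult add.commute)
    show "s [^] q = \<one>" if "s \<in> S" for s
      using pow[OF that, of q] by (intro eqI) (simp_all add: cl one)
    show "u = e [^] i u \<otimes> f [^] j u" if u: "u \<in> S" for u
      using pow[OF ef(1), of "i u"] pow[OF ef(3), of "j u"] range[OF u] u
      by (intro eqI) (simp_all add: cl mult ef i_def j_def)
    show "i u < q" "j u < q" if "u \<in> S" for u
      using range[OF that] by (simp_all add: i_def j_def)
    show "i (u \<otimes> v) = (i u + i v) mod q" "j (u \<otimes> v) = (j u + j v) mod q" if "u \<in> S" "v \<in> S" for u v
      using range[OF that(1)] range[OF that(2)]
      by (simp_all add: i_def j_def mult that nat_mod_distrib nat_add_distrib)
  qed (use ef in simp_all)
qed

section \<open>The direct product and the conclusion\<close>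

lemma pq_pair_DirProd:
  assumes K1: "nonabelian_pq K1 P1 Q1 p q" and K2: "nonabelian_pq K2 P2 Q2 r q"
    and A: "subgroup A (K1 \<times>\<times> K2)" "card A = q\<^sup>2"
      "\<And>s. s \<in> A \<Longrightarrow> s [^]\<^bsub>K1 \<times>\<times> K2\<^esub> q = \<one>\<^bsub>K1 \<times>\<times> K2\<^esub>"
  shows "pq_pair (K1 \<times>\<times> K2) K1 P1 Q1 K2 P2 Q2 p q r fst snd A"
proof -
  interpret K1: nonabelian_pq K1 P1 Q1 p q by (rule K1)
  interpret K2: nonabelian_pq K2 P2 Q2 r q by (rule K2)
  have "fin_group (K1 \<times>\<times> K2)"
    by (intro fin_group.intro fin_group_axioms.intro DirProd_group K1.group_axioms K2.group_axioms)
      (simp add: K1.finite_carrier K2.finite_carrier)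
  then show ?thesis
    by (intro pq_pair.intro pq_pair_axioms.intro K1 K2 A) (auto simp: hom_def)
qed

theorem theorem6p6:
  fixes p q r :: nat
    and G1 :: "'a monoid" and G2 :: "'b monoid"
    and S :: "('a \<times> 'b) set"
    and \<alpha> :: "'a \<times> 'b \<Rightarrow> 'a \<times> 'b \<Rightarrow> 'k :: {alg_closed_field, field_char_0}"
  defines "G \<equiv> G1 \<times>\<times> G2"
  assumes "prime p" and "prime q" and "prime r"
    and "q dvd p - 1" and "q dvd r - 1"
    and "group G1" and "is_semidirect_product G1 (integer_mod_group p) (integer_mod_group q)"
    and "\<not> comm_group G1"
    and "group G2" and "is_semidirect_product G2 (integer_mod_group r) (integer_mod_group q)"
    and "\<not> comm_group G2"
    and "subgroup S G" and "card S = q\<^sup>2"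
    and "G\<lparr>carrier := S\<rparr> \<cong> integer_mod_group q \<times>\<times> integer_mod_group q"
    and "group_2cocycle (G\<lparr>carrier := S\<rparr>) \<alpha>"
    and "\<not> group_2coboundary (G\<lparr>carrier := S\<rparr>) \<alpha>"
  shows "nondegenerate (G\<lparr>carrier := S\<rparr>) \<alpha> \<and>
    (\<forall>J. associated_twist G S \<alpha> J \<longrightarrow> simple_hopf_algebra (twisted_hopf_algebra G J))"
proof -
  \<comment> \<open>q divides the positive number m - 1, so it is smaller than m; this gives
    distinct primes in both factors.\<close>
  have ne: "m \<noteq> q" if "prime m" "q dvd m - 1" for m
    using that prime_ge_2_nat[OF that(1)] nat_dvd_not_less[of "m - 1" m] by auto
  obtain P1 Q1 where K1: "nonabelian_pq G1 P1 Q1 p q"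
    by (rule nonabelian_pq_of_semidirect_product[of G1 p q]) (use assms ne in blast)+
  obtain P2 Q2 where K2: "nonabelian_pq G2 P2 Q2 r q"
    by (rule nonabelian_pq_of_semidirect_product[of G2 r q]) (use assms ne in blast)+
  have G: "group G" unfolding G_def by (intro DirProd_group assms)
  obtain e f and i j where coord: "\<And>s t. s \<in> S \<Longrightarrow> t \<in> S \<Longrightarrow> s \<otimes>\<^bsub>G\<^esub> t = t \<otimes>\<^bsub>G\<^esub> s"
    "\<And>s. s \<in> S \<Longrightarrow> s [^]\<^bsub>G\<^esub> q = \<one>\<^bsub>G\<^esub>"
    "e \<in> S" "f \<in> S" "\<And>u. u \<in> S \<Longrightarrow> i u < q" "\<And>u. u \<in> S \<Longrightarrow> j u < q"
    "\<And>u. u \<in> S \<Longrightarrow> u = e [^]\<^bsub>G\<^esub> i u \<otimes>\<^bsub>G\<^esub> f [^]\<^bsub>G\<^esub> j u"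
    "\<And>u v. u \<in> S \<Longrightarrow> v \<in> S \<Longrightarrow> i (u \<otimes>\<^bsub>G\<^esub> v) = (i u + i v) mod q"
    "\<And>u v. u \<in> S \<Longrightarrow> v \<in> S \<Longrightarrow> j (u \<otimes>\<^bsub>G\<^esub> v) = (j u + j v) mod q"
    by (rule group.coordinates_of_iso[OF G assms(13,3,15)]) blast
  have pair: "pq_pair G G1 P1 Q1 G2 P2 Q2 p q r fst snd S"
    unfolding G_def by (rule pq_pair_DirProd[OF K1 K2]) (use assms(13,14) coord(2) in \<open>simp_all add: G_def\<close>)
  interpret fin_group G using pair by (rule pq_pair.axioms)
  have ab: "abelian_cocycle G S \<alpha>"
    using assms(13,16) coord(1) fin_group_axioms
    by (simp add: abelian_cocycle_def abelian_cocycle_axioms_def group_2cocycle_def)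
  have rk: "rank_two_cocycle G S \<alpha> q e f i j"
    by (intro rank_two_cocycle.intro rank_two_cocycle_axioms.intro ab assms(3) coord)
  have nd: "s = \<one>\<^bsub>G\<^esub>" if "s \<in> S" "\<And>t. t \<in> S \<Longrightarrow> \<alpha> s t = \<alpha> t s" for s
    using rank_two_cocycle.nondegenerate_if_not_coboundary[OF rk _ that] assms(17)
    by (auto simp: group_2coboundary_def)
  interpret nondeg_cocycle G S \<alpha>
    by (intro nondeg_cocycle.intro nondeg_cocycle_axioms.intro ab nd)
  have "simple_hopf_algebra (twisted_hopf_algebra G J)" if twist: "associated_twist G S \<alpha> J" for J
  proof -
    obtain \<sigma> \<phi> where \<sigma>: "hopf_2cocycle (function_algebra G) \<sigma>" and J: "J = twist_of_form G \<sigma>"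
      and \<phi>: "comodule_algebra_iso (cocycle_comodule_algebra (function_algebra G) \<sigma>) (galois_object G S \<alpha>) \<phi>"
      using twist unfolding associated_twist_def by blast
    obtain K where "group_twist G J K" using group_twist_of_cocycle[OF \<sigma>] J by blast
    then interpret group_twist G J K .
    obtain v w where vw: "v \<in> free_space (carrier G)" "w \<in> free_space (carrier G)"
      "gmult G v w = basis_vec \<one>\<^bsub>G\<^esub>" "gmult G w v = basis_vec \<one>\<^bsub>G\<^esub>"
      "gmult (G \<times>\<times> G) J (cop v) = gmult (G \<times>\<times> G) (tensor v v) J0"
      using galois_gauge[OF \<sigma> \<phi>] unfolding J by blast
    have "B = range (\<lambda>c. fscale c (basis_vec \<one>\<^bsub>G\<^esub>)) \<or> B = free_space (carrier G)"
      if B: "normal_hopf_subalgebra B H" for B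
    proof -
      have sub: "hopf_subalgebra B H" using B unfolding normal_hopf_subalgebra_def by blast
      then have BG: "B \<subseteq> free_space (carrier G)" by (simp add: hopf_subalgebra_def)
      \<comment> \<open>Stability under the chosen \<open>antipode H\<close> becomes stability under
        the explicit \<open>S\<close> by \<open>antipode_H\<close>.\<close>
      have "twist_subhopf G J K B"
        using sub antipode_H BG
        by (intro twist_subhopf.intro twist_subhopf_axioms.intro group_twist_axioms)
          (auto simp: hopf_subalgebra_def H_comult subset_iff)
      then have "twisted_pq_pair G J K B S \<alpha> v w G1 P1 Q1 G2 P2 Q2 p q r fst snd"
        by (intro twisted_pq_pair.intro gauged_twist.intro gauged_twist_axioms.intro pair vw nondeg_cocycle_axioms)
      from twisted_pq_pair.normal_hopf_subalgebra_trivial[OF this] show ?thesis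
        using B by (simp add: normal_hopf_subalgebra_def)
    qed
    then show ?thesis by (simp add: simple_hopf_algebra_def hopf_algebra_H)
  qed
  \<comment> \<open>S is abelian, so the commutation condition in the definition holds for all t in
    S.\<close>
  moreover have "nondegenerate (G\<lparr>carrier := S\<rparr>) \<alpha>"
    unfolding nondegenerate_def using nd coord(1) by simp
  ultimately show ?thesis by blast
qed

end
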